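(* Let $n\ge1$, $1<p<\infty$, $\frac1p+\frac1q=1$, $0<s<\min\{p,q\}$. Let $T$ be a bounded linear operator on $L_a^p$ and $r>0$. Then the operator-valued mapping $$v\mapsto\int_{\mathbb B_n}\langle TU_uk_0,U_uk_v\rangle\,(U_uk_v)\otimes(U_uk_0)\,d\lambda(u)$$ is uniformly continuous (with respect to the Bergman metric on $D(0,r)$ and the operator norm) and uniformly bounded on $D(0,r)$. Moreover, the integral $$\int_{D(0,r)}\int_{\mathbb B_n}\langle TU_uk_0,U_uk_v\rangle\,(U_uk_v)\otimes(U_uk_0)\,d\lambda(u)\,d\lambda(v)$$ is convergent in the norm topology. Furthermore, if $T\in\mathcal A_s^p$ (that is, $T$ is $s$-weakly localized), then $$\int_{D(0,r)}\int_{\mathbb B_n}\langle TU_uk_0,U_uk_v\rangle\,(U_uk_v)\otimes(U_uk_0)\,d\lambda(u)\,d\lambda(v)$$ converges to $T$ in operator norm as $r\to\infty$.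
   Context: $\mathbb B_n$ is the open unit ball of $\mathbb C^n$, $dv$ the Lebesgue measure on it normalized by $v(\mathbb B_n)=1$, and $L_a^p$ the Banach space of holomorphic $f$ on $\mathbb B_n$ with $\|f\|_p=(\int_{\mathbb B_n}|f|^pdv)^{1/p}<\infty$. The dual of $L_a^p$ is $L_a^q$ under $\langle f,g\rangle=\int_{\mathbb B_n} f\overline g\,dv$; $T^*$ is the operator on $L_a^q$ with $\langle Tf,g\rangle=\langle f,T^*g\rangle$. Let $K_z(w)=(1-w\cdot\overline z)^{-(n+1)}$ with $w\cdot\overline z=\sum_j w_j\overline{z_j}$, $\|K_z\|_2=(1-|z|^2)^{-(n+1)/2}$, $k_z=K_z/\|K_z\|_2$ (so $k_0=1$), and $d\lambda(z)=(1-|z|^2)^{-n-1}dv(z)$. $\varphi_z$ is the standard involutive automorphism (Möbius transform) of $\mathbb B_n$ interchanging $0$ and $z$. The Bergman metric is $\beta(z,w)=\frac12\log\frac{1+|\varphi_z(w)|}{1-|\varphi_z(w)|}$ and $D(z,r)=\{w\in\mathbb B_n:\beta(z,w)<r\}$. For $z\in\mathbb B_n$, $U_zf(w)=f(\varphi_z(w))k_z(w)$. Rank-one operators are $(f\otimes g)h=\langle h,g\rangle f$. An operator integral $\int_{\mathbb B_n}h(u)(U_uh_1)\otimes(U_uh_2)\,d\lambda(u)$, with $h$ bounded and $h_1,h_2$ bounded holomorphic, is the bounded operator on $L_a^p$ defined weakly by $\langle(\cdot)f,g\rangle=\int_{\mathbb B_n}h(u)\langle f,U_uh_2\rangle\langle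 U_uh_1,g\rangle\,d\lambda(u)$ for $f\in L_a^p$, $g\in L_a^q$. A bounded operator $T$ on $L_a^p$ is $s$-weakly localized (written $T\in\mathcal A_s^p$) if $$\sup_{z\in\mathbb B_n}\int_{\mathbb B_n}|\langle Tk_z,k_w\rangle|\frac{\|K_z\|_2^{1-\frac{2s}{q(n+1)}}}{\|K_w\|_2^{1-\frac{2s}{q(n+1)}}}d\lambda(w)<\infty,\qquad \sup_{z\in\mathbb B_n}\int_{\mathbb B_n}|\langle T^*k_z,k_w\rangle|\frac{\|K_z\|_2^{1-\frac{2s}{p(n+1)}}}{\|K_w\|_2^{1-\frac{2s}{p(n+1)}}}d\lambda(w)<\infty,$$ and the same two suprema with $\int_{\mathbb B_n}$ replaced by $\int_{\mathbb B_n\setminus D(z,r)}$ tend to $0$ as $r\to\infty$. *)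

theory Defs
  imports "HOL-Analysis.Analysis"
begin

text \<open>
  Functions on the unit ball of complex n-space, where n is the cardinality of the index type, are
  represented by total functions vanishing off the ball, and operators on a Bergman space by
  total maps vanishing off that space. In this way equality of functions and of operators
  is the equality of HOL, and all the objects below are uniquely determined.
\<close>

type_synonym 'n cfun = "complex ^ 'n \<Rightarrow> complex"
type_synonym 'n oper = "'n cfun \<Rightarrow> 'n cfun"

abbreviation unit_ball :: "(complex ^ 'n) set" where
  "unit_ball \<equiv> ball 0 1"

definition vol :: "(complex ^ 'n) measure" where
  "vol = uniform_measure (restrict_space lborel unit_ball) unit_ball"

definition inv_vol :: "(complex ^ 'n) measure" where
  "inv_vol = density vol (\<lambda>z. ennreal (1 / (1 - (norm z)\<^sup>2) ^ (CARD('n) + 1)))"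

definition holomorphic_several :: "'n cfun \<Rightarrow> (complex ^ 'n) set \<Rightarrow> bool" where
  "holomorphic_several f S \<longleftrightarrow>
     (\<forall>z\<in>S. \<exists>D. (f has_derivative D) (at z) \<and> (\<forall>c x. D (c *s x) = c * D x))"

definition bergman_space :: "real \<Rightarrow> ('n::finite) cfun set" where
  "bergman_space p = {f. holomorphic_several f unit_ball \<and> (\<forall>z. z \<notin> unit_ball \<longrightarrow> f z = 0) \<and>
                         integrable vol (\<lambda>z. norm (f z) powr p)}"

definition bergman_norm :: "real \<Rightarrow> ('n::finite) cfun \<Rightarrow> real" where
  "bergman_norm p f = (\<integral>z. norm (f z) powr p \<partial>vol) powr (1 / p)"

definition pairing :: "('n::finite) cfun \<Rightarrow> 'n cfun \<Rightarrow> complex" where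
  "pairing f g = (\<integral>z. f z * cnj (g z) \<partial>vol)"

definition bounded_op :: "real \<Rightarrow> ('n::finite) oper \<Rightarrow> bool" where
  "bounded_op p T \<longleftrightarrow>
     (\<forall>f\<in>bergman_space p. T f \<in> bergman_space p) \<and>
     (\<forall>f. f \<notin> bergman_space p \<longrightarrow> T f = (\<lambda>_. 0)) \<and>
     (\<forall>f\<in>bergman_space p. \<forall>g\<in>bergman_space p. T (\<lambda>z. f z + g z) = (\<lambda>z. T f z + T g z)) \<and>
     (\<forall>c. \<forall>f\<in>bergman_space p. T (\<lambda>z. c * f z) = (\<lambda>z. c * T f z)) \<and>
     (\<exists>C. \<forall>f\<in>bergman_space p. bergman_norm p (T f) \<le> C * bergman_norm p f)"

definition op_norm :: "real \<Rightarrow> ('n::finite) oper \<Rightarrow> real" where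
  "op_norm p T = Sup {bergman_norm p (T f) | f. f \<in> bergman_space p \<and> bergman_norm p f \<le> 1}"

definition adjoint_op :: "real \<Rightarrow> real \<Rightarrow> ('n::finite) oper \<Rightarrow> 'n oper" where
  "adjoint_op p q T = (THE S. bounded_op q S \<and>
     (\<forall>f\<in>bergman_space p. \<forall>g\<in>bergman_space q. pairing (T f) g = pairing f (S g)))"

definition cdot :: "complex ^ 'n \<Rightarrow> complex ^ 'n \<Rightarrow> complex" where
  "cdot w z = (\<Sum>j\<in>UNIV. w $ j * cnj (z $ j))"

definition kernel :: "complex ^ 'n \<Rightarrow> 'n cfun" where
  "kernel z w = (if w \<in> unit_ball then 1 / (1 - cdot w z) ^ (CARD('n) + 1) else 0)"

definition normalized_kernel :: "complex ^ 'n \<Rightarrow> 'n cfun" where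
  "normalized_kernel z w = kernel z w / of_real (bergman_norm 2 (kernel z))"

text \<open>
  The Moebius transform is
  \<open>\<phi>\<^sub>z(w) = (z - P\<^sub>z w - (1 - |z|\<^sup>2)\<^sup>1\<^sup>/\<^sup>2 (w - P\<^sub>z w)) / (1 - cdot w z)\<close>, where
  \<open>P\<^sub>z\<close> is the orthogonal projection onto the complex line spanned by \<open>z\<close>.
  As division by zero yields zero, \<open>P\<^sub>0 = 0\<close> and hence \<open>\<phi>\<^sub>0(w) = - w\<close>.
\<close>

definition line_proj :: "complex ^ 'n \<Rightarrow> complex ^ 'n \<Rightarrow> complex ^ 'n" where
  "line_proj z w = (cdot w z / cdot z z) *s z"

definition mobius :: "complex ^ 'n \<Rightarrow> complex ^ 'n \<Rightarrow> complex ^ 'n" where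
  "mobius z w = (1 / (1 - cdot w z)) *s
     (z - line_proj z w - sqrt (1 - (norm z)\<^sup>2) *\<^sub>R (w - line_proj z w))"

definition bergman_dist :: "complex ^ 'n \<Rightarrow> complex ^ 'n \<Rightarrow> real" where
  "bergman_dist z w = 1 / 2 * ln ((1 + norm (mobius z w)) / (1 - norm (mobius z w)))"

definition bergman_ball :: "complex ^ 'n \<Rightarrow> real \<Rightarrow> (complex ^ 'n) set" where
  "bergman_ball z r = {w \<in> unit_ball. bergman_dist z w < r}"

definition transl :: "complex ^ 'n \<Rightarrow> 'n cfun \<Rightarrow> 'n cfun" where
  "transl z f w = f (mobius z w) * normalized_kernel z w"

text \<open>
  The weakly defined operator \<open>\<integral> h(u) (U\<^sub>u h\<^sub>1) \<otimes> (U\<^sub>u h\<^sub>2) d\<lambda>(u)\<close>.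
\<close>

definition weak_op_integral ::
    "real \<Rightarrow> real \<Rightarrow> (complex ^ 'n \<Rightarrow> complex) \<Rightarrow> 'n cfun \<Rightarrow> 'n cfun \<Rightarrow> 'n oper" where
  "weak_op_integral p q h h\<^sub>1 h\<^sub>2 = (THE A. bounded_op p A \<and>
     (\<forall>f\<in>bergman_space p. \<forall>g\<in>bergman_space q.
        pairing (A f) g =
          (\<integral>u. h u * pairing f (transl u h\<^sub>2) * pairing (transl u h\<^sub>1) g \<partial>inv_vol)))"

definition localization_integral ::
    "real \<Rightarrow> real \<Rightarrow> 'n oper \<Rightarrow> (complex ^ 'n) set \<Rightarrow> complex ^ 'n \<Rightarrow> ennreal" where
  "localization_integral a s T E z =
     (\<integral>\<^sup>+w\<in>E. ennreal (norm (pairing (T (normalized_kernel z)) (normalized_kernel w)) *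
        (bergman_norm 2 (kernel z) powr (1 - 2 * s / (a * (CARD('n) + 1))) /
         bergman_norm 2 (kernel w) powr (1 - 2 * s / (a * (CARD('n) + 1))))) \<partial>inv_vol)"

definition weakly_localized :: "real \<Rightarrow> real \<Rightarrow> real \<Rightarrow> ('n::finite) oper \<Rightarrow> bool" where
  "weakly_localized p q s T \<longleftrightarrow>
     bounded_op p T \<and>
     (SUP z\<in>unit_ball. localization_integral q s T unit_ball z) < \<infinity> \<and>
     (SUP z\<in>unit_ball. localization_integral p s (adjoint_op p q T) unit_ball z) < \<infinity> \<and>
     ((\<lambda>r. SUP z\<in>unit_ball. localization_integral q s T (unit_ball - bergman_ball z r) z)
        \<longlongrightarrow> 0) at_top \<and>
     ((\<lambda>r. SUP z\<in>unit_ball.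
          localization_integral p s (adjoint_op p q T) (unit_ball - bergman_ball z r) z)
        \<longlongrightarrow> 0) at_top"

text \<open>
  The Bochner integral in the Banach space of bounded operators on the Bergman space with
  exponent \<open>p\<close>, i.e. the analogue of \<^const>\<open>has_bochner_integral\<close>. The latter is not
  applicable, because this Banach space depends on \<open>p\<close> and is therefore not a type. Borel
  measurability of the integrand is replaced by measurability of its distance to
  the approximating simple functions, since the operator space is not separable.
\<close>

definition op_simple :: "real \<Rightarrow> 'm measure \<Rightarrow> ('m \<Rightarrow> ('n::finite) oper) \<Rightarrow> bool" where
  "op_simple p M S \<longleftrightarrow> simple_function M S \<and> (\<forall>v\<in>space M. bounded_op p (S v)) \<and>
     emeasure M {v \<in> space M. S v \<noteq> (\<lambda>_ _. 0)} \<noteq> \<infinity>"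

definition op_simple_integral :: "'m measure \<Rightarrow> ('m \<Rightarrow> ('n::finite) oper) \<Rightarrow> 'n oper" where
  "op_simple_integral M S =
     (\<lambda>f w. \<Sum>B\<in>S ` space M. of_real (measure M {v \<in> space M. S v = B}) * B f w)"

definition op_has_integral :: "real \<Rightarrow> 'm measure \<Rightarrow> ('m \<Rightarrow> ('n::finite) oper) \<Rightarrow> 'n oper \<Rightarrow> bool" where
  "op_has_integral p M A I \<longleftrightarrow>
     (\<forall>v\<in>space M. bounded_op p (A v)) \<and> bounded_op p I \<and>
     (\<exists>S :: nat \<Rightarrow> 'm \<Rightarrow> 'n oper.
        (\<forall>i. op_simple p M (S i)) \<and>
        (\<forall>i. (\<lambda>v. op_norm p (A v - S i v)) \<in> borel_measurable M) \<and>
        (\<lambda>i. \<integral>\<^sup>+v. ennreal (op_norm p (A v - S i v)) \<partial>M) \<longlonglongrightarrow> 0 \<and>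
        (\<lambda>i. op_norm p (op_simple_integral M (S i) - I)) \<longlonglongrightarrow> 0)"

definition op_integrable :: "real \<Rightarrow> 'm measure \<Rightarrow> ('m \<Rightarrow> ('n::finite) oper) \<Rightarrow> bool" where
  "op_integrable p M A \<longleftrightarrow> (\<exists>I. op_has_integral p M A I)"

definition op_integral :: "real \<Rightarrow> 'm measure \<Rightarrow> ('m \<Rightarrow> ('n::finite) oper) \<Rightarrow> 'n oper" where
  "op_integral p M A = (THE I. op_has_integral p M A I)"

end

theory Submission
 imports Defs "HOL-Complex_Analysis.Complex_Analysis"
begin

text \<open>
 By the reproducing formula the operator at \<open>v\<close> is an integral operator with kernel \<open>\<Phi> v u w\<close>
 \<open>= \<langle>TU\<^sub>uk\<^sub>0, U\<^sub>uk\<^sub>v\<rangle> k\<^sub>v(\<phi>\<^sub>u(w)) K\<^sub>u(w)\<close>. The first factor is bounded in \<open>u\<close>, and \<open>v \<mapsto> k\<^sub>v\<close> is uniformly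
 continuous in the sup norm on compact sets, so \<open>\<Phi> v\<close> and its increments are dominated by \<open>|K\<^sub>u(w)|\<close>, the
 kernel of a bounded operator on \<open>L\<^sup>p\<close>. This gives the first two claims and the Bochner integral.
 Moreover \<open>\<Phi> v u w = (1 - |x|\<^sup>2)\<^sup>n\<^sup>+\<^sup>1 TK\<^sub>u(x) K\<^sub>x(w)\<close> for \<open>x = \<phi>\<^sub>u(v)\<close>. Substituting \<open>x\<close> for \<open>v\<close>, the difference
 of \<open>T\<close> and the integral over \<open>D(0,r)\<close> becomes the Bergman projection after the operator with kernel \<open>TK\<^sub>u(x)\<close>
 off \<open>D(u,r)\<close>, and weak localization is the hypothesis of the Schur test for that kernel with weights powers of
 \<open>1 - |z|\<^sup>2\<close>. The invariance of \<open>\<lambda>\<close> under \<open>\<phi>\<^sub>u\<close> follows by comparing the integrals of all \<open>|K\<^sub>v|\<^sup>2\<close>, which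
 determine a finite measure on the ball.
\<close>

text \<open>The invariance of \<open>\<lambda>\<close> under Moebius transforms comes before the
  reproducing formula, which is deduced from it and from the mean value property. Hence the norm of
  \<open>kernel v\<close> in L^2 cannot be read off the reproducing formula; it is summed as a power
  series whose moments come from comparing Gaussian integrals with integrals over the ball. The same
  series, with log-convexity of \<open>Gamma\<close>, yields the Forelli-Rudin estimates behind all
  norm bounds. The adjoint in the definition of weak localization is a definite description, so the
  duality of the Bergman spaces has to be established. It also provides the integrability in
  \<open>u\<close> of the kernel \<open>T (kernel u) x\<close>. All definite descriptions are
  resolved by point evaluation. In the last Schur test the weight is \<open>defect\<close> to the
  power \<open>- s / (p * q)\<close>: its \<open>p\<close>-th and \<open>q\<close>-th powers carry
  the exponents \<open>- s / q\<close> and \<open>- s / p\<close>, which are those produced by the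
  normalizations in the two localization conditions. The constant of that test is any bound of the
  two suprema over the far region, hence the convergence to 0.\<close>

lemmas lint_cong = Bochner_Integration.integral_cong
lemmas integrable_dominated = Bochner_Integration.integrable_bound

section \<open>The Hermitian inner product\<close>

lemma cdot_add_left: "cdot (x + y) z = cdot x z + cdot y z"
 by (simp add: cdot_def sum.distrib algebra_simps)
lemma cdot_add_right: "cdot z (x + y) = cdot z x + cdot z y"
 by (simp add: cdot_def sum.distrib algebra_simps)
lemma cdot_diff_left: "cdot (x - y) z = cdot x z - cdot y z"
 by (simp add: cdot_def sum_subtractf algebra_simps)
lemma cdot_diff_right: "cdot z (x - y) = cdot z x - cdot z y"
 by (simp add: cdot_def sum_subtractf algebra_simps)
lemma cdot_smult_left: "cdot (c *s x) z = c * cdot x z"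
 by (simp add: cdot_def sum_distrib_left algebra_simps)
lemma cdot_smult_right: "cdot z (c *s x) = cnj c * cdot z x"
 by (simp add: cdot_def sum_distrib_left algebra_simps)
lemma cdot_scaleR_left: "cdot (c *\<^sub>R x) z = of_real c * cdot x z"
 by (simp add: cdot_def sum_distrib_left algebra_simps scaleR_conv_of_real[where 'a = complex])
lemma cdot_scaleR_right: "cdot z (c *\<^sub>R x) = of_real c * cdot z x"
 by (simp add: cdot_def sum_distrib_left algebra_simps scaleR_conv_of_real[where 'a = complex])
lemma cdot_minus_left: "cdot (- x) z = - cdot x z"
 by (simp add: cdot_def sum_negf)
lemma cdot_minus_right: "cdot z (- x) = - cdot z x"
 by (simp add: cdot_def sum_negf)
lemma cdot_0 [simp]: "cdot 0 z = 0" "cdot z 0 = 0"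
 by (simp_all add: cdot_def)
lemma cnj_cdot: "cnj (cdot w z) = cdot z w"
 by (simp add: cdot_def mult.commute)

lemmas cdot_simps = cdot_add_left cdot_add_right cdot_diff_left cdot_diff_right cdot_smult_left
 cdot_smult_right cdot_scaleR_left cdot_scaleR_right cdot_minus_left cdot_minus_right

lemma Re_cdot: "Re (cdot w z) = inner w z"
 by (simp add: cdot_def inner_vec_def inner_complex_def)

lemma cdot_self: "cdot z z = of_real ((norm z)\<^sup>2)"
proof -
 have "Im (cdot z z) = 0" by (simp add: cdot_def)
 moreover have "Re (cdot z z) = (norm z)\<^sup>2" by (simp add: Re_cdot power2_norm_eq_inner)
 ultimately show ?thesis by (simp add: complex_eq_iff)
qed

lemma norm_smult_vec: "norm (c *s x) = norm c * norm (x :: complex ^ 'n)"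
proof -
 have "complex_of_real ((norm (c *s x))\<^sup>2) = of_real ((norm c * norm x)\<^sup>2)"
  by (simp only: cdot_self[symmetric] cdot_smult_left cdot_smult_right power_mult_distrib of_real_mult)
    (simp add: complex_norm_square cdot_self mult.assoc del: of_real_power)
 then have "(norm (c *s x))\<^sup>2 = (norm c * norm x)\<^sup>2" using of_real_eq_iff by blast
 then show ?thesis by (rule power2_eq_imp_eq) simp_all
qed

text \<open>The real Cauchy-Schwarz inequality applies once \<open>w\<close> is rotated by a
  unimodular scalar that makes the product real and nonnegative.\<close>

lemma norm_cdot_le: "norm (cdot w z) \<le> norm w * norm z"
proof (cases "cdot w z = 0")
 case False
 define c where "c = cnj (cdot w z) / norm (cdot w z)"
 have "norm c = 1" using False by (simp add: c_def norm_divide)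
 have "norm (cdot w z) = Re (c * cdot w z)"
  using False by (simp add: c_def mult.commute[of "cnj _"] complex_norm_square[symmetric] power2_eq_square del: of_real_power)
 also have "... = inner (c *s w) z" by (simp add: Re_cdot flip: cdot_smult_left)
 also have "... \<le> norm (c *s w) * norm z" by (rule norm_cauchy_schwarz)
 finally show ?thesis using \<open>norm c = 1\<close> by (simp add: norm_smult_vec)
qed simp

lemma continuous_on_cdot [continuous_intros]:
 "continuous_on S f ==> continuous_on S g ==> continuous_on S (\<lambda>x. cdot (f x) (g x))"
 unfolding cdot_def by (intro continuous_intros)

lemma continuous_on_smult_vec [continuous_intros]:
 "continuous_on S f ==> continuous_on S g ==>
  continuous_on S (\<lambda>x. f x *s (g x :: complex ^ 'n))"
 unfolding vector_scalar_mult_def by (intro continuous_intros continuous_on_vec_lambda) 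

section \<open>Moebius transforms of the ball\<close>

definition defect :: "complex ^ 'n \<Rightarrow> real" where
 "defect z = 1 - (norm z)\<^sup>2"

lemma one_plus_of_real_nz: "0 < x ==> 1 + complex_of_real x \<noteq> 0"
 by (auto simp: complex_eq_iff)

lemma defect_pos: "z \<in> unit_ball ==> 0 < defect z"
 by (simp add: defect_def power_less_one_iff abs_square_less_1)

lemma defect_le_1: "defect z \<le> 1"
 by (simp add: defect_def)

lemma defect_0 [simp]: "defect 0 = 1"
 by (simp add: defect_def)

lemma continuous_on_defect [continuous_intros]:
 "continuous_on S f ==> continuous_on S (\<lambda>x. defect (f x))"
 unfolding defect_def by (intro continuous_intros)

lemma norm_one_minus_cdot_ge: "1 - norm w * norm z \<le> norm (1 - cdot w z)"
 using norm_triangle_ineq2[of 1 "cdot w z"] norm_cdot_le[of w z] by simp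

lemma norm_mult_less_1: "w \<in> unit_ball ==> norm z \<le> 1 ==> norm w * norm z < 1"
 using mult_left_le[of "norm z" "norm w"] by simp

lemma norm_cdot_less_1: "w \<in> unit_ball ==> z \<in> unit_ball ==> norm (cdot w z) < 1"
 using norm_cdot_le[of w z] norm_mult_less_1[of w z] by auto

lemma one_minus_cdot_nz: "w \<in> unit_ball ==> z \<in> unit_ball ==> 1 - cdot w z \<noteq> 0"
 using norm_cdot_less_1[of w z] by auto

lemma norm_one_minus_cdot_le: "w \<in> unit_ball ==> z \<in> unit_ball ==> norm (1 - cdot w z) \<le> 2"
 using norm_cdot_less_1[of w z] norm_triangle_ineq4[of 1 "cdot w z"] by simp

lemma norm_one_minus_cdot_ge1: "w \<in> unit_ball ==> z \<in> unit_ball ==> 1 - norm z \<le> norm (1 - cdot w z)"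
 using norm_one_minus_cdot_ge[of w z] by (smt (verit) mem_ball_0 mult_left_le_one_le norm_ge_zero)

text \<open>Clearing the projection gives a formula for the Moebius transform without a case distinction
 at \<open>z = 0\<close>.\<close>

lemma mobius_alt:
 assumes "z \<in> unit_ball"
 shows "mobius z w = (1 / (1 - cdot w z)) *s
   ((1 - cdot w z / of_real (1 + sqrt (defect z))) *s z - of_real (sqrt (defect z)) *s w)"
proof (cases "z = 0")
 case True
 then show ?thesis
  by (simp add: mobius_def line_proj_def defect_def vec_eq_iff scaleR_conv_of_real[where 'a = complex])
next
 case False
 define s where "s = sqrt (defect z)"
 have s: "s > 0" "s\<^sup>2 = 1 - (norm z)\<^sup>2" using defect_pos[OF assms] by (auto simp: s_def defect_def)
 have c: "cdot z z = (1 - of_real s) * (1 + of_real s)"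
 proof -
  have "(norm z)\<^sup>2 = (1 - s) * (1 + s)" using s(2) by (simp add: algebra_simps power2_eq_square)
  then show ?thesis unfolding cdot_self by (simp only: of_real_mult of_real_diff of_real_add of_real_1)
 qed
 have nz: "cdot z z \<noteq> 0" using False by (simp add: cdot_self)
 have s1: "(1 + of_real s :: complex) \<noteq> 0" using s(1)
  by (simp add: complex_eq_iff)
 have "z - line_proj z w - s *\<^sub>R (w - line_proj z w)
  = (1 - cdot w z / (1 + of_real s)) *s z - of_real s *s w"
 proof -
  have "(1 - of_real s) * (cdot w z / cdot z z) = cdot w z / (1 + of_real s)"
   using nz s1 by (simp add: c field_simps)
  then have "z $ i - cdot w z / cdot z z * z $ i - of_real s * (w $ i - cdot w z / cdot z z * z $ i)
   = (1 - cdot w z / (1 + of_real s)) * z $ i - of_real s * w $ i" for i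
   by (simp only: flip: \<open>(1 - of_real s) * (cdot w z / cdot z z) = cdot w z / (1 + of_real s)\<close>) algebra
  then show ?thesis
   unfolding vec_eq_iff line_proj_def
   by (simp only: vector_smult_component vector_minus_component vector_scaleR_component scaleR_conv_of_real[where 'a = complex] simp_thms)
 qed
 from arg_cong[OF this, of "\<lambda>y. (1 / (1 - cdot w z)) *s y"] show ?thesis
  unfolding mobius_def s_def defect_def of_real_add of_real_1 .
qed

text \<open>With \<open>a = cdot w z\<close>, \<open>b = cdot z v\<close> and \<open>s\<close> the
  square root of \<open>defect z\<close>, expanding the inner product leaves an identity in
  \<open>a\<close>, \<open>b\<close>, \<open>s\<close>. The other identities for Moebius transforms
  specialize this one: \<open>v = 0\<close>, where \<open>mobius z 0 = z\<close>, and
  \<open>v = w\<close>.\<close>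

lemma one_minus_cdot_mobius_mobius:
 assumes z: "z \<in> unit_ball" and w: "w \<in> unit_ball" and v: "v \<in> unit_ball"
 shows "1 - cdot (mobius z w) (mobius z v)
   = of_real (defect z) * (1 - cdot w v) / ((1 - cdot w z) * (1 - cdot z v))"
proof -
 define s where "s = complex_of_real (sqrt (defect z))"
 have "of_real ((norm z)\<^sup>2) = 1 - s\<^sup>2" and ds: "of_real (defect z) = s\<^sup>2"
  using defect_pos[OF z] by (simp_all add: s_def defect_def flip: of_real_power)
 then have zz: "cdot z z = 1 - s\<^sup>2" by (simp add: cdot_self)
 have cs: "cnj s = s" by (simp add: s_def)
 have s1: "1 + s \<noteq> 0" using one_plus_of_real_nz[OF real_sqrt_gt_zero[OF defect_pos[OF z]]] unfolding s_def .
 define a b where "a = cdot w z" and "b = cdot z v"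
 have nz: "1 - a \<noteq> 0" "1 - b \<noteq> 0" unfolding a_def b_def using one_minus_cdot_nz w v z by auto
 have ca: "cdot v z = cnj b" by (simp add: b_def cnj_cdot)
 define \<alpha> \<beta> where "\<alpha> = 1 - a / (1 + s)" and "\<beta> = 1 - b / (1 + s)"
 have c\<beta>: "1 - cnj b / (1 + s) = cnj \<beta>" using cs by (simp add: \<beta>_def)
 have "cdot (\<alpha> *s z - s *s w) (cnj \<beta> *s z - s *s v)
   = \<alpha> * \<beta> * (1 - s\<^sup>2) - \<alpha> * s * b - s * \<beta> * a + s\<^sup>2 * cdot w v"
  using cs by (simp add: cdot_simps zz a_def[symmetric] b_def[symmetric] algebra_simps power2_eq_square)
 also have "... = (1 - a) * (1 - b) - s\<^sup>2 * (1 - cdot w v)"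
 proof -
  \<comment> \<open>Treating \<open>t\<close> as a variable subject to \<open>t * s = 1 - t\<close>
    turns an identity of fractions into one of polynomials.\<close>
  define t where "t = 1 / (1 + s)"
  have t: "t * s = 1 - t" using s1 by (simp add: t_def field_simps)
  have ab: "\<alpha> = 1 - a * t" "\<beta> = 1 - b * t" by (simp_all add: \<alpha>_def \<beta>_def t_def)
  have "s * \<alpha> = s - a + a * t" "s * \<beta> = s - b + b * t"
   using t unfolding ab by algebra+
  note e = this
  have "\<alpha> * \<beta> * (1 - s\<^sup>2) - \<alpha> * s * b - s * \<beta> * a
   = \<alpha> * \<beta> - (s * \<alpha>) * (s * \<beta>) - (s * \<alpha>) * b - (s * \<beta>) * a"
   by (simp add: power2_eq_square algebra_simps)
  also have "... = (1 - a * t) * (1 - b * t) - (s - a + a * t) * (s - b + b * t) - (s - a + a * t) * b - (s - b + b * t) * a"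
   unfolding e unfolding ab by simp
  also have "... = (1 - a) * (1 - b) - s\<^sup>2 + 0 * t"
   using t by algebra
  finally show ?thesis by (simp add: algebra_simps)
 qed
 finally have "cdot (mobius z w) (mobius z v)
   = ((1 - a) * (1 - b) - s\<^sup>2 * (1 - cdot w v)) / ((1 - a) * (1 - b))"
  unfolding mobius_alt[OF z] ca a_def[symmetric] of_real_add of_real_1 s_def[symmetric] c\<beta> \<alpha>_def[symmetric]
  by (simp only: cdot_smult_left cdot_smult_right) simp
 then show ?thesis using nz unfolding ds a_def[symmetric] b_def[symmetric] by (simp add: diff_divide_distrib)
qed

lemma one_minus_cdot_mobius:
 assumes z: "z \<in> unit_ball" and w: "w \<in> unit_ball"
 shows "1 - cdot (mobius z w) z = of_real (defect z) / (1 - cdot w z)"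
proof -
 have m0: "mobius z 0 = z" by (simp add: mobius_alt[OF z])
 show ?thesis using one_minus_cdot_mobius_mobius[OF z w, of 0] by (simp add: m0)
qed

lemma one_minus_cdot_mobius':
 assumes "z \<in> unit_ball" "w \<in> unit_ball"
 shows "1 - cdot z (mobius z w) = of_real (defect z) / (1 - cdot z w)"
 using arg_cong[OF one_minus_cdot_mobius[OF assms], of cnj] by (simp add: cnj_cdot)

lemma defect_mobius:
 assumes z: "z \<in> unit_ball" and w: "w \<in> unit_ball"
 shows "defect (mobius z w) = defect z * defect w / (norm (1 - cdot w z))\<^sup>2"
proof -
 have d: "complex_of_real (defect x) = 1 - cdot x x" for x :: "complex ^ 'n"
  by (simp add: defect_def cdot_self)
 have "1 - cdot z w = cnj (1 - cdot w z)" by (simp add: cnj_cdot)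
 then have "(1 - cdot w z) * (1 - cdot z w) = of_real ((norm (1 - cdot w z))\<^sup>2)"
  by (simp add: complex_norm_square del: of_real_power)
 then have "complex_of_real (defect (mobius z w)) = of_real (defect z * defect w / (norm (1 - cdot w z))\<^sup>2)"
  using one_minus_cdot_mobius_mobius[OF z w w] by (simp add: d)
 then show ?thesis using of_real_eq_iff by blast
qed

lemma mobius_in_ball [intro]:
 assumes "z \<in> unit_ball" "w \<in> unit_ball" shows "mobius z w \<in> unit_ball"
proof -
 have "defect (mobius z w) > 0"
  unfolding defect_mobius[OF assms] using assms one_minus_cdot_nz[of w z] by (auto intro!: divide_pos_pos mult_pos_pos defect_pos)
 then show ?thesis by (simp add: defect_def abs_square_less_1)
qed

lemma norm_mobius_commute:
 assumes "z \<in> unit_ball" "w \<in> unit_ball" shows "norm (mobius z w) = norm (mobius w z)"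
proof -
 have "norm (1 - cdot w z) = norm (1 - cdot z w)"
  by (metis cnj_cdot complex_cnj_diff complex_cnj_one complex_mod_cnj)
 then have "defect (mobius z w) = defect (mobius w z)" using assms by (simp add: defect_mobius)
 then show ?thesis by (simp add: defect_def)
qed

text \<open>For the image \<open>m\<close> the inner product \<open>cdot m z\<close> is known from
  \<open>one_minus_cdot_mobius\<close>, so applying \<open>mobius_alt\<close> to \<open>m\<close>
  leaves a combination of \<open>z\<close> and \<open>w\<close>. The coefficient of \<open>z\<close>
  vanishes because \<open>D * A = s * B\<close>.\<close>

lemma mobius_mobius:
 assumes z: "z \<in> unit_ball" and w: "w \<in> unit_ball"
 shows "mobius z (mobius z w) = w"
proof -
 define s where "s = complex_of_real (sqrt (defect z))"
 define D where "D = 1 - cdot w z"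
 have D: "D \<noteq> 0" unfolding D_def using one_minus_cdot_nz[OF w z] .
 have s: "s \<noteq> 0" using defect_pos[OF z] by (simp add: s_def)
 have ds: "of_real (defect z) = s\<^sup>2"
  using defect_pos[OF z] by (simp add: s_def flip: of_real_power)
 have s1: "1 + s \<noteq> 0" using one_plus_of_real_nz[OF real_sqrt_gt_zero[OF defect_pos[OF z]]] unfolding s_def .
 define m where "m = mobius z w"
 have m: "m = (1 / D) *s ((1 - (1 - D) / (1 + s)) *s z - s *s w)"
  by (simp add: m_def mobius_alt[OF z] s_def D_def)
 have mz: "1 - cdot m z = s\<^sup>2 / D"
  using one_minus_cdot_mobius[OF z w] by (simp add: m_def D_def ds)
 then have mz': "cdot m z = 1 - s\<^sup>2 / D" by (simp add: algebra_simps)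
 have "mobius z m = (D / s\<^sup>2) *s ((1 - (1 - s\<^sup>2 / D) / (1 + s)) *s z - s *s m)"
  using mobius_alt[OF z, of m] unfolding mz by (simp add: mz' s_def)
 also have "... = w"
 proof -
  define t where "t = 1 / (1 + s)"
  have t: "t * (1 + s) = 1" using s1 by (simp add: t_def)
  define A B where "A = 1 - (1 - s\<^sup>2 / D) * t" and "B = 1 - (1 - D) * t"
  have "D * A - s * B = D - D * t + s\<^sup>2 * t - s + s * t - s * D * t"
   using D by (simp add: A_def B_def field_simps)
  also have "... = 0" using t by algebra
  finally have AB: "D * A = s * B" by simp
  have "D / s\<^sup>2 * (A * z $ i - s * (1 / D * (B * z $ i - s * w $ i))) = w $ i" for i
  proof -
   have "D / s\<^sup>2 * (A * z $ i - s * (1 / D * (B * z $ i - s * w $ i)))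
     = (D * A - s * B) * z $ i / s\<^sup>2 + w $ i"
    using D s by (simp add: field_simps power2_eq_square)
   then show ?thesis by (simp add: AB)
  qed
  then have "((D / s\<^sup>2) *s (A *s z - s *s ((1 / D) *s (B *s z - s *s w)))) $ i = w $ i" for i
   by (simp only: vector_smult_component vector_minus_component)
  then show ?thesis
   unfolding vec_eq_iff m A_def B_def t_def by (simp only: times_divide_eq_right mult_1_right simp_thms)
 qed
 finally show ?thesis by (simp add: m_def)
qed

lemma mobius_0 [simp]: "mobius 0 w = - w"
 by (simp add: mobius_def line_proj_def vec_eq_iff)

lemma continuous_on_mobius:
 "continuous_on (unit_ball \<times> unit_ball) (\<lambda>x. mobius (fst x) (snd x))"
proof -
 have "continuous_on (unit_ball \<times> unit_ball) (\<lambda>x. (1 / (1 - cdot (snd x) (fst x))) *s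
   ((1 - cdot (snd x) (fst x) / of_real (1 + sqrt (defect (fst x)))) *s fst x - of_real (sqrt (defect (fst x))) *s snd x))"
 proof (intro continuous_intros ballI)
  fix x :: "(complex ^ 'n) \<times> (complex ^ 'n)" assume x: "x \<in> unit_ball \<times> unit_ball"
  then show "1 - cdot (snd x) (fst x) \<noteq> 0" using one_minus_cdot_nz[of "snd x" "fst x"] by (cases x) auto
  have "0 \<le> sqrt (defect (fst x))" using x defect_pos[of "fst x"] by (auto intro: less_imp_le)
  then have "1 + sqrt (defect (fst x)) \<noteq> 0" by linarith
  then show "complex_of_real (1 + sqrt (defect (fst x))) \<noteq> 0" using of_real_eq_0_iff by blast
 qed
 then show ?thesis
  by (rule continuous_on_eq) (auto simp: mobius_alt)
qed

lemma continuous_on_mobius_comp [continuous_intros]: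
 assumes "continuous_on S f" "continuous_on S g" "\<And>x. x \<in> S ==> f x \<in> unit_ball" "\<And>x. x \<in> S ==> g x \<in> unit_ball"
 shows "continuous_on S (\<lambda>x. mobius (f x) (g x))"
 using continuous_on_compose2[OF continuous_on_mobius, of S "\<lambda>x. (f x, g x)"] assms
 by (auto intro!: continuous_intros simp: image_subset_iff)

section \<open>The kernel and its transformation rule\<close>

lemma kernel_in:
 fixes w z :: "complex ^ 'n"
 shows "w \<in> unit_ball ==> kernel z w = 1 / (1 - cdot w z) ^ (CARD('n) + 1)"
 by (simp add: kernel_def)

lemma kernel_out [simp]: "w \<notin> unit_ball ==> kernel z w = 0"
 by (simp add: kernel_def)

lemma kernel_sym: "w \<in> unit_ball ==> z \<in> unit_ball ==> cnj (kernel z w) = kernel w z"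
 by (simp add: kernel_def cnj_cdot)

text \<open>Writing \<open>v\<close> as \<open>mobius u x\<close> with \<open>x = mobius u v\<close>
  lets \<open>one_minus_cdot_mobius_mobius\<close> compute the factors. This is why
  \<open>transl u\<close> maps kernel functions to multiples of kernel functions.\<close>

lemma kernel_mobius:
 assumes u: "u \<in> unit_ball" and v: "v \<in> unit_ball" and w: "(w :: complex ^ 'n) \<in> unit_ball"
 shows "kernel v (mobius u w) * kernel u w = kernel (mobius u v) w / (1 - cdot u v) ^ (CARD('n) + 1)"
proof -
 define x where "x = mobius u v"
 have x: "x \<in> unit_ball" "v = mobius u x" using mobius_in_ball[OF u v] mobius_mobius[OF u v] by (simp_all add: x_def)
 have "1 - cdot (mobius u w) v = of_real (defect u) * (1 - cdot w x) / ((1 - cdot w u) * (1 - cdot u x))"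
  unfolding x(2) by (rule one_minus_cdot_mobius_mobius[OF u w x(1)])
 moreover have "1 - cdot u x = of_real (defect u) / (1 - cdot u v)"
  unfolding x_def by (rule one_minus_cdot_mobius'[OF u v])
 ultimately have "(1 - cdot (mobius u w) v) * (1 - cdot w u) = (1 - cdot w x) * (1 - cdot u v)"
  using one_minus_cdot_nz[OF w u] one_minus_cdot_nz[OF u v] defect_pos[OF u] by simp
 then have "(1 - cdot (mobius u w) v) ^ (CARD('n) + 1) * (1 - cdot w u) ^ (CARD('n) + 1)
  = (1 - cdot w x) ^ (CARD('n) + 1) * (1 - cdot u v) ^ (CARD('n) + 1)"
  by (simp only: power_mult_distrib[symmetric])
 then show ?thesis using mobius_in_ball[OF u w] w by (simp add: kernel_def x_def)
qed

lemma continuous_on_kernel [continuous_intros]: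
 fixes f g :: "'a :: topological_space \<Rightarrow> complex ^ 'n"
 assumes "continuous_on S f" "continuous_on S g" "\<And>x. x \<in> S ==> f x \<in> unit_ball" "\<And>x. x \<in> S ==> g x \<in> unit_ball"
 shows "continuous_on S (\<lambda>x. kernel (f x) (g x))"
proof -
 have "continuous_on S (\<lambda>x. 1 / (1 - cdot (g x) (f x)) ^ (CARD('n) + 1))"
  using assms one_minus_cdot_nz by (intro continuous_intros) auto
 then show ?thesis by (rule continuous_on_eq) (use assms(4) in \<open>simp add: kernel_def\<close>)
qed

lemma norm_kernel_le:
 fixes w z :: "complex ^ 'n"
 assumes "w \<in> unit_ball" "z \<in> unit_ball"
 shows "norm (kernel z w) \<le> 1 / (1 - norm z) ^ (CARD('n) + 1)"
 unfolding kernel_in[OF assms(1)] norm_divide norm_power norm_one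
 using norm_one_minus_cdot_ge1[OF assms] one_minus_cdot_nz[OF assms] assms
 by (intro divide_left_mono power_mono mult_pos_pos zero_less_power) auto

section \<open>Isometries and radial layers of Lebesgue measure\<close>

lemma nn_integral_lborel_translate:
 fixes f :: "'a::euclidean_space \<Rightarrow> ennreal"
 assumes [measurable]: "f \<in> borel_measurable borel"
 shows "(\<integral>\<^sup>+x. f (c + x) \<partial>lborel) = (\<integral>\<^sup>+x. f x \<partial>lborel)"
 by (subst lborel_distr_plus[of c, symmetric]) (simp add: nn_integral_distr)

text \<open>Integrating \<open>1\<^sub>A(f t + y) 1\<^sub>B(y)\<close> over \<open>t\<close> and \<open>y\<close>, \<open>B\<close> the unit ball, in both orders
 and using translation invariance gives \<open>\<lambda>(f\<^sup>-\<^sup>1 A) \<lambda>(B) = \<lambda>(A) \<lambda>(B)\<close>.\<close>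

lemma distr_lborel_isometry:
 fixes f :: "'a::euclidean_space \<Rightarrow> 'a"
 assumes f: "linear f" "surj f" "\<And>x. norm (f x) = norm x"
 shows "distr lborel borel f = lborel"
proof (rule measure_eqI)
 have fm[measurable]: "f \<in> borel_measurable borel"
  using f(1) by (intro borel_measurable_continuous_onI linear_continuous_on)
   (auto simp: linear_conv_bounded_linear)
 fix A assume "A \<in> sets (distr lborel borel f)"
 then have A[measurable]: "A \<in> sets borel" by simp
 define B :: "'a set" where "B = ball 0 1"
 have B[measurable]: "B \<in> sets borel" by (simp add: B_def)
 define G :: "'a \<Rightarrow> 'a \<Rightarrow> ennreal" where "G t y = indicator A (f t + y) * indicator B y" for t y
 have Gm[measurable]: "case_prod G \<in> borel_measurable (lborel \<Otimes>\<^sub>M lborel)"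
  unfolding G_def by measurable
 have inv: "\<exists>x. f x = y" for y using f(2) by (metis surjD)
 have "(\<integral>\<^sup>+t. indicator A (f t + y) \<partial>lborel) = emeasure (distr lborel borel f) A" for y
 proof -
  obtain x where x: "f x = y" using inv by blast
  have "(\<integral>\<^sup>+t. indicator A (f t + y) \<partial>lborel) = (\<integral>\<^sup>+t. indicator A (f (x + t)) \<partial>lborel)"
   by (simp add: linear_add[OF f(1)] x add.commute)
  also have "... = (\<integral>\<^sup>+t. indicator A (f t) \<partial>lborel)"
   by (rule nn_integral_lborel_translate) measurable
  also have "... = (\<integral>\<^sup>+t. indicator A t \<partial>distr lborel borel f)"
   by (subst nn_integral_distr) auto
  finally show ?thesis by simp
 qed
 then have "(\<integral>\<^sup>+y. (\<integral>\<^sup>+t. G t y \<partial>lborel) \<partial>lborel) = emeasure (distr lborel borel f) A * emeasure lborel B"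
  by (simp add: G_def nn_integral_multc nn_integral_cmult)
 moreover have "(\<integral>\<^sup>+y. (\<integral>\<^sup>+t. G t y \<partial>lborel) \<partial>lborel) = emeasure lborel A * emeasure lborel B"
 proof -
  have "(\<integral>\<^sup>+y. G t y \<partial>lborel) = (\<integral>\<^sup>+y. indicator A y * indicator B (y - f t) \<partial>lborel)" for t
   using nn_integral_lborel_translate[of "\<lambda>y. indicator A (f t + y) * indicator B y" "- f t"]
   by (simp add: G_def)
  then have "(\<integral>\<^sup>+y. (\<integral>\<^sup>+t. G t y \<partial>lborel) \<partial>lborel)
    = (\<integral>\<^sup>+t. (\<integral>\<^sup>+y. indicator A y * indicator B (y - f t) \<partial>lborel) \<partial>lborel)"
   by (subst lborel_pair.Fubini') auto
  also have "... = (\<integral>\<^sup>+y. (\<integral>\<^sup>+t. indicator A y * indicator B (y - f t) \<partial>lborel) \<partial>lborel)"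
   by (rule lborel_pair.Fubini') measurable
  also have "... = (\<integral>\<^sup>+y. indicator A y * emeasure lborel B \<partial>lborel)"
  proof (rule nn_integral_cong)
   fix y
   obtain x where x: "f x = y" using inv by blast
   have e: "indicator B (y - f t) = (indicator B (- x + t) :: ennreal)" for t
    using f(3)[of "x - t"] by (simp add: B_def indicator_def linear_diff[OF f(1)] x norm_minus_commute)
   have "(\<integral>\<^sup>+t. indicator B (y - f t) \<partial>lborel) = (\<integral>\<^sup>+t. indicator B t \<partial>lborel)"
    unfolding e by (rule nn_integral_lborel_translate) measurable
   then show "(\<integral>\<^sup>+t. indicator A y * indicator B (y - f t) \<partial>lborel) = indicator A y * emeasure lborel B"
    by (simp add: nn_integral_cmult)
  qed
  finally show ?thesis by (simp add: nn_integral_multc)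
 qed
 moreover have "emeasure lborel B \<noteq> 0" "emeasure lborel B \<noteq> top"
  using emeasure_lborel_ball_finite[of "0::'a" 1] content_ball_pos[of 1 "0::'a"] unfolding B_def 
  by (auto simp: measure_def less_top[symmetric])
 ultimately show "emeasure (distr lborel borel f) A = emeasure lborel A"
  by (metis ennreal_mult_divide_eq)
qed simp

text \<open>These rotations separate the monomials \<open>cdot w v ^ j * cnj (cdot w v) ^ k\<close>
  with \<open>j \<noteq> k\<close>; see \<open>rotation_integral_zero\<close>.\<close>

lemma distr_lborel_unimodular:
 assumes "norm c = 1"
 shows "distr lborel borel (\<lambda>x. c *s (x :: complex ^ 'n)) = lborel"
proof (rule distr_lborel_isometry)
 show "linear (\<lambda>x. c *s (x :: complex ^ 'n))"
  by (rule linearI) (simp_all add: vec_eq_iff algebra_simps)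
 have "c *s (inverse c *s y) = y" for y :: "complex ^ 'n" using assms by (cases "c = 0") (auto simp: vec_eq_iff)
 then show "surj (\<lambda>x. c *s (x :: complex ^ 'n))" by (metis surj_def)
qed (simp add: norm_smult_vec assms)

lemma nn_integral_lborel_scale:
 fixes f :: "'a::euclidean_space \<Rightarrow> ennreal"
 assumes [measurable]: "f \<in> borel_measurable borel" and c: "c > 0"
 shows "(\<integral>\<^sup>+x. f x \<partial>lborel) = ennreal (c ^ DIM('a)) * (\<integral>\<^sup>+x. f (c *\<^sub>R x) \<partial>lborel)"
 using c by (subst lborel_affine[of c 0])
  (simp_all add: nn_integral_density nn_integral_distr nn_integral_cmult)

text \<open>The measure of the layers \<open>|x|\<^sup>2 \<in> E\<close> is computed on the generator \<open>{..<a}\<close> by scaling.\<close>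

lemma nn_integral_radial:
 fixes F :: "'a::euclidean_space \<Rightarrow> ennreal"
 assumes Fm[measurable]: "F \<in> borel_measurable borel" and \<psi>[measurable]: "\<psi> \<in> borel_measurable borel"
  and hom: "\<And>t x. t > 0 ==> F (t *\<^sub>R x) = ennreal (t ^ m) * F x"
  and kap: "kap = (DIM('a) + m) / 2"
  and C: "C = (\<integral>\<^sup>+x. F x * indicator (ball 0 1) x \<partial>lborel)" and fin: "C < \<infinity>"
 shows "(\<integral>\<^sup>+x. F x * \<psi> ((norm x)\<^sup>2) \<partial>lborel)
  = C * (\<integral>\<^sup>+y. ennreal (kap * y powr (kap - 1)) * indicator {0<..} y * \<psi> y \<partial>lborel)"
proof -
 have kap0: "kap > 0" using DIM_positive[where 'a='a] by (simp add: kap add_pos_nonneg)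
 have [measurable]: "ball (0::'a) 1 \<in> sets borel" by simp
 have Fm': "(\<lambda>x. F x * indicator (ball 0 1) x) \<in> borel_measurable lborel" by measurable
 define \<nu> where "\<nu> = distr (density lborel F) borel (\<lambda>x. (norm x)\<^sup>2)"
 define g where "g y = C * (ennreal (kap * y powr (kap - 1)) * indicator {0<..} y)" for y :: real
 have gm[measurable]: "g \<in> borel_measurable borel" unfolding g_def by measurable
 have pw: "(\<integral>\<^sup>+y. ennreal (kap * y powr (kap - 1)) * indicator {0<..} y * indicator {..<a} y \<partial>lborel) = ennreal (a powr kap)"
  if "a > 0" for a
 proof -
  have "((\<lambda>y. kap * y powr (kap - 1)) has_integral kap * (a powr (kap - 1 + 1) / (kap - 1 + 1))) {0..a}"
   using kap0 that by (intro has_integral_mult_right has_integral_powr_from_0) auto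
  then have "((\<lambda>y. kap * y powr (kap - 1)) has_integral a powr kap) {0..a}" using kap0 by simp
  then have "((\<lambda>y. kap * y powr (kap - 1)) has_integral a powr kap) {0<..<a}"
   by (simp add: has_integral_Icc_iff_Ioo)
  then have "(\<integral>\<^sup>+y. ennreal (kap * y powr (kap - 1)) * indicator {0<..<a} y \<partial>lborel) = ennreal (a powr kap)"
   using kap0 by (intro nn_integral_has_integral_lebesgue') auto
  also have "(\<integral>\<^sup>+y. ennreal (kap * y powr (kap - 1)) * indicator {0<..<a} y \<partial>lborel)
   = (\<integral>\<^sup>+y. ennreal (kap * y powr (kap - 1)) * indicator {0<..} y * indicator {..<a} y \<partial>lborel)"
   by (intro nn_integral_cong) (auto split: split_indicator)
  finally show ?thesis .
 qed
 \<comment> \<open>Scaling by \<open>t = sqrt a\<close> produces the factor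
   \<open>t ^ (DIM('a) + m)\<close>, which is the origin of the exponent \<open>kap\<close> in terms
   of \<open>a\<close>.\<close>
 have lay: "(\<integral>\<^sup>+x. F x * indicator {..<a} ((norm x)\<^sup>2) \<partial>lborel) = C * ennreal (a powr kap)" if a: "a > 0" for a
 proof -
  define t where "t = sqrt a"
  have t: "t > 0" "t\<^sup>2 = a" using a by (auto simp: t_def)
  have i: "indicator {..<a} ((norm (t *\<^sub>R x))\<^sup>2) = (indicator (ball 0 1) x :: ennreal)" for x :: 'a
  proof -
   have "(norm (t *\<^sub>R x))\<^sup>2 = a * (norm x)\<^sup>2" using t by (simp add: power_mult_distrib)
   then have "(norm (t *\<^sub>R x))\<^sup>2 < a \<longleftrightarrow> (norm x)\<^sup>2 < 1" using a by (simp add: mult_less_cancel_left1)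
   also have "... \<longleftrightarrow> norm x < 1" by (simp add: abs_square_less_1)
   finally show ?thesis by (simp add: indicator_def)
  qed
  have "(\<integral>\<^sup>+x. F x * indicator {..<a} ((norm x)\<^sup>2) \<partial>lborel)
   = ennreal (t ^ DIM('a)) * (\<integral>\<^sup>+x. F (t *\<^sub>R x) * indicator {..<a} ((norm (t *\<^sub>R x))\<^sup>2) \<partial>lborel)"
   by (rule nn_integral_lborel_scale) (auto simp: t)
  also have "... = ennreal (t ^ DIM('a)) * (\<integral>\<^sup>+x. ennreal (t ^ m) * (F x * indicator (ball 0 1) x) \<partial>lborel)"
   unfolding i using t by (simp only: hom mult.assoc)
  also have "... = ennreal (t ^ DIM('a)) * (ennreal (t ^ m) * C)"
   unfolding C by (subst nn_integral_cmult[OF Fm']) (rule refl)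
  also have "... = C * ennreal (t ^ (DIM('a) + m))"
   using t by (simp add: power_add ennreal_mult mult_ac)
  also have "t ^ (DIM('a) + m) = a powr kap"
   using t a by (simp add: kap t_def powr_half_sqrt[symmetric] powr_powr add_divide_distrib flip: powr_realpow)
  finally show ?thesis .
 qed
 have "\<nu> = density lborel g"
 proof (rule measure_eqI_generator_eq[where E="range lessThan" and \<Omega>=UNIV and A="\<lambda>i. {..<real (Suc i)}"])
  have [simp]: "{..<a} \<inter> {..<b} = {..<min a b}" for a b :: real by auto
  show "Int_stable (range (lessThan :: real \<Rightarrow> _))" by (auto simp: Int_stable_def)
  show "sets \<nu> = sigma_sets UNIV (range lessThan)" "sets (density lborel g) = sigma_sets UNIV (range lessThan)"
   by (simp_all add: \<nu>_def borel_Iio)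
  have \<nu>1: "emeasure \<nu> {..<a} = (\<integral>\<^sup>+x. F x * indicator {..<a} ((norm x)\<^sup>2) \<partial>lborel)" for a
  proof -
   have "(\<lambda>x :: 'a. (norm x)\<^sup>2) -` {..<a} \<in> sets borel"
    by (rule measurable_sets_borel) measurable
   then show ?thesis unfolding \<nu>_def
    by (subst emeasure_distr) (auto simp: emeasure_density intro!: nn_integral_cong split: split_indicator)
  qed
  show "emeasure \<nu> X = emeasure (density lborel g) X" if "X \<in> range lessThan" for X
  proof -
   from that obtain a where X: "X = {..<a}" by auto
   have g1: "emeasure (density lborel g) X = C * (\<integral>\<^sup>+y. ennreal (kap * y powr (kap - 1)) * indicator {0<..} y * indicator {..<a} y \<partial>lborel)"
    by (simp add: X emeasure_density g_def mult.assoc nn_integral_cmult)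
   show ?thesis
   proof (cases "a > 0")
    case True
    then show ?thesis using lay pw g1 by (simp add: X \<nu>1)
   next
    case False
    have "indicator {..<a} ((norm x)\<^sup>2) = (0::ennreal)" for x :: 'a
     using False by (auto simp: indicator_def) (smt (verit) zero_le_power2)
    then have "emeasure \<nu> X = 0" by (simp add: \<nu>1 X)
    have "ennreal (kap * y powr (kap - 1)) * indicator {0<..} y * indicator {..<a} y = 0" for y
     using False by (auto simp: indicator_def)
    then have "emeasure (density lborel g) X = 0" unfolding g1 by (simp only: nn_integral_const mult_zero_left mult_zero_right)
    then show ?thesis using \<open>emeasure \<nu> X = 0\<close> by simp
   qed
  qed
  show "(\<Union>i. {..<real (Suc i)}) = UNIV"
  proof (intro set_eqI iffI UNIV_I)
   fix x :: real
   obtain n where "x < real n" using reals_Archimedean2 by blast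
   then have "x \<in> {..<real (Suc n)}" by simp
   then show "x \<in> (\<Union>i. {..<real (Suc i)})" by blast
  qed
  have "real (Suc i) > 0" for i by simp
  then show "emeasure \<nu> {..<real (Suc i)} \<noteq> \<infinity>" for i
   using lay[of "real (Suc i)"] \<nu>1[of "real (Suc i)"] fin by (simp add: ennreal_mult_eq_top_iff del: of_nat_Suc)
  show "range (\<lambda>i. {..<real (Suc i)}) \<subseteq> range lessThan" by blast
  show "range (lessThan :: real \<Rightarrow> _) \<subseteq> Pow UNIV" by blast
 qed
 then have "(\<integral>\<^sup>+y. \<psi> y \<partial>\<nu>) = (\<integral>\<^sup>+y. \<psi> y \<partial>density lborel g)" by simp
 then show ?thesis
  by (simp add: \<nu>_def nn_integral_distr nn_integral_density g_def mult.assoc nn_integral_cmult)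
qed

section \<open>Parseval formulas for power series in an inner product\<close>

lemma borel_measurable_cnj [measurable (raw)]:
 "f \<in> borel_measurable M ==> (\<lambda>x. cnj (f x)) \<in> borel_measurable M"
 by (rule measurable_compose[where g = cnj]) (auto intro!: borel_measurable_continuous_onI continuous_intros)

text \<open>\<open>|f|^2\<close> is the Cauchy product of the power series and its conjugate. As the
  coefficients are nonnegative, its terms are dominated by those of the Cauchy product
  \<open>H\<close> for \<open>|X|\<close>, whose sum \<open>S^2\<close> is integrable. Grouping by
  total degree \<open>l\<close> serves two purposes: for rotation invariant measures only
  \<open>2 * j = l\<close> survives, and for arbitrary finite measures on the ball the degrees can
  be compared one by one.\<close>

lemma power_pairing_sums:
 fixes X :: "'a \<Rightarrow> complex" and b :: "nat \<Rightarrow> real"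
 assumes [measurable]: "X \<in> borel_measurable M" "f \<in> borel_measurable M"
  and b: "\<And>j. b j \<ge> 0"
  and S: "AE x in M. (\<lambda>j. b j * norm (X x) ^ j) sums S x"
  and int: "integrable M (\<lambda>x. (S x)\<^sup>2)"
  and f: "AE x in M. (\<lambda>j. of_real (b j) * X x ^ j) sums f x"
 shows "(\<lambda>l. \<Sum>j\<le>l. of_real (b j * b (l - j)) * (LINT x|M. X x ^ j * cnj (X x) ^ (l - j)))
  sums (of_real (LINT x|M. (norm (f x))\<^sup>2))"
proof -
 define h where "h l x = (\<Sum>j\<le>l. of_real (b j * b (l - j)) * (X x ^ j * cnj (X x) ^ (l - j)))" for l x
 define H where "H l x = (\<Sum>j\<le>l. (b j * norm (X x) ^ j) * (b (l - j) * norm (X x) ^ (l - j)))" for l x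
 have hm[measurable]: "h l \<in> borel_measurable M" and Hm[measurable]: "H l \<in> borel_measurable M" for l
  unfolding h_def H_def by measurable
 have hH: "norm (h l x) \<le> H l x" for l x
  unfolding h_def H_def using b
  by (intro order_trans[OF norm_sum] sum_mono) (simp add: norm_mult norm_power mult_ac)
 have H0: "0 \<le> H l x" for l x using hH[of l x] norm_ge_zero order_trans by blast
 have HS: "AE x in M. (\<lambda>l. H l x) sums (S x)\<^sup>2"
  using S
 proof eventually_elim
  fix x assume "(\<lambda>j. b j * norm (X x) ^ j) sums S x"
  moreover from this have "summable (\<lambda>j. norm (b j * norm (X x) ^ j))"
   using b by (simp add: sums_iff norm_mult norm_power)
  ultimately show "(\<lambda>l. H l x) sums (S x)\<^sup>2"
   using Cauchy_product_sums[of "\<lambda>j. b j * norm (X x) ^ j" "\<lambda>j. b j * norm (X x) ^ j"]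
   by (simp add: H_def sums_iff power2_eq_square)
 qed
 have hf: "AE x in M. (\<lambda>l. h l x) sums of_real ((norm (f x))\<^sup>2)"
  using S f
 proof eventually_elim
  fix x assume 1: "(\<lambda>j. b j * norm (X x) ^ j) sums S x" and 2: "(\<lambda>j. of_real (b j) * X x ^ j) sums f x"
  have sm: "summable (\<lambda>j. norm (of_real (b j) * X x ^ j))"
   using 1 b by (simp add: sums_iff norm_mult norm_power)
  then have sm': "summable (\<lambda>j. norm (cnj (of_real (b j) * X x ^ j)))" by (simp add: norm_mult norm_power)
  have "(\<lambda>j. cnj (of_real (b j) * X x ^ j)) sums cnj (f x)" using 2 by (simp only: sums_cnj)
  then have "(\<Sum>j. cnj (of_real (b j) * X x ^ j)) = cnj (f x)" by (simp add: sums_iff)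
  moreover have "(\<Sum>j. of_real (b j) * X x ^ j) = f x" using 2 by (simp add: sums_iff)
  ultimately have "(\<lambda>l. \<Sum>j\<le>l. (of_real (b j) * X x ^ j) * cnj (of_real (b (l - j)) * X x ^ (l - j))) sums (f x * cnj (f x))"
   using Cauchy_product_sums[OF sm sm'] by simp
  moreover have "(\<Sum>j\<le>l. (of_real (b j) * X x ^ j) * cnj (of_real (b (l - j)) * X x ^ (l - j))) = h l x" for l
   unfolding h_def by (intro sum.cong) (auto simp: mult_ac)
  ultimately show "(\<lambda>l. h l x) sums of_real ((norm (f x))\<^sup>2)"
   by (simp add: complex_norm_square mult_ac del: of_real_power)
 qed
 have iH: "integrable M (H l)" for l
 proof (rule integrable_dominated[OF int])
  show "AE x in M. norm (H l x) \<le> norm ((S x)\<^sup>2)"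
   using HS
  proof eventually_elim
   fix x assume "(\<lambda>l. H l x) sums (S x)\<^sup>2"
   then have "H l x \<le> (S x)\<^sup>2" using sum_le_suminf[of "\<lambda>l. H l x" "{l}"] H0 by (auto simp: sums_iff)
   then show "norm (H l x) \<le> norm ((S x)\<^sup>2)" using H0 by simp
  qed
 qed simp
 have ih: "integrable M (h l)" for l
  by (rule integrable_dominated[OF iH[of l]]) (use hH H0 in auto)
 \<comment> \<open>A single term is bounded by \<open>H (j + k)\<close> only when its coefficient is
   positive; terms with coefficient 0 are treated separately when the integral is taken out of the
   sum.\<close>
 have isum: "integrable M (\<lambda>x. X x ^ j * cnj (X x) ^ k)" if "b j * b k > 0" for j k
 proof -
  have "norm (X x ^ j * cnj (X x) ^ k) \<le> norm (H (j + k) x / (b j * b k))" for x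
  proof -
   have "(b j * norm (X x) ^ j) * (b (j + k - j) * norm (X x) ^ (j + k - j)) \<le> H (j + k) x"
    unfolding H_def using b by (intro member_le_sum) auto
   then have "(norm (X x) ^ j * norm (X x) ^ k) * (b j * b k) \<le> H (j + k) x" by (simp add: mult_ac)
   then have "norm (X x) ^ j * norm (X x) ^ k \<le> H (j + k) x / (b j * b k)"
    using that by (simp add: pos_le_divide_eq)
   moreover have "\<bar>H (j + k) x / (b j * b k)\<bar> = H (j + k) x / (b j * b k)"
    using H0 that by (intro abs_of_nonneg) simp
   ultimately show ?thesis by (simp only: norm_mult norm_power complex_mod_cnj real_norm_def)
  qed
  then show ?thesis
   by (intro integrable_dominated[OF integrable_divide[OF iH[of "j + k"]]]) auto
 qed
 have "(\<lambda>l. integral\<^sup>L M (h l)) sums (LINT x|M. (\<Sum>l. h l x))"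
 proof (rule sums_integral)
  show "AE x in M. summable (\<lambda>l. norm (h l x))"
   using HS by eventually_elim (rule summable_comparison_test', auto simp: sums_iff intro: hH)
  show "summable (\<lambda>l. \<integral>x. norm (h l x) \<partial>M)"
  proof (rule summable_comparison_test')
   show "summable (\<lambda>l. \<integral>x. H l x \<partial>M)"
   proof (rule summableI_nonneg_bounded)
    show "0 \<le> (LINT x|M. H l x)" for l using H0 by (simp add: integral_nonneg_AE)
    show "(\<Sum>l<N. \<integral>x. H l x \<partial>M) \<le> (LINT x|M. (S x)\<^sup>2)" for N
    proof -
     have "(\<Sum>l<N. \<integral>x. H l x \<partial>M) = (LINT x|M. (\<Sum>l<N. H l x))"
      using iH by (simp add: Bochner_Integration.integral_sum)
     also have "... \<le> (LINT x|M. (S x)\<^sup>2)"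
     proof (rule integral_mono_AE)
      show "AE x in M. (\<Sum>l<N. H l x) \<le> (S x)\<^sup>2"
       using HS
      proof eventually_elim
       fix x assume "(\<lambda>l. H l x) sums (S x)\<^sup>2"
       then show "(\<Sum>l<N. H l x) \<le> (S x)\<^sup>2"
        using sum_le_suminf[of "\<lambda>l. H l x" "{..<N}"] H0 by (auto simp: sums_iff)
      qed
     qed (use iH int in auto)
     finally show ?thesis .
    qed
   qed
   show "norm (LINT x|M. norm (h l x)) \<le> (LINT x|M. H l x)" if "l \<ge> 0" for l
    using hH ih iH by (simp add: integral_nonneg_AE) (intro integral_mono, auto)
  qed
 qed (rule ih)
 moreover have "(LINT x|M. (\<Sum>l. h l x)) = (LINT x|M. of_real ((norm (f x))\<^sup>2))"
 proof -
  have eq: "AE x in M. (\<Sum>l. h l x) = of_real ((norm (f x))\<^sup>2)"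
   using hf by eventually_elim (simp only: sums_iff)
  show ?thesis by (rule integral_cong_AE) (use eq in measurable)
 qed
 moreover have "integral\<^sup>L M (h l) = (\<Sum>j\<le>l. of_real (b j * b (l - j)) * (LINT x|M. X x ^ j * cnj (X x) ^ (l - j)))" for l
 proof -
  have i: "integrable M (\<lambda>x. of_real (b j * b (l - j)) * (X x ^ j * cnj (X x) ^ (l - j)))" for j
  proof (cases "b j * b (l - j) = 0")
   case False
   then have "b j * b (l - j) > 0" using b by (simp add: order_less_le)
   from isum[OF this] show ?thesis by simp
  next
   case True then show ?thesis by (simp only: True of_real_0 mult_zero_left) simp
  qed
  show ?thesis unfolding h_def by (subst Bochner_Integration.integral_sum) (use i in auto)
 qed
 ultimately show ?thesis by (simp only: integral_complex_of_real)
qed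

text \<open>After division by the lowest power with a nonzero difference, the limit at 0 from the
  right is that difference. Only positive \<open>x\<close> are considered, because the lemma is
  applied to \<open>x = t^2\<close> and to scaling factors \<open>t\<close>.\<close>

lemma powser_coeff_unique:
 fixes a b :: "nat \<Rightarrow> real"
 assumes r: "r > 0"
  and a: "\<And>x. 0 < x ==> x < r ==> (\<lambda>i. a i * x ^ i) sums f x"
  and b: "\<And>x. 0 < x ==> x < r ==> (\<lambda>i. b i * x ^ i) sums f x"
 shows "a = b"
proof (rule ccontr)
 assume "a \<noteq> b"
 define d where "d i = a i - b i" for i
 have d: "(\<lambda>i. d i * x ^ i) sums 0" if "0 < x" "x < r" for x
  using sums_diff[OF a[OF that] b[OF that]] by (simp add: d_def algebra_simps)
 have ex: "\<exists>k. d k \<noteq> 0" using \<open>a \<noteq> b\<close> by (auto simp: d_def fun_eq_iff)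
 define k where "k = (LEAST k. d k \<noteq> 0)"
 have k: "d k \<noteq> 0" unfolding k_def using ex by (rule LeastI_ex)
 have k': "d i = 0" if "i < k" for i using not_less_Least[of i "\<lambda>k. d k \<noteq> 0"] that by (auto simp: k_def)
 define e where "e i = d (i + k)" for i
 have e: "(\<lambda>i. e i * x ^ i) sums 0" if x: "0 < x" "x < r" for x
 proof -
  have "(\<lambda>i. d (i + k) * x ^ (i + k)) sums (0 - (\<Sum>i<k. d i * x ^ i))"
   by (rule sums_split_initial_segment[OF d[OF x]])
  then have "(\<lambda>i. (e i * x ^ i) * x ^ k) sums 0" using k' by (simp add: e_def power_add mult.assoc)
  then have "(\<lambda>i. (e i * x ^ i) * x ^ k / x ^ k) sums (0 / x ^ k)" by (rule sums_divide)
  then show ?thesis using x by simp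
 qed
 define F where "F x = (\<Sum>i. e i * x ^ i)" for x
 have "(F \<longlongrightarrow> e 0) (at 0)"
 proof (rule powser_limit_0[of "r/2"])
  fix x :: real assume "norm x < r / 2"
  moreover have "summable (\<lambda>i. e i * (r/2) ^ i)" using e[of "r/2"] r by (simp add: sums_iff)
  ultimately show "(\<lambda>n. e n * x ^ n) sums F x"
   unfolding F_def using powser_inside[of e "r/2" x] r by (simp add: summable_sums)
 qed (use r in simp)
 then have "(F \<longlongrightarrow> e 0) (at_right 0)" by (rule filterlim_mono) (auto simp: at_le)
 moreover have "\<forall>\<^sub>F x in at_right 0. F x = 0"
  unfolding eventually_at_right_field using r e by (auto simp: F_def sums_iff intro!: exI[of _ r])
 ultimately have "((\<lambda>x. 0) \<longlongrightarrow> e 0) (at_right (0::real))"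
  by (rule Lim_transform_eventually)
 then have "e 0 = 0" by (simp add: tendsto_const_iff)
 then show False using k by (simp add: e_def)
qed

lemma rotation_integral_zero:
 fixes v :: "complex ^ 'n" and g :: "complex ^ 'n \<Rightarrow> real"
 assumes gm[measurable]: "g \<in> borel_measurable borel"
  and g: "\<And>c w. norm c = 1 ==> g (c *s w) = g w" and jk: "j \<noteq> k"
 shows "(LINT w|lborel. g w *\<^sub>R (cdot w v ^ j * cnj (cdot w v) ^ k)) = 0"
proof -
 have [measurable]: "(\<lambda>w. cdot w v) \<in> borel_measurable borel"
  by (intro borel_measurable_continuous_onI continuous_intros)
 have [measurable]: "(\<lambda>w :: complex ^ 'n. c *s w) \<in> borel_measurable borel" for c
  by (intro borel_measurable_continuous_onI continuous_intros)
 define I where "I = (LINT w|lborel. g w *\<^sub>R (cdot w v ^ j * cnj (cdot w v) ^ k))"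
 \<comment> \<open>With this angle \<open>c ^ j * cnj c ^ k = -1\<close>, so the integral equals its
   own negative.\<close>
 define c where "c = cis (pi / (real j - real k))"
 have c1: "norm c = 1" by (simp add: c_def)
 have cc: "c ^ j * cnj c ^ k = -1"
 proof -
  have "c ^ j * cnj c ^ k = cis (real j * (pi / (real j - real k)) + real k * (- (pi / (real j - real k))))"
   by (simp add: c_def Complex.DeMoivre cis_cnj cis_mult)
  also have "real j * (pi / (real j - real k)) + real k * (- (pi / (real j - real k))) = (real j - real k) * (pi / (real j - real k))"
  proof -
   have "real j * x + real k * (- x) = (real j - real k) * x" for x :: real by (simp add: left_diff_distrib)
   then show ?thesis .
  qed
  also have "(real j - real k) * (pi / (real j - real k)) = pi" using jk by simp
  finally show ?thesis by simp
 qed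
 have "I = (LINT w|(distr lborel borel (\<lambda>w. c *s w)). g w *\<^sub>R (cdot w v ^ j * cnj (cdot w v) ^ k))"
  by (simp add: I_def distr_lborel_unimodular[OF c1])
 also have "... = (LINT w|lborel. g (c *s w) *\<^sub>R (cdot (c *s w) v ^ j * cnj (cdot (c *s w) v) ^ k))"
  by (rule integral_distr) measurable
 also have "... = (LINT w|lborel. (c ^ j * cnj c ^ k) * (g w *\<^sub>R (cdot w v ^ j * cnj (cdot w v) ^ k)))"
  by (intro lint_cong)
   (auto simp: g[OF c1] cdot_smult_left power_mult_distrib scaleR_conv_of_real)
 also have "... = (c ^ j * cnj c ^ k) * I" unfolding I_def by (rule integral_mult_right_zero)
 finally show ?thesis unfolding cc I_def by simp
qed

text \<open>By \<open>rotation_integral_zero\<close> only the diagonal terms of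
  \<open>power_pairing_sums\<close> remain. They sit in even total degree, and the series is
  reindexed by half of it.\<close>

lemma radial_parseval:
 fixes v :: "complex ^ 'n" and g S :: "complex ^ 'n \<Rightarrow> real" and f :: "complex ^ 'n \<Rightarrow> complex"
 assumes gm[measurable]: "g \<in> borel_measurable borel" and Sm[measurable]: "S \<in> borel_measurable borel"
  and fm[measurable]: "f \<in> borel_measurable borel"
  and g0: "\<And>w. 0 \<le> g w" and g: "\<And>c w. norm c = 1 ==> g (c *s w) = g w"
  and b: "\<And>j. b j \<ge> 0"
  and S: "\<And>w. g w > 0 ==> (\<lambda>j. b j * norm (cdot w v) ^ j) sums S w"
  and int: "integrable lborel (\<lambda>w. g w * (S w)\<^sup>2)"
  and f: "\<And>w. g w > 0 ==> (\<lambda>j. of_real (b j) * cdot w v ^ j) sums f w"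
 shows "(\<lambda>j. (b j)\<^sup>2 * (LINT w|lborel. g w * norm (cdot w v) ^ (2 * j))) sums (LINT w|lborel. g w * (norm (f w))\<^sup>2)"
proof -
 have [measurable]: "(\<lambda>w. cdot w v) \<in> borel_measurable borel"
  by (intro borel_measurable_continuous_onI continuous_intros)
 define M where "M = density lborel (\<lambda>w. ennreal (g w))"
 have AEM: "AE w in M. P w" if "\<And>w. g w > 0 ==> P w" for P
  unfolding M_def using that by (subst AE_density) auto
 have Mi: "integral\<^sup>L M h = (LINT w|lborel. g w *\<^sub>R h w)" if "h \<in> borel_measurable borel"
  for h :: "complex ^ 'n \<Rightarrow> 'b::{banach, second_countable_topology}"
  unfolding M_def using that g0 by (intro integral_density) auto
 have "(\<lambda>l. \<Sum>j\<le>l. of_real (b j * b (l - j)) * (LINT w|M. cdot w v ^ j * cnj (cdot w v) ^ (l - j)))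
  sums (of_real (LINT w|M. (norm (f w))\<^sup>2))"
 proof (rule power_pairing_sums[where S = S])
  show "integrable M (\<lambda>x. (S x)\<^sup>2)"
   unfolding M_def using int g0 by (subst integrable_real_density) auto
 qed (auto intro!: AEM S f b simp: M_def)
 also have "(\<lambda>l. \<Sum>j\<le>l. of_real (b j * b (l - j)) * (LINT w|M. cdot w v ^ j * cnj (cdot w v) ^ (l - j)))
  = (\<lambda>l. if even l then of_real ((b (l div 2))\<^sup>2 * (LINT w|lborel. g w * norm (cdot w v) ^ l)) else 0)" (is "?L = ?R")
 proof
  fix l
  have z: "(LINT w|M. cdot w v ^ j * cnj (cdot w v) ^ k) = 0" if "j \<noteq> k" for j k
  proof -
   have "(\<lambda>w. cdot w v ^ j * cnj (cdot w v) ^ k) \<in> borel_measurable borel" by measurable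
   from Mi[OF this] show ?thesis using rotation_integral_zero[OF gm g that] by simp
  qed
  show "?L l = ?R l"
  proof (cases "even l")
   case True
   then obtain m where l: "l = 2 * m" by auto
   have L: "?L l = (\<Sum>j\<in>{m}. of_real (b j * b (l - j)) * (LINT w|M. cdot w v ^ j * cnj (cdot w v) ^ (l - j)))"
    by (rule sum.mono_neutral_right) (auto simp: l z)
   have "(LINT w|M. cdot w v ^ m * cnj (cdot w v) ^ m) = (LINT w|M. of_real (norm (cdot w v) ^ (2 * m)))"
    by (intro lint_cong)
     (simp_all only: power_mult_distrib[symmetric] complex_norm_square[symmetric] power_mult of_real_power)
   then have "(LINT w|M. cdot w v ^ m * cnj (cdot w v) ^ m) = of_real (LINT w|M. norm (cdot w v) ^ (2 * m))"
    by (simp only: integral_complex_of_real)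
   then have "(\<Sum>j\<in>{m}. of_real (b j * b (l - j)) * (LINT w|M. cdot w v ^ j * cnj (cdot w v) ^ (l - j)))
    = of_real ((b m)\<^sup>2 * (LINT w|M. norm (cdot w v) ^ (2 * m)))"
    by (simp add: l power2_eq_square)
   with L show ?thesis by (simp add: l Mi)
  next
   case False
   then have "j \<noteq> l - j" if "j \<le> l" for j using that by (metis add.commute le_add_diff_inverse2 mult_2 dvd_triv_left)
   then have "?L l = 0" by (intro sum.neutral) (auto simp: z)
   then show ?thesis using False by simp
  qed
 qed
 also have "... sums (of_real (LINT w|M. (norm (f w))\<^sup>2)) \<longleftrightarrow>
   (\<lambda>m. ?R (2 * m)) sums (of_real (LINT w|M. (norm (f w))\<^sup>2))"
  by (rule sums_mono_reindex[symmetric]) (auto simp: strict_mono_def elim!: oddE dest: spec[of _ "_ div 2"])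
 finally have "(\<lambda>m. complex_of_real ((b m)\<^sup>2 * (LINT w|lborel. g w * norm (cdot w v) ^ (2 * m))))
   sums of_real (LINT w|M. (norm (f w))\<^sup>2)" by simp
 then have "(\<lambda>m. (b m)\<^sup>2 * (LINT w|lborel. g w * norm (cdot w v) ^ (2 * m))) sums (LINT w|M. (norm (f w))\<^sup>2)"
  by (simp only: sums_of_real_iff)
 then show ?thesis by (simp add: Mi)
qed

section \<open>Moments of the Gaussian and of radial weights on the ball\<close>

lemma nn_integral_radial_exp:
 fixes F :: "'a::euclidean_space \<Rightarrow> ennreal"
 assumes Fm: "F \<in> borel_measurable borel"
  and hom: "\<And>t x. t > 0 ==> F (t *\<^sub>R x) = ennreal (t ^ m) * F x"
  and kap: "kap = (DIM('a) + m) / 2"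
  and C: "C = (\<integral>\<^sup>+x. F x * indicator (ball 0 1) x \<partial>lborel)" and fin: "C < \<infinity>"
 shows "(\<integral>\<^sup>+x. F x * ennreal (exp (- (norm x)\<^sup>2)) \<partial>lborel) = C * ennreal (Gamma (kap + 1))"
proof -
 have kap0: "kap > 0" using DIM_positive[where 'a='a] by (simp add: kap add_pos_nonneg)
 have "(\<integral>\<^sup>+y. ennreal (kap * y powr (kap - 1)) * indicator {0<..} y * ennreal (exp (- y)) \<partial>lborel)
  = (\<integral>\<^sup>+y. ennreal kap * ennreal (indicator {0..} y * y powr (kap - 1) / exp y) \<partial>lborel)"
  by (intro nn_integral_cong) (use kap0 in \<open>auto simp: indicator_def ennreal_mult[symmetric] exp_minus divide_inverse mult_ac\<close>)
 also have "... = ennreal (kap * Gamma kap)"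
  using kap0 by (subst nn_integral_cmult) (auto simp: Gamma_conv_nn_integral_real[symmetric] ennreal_mult Gamma_real_pos less_imp_le)
 also have "kap * Gamma kap = Gamma (kap + 1)" using kap0 by (subst Gamma_plus1) (auto elim!: nonpos_Ints_cases)
 finally show ?thesis
  using nn_integral_radial[OF Fm, of "\<lambda>y. ennreal (exp (- y))", OF _ hom kap C fin] by simp
qed

text \<open>The constant \<open>C\<close> depends on \<open>F\<close> alone and is shared with
  \<open>nn_integral_radial_exp\<close>. The Gaussian integral, which can be evaluated by other
  means, therefore determines all integrals against \<open>(1 - |x|^2) powr a\<close>.\<close>

lemma nn_integral_radial_power:
 fixes F :: "'a::euclidean_space \<Rightarrow> ennreal"
 assumes Fm: "F \<in> borel_measurable borel"
  and hom: "\<And>t x. t > 0 ==> F (t *\<^sub>R x) = ennreal (t ^ m) * F x"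
  and kap: "kap = (DIM('a) + m) / 2"
  and C: "C = (\<integral>\<^sup>+x. F x * indicator (ball 0 1) x \<partial>lborel)" and fin: "C < \<infinity>" and a: "a > -1"
 shows "(\<integral>\<^sup>+x. F x * (ennreal ((1 - (norm x)\<^sup>2) powr a) * indicator (ball 0 1) x) \<partial>lborel) = C * ennreal (kap * Beta kap (a + 1))"
proof -
 have kap0: "kap > 0" using DIM_positive[where 'a='a] by (simp add: kap add_pos_nonneg)
 have "((\<lambda>t. kap * (t powr (kap - 1) * (1 - t) powr (a + 1 - 1))) has_integral kap * Beta kap (a + 1)) {0..1}"
  using kap0 a by (intro has_integral_mult_right has_integral_Beta_real) auto
 then have "((\<lambda>t. kap * (t powr (kap - 1) * (1 - t) powr a)) has_integral kap * Beta kap (a + 1)) {0<..<1}"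
  by (simp add: has_integral_Icc_iff_Ioo)
 then have "(\<integral>\<^sup>+t. ennreal (kap * (t powr (kap - 1) * (1 - t) powr a)) * indicator {0<..<1} t \<partial>lborel) = ennreal (kap * Beta kap (a + 1))"
  using kap0 by (intro nn_integral_has_integral_lebesgue') auto
 also have "(\<integral>\<^sup>+t. ennreal (kap * (t powr (kap - 1) * (1 - t) powr a)) * indicator {0<..<1} t \<partial>lborel)
  = (\<integral>\<^sup>+y. ennreal (kap * y powr (kap - 1)) * indicator {0<..} y * (ennreal ((1 - y) powr a) * indicator {..<1} y) \<partial>lborel)"
  by (intro nn_integral_cong) (use kap0 in \<open>auto simp: indicator_def ennreal_mult[symmetric] mult_ac\<close>)
 finally have *: "(\<integral>\<^sup>+y. ennreal (kap * y powr (kap - 1)) * indicator {0<..} y * (ennreal ((1 - y) powr a) * indicator {..<1} y) \<partial>lborel) = ennreal (kap * Beta kap (a + 1))" .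
 have i: "indicator {..<1} ((norm x)\<^sup>2) = (indicator (ball 0 1) x :: ennreal)" for x :: 'a
  by (auto simp: indicator_def abs_square_less_1)
 show ?thesis
  using nn_integral_radial[OF Fm, of "\<lambda>y. ennreal ((1 - y) powr a) * indicator {..<1} y", OF _ hom kap C fin] unfolding * i by simp
qed

text \<open>The value pi^n stays implicit: it cancels when the measure is normalized by the volume
  \<open>gauss_const / fact n\<close> of the ball.\<close>

definition gauss_const :: "'n::finite itself \<Rightarrow> real" where
 "gauss_const _ = (LINT w|(lborel :: (complex ^ 'n) measure). exp (- (norm w)\<^sup>2))"

lemma emeasure_ball_finite: "emeasure lborel (ball (0::'a::euclidean_space) 1) < \<infinity>"
 using emeasure_lborel_ball_finite[of "0::'a" 1] by (simp add: less_top[symmetric])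

lemma gauss_nn: "(\<integral>\<^sup>+x. ennreal (exp (- (norm x)\<^sup>2)) \<partial>(lborel :: (complex ^ 'n) measure))
  = emeasure lborel (ball (0 :: complex ^ 'n) 1) * ennreal (fact CARD('n))"
proof -
 have "(\<integral>\<^sup>+x. 1 * ennreal (exp (- (norm x)\<^sup>2)) \<partial>(lborel :: (complex ^ 'n) measure))
   = emeasure lborel (ball (0 :: complex ^ 'n) 1) * ennreal (Gamma (real CARD('n) + 1))"
  by (rule nn_integral_radial_exp[where m = 0]) (use emeasure_ball_finite in auto)
 then show ?thesis using Gamma_fact[of "CARD('n)", where 'a = real] by (simp add: add.commute)
qed

lemma gauss_integrable: "integrable lborel (\<lambda>w :: complex ^ 'n. exp (- (norm w)\<^sup>2))"
proof (rule integrableI_nonneg)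
 show "(\<integral>\<^sup>+x. ennreal (exp (- (norm x)\<^sup>2)) \<partial>(lborel :: (complex ^ 'n) measure)) < \<infinity>"
  unfolding gauss_nn using emeasure_ball_finite by (auto simp: ennreal_mult_less_top)
qed auto

lemma gauss_const_eq:
 "ennreal (gauss_const TYPE('n::finite)) = emeasure lborel (ball (0 :: complex ^ 'n) 1) * ennreal (fact CARD('n))"
 using nn_integral_eq_integral[OF gauss_integrable[where 'n='n]] by (simp add: gauss_const_def gauss_nn)

lemma gauss_const_pos: "gauss_const TYPE('n::finite) > 0"
proof -
 have "emeasure lborel (ball (0 :: complex ^ 'n) 1) \<noteq> 0"
  using content_ball_pos[of 1 "0 :: complex ^ 'n"] by (auto simp: measure_def)
 then have "ennreal (gauss_const TYPE('n)) \<noteq> 0" unfolding gauss_const_eq by auto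
 then show ?thesis by (simp add: not_le[symmetric] ennreal_eq_0_iff)
qed

lemma emeasure_unit_ball: "emeasure lborel (ball (0 :: complex ^ 'n) 1) = ennreal (gauss_const TYPE('n::finite) / fact CARD('n))"
proof -
 have "emeasure lborel (ball (0 :: complex ^ 'n) 1) = ennreal (gauss_const TYPE('n)) / ennreal (fact CARD('n))"
  unfolding gauss_const_eq by (subst ennreal_mult_divide_eq) auto
 then show ?thesis using gauss_const_pos[where 'n='n] by (simp add: divide_ennreal)
qed

text \<open>Complete the square and translate by \<open>a\<close>.\<close>

lemma exp_inner_gauss:
 fixes a :: "complex ^ 'n"
 shows "integrable lborel (\<lambda>w. exp (2 * inner w a - (norm w)\<^sup>2))" (is ?i)
  and "(LINT w|lborel. exp (2 * inner w a - (norm w)\<^sup>2)) = exp ((norm a)\<^sup>2) * gauss_const TYPE('n)" (is ?e)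
proof -
 have eq: "exp (2 * inner w a - (norm w)\<^sup>2) = exp ((norm a)\<^sup>2) * exp (- (norm (- a + w))\<^sup>2)" for w
 proof -
  have "(norm (- a + w))\<^sup>2 = (norm w)\<^sup>2 - 2 * inner w a + (norm a)\<^sup>2"
   by (simp add: power2_norm_eq_inner inner_simps inner_commute algebra_simps)
  then show ?thesis by (simp flip: exp_add)
 qed
 have "integrable (distr lborel borel ((+) (- a))) (\<lambda>w. exp (- (norm w)\<^sup>2))"
  using gauss_integrable by (simp add: lborel_distr_plus)
 then have i: "integrable lborel (\<lambda>w. exp (- (norm (- a + w))\<^sup>2))"
  by (subst (asm) integrable_distr_eq) auto
 then show ?i unfolding eq by simp
 have "gauss_const TYPE('n) = (LINT w|(distr lborel borel ((+) (- a))). exp (- (norm w)\<^sup>2))"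
  by (simp add: lborel_distr_plus gauss_const_def)
 also have "... = (LINT w|lborel. exp (- (norm (- a + w))\<^sup>2))" by (rule integral_distr) auto
 finally show ?e unfolding eq by simp
qed

lemma gauss_moment_aux:
 fixes v :: "complex ^ 'n"
 assumes t: "t > 0"
 shows "integrable lborel (\<lambda>w. exp (- (norm w)\<^sup>2) * (exp (t * norm (cdot w v)))\<^sup>2)"
proof -
 define E where "E a w = exp (2 * inner w a - (norm w)\<^sup>2)" for a w :: "complex ^ 'n"
 \<comment> \<open>From \<open>|z| \<le> |Re z| + |Im z|\<close> and
   \<open>x * y \<le> x^2 + y^2\<close> the integrand is at most a sum of four shifted Gaussians.
   The shifts are \<open>2 * t\<close> rather than \<open>t\<close> because squaring occurs
   twice.\<close>
 define B where "B w = E ((2 * t) *\<^sub>R v) w + E (- (2 * t) *\<^sub>R v) w + E ((2 * t) *\<^sub>R (\<i> *s v)) w + E (- (2 * t) *\<^sub>R (\<i> *s v)) w" for w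
 show ?thesis
 proof (rule integrable_dominated)
  show "integrable lborel B" unfolding B_def E_def by (intro Bochner_Integration.integrable_add exp_inner_gauss)
  have "exp (- (norm w)\<^sup>2) * (exp (t * norm (cdot w v)))\<^sup>2 \<le> B w" for w
  proof -
   have Re: "Re (cdot w v) = inner w v" by (rule Re_cdot)
   have Im: "Im (cdot w v) = inner w (\<i> *s v)" by (simp add: Re_cdot[symmetric] cdot_smult_right)
   have abs: "exp (2 * \<bar>x\<bar>) \<le> exp (2 * x) + exp (- (2 * x))" for x :: real by (cases "x \<ge> 0") auto
   have nle: "norm (cdot w v) \<le> \<bar>inner w v\<bar> + \<bar>inner w (\<i> *s v)\<bar>"
    using cmod_le[of "cdot w v"] by (simp add: Re Im)
   have "(exp (t * norm (cdot w v)))\<^sup>2 \<le> exp (2 * \<bar>t * inner w v\<bar>) * exp (2 * \<bar>t * inner w (\<i> *s v)\<bar>)"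
   proof -
    have "2 * (t * norm (cdot w v)) \<le> 2 * \<bar>t * inner w v\<bar> + 2 * \<bar>t * inner w (\<i> *s v)\<bar>"
     using mult_left_mono[OF nle, of "2 * t"] t by (simp add: abs_mult distrib_left)
    then have "exp (2 * (t * norm (cdot w v))) \<le> exp (2 * \<bar>t * inner w v\<bar> + 2 * \<bar>t * inner w (\<i> *s v)\<bar>)"
     by simp
    moreover have "(exp (t * norm (cdot w v)))\<^sup>2 = exp (2 * (t * norm (cdot w v)))"
     by (rule exp_double[symmetric])
    ultimately show ?thesis by (simp only: exp_add)
   qed
   also have "... \<le> (exp (2 * \<bar>t * inner w v\<bar>))\<^sup>2 + (exp (2 * \<bar>t * inner w (\<i> *s v)\<bar>))\<^sup>2"
   proof -
    have "a * b \<le> a\<^sup>2 + b\<^sup>2" if "a \<ge> 0" "b \<ge> 0" for a b :: real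
     using sum_squares_bound[of a b] mult_nonneg_nonneg[OF that] by linarith
    then show ?thesis by simp
   qed
   also have "... = exp (2 * \<bar>2 * (t * inner w v)\<bar>) + exp (2 * \<bar>2 * (t * inner w (\<i> *s v))\<bar>)"
    by (simp only: exp_double[symmetric] abs_mult abs_numeral)
   also have "... \<le> (exp (2 * (2 * (t * inner w v))) + exp (- (2 * (2 * (t * inner w v)))))
     + (exp (2 * (2 * (t * inner w (\<i> *s v)))) + exp (- (2 * (2 * (t * inner w (\<i> *s v))))))"
    by (intro add_mono abs)
   finally have "exp (- (norm w)\<^sup>2) * (exp (t * norm (cdot w v)))\<^sup>2 \<le> exp (- (norm w)\<^sup>2) * ..."
    by (rule mult_left_mono) simp
   also have "... = B w"
   proof -
    have E: "E a w = exp (- (norm w)\<^sup>2) * exp (2 * inner w a)" for a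
     unfolding E_def exp_add[symmetric] by simp
    show ?thesis unfolding B_def E inner_scaleR_right by (simp add: distrib_left mult.assoc)
   qed
   finally show ?thesis .
  qed
  then show "AE w in lborel. norm (exp (- (norm w)\<^sup>2) * (exp (t * norm (cdot w v)))\<^sup>2) \<le> norm (B w)"
   by (auto intro!: AE_I2 order_trans[OF _ abs_ge_self])
  have "(\<lambda>w. exp (- (norm w)\<^sup>2) * (exp (t * norm (cdot w v)))\<^sup>2) \<in> borel_measurable borel"
   by (intro borel_measurable_continuous_onI continuous_intros)
  then show "(\<lambda>w. exp (- (norm w)\<^sup>2) * (exp (t * norm (cdot w v)))\<^sup>2) \<in> borel_measurable lborel" by simp
 qed
qed

text \<open>A generating function argument. For \<open>f w = exp (t * cdot w v)\<close> the series
  in \<open>radial_parseval\<close> is a power series in \<open>x = t^2\<close> whose coefficients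
  are the moments divided by squared factorials, while its sum is a shifted Gaussian integral,
  \<open>exp (x * |v|^2) * gauss_const\<close>.\<close>

lemma gauss_moment:
 fixes v :: "complex ^ 'n"
 shows "(LINT w|lborel. exp (- (norm w)\<^sup>2) * norm (cdot w v) ^ (2 * i)) = gauss_const TYPE('n) * fact i * norm v ^ (2 * i)"
proof -
 define M where "M i = (LINT w|lborel. exp (- (norm w)\<^sup>2) * norm (cdot w v) ^ (2 * i))" for i
 have "(\<lambda>i. M i / (fact i)\<^sup>2) = (\<lambda>i. gauss_const TYPE('n) * norm v ^ (2 * i) / fact i)"
 proof (rule powser_coeff_unique[of 1])
  fix x :: real assume x: "0 < x" "x < 1"
  define t where "t = sqrt x"
  have t: "t > 0" "t\<^sup>2 = x" using x by (auto simp: t_def)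
  have "(\<lambda>i. (t ^ i / fact i)\<^sup>2 * M i) sums (LINT w|lborel. exp (- (norm w)\<^sup>2) * (norm (exp (of_real t * cdot w v)))\<^sup>2)"
   unfolding M_def
  proof (rule radial_parseval[where S = "\<lambda>w. exp (t * norm (cdot w v))"])
   show "(\<lambda>w. exp (t * norm (cdot w v))) \<in> borel_measurable borel"
    "(\<lambda>w. exp (of_real t * cdot w v)) \<in> borel_measurable borel"
    by (intro borel_measurable_continuous_onI continuous_intros)+
   show "(\<lambda>j. t ^ j / fact j * norm (cdot w v) ^ j) sums exp (t * norm (cdot w v))" for w
    using exp_converges[of "t * norm (cdot w v)"] by (simp add: power_mult_distrib field_simps)
   show "(\<lambda>j. of_real (t ^ j / fact j) * cdot w v ^ j) sums exp (of_real t * cdot w v)" for w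
    using exp_converges[of "of_real t * cdot w v"] by (simp add: power_mult_distrib scaleR_conv_of_real field_simps)
   show "integrable lborel (\<lambda>w. exp (- (norm w)\<^sup>2) * (exp (t * norm (cdot w v)))\<^sup>2)"
    by (rule gauss_moment_aux) (rule t)
  qed (use t in \<open>auto simp: norm_smult_vec\<close>)
  also have "(LINT w|lborel. exp (- (norm w)\<^sup>2) * (norm (exp (of_real t * cdot w v)))\<^sup>2)
   = (LINT w|lborel. exp (2 * inner w (t *\<^sub>R v) - (norm w)\<^sup>2))"
   by (intro lint_cong) (simp_all add: Re_cdot power2_eq_square flip: exp_add)
  also have "... = exp (x * (norm v)\<^sup>2) * gauss_const TYPE('n)"
   by (subst exp_inner_gauss) (simp add: power_mult_distrib t)
  finally have "(\<lambda>i. (t ^ i / fact i)\<^sup>2 * M i) sums (exp (x * (norm v)\<^sup>2) * gauss_const TYPE('n))" .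
  moreover have "(t ^ i / fact i)\<^sup>2 * M i = M i / (fact i)\<^sup>2 * x ^ i" for i
   by (simp add: power_divide power_mult[symmetric] mult.commute[of i 2] t(2)[symmetric])
  ultimately show "(\<lambda>i. M i / (fact i)\<^sup>2 * x ^ i) sums (exp (x * (norm v)\<^sup>2) * gauss_const TYPE('n))" by simp
  show "(\<lambda>i. gauss_const TYPE('n) * norm v ^ (2 * i) / fact i * x ^ i) sums (exp (x * (norm v)\<^sup>2) * gauss_const TYPE('n))"
   using sums_mult[OF exp_converges[of "x * (norm v)\<^sup>2"], of "gauss_const TYPE('n)"]
   unfolding power_mult by (simp add: power_mult_distrib field_simps del: power_mult)
 qed simp
 from fun_cong[OF this, of i] show ?thesis by (simp add: M_def power2_eq_square field_simps)
qed

definition radial_weight :: "real \<Rightarrow> complex ^ 'n \<Rightarrow> real" where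
 "radial_weight a w = (1 - (norm w)\<^sup>2) powr a * indicator (ball 0 1) w"

lemma radial_weight_measurable [measurable]: "radial_weight a \<in> borel_measurable borel"
proof -
 have [measurable]: "ball (0 :: complex ^ 'n) 1 \<in> sets borel" by simp
 show ?thesis unfolding radial_weight_def by measurable
qed

text \<open>\<open>gauss_moment\<close> determines the common constant \<open>C\<close> of the two
  radial formulas, and the Beta integral converts it into the weighted moment;
  \<open>Gamma (kap + 1) = kap * Gamma kap\<close> simplifies the quotient.\<close>

lemma ball_moment:
 fixes v :: "complex ^ 'n"
 assumes a: "a > -1"
 shows "(\<integral>\<^sup>+w. ennreal (radial_weight a w * norm (cdot w v) ^ (2 * j)) \<partial>lborel)
  = ennreal (gauss_const TYPE('n) * fact j * norm v ^ (2 * j) * Gamma (a + 1) / Gamma (real CARD('n) + real j + a + 1))"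
proof -
 define F where "F w = ennreal (norm (cdot w v) ^ (2 * j))" for w
 define kap where "kap = real CARD('n) + real j"
 have kap0: "kap > 0" by (simp add: kap_def add_pos_nonneg)
 have Fm[measurable]: "F \<in> borel_measurable borel"
  unfolding F_def by (intro measurable_compose[OF _ measurable_ennreal] borel_measurable_continuous_onI continuous_intros)
 define C where "C = (\<integral>\<^sup>+x. F x * indicator (ball 0 1) x \<partial>lborel)"
 have fin: "C < \<infinity>"
 proof -
  have "C \<le> (\<integral>\<^sup>+x. ennreal (norm v ^ (2 * j)) * indicator (ball 0 1) x \<partial>(lborel :: (complex ^ 'n) measure))"
   unfolding C_def
  proof (intro nn_integral_mono)
   fix x :: "complex ^ 'n"
   show "F x * indicator (ball 0 1) x \<le> ennreal (norm v ^ (2 * j)) * indicator (ball 0 1) x"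
   proof (cases "norm x < 1")
    case True
    then have "norm (cdot x v) \<le> norm v" using norm_cdot_le[of x v] mult_right_mono[of "norm x" 1 "norm v"] by simp
    then show ?thesis by (simp add: F_def indicator_def power_mono)
   qed simp
  qed
  also have "... = ennreal (norm v ^ (2 * j)) * emeasure lborel (ball (0 :: complex ^ 'n) 1)"
   by (rule nn_integral_cmult_indicator) simp
  also have "... < \<infinity>" using emeasure_ball_finite by (auto simp: ennreal_mult_less_top)
  finally show ?thesis .
 qed
 have hom: "F (t *\<^sub>R x) = ennreal (t ^ (2 * j)) * F x" if "t > 0" for t x
  using that by (simp add: F_def cdot_scaleR_left norm_mult power_mult_distrib ennreal_mult)
 have kap: "kap = (DIM(complex ^ 'n) + 2 * j) / 2" by (simp add: kap_def)
 have "(\<integral>\<^sup>+w. F w * ennreal (exp (- (norm w)\<^sup>2)) \<partial>lborel) = C * ennreal (Gamma (kap + 1))"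
  by (rule nn_integral_radial_exp[OF Fm hom kap C_def fin])
 moreover have "(\<integral>\<^sup>+w. F w * ennreal (exp (- (norm w)\<^sup>2)) \<partial>lborel) = ennreal (gauss_const TYPE('n) * fact j * norm v ^ (2 * j))"
 proof -
  define h where "h w = exp (- (norm w)\<^sup>2) * norm (cdot w v) ^ (2 * j)" for w
  have "h \<in> borel_measurable borel" unfolding h_def by (intro borel_measurable_continuous_onI continuous_intros)
  have e: "(\<integral>\<^sup>+w. ennreal (h w) \<partial>lborel) = C * ennreal (Gamma (kap + 1))"
  proof -
   have "(\<integral>\<^sup>+w. ennreal (h w) \<partial>lborel) = (\<integral>\<^sup>+w. F w * ennreal (exp (- (norm w)\<^sup>2)) \<partial>lborel)"
    unfolding h_def F_def by (intro nn_integral_cong) (simp add: ennreal_mult mult.commute)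
   then show ?thesis using nn_integral_radial_exp[OF Fm hom kap C_def fin] by simp
  qed
  also have "... < \<infinity>" using fin by (auto simp: ennreal_mult_less_top)
  finally have "integrable lborel h"
   using \<open>h \<in> borel_measurable borel\<close> by (intro integrableI_nonneg) (auto simp: h_def)
  then have "(\<integral>\<^sup>+w. ennreal (h w) \<partial>lborel) = ennreal (gauss_const TYPE('n) * fact j * norm v ^ (2 * j))"
   unfolding gauss_moment[symmetric] h_def[symmetric] by (subst nn_integral_eq_integral) (auto simp: h_def)
  then show ?thesis using e nn_integral_radial_exp[OF Fm hom kap C_def fin] by simp
 qed
 ultimately have "C * ennreal (Gamma (kap + 1)) = ennreal (gauss_const TYPE('n) * fact j * norm v ^ (2 * j))" by simp
 then have "C = ennreal (gauss_const TYPE('n) * fact j * norm v ^ (2 * j)) / ennreal (Gamma (kap + 1))"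
 proof -
  have "Gamma (kap + 1) > 0" using kap0 by (intro Gamma_real_pos) simp
  then have "ennreal (Gamma (kap + 1)) \<noteq> 0" by simp
  from ennreal_mult_divide_eq[OF this, of C] show ?thesis using \<open>C * _ = _\<close> by simp
 qed
 then have C: "C = ennreal (gauss_const TYPE('n) * fact j * norm v ^ (2 * j) / Gamma (kap + 1))"
  using kap0 Gamma_real_pos[of "kap + 1"] gauss_const_pos[where 'n='n] by (simp add: divide_ennreal)
 have "(\<integral>\<^sup>+w. ennreal (radial_weight a w * norm (cdot w v) ^ (2 * j)) \<partial>lborel)
  = (\<integral>\<^sup>+w. F w * (ennreal ((1 - (norm w)\<^sup>2) powr a) * indicator (ball 0 1) w) \<partial>lborel)"
  by (intro nn_integral_cong) (simp add: radial_weight_def F_def indicator_def ennreal_mult mult.commute)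
 also have "... = C * ennreal (kap * Beta kap (a + 1))"
  by (rule nn_integral_radial_power[OF Fm hom kap C_def fin a])
 also have "... = ennreal (gauss_const TYPE('n) * fact j * norm v ^ (2 * j) / Gamma (kap + 1) * (kap * Beta kap (a + 1)))"
  unfolding C using gauss_const_pos[where 'n='n] kap0 Gamma_real_pos[of "kap + 1"] by (subst ennreal_mult') auto
 also have "gauss_const TYPE('n) * fact j * norm v ^ (2 * j) / Gamma (kap + 1) * (kap * Beta kap (a + 1))
  = gauss_const TYPE('n) * fact j * norm v ^ (2 * j) * Gamma (a + 1) / Gamma (kap + a + 1)"
 proof -
  have "Gamma (kap + 1) = kap * Gamma kap" using kap0 by (subst Gamma_plus1) (auto elim!: nonpos_Ints_cases)
  moreover have "Gamma kap \<noteq> 0" using Gamma_real_pos[OF kap0] by simp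
  ultimately show ?thesis using kap0 by (simp add: Beta_def add.assoc)
 qed
 finally show ?thesis by (simp add: kap_def)
qed

section \<open>Forelli-Rudin integrals as power series\<close>

lemma powr_neg_series_complex:
 fixes c :: real and z :: complex assumes "norm z < 1"
 shows "(\<lambda>j. of_real (pochhammer c j / fact j) * z ^ j) sums ((1 - z) powr of_real (- c))"
proof -
 have "(of_real (- c) gchoose j) * (- z) ^ j = of_real (pochhammer c j / fact j) * z ^ j" for j
  by (simp add: gbinomial_pochhammer pochhammer_of_real[symmetric] power_minus[of z] mult.assoc)
 then show ?thesis using gen_binomial_complex[of "- z" "of_real (- c)"] assms by simp
qed

lemma powr_neg_series_real:
 fixes c :: real assumes "0 \<le> x" "x < 1"
 shows "(\<lambda>j. pochhammer c j / fact j * x ^ j) sums ((1 - x) powr (- c))"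
proof -
 have "(\<lambda>j. of_real (pochhammer c j / fact j) * of_real x ^ j) sums ((1 - of_real x) powr complex_of_real (- c))"
  by (rule powr_neg_series_complex) (use assms in simp)
 also have "(1 - complex_of_real x) powr complex_of_real (- c) = of_real ((1 - x) powr (- c))"
  using assms powr_of_real[of "1 - x" "- c"] by simp
 finally have "(\<lambda>j. complex_of_real (pochhammer c j / fact j * x ^ j)) sums of_real ((1 - x) powr (- c))"
  by simp
 then show ?thesis by (simp only: sums_of_real_iff)
qed

text \<open>The integrand is the weight times \<open>|f|^2\<close> for the principal branch
  \<open>f w = (1 - cdot w v) powr (- c)\<close>. Its Taylor coefficients are nonnegative, so
  \<open>radial_parseval\<close> applies, with the moments of \<open>ball_moment\<close>.
  Convergence is uniform in \<open>w\<close> because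
  \<open>|cdot w v| \<le> |v| < 1\<close>.\<close>

lemma Forelli_Rudin_series:
 fixes v :: "complex ^ 'n" and c :: real
 assumes v: "v \<in> unit_ball" and a: "a > -1" and c: "c > 0"
 shows "(\<lambda>j. (pochhammer c j / fact j)\<^sup>2 * (gauss_const TYPE('n) * fact j * norm v ^ (2 * j) * Gamma (a + 1)
   / Gamma (real CARD('n) + real j + a + 1)))
  sums (LINT w|lborel. radial_weight a w * norm (1 - cdot w v) powr (- (2 * c)))" (is ?s)
  and "integrable lborel (\<lambda>w. radial_weight a w * norm (1 - cdot w v) powr (- (2 * c)))" (is ?i)
proof -
 have [measurable]: "ball (0 :: complex ^ 'n) 1 \<in> sets borel" by simp
 have cm[measurable]: "(\<lambda>w. cdot w v) \<in> borel_measurable borel"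
  by (intro borel_measurable_continuous_onI continuous_intros)
 have rw0: "0 \<le> radial_weight a w" for w :: "complex ^ 'n" by (simp add: radial_weight_def)
 have rwpos: "w \<in> unit_ball" if "radial_weight a w > 0" for w :: "complex ^ 'n"
  using that by (cases "norm w < 1") (auto simp: radial_weight_def)
 have irw: "integrable lborel (radial_weight a :: complex ^ 'n \<Rightarrow> real)"
  using ball_moment[OF a, of "0 :: complex ^ 'n" 0] rw0 by (intro integrableI_nonneg) auto
 have mom: "(LINT w|lborel. radial_weight a w * norm (cdot w v) ^ (2 * j))
  = gauss_const TYPE('n) * fact j * norm v ^ (2 * j) * Gamma (a + 1) / Gamma (real CARD('n) + real j + a + 1)" for j
 proof -
  have "0 < Gamma (a + 1)" "0 < Gamma (real CARD('n) + real j + a + 1)"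
   using a by (auto intro!: Gamma_real_pos simp: add_nonneg_pos)
  then show ?thesis
   by (subst integral_eq_nn_integral) (use rw0 gauss_const_pos[where 'n='n] in \<open>auto simp: ball_moment[OF a]\<close>)
 qed
 have lt: "norm (cdot w v) < norm v" if "w \<in> unit_ball" "v \<noteq> 0" for w
  using norm_cdot_le[of w v] that mult_strict_right_mono[of "norm w" 1 "norm v"] by (simp add: order_le_less_trans)
 have le: "norm (cdot w v) \<le> norm v" if "w \<in> unit_ball" for w
  using lt[OF that] by (cases "v = 0") auto
 have v1: "norm v < 1" using v by simp
 define S where "S w = (if norm (cdot w v) < 1 then (1 - norm (cdot w v)) powr (- c) else 0)" for w
 define f where "f w = (1 - cdot w v) powr (of_real (- c))" for w
 have Sle: "S w \<le> (1 - norm v) powr (- c)" if "w \<in> unit_ball" for w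
  using le[OF that] v1 c by (auto simp: S_def intro!: powr_mono2')
 have S0: "0 \<le> S w" for w by (simp add: S_def)
 have bound: "integrable lborel (\<lambda>w. radial_weight a w * h w)"
  if "h \<in> borel_measurable borel" "\<And>w. w \<in> unit_ball ==> \<bar>h w\<bar> \<le> K" for h :: "complex ^ 'n \<Rightarrow> real" and K
 proof (rule integrable_dominated[OF integrable_mult_left[OF irw, of K]])
  show "AE w in lborel. norm (radial_weight a w * h w) \<le> norm (radial_weight a w * K)"
  proof (rule AE_I2)
   fix w :: "complex ^ 'n"
   show "norm (radial_weight a w * h w) \<le> norm (radial_weight a w * K)"
    using that(2)[of w] rw0[of w] by (cases "w \<in> unit_ball") (auto simp: abs_mult radial_weight_def intro!: mult_left_mono)
  qed
 qed (use that in measurable)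
 have [measurable]: "S \<in> borel_measurable borel" unfolding S_def by measurable
 have [measurable]: "f \<in> borel_measurable borel" unfolding f_def by measurable
 have nf: "(norm (f w))\<^sup>2 = norm (1 - cdot w v) powr (- (2 * c))" for w
  unfolding f_def by (simp add: norm_powr_real_powr' power2_eq_square flip: powr_add)
 have "(\<lambda>j. (pochhammer c j / fact j)\<^sup>2 * (LINT w|lborel. radial_weight a w * norm (cdot w v) ^ (2 * j)))
   sums (LINT w|lborel. radial_weight a w * (norm (f w))\<^sup>2)"
 proof (rule radial_parseval[where S = S])
  show "integrable lborel (\<lambda>w. radial_weight a w * (S w)\<^sup>2)"
   by (rule bound[where K = "((1 - norm v) powr (- c))\<^sup>2"]) (use Sle S0 in \<open>auto intro!: power_mono\<close>)
  show "0 \<le> pochhammer c j / fact j" for j using c by (simp add: pochhammer_nonneg)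
  show "(\<lambda>j. pochhammer c j / fact j * norm (cdot w v) ^ j) sums S w" if "radial_weight a w > 0" for w
   using powr_neg_series_real[of "norm (cdot w v)" c] norm_cdot_less_1[OF rwpos[OF that] v] by (simp add: S_def)
  show "(\<lambda>j. of_real (pochhammer c j / fact j) * cdot w v ^ j) sums f w" if "radial_weight a w > 0" for w
   unfolding f_def using norm_cdot_less_1[OF rwpos[OF that] v] by (rule powr_neg_series_complex)
 qed (auto simp: rw0, simp add: radial_weight_def norm_smult_vec indicator_def)
 then show ?s unfolding nf mom .
 have "(1 - norm v) powr (- (2 * c)) \<ge> norm (1 - cdot w v) powr (- (2 * c))" if "w \<in> unit_ball" for w
  using norm_one_minus_cdot_ge1[OF that v] v1 c by (intro powr_mono2') auto
 then show ?i by (intro bound[where K = "(1 - norm v) powr (- (2 * c))"]) auto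
qed

section \<open>The normalized measure, Forelli-Rudin estimates and the norm of the kernel\<close>

lemma space_vol [simp]: "space vol = unit_ball"
 by (simp add: vol_def)

lemma sets_vol: "sets vol = sets (restrict_space borel unit_ball)"
 unfolding vol_def sets_uniform_measure by (rule sets_restrict_space_cong) simp

lemma space_inv_vol [simp]: "space inv_vol = unit_ball"
 by (simp add: inv_vol_def)

lemma sets_inv_vol: "sets inv_vol = sets vol"
 by (simp add: inv_vol_def)

lemma unit_ball_sets [measurable, simp]: "unit_ball \<in> sets borel"
 by simp

lemma measurable_vol_borel: "f \<in> borel_measurable vol \<longleftrightarrow> f \<in> borel_measurable (restrict_space borel unit_ball)"
 by (subst measurable_cong_sets[OF sets_vol refl]) (rule refl)

lemma measurable_volI: "f \<in> measurable borel N ==> f \<in> measurable vol N"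
 by (subst measurable_cong_sets[OF sets_vol refl]) (rule measurable_restrict_space1)

lemma measurable_ident_vol [measurable]: "(\<lambda>x. x) \<in> measurable vol borel"
 by (rule measurable_volI) simp

lemma measurable_vol_continuous: "continuous_on unit_ball f ==> f \<in> borel_measurable vol"
 unfolding measurable_vol_borel by (rule borel_measurable_continuous_on_restrict)

lemma in_sets_vol_iff: "A \<in> sets vol \<longleftrightarrow> A \<subseteq> unit_ball \<and> A \<in> sets borel"
 unfolding sets_vol by (subst sets_restrict_space_iff) auto

lemma nn_integral_vol:
 fixes f :: "complex ^ 'n \<Rightarrow> ennreal"
 assumes [measurable]: "f \<in> borel_measurable vol"
 shows "(\<integral>\<^sup>+x. f x \<partial>vol) = (\<integral>\<^sup>+x. f x * indicator unit_ball x \<partial>lborel) / emeasure lborel (unit_ball :: (complex ^ 'n) set)"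
proof -
 have "f \<in> borel_measurable (restrict_space lborel unit_ball)"
  using assms unfolding vol_def by simp
 moreover have "unit_ball \<in> sets (restrict_space lborel (unit_ball :: (complex ^ 'n) set))"
  by (subst sets_restrict_space_iff) auto
 ultimately have "(\<integral>\<^sup>+x. f x \<partial>vol)
  = (\<integral>\<^sup>+x. f x * indicator unit_ball x \<partial>restrict_space lborel unit_ball) / emeasure (restrict_space lborel unit_ball) (unit_ball :: (complex ^ 'n) set)"
  unfolding vol_def by (rule nn_integral_uniform_measure)
 also have "... = (\<integral>\<^sup>+x. f x * indicator unit_ball x * indicator unit_ball x \<partial>lborel) / emeasure lborel (unit_ball :: (complex ^ 'n) set)"
  by (subst nn_integral_restrict_space) (auto simp: emeasure_restrict_space)
 also have "(\<integral>\<^sup>+x. f x * indicator unit_ball x * indicator unit_ball x \<partial>lborel) = (\<integral>\<^sup>+x. f x * indicator unit_ball x \<partial>lborel)"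
  by (intro nn_integral_cong) (simp split: split_indicator)
 finally show ?thesis .
qed

lemma emeasure_unit_ball_pos: "emeasure lborel (unit_ball :: (complex ^ 'n) set) \<noteq> 0"
 using gauss_const_pos[where 'n='n] by (simp add: emeasure_unit_ball)

lemma emeasure_vol_space: "emeasure vol (unit_ball :: (complex ^ 'n) set) = 1"
proof -
 have "emeasure vol (unit_ball :: (complex ^ 'n) set) = (\<integral>\<^sup>+x. 1 \<partial>(vol :: (complex ^ 'n) measure))" by simp
 also have "... = emeasure lborel (unit_ball :: (complex ^ 'n) set) / emeasure lborel (unit_ball :: (complex ^ 'n) set)"
  by (subst nn_integral_vol) auto
 also have "... = 1" using emeasure_unit_ball_pos emeasure_ball_finite by (intro ennreal_divide_self) auto
 finally show ?thesis .
qed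

interpretation vol: finite_measure vol
 by (rule finite_measureI) (simp add: emeasure_vol_space)

lemma measure_vol_space [simp]: "measure vol unit_ball = 1"
 by (simp add: measure_def emeasure_vol_space)

text \<open>Division by the volume of the ball replaces the Gaussian constant by
  \<open>fact n\<close>.\<close>

lemma Forelli_Rudin_vol:
 fixes v :: "complex ^ 'n" and c :: real
 assumes v: "v \<in> unit_ball" and a: "a > -1" and c: "c > 0"
 shows "(\<lambda>j. (pochhammer c j / fact j)\<^sup>2 * (fact CARD('n) * fact j * norm v ^ (2 * j) * Gamma (a + 1)
   / Gamma (real CARD('n) + real j + a + 1)))
  sums enn2real (\<integral>\<^sup>+w. ennreal (defect w powr a * norm (1 - cdot w v) powr (- (2 * c))) \<partial>vol)"
  and "(\<integral>\<^sup>+w. ennreal (defect w powr a * norm (1 - cdot w v) powr (- (2 * c))) \<partial>vol) < \<infinity>"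
proof -
 define G where "G = gauss_const TYPE('n)"
 have G: "G > 0" unfolding G_def by (rule gauss_const_pos)
 define I where "I = (LINT w|lborel. radial_weight a w * norm (1 - cdot w v) powr (- (2 * c)))"
 have I0: "I \<ge> 0" unfolding I_def by (intro integral_nonneg_AE AE_I2) (simp add: radial_weight_def)
 have [measurable]: "(\<lambda>w. cdot w v) \<in> borel_measurable borel" "(defect :: complex ^ 'n \<Rightarrow> real) \<in> borel_measurable borel"
  unfolding defect_def by (intro borel_measurable_continuous_onI continuous_intros)+
 have "(\<integral>\<^sup>+w. ennreal (defect w powr a * norm (1 - cdot w v) powr (- (2 * c))) \<partial>vol)
   = (\<integral>\<^sup>+w. ennreal (defect w powr a * norm (1 - cdot w v) powr (- (2 * c))) * indicator unit_ball w \<partial>lborel) / ennreal (G / fact CARD('n))"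
  unfolding G_def emeasure_unit_ball[symmetric] by (rule nn_integral_vol) (intro measurable_volI, measurable)
 also have "(\<integral>\<^sup>+w. ennreal (defect w powr a * norm (1 - cdot w v) powr (- (2 * c))) * indicator unit_ball w \<partial>lborel)
   = (\<integral>\<^sup>+w. ennreal (radial_weight a w * norm (1 - cdot w v) powr (- (2 * c))) \<partial>lborel)"
  by (intro nn_integral_cong) (simp add: radial_weight_def defect_def split: split_indicator)
 also have "... = ennreal I"
  unfolding I_def using Forelli_Rudin_series(2)[OF v a c] by (intro nn_integral_eq_integral) (auto simp: radial_weight_def)
 finally have e: "(\<integral>\<^sup>+w. ennreal (defect w powr a * norm (1 - cdot w v) powr (- (2 * c))) \<partial>vol) = ennreal (I / (G / fact CARD('n)))"
  using I0 G by (simp add: divide_ennreal)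
 then show "(\<integral>\<^sup>+w. ennreal (defect w powr a * norm (1 - cdot w v) powr (- (2 * c))) \<partial>vol) < \<infinity>" by simp
 have "I / (G / fact CARD('n)) \<ge> 0" using I0 G by simp
 moreover have "(\<lambda>j. (pochhammer c j / fact j)\<^sup>2 * (fact CARD('n) * fact j * norm v ^ (2 * j) * Gamma (a + 1)
   / Gamma (real CARD('n) + real j + a + 1))) sums (I / (G / fact CARD('n)))"
  using sums_divide[OF Forelli_Rudin_series(1)[OF v a c], of "G / fact CARD('n)"] G
  unfolding I_def[symmetric] G_def[symmetric] by (simp add: field_simps)
 ultimately show "(\<lambda>j. (pochhammer c j / fact j)\<^sup>2 * (fact CARD('n) * fact j * norm v ^ (2 * j) * Gamma (a + 1)
   / Gamma (real CARD('n) + real j + a + 1)))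
  sums enn2real (\<integral>\<^sup>+w. ennreal (defect w powr a * norm (1 - cdot w v) powr (- (2 * c))) \<partial>vol)"
  unfolding e by simp
qed

lemma Gamma_log_convex_mid:
 fixes x y :: real assumes "x > 0" "y > 0"
 shows "(Gamma ((x + y) / 2))\<^sup>2 \<le> Gamma x * Gamma y"
proof -
 have p: "Gamma x > 0" "Gamma y > 0" "Gamma ((x + y) / 2) > 0" using assms by (auto intro!: Gamma_real_pos)
 have "(ln \<circ> Gamma) ((1 - 1/2) *\<^sub>R x + (1/2) *\<^sub>R y) \<le> (1 - 1/2) * (ln \<circ> Gamma) x + (1/2) * (ln \<circ> Gamma) y"
  by (rule convex_onD[OF log_convex_Gamma_real]) (use assms in auto)
 then have "2 * ln (Gamma ((x + y) / 2)) \<le> ln (Gamma x) + ln (Gamma y)"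
  by (simp add: add_divide_distrib)
 then have "ln ((Gamma ((x + y) / 2))\<^sup>2) \<le> ln (Gamma x * Gamma y)"
  using p by (simp add: ln_mult ln_realpow)
 then show ?thesis using p by (subst (asm) ln_le_cancel_iff) auto
qed

text \<open>The series of \<open>Forelli_Rudin_vol\<close> is bounded term by term by that of
  \<open>C * defect v powr (- e)\<close>. Since \<open>2 * c = e + (n + 1 + a)\<close>, the number
  \<open>c + j\<close> is the midpoint of \<open>e + j\<close> and \<open>n + j + a + 1\<close>, and
  midpoint log-convexity of \<open>Gamma\<close> gives the inequality without asymptotics. The
  constant \<open>C\<close> collects the Gamma values that do not depend on
  \<open>j\<close>.\<close>

theorem Forelli_Rudin:
 fixes c a e :: real
 assumes a: "a > -1" and c: "c > 0" and e: "e > 0" "e = 2 * c - (real CARD('n) + 1 + a)"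
 obtains C where "C > 0" "\<And>v :: complex ^ 'n. v \<in> unit_ball ==>
  (\<integral>\<^sup>+w. ennreal (defect w powr a * norm (1 - cdot w v) powr (- (2 * c))) \<partial>vol) \<le> ennreal (C * defect v powr (- e))"
proof
 define C where "C = fact CARD('n) * Gamma (a + 1) * Gamma e / (Gamma c)\<^sup>2"
 have p: "Gamma (a + 1) > 0" "Gamma e > 0" "Gamma c > 0" using assms by (auto intro!: Gamma_real_pos)
 show "C > 0" using p by (simp add: C_def)
 fix v :: "complex ^ 'n" assume v: "v \<in> unit_ball"
 define I where "I = (\<integral>\<^sup>+w. ennreal (defect w powr a * norm (1 - cdot w v) powr (- (2 * c))) \<partial>vol)"
 have "(norm v)\<^sup>2 < 1" using v by (simp add: abs_square_less_1)
 then have s: "(\<lambda>j. C * (pochhammer e j / fact j * (norm v)\<^sup>2 ^ j)) sums (C * defect v powr (- e))"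
  unfolding defect_def by (intro sums_mult powr_neg_series_real) auto
 have npi: "x \<notin> \<int>\<^sub>\<le>\<^sub>0" if "x > 0" for x :: real using that by (auto elim!: nonpos_Ints_cases)
 have "enn2real I \<le> C * defect v powr (- e)"
  unfolding I_def
 proof (rule sums_le[OF _ Forelli_Rudin_vol(1)[OF v a c] s])
  fix j
  define x where "x = real CARD('n) + real j + a + 1"
  have x: "x > 0" using a by (simp add: x_def)
  have mid: "((e + real j) + x) / 2 = c + real j" by (simp add: e x_def)
  then have le: "(Gamma (c + real j))\<^sup>2 \<le> Gamma (e + real j) * Gamma x"
   using Gamma_log_convex_mid[of "e + real j" x] x e(1) unfolding mid by simp
  have gx: "Gamma x > 0" using x by (rule Gamma_real_pos)
  define K where "K = fact CARD('n) * Gamma (a + 1) * norm v ^ (2 * j) / ((Gamma c)\<^sup>2 * fact j)"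
  have K: "K \<ge> 0" using p by (simp add: K_def)
  have "(pochhammer c j / fact j)\<^sup>2 * (fact CARD('n) * fact j * norm v ^ (2 * j) * Gamma (a + 1) / Gamma x)
   = K * ((Gamma (c + real j))\<^sup>2 / Gamma x)"
   using pochhammer_Gamma[OF npi[OF c], of j] p gx by (simp add: K_def power_divide power2_eq_square mult_ac)
  also have "... \<le> K * Gamma (e + real j)"
   using K le gx by (intro mult_left_mono) (simp_all add: pos_divide_le_eq)
  also have "... = C * (pochhammer e j / fact j * (norm v)\<^sup>2 ^ j)"
   using pochhammer_Gamma[OF npi[OF e(1)], of j] p by (simp add: K_def C_def power_mult)
  finally show "(pochhammer c j / fact j)\<^sup>2 * (fact CARD('n) * fact j * norm v ^ (2 * j) * Gamma (a + 1)
    / Gamma (real CARD('n) + real j + a + 1)) \<le> C * (pochhammer e j / fact j * (norm v)\<^sup>2 ^ j)"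
   by (simp add: x_def)
 qed
 moreover have "I < \<infinity>" unfolding I_def by (rule Forelli_Rudin_vol(2)[OF v a c])
 ultimately show "I \<le> ennreal (C * defect v powr (- e))"
  by (metis ennreal_enn2real ennreal_leI infinity_ennreal_def)
qed

lemma norm_kernel_powr:
 fixes v w :: "complex ^ 'n"
 assumes "w \<in> unit_ball" "v \<in> unit_ball"
 shows "norm (kernel v w) = norm (1 - cdot w v) powr (- (real CARD('n) + 1))"
proof -
 have "norm (1 - cdot w v) > 0" using one_minus_cdot_nz[OF assms] by simp
 then have "norm (1 - cdot w v) powr (real (CARD('n) + 1)) = norm (1 - cdot w v) ^ (CARD('n) + 1)"
  by (rule powr_realpow)
 then show ?thesis unfolding kernel_in[OF assms(1)] norm_divide norm_power powr_minus
  by (simp add: divide_inverse add.commute)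
qed

text \<open>For \<open>a = 0\<close> and \<open>c = n + 1\<close> the Gamma quotients cancel exactly
  and the Forelli-Rudin series becomes the binomial series of \<open>(1 - |v|^2) powr (- c)\<close>.
  This value is the input for the change of variables, from which the reproducing formula is derived
  later.\<close>

lemma kernel_norm2:
 fixes v :: "complex ^ 'n"
 assumes v: "v \<in> unit_ball"
 shows "(\<integral>\<^sup>+w. ennreal ((norm (kernel v w))\<^sup>2) \<partial>vol) = ennreal (1 / defect v ^ (CARD('n) + 1))"
proof -
 define c where "c = real CARD('n) + 1"
 have c: "c > 0" by (simp add: c_def)
 define I where "I = (\<integral>\<^sup>+w. ennreal (defect w powr 0 * norm (1 - cdot w v) powr (- (2 * c))) \<partial>vol)"
 have I: "I = (\<integral>\<^sup>+w. ennreal ((norm (kernel v w))\<^sup>2) \<partial>vol)"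
  unfolding I_def
 proof (rule nn_integral_cong)
  fix w :: "complex ^ 'n" assume "w \<in> space vol"
  then have w: "w \<in> unit_ball" by simp
  show "ennreal (defect w powr 0 * norm (1 - cdot w v) powr (- (2 * c))) = ennreal ((norm (kernel v w))\<^sup>2)"
   using defect_pos[OF w] by (simp add: norm_kernel_powr[OF w v] c_def power2_eq_square flip: powr_add)
 qed
 have "(norm v)\<^sup>2 < 1" using v by (simp add: abs_square_less_1)
 then have s: "(\<lambda>j. pochhammer c j / fact j * (norm v)\<^sup>2 ^ j) sums (defect v powr (- c))"
  unfolding defect_def by (intro powr_neg_series_real) auto
 have "c \<notin> \<int>\<^sub>\<le>\<^sub>0" using c by (auto elim!: nonpos_Ints_cases)
 then have ph: "pochhammer c j = Gamma (c + real j) / Gamma c" for j by (rule pochhammer_Gamma)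
 have gc: "Gamma c = fact CARD('n)" using Gamma_fact[of "CARD('n)", where 'a=real] by (simp add: c_def add.commute)
 have "(pochhammer c j / fact j)\<^sup>2 * (fact CARD('n) * fact j * norm v ^ (2 * j) * Gamma (0 + 1)
   / Gamma (real CARD('n) + real j + 0 + 1)) = pochhammer c j / fact j * (norm v)\<^sup>2 ^ j" for j
 proof -
  have eq: "real CARD('n) + real j + 0 + 1 = c + real j" by (simp add: c_def)
  have "Gamma (c + real j) > 0" using c by (intro Gamma_real_pos) simp
  then show ?thesis unfolding ph gc eq by (simp add: power2_eq_square power_mult)
 qed
 then have "(\<lambda>j. pochhammer c j / fact j * (norm v)\<^sup>2 ^ j) sums enn2real I"
  using Forelli_Rudin_vol(1)[OF v, of 0 c] c unfolding I_def by simp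
 then have "enn2real I = defect v powr (- c)" using s sums_unique2 by blast
 moreover have "I < \<infinity>" unfolding I_def using Forelli_Rudin_vol(2)[OF v _ c, of 0] by simp
 ultimately have "I = ennreal (defect v powr (- c))" by (metis ennreal_enn2real infinity_ennreal_def)
 moreover have "defect v powr (- c) = 1 / defect v ^ (CARD('n) + 1)"
 proof -
  have "c = real (CARD('n) + 1)" by (simp add: c_def)
  then show ?thesis by (simp only: powr_minus powr_realpow[OF defect_pos[OF v]] divide_inverse mult_1_left)
 qed
 ultimately show ?thesis by (simp add: I)
qed

section \<open>Finite measures on the ball are determined by the integrals of |K_v|^2\<close>

lemma powser_coeff_unique_complex:
 fixes a b :: "nat \<Rightarrow> complex"
 assumes r: "r > 0"
  and a: "\<And>x. 0 < x ==> x < r ==> (\<lambda>i. a i * of_real (x ^ i)) sums f x"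
  and b: "\<And>x. 0 < x ==> x < r ==> (\<lambda>i. b i * of_real (x ^ i)) sums f x"
 shows "a = b"
proof -
 have "(\<lambda>i. Re (a i)) = (\<lambda>i. Re (b i))"
  using r sums_Re[OF a] sums_Re[OF b] by (intro powser_coeff_unique[of r _ "\<lambda>x. Re (f x)"]) simp_all
 moreover have "(\<lambda>i. Im (a i)) = (\<lambda>i. Im (b i))"
  using r sums_Im[OF a] sums_Im[OF b] by (intro powser_coeff_unique[of r _ "\<lambda>x. Im (f x)"]) simp_all
 ultimately show ?thesis by (auto simp: fun_eq_iff complex_eq_iff)
qed

text \<open>Supplies infinitely many roots of the polynomial in \<open>moments_eqI\<close>, whose
  variable is the square of a unimodular number.\<close>

lemma infinite_unit_circle_squares: "infinite {z :: complex. \<exists>w. norm w = 1 \<and> z = w\<^sup>2}"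
proof -
 have "inj_on cis {0<..<pi}"
 proof (rule inj_onI)
  fix x y :: real assume xy: "x \<in> {0<..<pi}" "y \<in> {0<..<pi}" and "cis x = cis y"
  from arg_cong[OF this(3), of Re] have "arccos (cos x) = arccos (cos y)" by (simp only: cis.sel)
  moreover have "arccos (cos x) = x" "arccos (cos y) = y" using xy by (intro arccos_cos; simp)+
  ultimately show "x = y" by (simp only:)
 qed
 then have "infinite (cis ` {0<..<pi})" by (simp add: finite_image_iff)
 moreover have "cis ` {0<..<pi} \<subseteq> {z. \<exists>w. norm w = 1 \<and> z = w\<^sup>2}"
 proof
  fix z assume "z \<in> cis ` {0<..<pi}"
  then obtain t where "z = cis t" by auto
  then have "z = (cis (t / 2))\<^sup>2" by (simp add: power2_eq_square cis_mult)
  then show "z \<in> {z. \<exists>w. norm w = 1 \<and> z = w\<^sup>2}" by (auto intro!: exI[of _ "cis (t/2)"])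
 qed
 ultimately show ?thesis using finite_subset by blast
qed

declare measurable_ident_vol [measurable del]

text \<open>The measure lives on all Borel sets, and only almost all of its mass is required to lie
  in the ball. Thus closed sets form a generator, and functions continuous on the whole space can be
  integrated.\<close>

locale ball_measure =
 fixes M :: "(complex ^ 'n) measure"
 assumes sets_M [simp, measurable_cong]: "sets M = sets borel"
  and fin_M: "emeasure M UNIV < \<infinity>"
  and AE_ball: "AE w in M. w \<in> unit_ball"
begin

lemma space_M [simp]: "space M = UNIV"
 using sets_eq_imp_space_eq[OF sets_M] by simp

lemma measurable_M: "f \<in> measurable borel N ==> f \<in> measurable M N"
 by (subst measurable_cong_sets[OF sets_M refl])

lemma finite_M: "finite_measure M"
 by (rule finite_measureI) (use fin_M in auto)

lemma integrable_bounded_on_ball: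
 fixes f :: "complex ^ 'n \<Rightarrow> 'b::{banach, second_countable_topology}"
 assumes "f \<in> borel_measurable borel" "\<And>w. w \<in> unit_ball ==> norm (f w) \<le> K"
 shows "integrable M f"
proof (rule finite_measure.integrable_const_bound[OF finite_M])
 show "AE w in M. norm (f w) \<le> K" using AE_ball by eventually_elim (rule assms)
qed (rule measurable_M[OF assms(1)])

lemma cdot_measurable: "(\<lambda>w :: complex ^ 'n. cdot w v) \<in> borel_measurable borel"
 by (intro borel_measurable_continuous_onI continuous_intros)

text \<open>The scaling \<open>t\<close> is a bookkeeping variable: moments of total degree
  \<open>l\<close> acquire the factor \<open>t ^ l\<close>, so that they can be compared degree by
  degree.\<close>

lemma kernel_power_series:
 assumes v: "v \<in> unit_ball" and t: "0 < t" "t < 1"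
 defines "b \<equiv> \<lambda>j. pochhammer (real CARD('n) + 1) j / fact j"
 shows "(\<lambda>l. (\<Sum>j\<le>l. of_real (b j * b (l - j)) * (LINT w|M. cdot w v ^ j * cnj (cdot w v) ^ (l - j))) * of_real (t ^ l))
  sums (of_real (enn2real (\<integral>\<^sup>+w. ennreal ((norm (kernel (t *\<^sub>R v) w))\<^sup>2) \<partial>M)))"
proof -
 define c where "c = real CARD('n) + 1"
 define u where "u = t *\<^sub>R v"
 note [measurable] = cdot_measurable
 have u: "u \<in> unit_ball"
 proof -
  have "t * norm v \<le> 1 * norm v" using t by (intro mult_right_mono) auto
  then show ?thesis using v t by (simp add: u_def)
 qed
 have u1: "norm u < 1" using u by simp
 have le: "norm (cdot w u) \<le> norm u" if "w \<in> unit_ball" for w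
  using norm_cdot_le[of w u] that mult_right_mono[of "norm w" 1 "norm u"] by simp
 define S where "S w = (if norm (cdot w u) < 1 then (1 - norm (cdot w u)) powr (- c) else 0)" for w
 define f where "f w = (1 - cdot w u) powr (of_real (- c))" for w
 have [measurable]: "S \<in> borel_measurable borel" "f \<in> borel_measurable borel"
  unfolding S_def f_def by measurable
 have "(\<lambda>l. \<Sum>j\<le>l. of_real (b j * b (l - j)) * (LINT w|M. cdot w u ^ j * cnj (cdot w u) ^ (l - j)))
  sums (of_real (LINT w|M. (norm (f w))\<^sup>2))"
 proof (rule power_pairing_sums[where S = S])
  show "(\<lambda>w. cdot w u) \<in> borel_measurable M" "f \<in> borel_measurable M"
   by (rule measurable_M, measurable)+
  show "0 \<le> b j" for j by (simp add: b_def pochhammer_nonneg)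
  show "AE w in M. (\<lambda>j. b j * norm (cdot w u) ^ j) sums S w"
   using AE_ball
  proof eventually_elim
   fix w :: "complex ^ 'n" assume "w \<in> unit_ball"
   then have "norm (cdot w u) < 1" using u by (rule norm_cdot_less_1)
   then show "(\<lambda>j. b j * norm (cdot w u) ^ j) sums S w"
    using powr_neg_series_real[of "norm (cdot w u)" c] by (simp add: S_def b_def c_def)
  qed
  show "AE w in M. (\<lambda>j. of_real (b j) * cdot w u ^ j) sums f w"
   using AE_ball
  proof eventually_elim
   fix w :: "complex ^ 'n" assume "w \<in> unit_ball"
   then have "norm (cdot w u) < 1" using u by (rule norm_cdot_less_1)
   then show "(\<lambda>j. of_real (b j) * cdot w u ^ j) sums f w"
    using powr_neg_series_complex[of "cdot w u" c] by (simp only: f_def b_def c_def)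
  qed
  show "integrable M (\<lambda>w. (S w)\<^sup>2)"
  proof (rule integrable_bounded_on_ball[where K = "((1 - norm u) powr (- c))\<^sup>2"])
   fix w :: "complex ^ 'n" assume w: "w \<in> unit_ball"
   have "0 \<le> S w" by (simp add: S_def)
   moreover have "S w \<le> (1 - norm u) powr (- c)"
    using le[OF w] u1 by (auto simp: S_def c_def intro!: powr_mono2')
   ultimately show "norm ((S w)\<^sup>2) \<le> ((1 - norm u) powr (- c))\<^sup>2" by (simp add: power_mono)
  qed measurable
 qed
 also have "(\<lambda>l. \<Sum>j\<le>l. of_real (b j * b (l - j)) * (LINT w|M. cdot w u ^ j * cnj (cdot w u) ^ (l - j)))
  = (\<lambda>l. (\<Sum>j\<le>l. of_real (b j * b (l - j)) * (LINT w|M. cdot w v ^ j * cnj (cdot w v) ^ (l - j))) * of_real (t ^ l))"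
 proof
  fix l
  have "(LINT w|M. cdot w u ^ j * cnj (cdot w u) ^ (l - j)) = (LINT w|M. cdot w v ^ j * cnj (cdot w v) ^ (l - j)) * of_real (t ^ l)" if "j \<le> l" for j
  proof -
   have "cdot w u ^ j * cnj (cdot w u) ^ (l - j) = (cdot w v ^ j * cnj (cdot w v) ^ (l - j)) * of_real (t ^ l)" for w
   proof -
    have "t ^ l = t ^ j * t ^ (l - j)" using that by (simp flip: power_add)
    then show ?thesis by (simp add: u_def cdot_scaleR_right power_mult_distrib)
   qed
   then show ?thesis by (simp only: integral_mult_left_zero)
  qed
  then show "(\<Sum>j\<le>l. of_real (b j * b (l - j)) * (LINT w|M. cdot w u ^ j * cnj (cdot w u) ^ (l - j)))
   = (\<Sum>j\<le>l. of_real (b j * b (l - j)) * (LINT w|M. cdot w v ^ j * cnj (cdot w v) ^ (l - j))) * of_real (t ^ l)"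
   unfolding sum_distrib_right by (intro sum.cong) (simp_all add: mult.assoc)
 qed
 also have "(LINT w|M. (norm (f w))\<^sup>2) = enn2real (\<integral>\<^sup>+w. ennreal ((norm (f w))\<^sup>2) \<partial>M)"
  by (rule integral_eq_nn_integral) auto
 also have "(\<integral>\<^sup>+w. ennreal ((norm (f w))\<^sup>2) \<partial>M) = (\<integral>\<^sup>+w. ennreal ((norm (kernel u w))\<^sup>2) \<partial>M)"
 proof (rule nn_integral_cong_AE)
  show "AE w in M. ennreal ((norm (f w))\<^sup>2) = ennreal ((norm (kernel u w))\<^sup>2)"
   using AE_ball
  proof eventually_elim
   fix w :: "complex ^ 'n" assume w: "w \<in> unit_ball"
   have "norm (f w) = norm (1 - cdot w u) powr (- c)"
    unfolding f_def by (simp add: norm_powr_real_powr')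
   then show "ennreal ((norm (f w))\<^sup>2) = ennreal ((norm (kernel u w))\<^sup>2)"
    by (simp add: norm_kernel_powr[OF w u] c_def)
  qed
 qed
 finally show ?thesis by (simp add: u_def)
qed

text \<open>As \<open>|exp (cdot w v)|^2 = exp (2 * inner w v)\<close>, the moments determine the
  integrals of real exponentials, whose span is an algebra suited to the Stone-Weierstrass
  theorem.\<close>

lemma exp_moment_series:
 defines "b \<equiv> \<lambda>j. 1 / fact j :: real"
 shows "(\<lambda>l. (\<Sum>j\<le>l. of_real (b j * b (l - j)) * (LINT w|M. cdot w v ^ j * cnj (cdot w v) ^ (l - j))))
  sums (of_real (LINT w|M. exp (2 * inner w v)))"
proof -
 note [measurable] = cdot_measurable
 have "(\<lambda>l. (\<Sum>j\<le>l. of_real (b j * b (l - j)) * (LINT w|M. cdot w v ^ j * cnj (cdot w v) ^ (l - j))))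
  sums (of_real (LINT w|M. (norm (exp (cdot w v)))\<^sup>2))"
 proof (rule power_pairing_sums[where S = "\<lambda>w. exp (norm (cdot w v))"])
  show "(\<lambda>w. cdot w v) \<in> borel_measurable M" "(\<lambda>w. exp (cdot w v)) \<in> borel_measurable M"
   by (intro measurable_M borel_measurable_continuous_onI continuous_intros)+
  show "AE w in M. (\<lambda>j. b j * norm (cdot w v) ^ j) sums exp (norm (cdot w v))"
   using exp_converges[of "norm (cdot _ v)"] by (simp add: b_def field_simps)
  show "AE w in M. (\<lambda>j. of_real (b j) * cdot w v ^ j) sums exp (cdot w v)"
   using exp_converges[of "cdot _ v"] by (simp add: b_def scaleR_conv_of_real field_simps)
  show "integrable M (\<lambda>w. (exp (norm (cdot w v)))\<^sup>2)"
  proof (rule integrable_bounded_on_ball[where K = "(exp (norm v))\<^sup>2"])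
   fix w :: "complex ^ 'n" assume "w \<in> unit_ball"
   then have "norm (cdot w v) \<le> norm v"
    using norm_cdot_le[of w v] mult_right_mono[of "norm w" 1 "norm v"] by simp
   then show "norm ((exp (norm (cdot w v)))\<^sup>2) \<le> (exp (norm v))\<^sup>2" by (simp add: power_mono)
  qed measurable
 qed (simp add: b_def)
 also have "(\<lambda>w. (norm (exp (cdot w v)))\<^sup>2) = (\<lambda>w. exp (2 * inner w v))"
  by (simp add: exp_double Re_cdot)
 finally show ?thesis .
qed

end

text \<open>Comparing coefficients of \<open>t\<^sup>l\<close> and then, with \<open>v\<close> replaced by \<open>\<omega> v\<close>, of powers of the unimodular
 number \<open>\<omega>\<close> recovers all moments from the integrals of \<open>|K\<^sub>v|\<^sup>2\<close>.\<close>

lemma moments_eqI: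
 fixes M N :: "(complex ^ 'n) measure"
 assumes M: "ball_measure M" and N: "ball_measure N"
  and K: "\<And>v. v \<in> unit_ball ==> (\<integral>\<^sup>+w. ennreal ((norm (kernel v w))\<^sup>2) \<partial>M) = (\<integral>\<^sup>+w. ennreal ((norm (kernel v w))\<^sup>2) \<partial>N)"
 shows "(LINT w|M. cdot w v ^ j * cnj (cdot w v) ^ k) = (LINT w|N. cdot w v ^ j * cnj (cdot w v) ^ k)"
proof -
 interpret M: ball_measure M by fact
 interpret N: ball_measure N by fact
 define b where "b j = pochhammer (real CARD('n) + 1) j / fact j" for j
 have bpos: "b j > 0" for j by (simp add: b_def pochhammer_pos)
 define m where "m P v j k = (LINT w|P. cdot w v ^ j * cnj (cdot w v) ^ k)" for P and v :: "complex ^ 'n" and j k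
 have sb: "t *\<^sub>R v \<in> unit_ball" if "v \<in> unit_ball" "0 < t" "t < 1" for t and v :: "complex ^ 'n"
 proof -
  have "t * norm v \<le> 1 * norm v" using that by (intro mult_right_mono) auto
  then show ?thesis using that by simp
 qed
 have coeff: "(\<Sum>j\<le>l. of_real (b j * b (l - j)) * m M v j (l - j)) = (\<Sum>j\<le>l. of_real (b j * b (l - j)) * m N v j (l - j))"
  if v: "v \<in> unit_ball" for v l
 proof -
  have "(\<lambda>l. \<Sum>j\<le>l. of_real (b j * b (l - j)) * m M v j (l - j)) = (\<lambda>l. \<Sum>j\<le>l. of_real (b j * b (l - j)) * m N v j (l - j))"
  proof (rule powser_coeff_unique_complex[of 1])
   fix t :: real assume t: "0 < t" "t < 1"
   show "(\<lambda>l. (\<Sum>j\<le>l. of_real (b j * b (l - j)) * m M v j (l - j)) * of_real (t ^ l))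
    sums (of_real (enn2real (\<integral>\<^sup>+w. ennreal ((norm (kernel (t *\<^sub>R v) w))\<^sup>2) \<partial>M)))"
    unfolding b_def m_def by (rule M.kernel_power_series[OF v t])
   show "(\<lambda>l. (\<Sum>j\<le>l. of_real (b j * b (l - j)) * m N v j (l - j)) * of_real (t ^ l))
    sums (of_real (enn2real (\<integral>\<^sup>+w. ennreal ((norm (kernel (t *\<^sub>R v) w))\<^sup>2) \<partial>M)))"
    unfolding b_def m_def K[OF sb[OF v t]] by (rule N.kernel_power_series[OF v t])
  qed simp
  then show ?thesis by (rule fun_cong)
 qed
 \<comment> \<open>Pulling out \<open>\<omega> ^ l\<close> leaves powers of the square of
   \<open>cnj \<omega>\<close>, so the identity in degree \<open>l\<close> becomes a polynomial
   identity in one variable.\<close>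
 have rot: "m P (\<omega> *s v) j (l - j) = \<omega> ^ l * ((cnj \<omega>)\<^sup>2 ^ j * m P v j (l - j))"
  if "norm \<omega> = 1" "j \<le> l" for P \<omega> v j l
 proof -
  have 1: "\<omega> * cnj \<omega> = 1" using that by (simp flip: complex_norm_square)
  have "cnj \<omega> ^ j * \<omega> ^ (l - j) = \<omega> ^ l * (cnj \<omega>)\<^sup>2 ^ j"
  proof -
   have "\<omega> ^ l * (cnj \<omega>)\<^sup>2 ^ j = \<omega> ^ (l - j) * (\<omega> ^ j * (cnj \<omega> ^ j * cnj \<omega> ^ j))"
    using that by (simp add: power2_eq_square power_mult_distrib flip: power_add)
   also have "\<omega> ^ j * (cnj \<omega> ^ j * cnj \<omega> ^ j) = (\<omega> * cnj \<omega>) ^ j * cnj \<omega> ^ j"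
    by (simp only: power_mult_distrib mult.assoc)
   finally show ?thesis by (simp add: 1 mult.commute)
  qed
  moreover have "cdot w (\<omega> *s v) ^ j * cnj (cdot w (\<omega> *s v)) ^ (l - j)
   = (cnj \<omega> ^ j * \<omega> ^ (l - j)) * (cdot w v ^ j * cnj (cdot w v) ^ (l - j))" for w
   by (simp add: cdot_smult_right power_mult_distrib mult_ac)
  ultimately show ?thesis unfolding m_def by (simp only: integral_mult_right_zero mult.assoc)
 qed
 have ball: "m M v j k = m N v j k" if v: "v \<in> unit_ball" for v j k
 proof -
  define l where "l = j + k"
  define d where "d i = of_real (b i * b (l - i)) * (m M v i (l - i) - m N v i (l - i))" for i
  have "{z. \<exists>\<omega>. norm \<omega> = 1 \<and> z = \<omega>\<^sup>2} \<subseteq> {z. (\<Sum>i\<le>l. d i * z ^ i) = 0}"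
  proof
   fix z :: complex assume "z \<in> {z. \<exists>\<omega>. norm \<omega> = 1 \<and> z = \<omega>\<^sup>2}"
   then obtain \<omega> where \<omega>: "norm \<omega> = 1" "z = \<omega>\<^sup>2" by auto
   define \<eta> where "\<eta> = cnj \<omega>"
   have \<eta>: "norm \<eta> = 1" "z = (cnj \<eta>)\<^sup>2" using \<omega> by (simp_all add: \<eta>_def)
   have "\<eta> *s v \<in> unit_ball" using v \<eta> by (simp add: norm_smult_vec)
   from coeff[OF this, of l]
   have "(\<Sum>i\<le>l. of_real (b i * b (l - i)) * (\<eta> ^ l * (z ^ i * m M v i (l - i))))
     = (\<Sum>i\<le>l. of_real (b i * b (l - i)) * (\<eta> ^ l * (z ^ i * m N v i (l - i))))"
    by (simp add: rot[OF \<eta>(1)] \<eta>(2))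
   then have "\<eta> ^ l * (\<Sum>i\<le>l. d i * z ^ i) = 0"
    by (simp add: d_def sum_distrib_left algebra_simps sum_subtractf)
   moreover have "\<eta> \<noteq> 0" using \<eta> by auto
   ultimately show "z \<in> {z. (\<Sum>i\<le>l. d i * z ^ i) = 0}" by simp
  qed
  then have "infinite {z. (\<Sum>i\<le>l. d i * z ^ i) = 0}" using infinite_unit_circle_squares finite_subset by blast
  then have "d j = 0" unfolding polyfun_finite_roots by (auto simp: l_def)
  then show ?thesis using bpos[of j] bpos[of k] by (simp add: d_def l_def)
 qed
 have "m M v j k = m N v j k"
 proof -
  define t where "t = 1 / (norm v + 1)"
  have t: "t > 0" by (simp add: t_def add_nonneg_pos)
  have "t *\<^sub>R v \<in> unit_ball" using t by (simp add: t_def)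
  from ball[OF this, of j k] have "m M (t *\<^sub>R v) j k = m N (t *\<^sub>R v) j k" .
  moreover have "m P (t *\<^sub>R v) j k = of_real (t ^ j * t ^ k) * m P v j k" for P
  proof -
   have "cdot w (t *\<^sub>R v) ^ j * cnj (cdot w (t *\<^sub>R v)) ^ k = of_real (t ^ j * t ^ k) * (cdot w v ^ j * cnj (cdot w v) ^ k)" for w
    by (simp add: cdot_scaleR_right power_mult_distrib)
   then show ?thesis unfolding m_def by (simp only: integral_mult_right_zero)
  qed
  ultimately show ?thesis using t by simp
 qed
 then show ?thesis by (simp add: m_def)
qed

text \<open>The span of exponentials of linear forms. It contains the constants
  (\<open>v = 0\<close>), separates points and is closed under products, which are the hypotheses of
  the Stone-Weierstrass theorem in predicate form.\<close>

inductive exp_sum :: "('a::real_inner \<Rightarrow> real) \<Rightarrow> bool" where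
 base: "exp_sum (\<lambda>w. c * exp (2 * inner w v))"
| add: "exp_sum f ==> exp_sum g ==> exp_sum (\<lambda>w. f w + g w)"

lemma exp_sum_mult_base: "exp_sum g ==> exp_sum (\<lambda>w. c * exp (2 * inner w v) * g w)"
proof (induction rule: exp_sum.induct)
 case (base d u)
 have "(\<lambda>w. c * exp (2 * inner w v) * (d * exp (2 * inner w u))) = (\<lambda>w. (c * d) * exp (2 * inner w (v + u)))"
  by (auto simp: inner_add_right distrib_left exp_add)
 then show ?case by (simp only: exp_sum.base)
next
 case (add f g)
 then show ?case by (simp only: distrib_left exp_sum.add)
qed

lemma exp_sum_mult: "exp_sum f ==> exp_sum g ==> exp_sum (\<lambda>w. f w * g w)"
proof (induction rule: exp_sum.induct)
 case (base c v)
 then show ?case by (rule exp_sum_mult_base)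
next
 case (add f g)
 then show ?case by (simp only: distrib_right exp_sum.add)
qed

lemma exp_sum_continuous: "exp_sum f ==> continuous_on S f"
 by (induction rule: exp_sum.induct) (intro continuous_intros; simp)+

text \<open>Equal moments give equal integrals of exponentials, uniform approximation on the closed
  ball extends this to continuous functions, and the functions \<open>h n\<close>, which tend to the
  indicator of a closed set, extend it to a generator stable under intersection.\<close>

lemma ball_measure_eqI:
 fixes M N :: "(complex ^ 'n) measure"
 assumes M: "ball_measure M" and N: "ball_measure N"
  and K: "\<And>v. v \<in> unit_ball ==> (\<integral>\<^sup>+w. ennreal ((norm (kernel v w))\<^sup>2) \<partial>M) = (\<integral>\<^sup>+w. ennreal ((norm (kernel v w))\<^sup>2) \<partial>N)"
 shows "M = N"
proof -
 interpret M: ball_measure M by fact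
 interpret N: ball_measure N by fact
 interpret M: finite_measure M by (rule M.finite_M)
 interpret N: finite_measure N by (rule N.finite_M)
 have mom: "(LINT w|M. cdot w v ^ j * cnj (cdot w v) ^ k) = (LINT w|N. cdot w v ^ j * cnj (cdot w v) ^ k)" for v j k
  by (rule moments_eqI[OF M N]) (rule K)
 have ex: "(LINT w|M. exp (2 * inner w v)) = (LINT w|N. exp (2 * inner w v))" for v
 proof -
  have "complex_of_real (LINT w|M. exp (2 * inner w v)) = of_real (LINT w|N. exp (2 * inner w v))"
   using M.exp_moment_series[of v] N.exp_moment_series[of v] unfolding mom by (rule sums_unique2)
  then show ?thesis by (simp only: of_real_eq_iff)
 qed
 have bdd: "integrable M f \<and> integrable N f" if "continuous_on UNIV f" for f :: "complex ^ 'n \<Rightarrow> real"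
 proof -
  have "compact (f ` cball 0 1)" using that by (intro compact_continuous_image) (auto intro: continuous_on_subset)
  then have "bounded (f ` cball 0 1)" by (rule compact_imp_bounded)
  then obtain B where B: "\<And>w. w \<in> cball 0 1 ==> norm (f w) \<le> B" unfolding bounded_iff by blast
  have "f \<in> borel_measurable borel" using that by (rule borel_measurable_continuous_onI)
  then show ?thesis using B by (auto intro!: M.integrable_bounded_on_ball[where K=B] N.integrable_bounded_on_ball[where K=B])
 qed
 have es: "(LINT w|M. f w) = (LINT w|N. f w)" if "exp_sum f" for f
  using that
 proof (induction rule: exp_sum.induct)
  case (base c v) then show ?case by (simp add: ex)
 next
  case (add f g)
  then show ?case using bdd[of f] bdd[of g] exp_sum_continuous[of f UNIV] exp_sum_continuous[of g UNIV] by simp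
 qed
 have cont: "(LINT w|M. f w) = (LINT w|N. f w)" if f: "continuous_on UNIV f" for f :: "complex ^ 'n \<Rightarrow> real"
 proof -
  define m where "m = measure M UNIV + measure N UNIV + 1"
  have m: "m > 0" by (simp add: m_def add_nonneg_pos)
  have "\<bar>(LINT w|M. f w) - (LINT w|N. f w)\<bar> \<le> e" if e: "e > 0" for e
  proof -
   \<comment> \<open>Approximation on the closed ball suffices, since almost all mass of both
     measures lies there.\<close>
   have "\<exists>g. exp_sum g \<and> (\<forall>x\<in>cball 0 1. \<bar>f x - g x\<bar> < e / m)"
   proof (rule Stone_Weierstrass_HOL)
    show "exp_sum (\<lambda>x. c)" for c using exp_sum.base[of c 0] by simp
    show "\<exists>g. exp_sum g \<and> g x \<noteq> g y" if "x \<in> cball 0 1 \<and> y \<in> cball 0 1 \<and> x \<noteq> y" for x y :: "complex ^ 'n"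
    proof (intro exI conjI)
     show "exp_sum (\<lambda>w. 1 * exp (2 * inner w (x - y)))" by (rule exp_sum.base)
     have "inner (x - y) (x - y) \<noteq> 0" using that by simp
     then show "1 * exp (2 * inner x (x - y)) \<noteq> 1 * exp (2 * inner y (x - y))"
      by (simp add: inner_diff_left)
    qed
    show "continuous_on (cball 0 1) f" using f by (rule continuous_on_subset) simp
    show "0 < e / m" using e m by simp
   qed (auto intro: exp_sum_continuous exp_sum.add exp_sum_mult)
   then obtain g where g: "exp_sum g" "\<And>x. x \<in> cball 0 1 ==> \<bar>f x - g x\<bar> < e / m" by blast
   have gi: "integrable M g" "integrable N g" using bdd[OF exp_sum_continuous[OF g(1)]] by auto
   have fi: "integrable M f" "integrable N f" using bdd[OF f] by auto
   have "\<bar>(LINT w|M. f w - g w)\<bar> \<le> (LINT w|M. e / m)"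
    using M.AE_ball gi fi g(2) by (intro order_trans[OF integral_abs_bound] integral_mono_AE) (auto intro: less_imp_le)
   moreover have "\<bar>(LINT w|N. f w - g w)\<bar> \<le> (LINT w|N. e / m)"
    using N.AE_ball gi fi g(2) by (intro order_trans[OF integral_abs_bound] integral_mono_AE) (auto intro: less_imp_le)
   ultimately have "\<bar>(LINT w|M. f w) - (LINT w|N. f w)\<bar> \<le> measure M UNIV * (e / m) + measure N UNIV * (e / m)"
    using es[OF g(1)] fi gi by simp
   also have "... = (measure M UNIV + measure N UNIV) * (e / m)" by (simp only: distrib_right)
   also have "... \<le> m * (e / m)" using e m by (intro mult_right_mono) (auto simp: m_def)
   finally show ?thesis using m by simp
  qed
  then show ?thesis by (metis abs_le_zero_iff diff_gt_0_iff_gt eq_iff_diff_eq_0 field_le_epsilon add_0)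
 qed
 have closed: "emeasure M C = emeasure N C" if C: "closed C" for C
 proof (cases "C = {}")
  case False
  define h where "h n w = max 0 (1 - real n * infdist w C)" for n :: nat and w
  have hc: "continuous_on UNIV (h n)" for n unfolding h_def by (intro continuous_intros)
  have hb: "\<bar>h n w\<bar> \<le> 1" for n w using infdist_nonneg[of w C] by (auto simp: h_def max_def)
  have lim: "(\<lambda>n. h n w) \<longlonglongrightarrow> indicator C w" for w
  proof (cases "w \<in> C")
   case True then show ?thesis by (simp add: h_def)
  next
   case False
   then have "infdist w C > 0" using C \<open>C \<noteq> {}\<close> in_closed_iff_infdist_zero infdist_nonneg by (metis less_eq_real_def)
   then obtain n0 where n0: "1 < real n0 * infdist w C" using reals_Archimedean3 by blast
   have "h n w = 0" if "n \<ge> n0" for n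
   proof -
    have "real n0 * infdist w C \<le> real n * infdist w C" using that by (intro mult_right_mono infdist_nonneg) simp
    then show ?thesis using n0 by (simp add: h_def)
   qed
   then have "\<forall>\<^sub>F n in sequentially. h n w = 0" using eventually_sequentially by blast
   then show ?thesis using False by (simp add: tendsto_eventually)
  qed
  have hm[measurable]: "h n \<in> borel_measurable borel" for n using hc by (rule borel_measurable_continuous_onI)
  have Cm[measurable]: "C \<in> sets borel" using C by simp
  have "(\<lambda>n. \<integral>w. h n w \<partial>M) \<longlonglongrightarrow> (LINT w|M. indicator C w)"
   by (rule integral_dominated_convergence[where w = "\<lambda>_. 1"]) (use hb lim in \<open>auto\<close>)
  moreover have "(\<lambda>n. \<integral>w. h n w \<partial>N) \<longlonglongrightarrow> (LINT w|N. indicator C w)"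
   by (rule integral_dominated_convergence[where w = "\<lambda>_. 1"]) (use hb lim in \<open>auto\<close>)
  ultimately have "(LINT w|M. indicator C w) = (\<integral>w. indicator C w \<partial>N :: real)"
   unfolding cont[OF hc] by (rule LIMSEQ_unique)
  then have "measure M C = measure N C" by simp
  then show ?thesis by (simp add: M.emeasure_eq_measure N.emeasure_eq_measure)
 qed simp
 show "M = N"
 proof (rule measure_eqI_generator_eq[where E = "Collect closed" and \<Omega> = UNIV and A = "\<lambda>_. UNIV"])
  show "Int_stable (Collect closed :: (complex ^ 'n) set set)" by (auto simp: Int_stable_def)
  show "sets M = sigma_sets UNIV (Collect closed)" "sets N = sigma_sets UNIV (Collect closed)"
   by (simp_all add: borel_eq_closed)
 qed (use closed in \<open>auto simp: M.emeasure_eq_measure\<close>)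
qed

section \<open>Behaviour of v and lambda under rotations and Moebius transforms\<close>

lemma nn_integral_distr':
 "T \<in> measurable M N ==> f \<in> borel_measurable N ==> (\<integral>\<^sup>+x. f x \<partial>distr M N T) = (\<integral>\<^sup>+x. f (T x) \<partial>M)"
 by (simp add: nn_integral_distr)

lemma measurable_into_vol:
 fixes f :: "'a \<Rightarrow> complex ^ 'n"
 assumes "f \<in> borel_measurable M" "\<And>x. x \<in> space M ==> f x \<in> unit_ball"
 shows "f \<in> measurable M vol"
proof (rule measurableI)
 fix A :: "(complex ^ 'n) set" assume "A \<in> sets vol"
 then have "A \<in> sets borel" by (simp add: in_sets_vol_iff)
 then show "f -` A \<inter> space M \<in> sets M" using assms(1) by (rule measurable_sets[rotated])
qed (use assms in auto)

lemma mobius_measurable: "z \<in> unit_ball ==> mobius z \<in> measurable vol vol"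
 by (intro measurable_into_vol measurable_vol_continuous continuous_on_mobius_comp[where f = "\<lambda>_. z" and g = "\<lambda>x. x", simplified eta_contract_eq]
   continuous_intros) (simp_all only: space_vol mobius_in_ball)

lemma smult_measurable_vol: "norm c = 1 ==> (\<lambda>w. c *s w) \<in> measurable vol vol"
 by (intro measurable_into_vol measurable_vol_continuous continuous_intros) (auto simp: norm_smult_vec)

lemma ball_measure_distr:
 assumes [measurable]: "T \<in> measurable P borel" and "\<And>x. x \<in> space P ==> T x \<in> unit_ball" and "emeasure P (space P) < \<infinity>"
 shows "ball_measure (distr P borel T)"
proof
 show "sets (distr P borel T) = sets borel" by simp
 show "emeasure (distr P borel T) UNIV < \<infinity>" using assms by (subst emeasure_distr) auto
 show "AE w in distr P borel T. w \<in> unit_ball"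
  using assms(2) by (subst AE_distr_iff) auto
qed

text \<open>Transfers the uniqueness result for measures on the whole space to \<open>vol\<close>,
  whose sets are the Borel subsets of the ball.\<close>

lemma distr_borel_eq_imp_distr_vol_eq:
 assumes T: "T \<in> measurable P vol" and eq: "distr P borel T = distr vol borel (\<lambda>x. x)"
 shows "distr P vol T = vol"
proof (rule measure_eqI)
 fix A assume "A \<in> sets (distr P vol T)"
 then have A: "A \<in> sets vol" by simp
 then have Ab: "A \<in> sets borel" and AB: "A \<subseteq> unit_ball" by (auto simp: in_sets_vol_iff)
 have T': "T \<in> measurable P borel" using measurable_compose[OF T measurable_ident_vol] .
 have "emeasure (distr P vol T) A = emeasure (distr P borel T) A"
  using T T' A Ab by (simp add: emeasure_distr)
 also have "... = emeasure vol ((\<lambda>x. x) -` A \<inter> space vol)"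
  unfolding eq using Ab by (subst emeasure_distr) (auto intro: measurable_ident_vol)
 also have "(\<lambda>x. x) -` A \<inter> space vol = A" using AB by auto
 finally show "emeasure (distr P vol T) A = emeasure vol A" .
qed simp

text \<open>Composition with the rotation turns the kernel at \<open>v\<close> into the kernel at
  \<open>cnj c *s v\<close>, which has the same L^2 norm by \<open>kernel_norm2\<close>; then
  \<open>ball_measure_eqI\<close> applies.\<close>

lemma distr_vol_rotation:
 assumes c: "norm c = 1"
 shows "distr vol vol (\<lambda>w. c *s w) = (vol :: (complex ^ 'n) measure)"
proof (rule distr_borel_eq_imp_distr_vol_eq[OF smult_measurable_vol[OF c]])
 have m: "(\<lambda>w :: complex ^ 'n. c *s w) \<in> borel_measurable vol"
  by (intro measurable_vol_continuous continuous_intros)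
 show "distr vol borel (\<lambda>w. c *s w) = (distr vol borel (\<lambda>x. x) :: (complex ^ 'n) measure)"
 proof (rule ball_measure_eqI)
  show "ball_measure (distr vol borel (\<lambda>w :: complex ^ 'n. c *s w))"
   by (rule ball_measure_distr[OF m]) (use c in \<open>auto simp: norm_smult_vec emeasure_vol_space\<close>)
  show "ball_measure (distr vol borel (\<lambda>x :: complex ^ 'n. x))"
   by (rule ball_measure_distr[OF measurable_ident_vol]) (auto simp: emeasure_vol_space)
  fix v :: "complex ^ 'n" assume v: "v \<in> unit_ball"
  have cv: "cnj c *s v \<in> unit_ball" using v c by (simp add: norm_smult_vec)
  have km: "(\<lambda>w. ennreal ((norm (kernel v w))\<^sup>2)) \<in> borel_measurable borel"
  proof -
   have "(\<lambda>w. indicator unit_ball w *\<^sub>R kernel v w) \<in> borel_measurable borel"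
    using v by (intro borel_measurable_continuous_on_indicator continuous_intros) auto
   moreover have "(\<lambda>w. indicator unit_ball w *\<^sub>R kernel v w) = kernel v" by (auto simp: fun_eq_iff indicator_def)
   ultimately have [measurable]: "kernel v \<in> borel_measurable borel" by simp
   show ?thesis by measurable
  qed
  have "(\<integral>\<^sup>+w. ennreal ((norm (kernel v w))\<^sup>2) \<partial>distr vol borel (\<lambda>w. c *s w)) = (\<integral>\<^sup>+w. ennreal ((norm (kernel v (c *s w)))\<^sup>2) \<partial>vol)"
   by (rule nn_integral_distr'[OF m km])
  also have "... = (\<integral>\<^sup>+w. ennreal ((norm (kernel (cnj c *s v) w))\<^sup>2) \<partial>vol)"
   by (intro nn_integral_cong) (use c in \<open>simp add: kernel_def norm_smult_vec cdot_smult_left cdot_smult_right\<close>)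
  also have "... = (\<integral>\<^sup>+w. ennreal ((norm (kernel v w))\<^sup>2) \<partial>vol)"
   unfolding kernel_norm2[OF cv] kernel_norm2[OF v] using c by (simp add: defect_def norm_smult_vec)
  also have "... = (\<integral>\<^sup>+w. ennreal ((norm (kernel v w))\<^sup>2) \<partial>distr vol borel (\<lambda>x. x))"
   by (rule nn_integral_distr'[OF measurable_ident_vol km, symmetric])
  finally show "(\<integral>\<^sup>+w. ennreal ((norm (kernel v w))\<^sup>2) \<partial>distr vol borel (\<lambda>w. c *s w))
   = (\<integral>\<^sup>+w. ennreal ((norm (kernel v w))\<^sup>2) \<partial>distr vol borel (\<lambda>x. x))" .
 qed
qed

lemma kernel_measurable_borel: 
 assumes "v \<in> unit_ball" shows "kernel v \<in> borel_measurable borel"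
proof -
 have "(\<lambda>w. indicator unit_ball w *\<^sub>R kernel v w) \<in> borel_measurable borel"
  using assms by (intro borel_measurable_continuous_on_indicator continuous_intros) auto
 moreover have "(\<lambda>w. indicator unit_ball w *\<^sub>R kernel v w) = kernel v" by (auto simp: fun_eq_iff indicator_def)
 ultimately show ?thesis by simp
qed

text \<open>The squared modulus of the normalized kernel at \<open>z\<close>, which is the real
  Jacobian determinant of \<open>mobius z\<close>. The change of variables below is proved without
  differentiating.\<close>

definition mobius_density :: "complex ^ 'n \<Rightarrow> complex ^ 'n \<Rightarrow> real" where
 "mobius_density z w = defect z ^ (CARD('n) + 1) * (norm (kernel z w))\<^sup>2"

lemma mobius_density_nonneg: "z \<in> unit_ball ==> 0 \<le> mobius_density z w"
 using defect_pos[of z] by (simp add: mobius_density_def)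

lemma mobius_density_measurable:
 assumes z: "z \<in> unit_ball"
 shows "mobius_density z \<in> borel_measurable borel"
proof -
 note [measurable] = kernel_measurable_borel[OF z]
 show ?thesis unfolding mobius_density_def by measurable
qed

lemma nn_integral_mobius_density:
 assumes z: "z \<in> unit_ball"
 shows "(\<integral>\<^sup>+w. ennreal (mobius_density z w) \<partial>(vol :: (complex ^ 'n) measure)) = 1"
proof -
 note [measurable] = measurable_volI[OF kernel_measurable_borel[OF z]]
 have "(\<integral>\<^sup>+w. ennreal (mobius_density z w) \<partial>(vol :: (complex ^ 'n) measure))
  = (\<integral>\<^sup>+w. ennreal (defect z ^ (CARD('n) + 1)) * ennreal ((norm (kernel z w))\<^sup>2) \<partial>vol)"
  using defect_pos[OF z] by (simp add: mobius_density_def ennreal_mult)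
 also have "... = ennreal (defect z ^ (CARD('n) + 1)) * ennreal (1 / defect z ^ (CARD('n) + 1))"
  by (subst nn_integral_cmult) (simp_all add: kernel_norm2[OF z] del: power_Suc)
 also have "... = ennreal 1"
 proof -
  define D where "D = defect z ^ (CARD('n) + 1)"
  have "D > 0" unfolding D_def using defect_pos[OF z] by (rule zero_less_power)
  then have "ennreal D * ennreal (1 / D) = ennreal 1" by (subst ennreal_mult[symmetric]) simp_all
  then show ?thesis unfolding D_def .
 qed
 finally show ?thesis by simp
qed

lemma norm_one_minus_cdot_commute: "norm (1 - cdot w z) = norm (1 - cdot z w)"
 by (metis cnj_cdot complex_cnj_diff complex_cnj_one complex_mod_cnj)

text \<open>By \<open>kernel_mobius\<close>, the density times \<open>|K_v|^2\<close> composed with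
  \<open>mobius z\<close> is a constant multiple of \<open>|K_x|^2\<close> for
  \<open>x = mobius z v\<close>. The values of \<open>kernel_norm2\<close> and
  \<open>defect_mobius\<close> show that its integral is that of \<open>|K_v|^2\<close>, and
  \<open>ball_measure_eqI\<close> concludes.\<close>

theorem distr_vol_mobius:
 fixes z :: "complex ^ 'n"
 assumes z: "z \<in> unit_ball"
 shows "distr (density vol (\<lambda>w. ennreal (mobius_density z w))) vol (mobius z) = vol"
proof (rule distr_borel_eq_imp_distr_vol_eq)
 let ?P = "density vol (\<lambda>w. ennreal (mobius_density z w))"
 have gm[measurable]: "(\<lambda>w. ennreal (mobius_density z w)) \<in> borel_measurable vol"
  using measurable_volI[OF mobius_density_measurable[OF z]] by measurable
 show mm: "mobius z \<in> measurable ?P vol" using mobius_measurable[OF z] by simp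
 have mb: "mobius z \<in> measurable ?P borel" using measurable_compose[OF mm measurable_ident_vol] .
 show "distr ?P borel (mobius z) = distr vol borel (\<lambda>x. x)"
 proof (rule ball_measure_eqI)
  have "emeasure ?P (space ?P) = (\<integral>\<^sup>+w. ennreal (mobius_density z w) \<partial>vol)"
  proof -
   have "emeasure ?P (space vol) = (\<integral>\<^sup>+w. ennreal (mobius_density z w) * indicator (space vol) w \<partial>vol)"
    by (rule emeasure_density[OF gm sets.top])
   also have "... = (\<integral>\<^sup>+w. ennreal (mobius_density z w) \<partial>vol)" by (rule nn_integral_cong) simp
   finally show ?thesis by simp
  qed
  then show "ball_measure (distr ?P borel (mobius z))"
   using mobius_in_ball[OF z] by (intro ball_measure_distr[OF mb]) (auto simp: nn_integral_mobius_density[OF z])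
  show "ball_measure (distr vol borel (\<lambda>x :: complex ^ 'n. x))"
   by (rule ball_measure_distr[OF measurable_ident_vol]) (auto simp: emeasure_vol_space)
  fix v :: "complex ^ 'n" assume v: "v \<in> unit_ball"
  define N where "N = CARD('n) + 1"
  define x where "x = mobius z v"
  have x: "x \<in> unit_ball" unfolding x_def by (rule mobius_in_ball[OF z v])
  define r where "r = norm (1 - cdot z v)"
  have r: "r > 0" using one_minus_cdot_nz[OF z v] by (simp add: r_def)
  have km: "(\<lambda>w. ennreal ((norm (kernel v w))\<^sup>2)) \<in> borel_measurable borel"
   using kernel_measurable_borel[OF v] by measurable
  note [measurable] = measurable_volI[OF kernel_measurable_borel[OF x]]
  have pt: "mobius_density z w * (norm (kernel v (mobius z w)))\<^sup>2 = defect z ^ N / r ^ (2 * N) * (norm (kernel x w))\<^sup>2"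
   if w: "w \<in> unit_ball" for w
  proof -
   have "norm (kernel v (mobius z w)) * norm (kernel z w) = norm (kernel x w) / r ^ N"
    using arg_cong[OF kernel_mobius[OF z v w], of norm]
    by (simp add: norm_mult norm_divide norm_power x_def r_def N_def)
   then have "(norm (kernel v (mobius z w)) * norm (kernel z w))\<^sup>2 = (norm (kernel x w) / r ^ N)\<^sup>2" by simp
   then have "defect z ^ N * (norm (kernel z w))\<^sup>2 * (norm (kernel v (mobius z w)))\<^sup>2 = defect z ^ N / r ^ (2 * N) * (norm (kernel x w))\<^sup>2"
    by (simp add: power_mult_distrib power_divide mult.commute[of 2 N] power_mult mult.assoc)
      (simp add: mult.commute)
   then show ?thesis unfolding mobius_density_def N_def[symmetric] .
  qed
  have "(\<integral>\<^sup>+w. ennreal ((norm (kernel v w))\<^sup>2) \<partial>distr ?P borel (mobius z))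
   = (\<integral>\<^sup>+w. ennreal ((norm (kernel v (mobius z w)))\<^sup>2) \<partial>?P)"
   by (rule nn_integral_distr'[OF mb km])
  also have "... = (\<integral>\<^sup>+w. ennreal (mobius_density z w) * ennreal ((norm (kernel v (mobius z w)))\<^sup>2) \<partial>vol)"
   using measurable_compose[OF mb km] by (intro nn_integral_density) auto
  also have "... = (\<integral>\<^sup>+w. ennreal (defect z ^ N / r ^ (2 * N)) * ennreal ((norm (kernel x w))\<^sup>2) \<partial>vol)"
  proof (rule nn_integral_cong)
   fix w :: "complex ^ 'n" assume "w \<in> space vol"
   then have w: "w \<in> unit_ball" by simp
   have "0 \<le> defect z ^ N / r ^ (2 * N)" using defect_pos[OF z] r by simp
   then show "ennreal (mobius_density z w) * ennreal ((norm (kernel v (mobius z w)))\<^sup>2)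
    = ennreal (defect z ^ N / r ^ (2 * N)) * ennreal ((norm (kernel x w))\<^sup>2)"
    using pt[OF w] mobius_density_nonneg[OF z, of w] by (simp flip: ennreal_mult)
  qed
  also have "... = ennreal (defect z ^ N / r ^ (2 * N)) * ennreal (1 / defect x ^ N)"
   unfolding N_def kernel_norm2[OF x, symmetric] by (rule nn_integral_cmult) measurable
  also have "... = ennreal (1 / defect v ^ N)"
  proof -
   have "defect x = defect z * defect v / r\<^sup>2"
    unfolding x_def r_def defect_mobius[OF z v] norm_one_minus_cdot_commute[of v z] ..
   then have "defect z ^ N / r ^ (2 * N) * (1 / defect x ^ N) = 1 / defect v ^ N"
    using defect_pos[OF z] r by (simp add: power_mult power_mult_distrib power_divide)
   then show ?thesis using defect_pos[OF z] defect_pos[OF x] r by (simp flip: ennreal_mult)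
  qed
  also have "... = (\<integral>\<^sup>+w. ennreal ((norm (kernel v w))\<^sup>2) \<partial>vol)"
   unfolding N_def kernel_norm2[OF v] ..
  also have "... = (\<integral>\<^sup>+w. ennreal ((norm (kernel v w))\<^sup>2) \<partial>distr vol borel (\<lambda>x. x))"
   by (rule nn_integral_distr'[OF measurable_ident_vol km, symmetric])
  finally show "(\<integral>\<^sup>+w. ennreal ((norm (kernel v w))\<^sup>2) \<partial>distr ?P borel (mobius z))
   = (\<integral>\<^sup>+w. ennreal ((norm (kernel v w))\<^sup>2) \<partial>distr vol borel (\<lambda>x. x))" .
 qed
qed

lemma kernel_self_mobius:
 fixes z w :: "complex ^ 'n"
 assumes z: "z \<in> unit_ball" and w: "w \<in> unit_ball"
 shows "kernel z (mobius z w) * kernel z w = of_real (1 / defect z ^ (CARD('n) + 1))"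
proof -
 have "1 - cdot (mobius z w) z = of_real (defect z) / (1 - cdot w z)" by (rule one_minus_cdot_mobius[OF z w])
 then show ?thesis using mobius_in_ball[OF z w] w one_minus_cdot_nz[OF w z]
  by (simp add: kernel_def power_divide del: power_Suc)
qed

text \<open>The chain rule for the involution, read off from
  \<open>kernel_self_mobius\<close>.\<close>

lemma mobius_density_mobius:
 assumes z: "z \<in> unit_ball" and w: "w \<in> unit_ball"
 shows "mobius_density z (mobius z w) * mobius_density z w = 1"
proof -
 define N where "N = CARD('a) + 1"
 have d: "defect z ^ N > 0" using defect_pos[OF z] by (rule zero_less_power)
 have "norm (kernel z (mobius z w)) * norm (kernel z w) = 1 / defect z ^ N"
  using arg_cong[OF kernel_self_mobius[OF z w], of norm] d by (simp only: norm_mult norm_of_real N_def abs_of_pos divide_pos_pos zero_less_one)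
 then have "(norm (kernel z (mobius z w)) * norm (kernel z w))\<^sup>2 = (1 / defect z ^ N)\<^sup>2" by simp
 then show ?thesis
  using d unfolding mobius_density_def N_def[symmetric] proof -
  have "(defect z ^ N * (norm (kernel z (mobius z w)))\<^sup>2) * (defect z ^ N * (norm (kernel z w))\<^sup>2)
   = (defect z ^ N)\<^sup>2 * (norm (kernel z (mobius z w)) * norm (kernel z w))\<^sup>2"
   by (simp add: power_mult_distrib power2_eq_square mult_ac)
  also have "... = 1" unfolding \<open>_ = (1 / defect z ^ N)\<^sup>2\<close> using d by (simp add: power_divide del: power_eq_0_iff)
  finally show "(defect z ^ N * (norm (kernel z (mobius z w)))\<^sup>2) * (defect z ^ N * (norm (kernel z w))\<^sup>2) = 1" .
 qed
qed

text \<open>The weight of \<open>inv_vol\<close> changes by precisely the factor in the change of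
  variables for \<open>vol\<close>, whence the invariance of \<open>inv_vol\<close>.\<close>

lemma defect_eq_kernel:
 fixes z w :: "complex ^ 'n"
 assumes z: "z \<in> unit_ball" and w: "w \<in> unit_ball"
 shows "defect (mobius z w) ^ (CARD('n) + 1) = defect w ^ (CARD('n) + 1) * mobius_density z w"
 unfolding defect_mobius[OF z w] mobius_density_def kernel_in[OF w] norm_divide norm_power
 by (simp add: power_mult_distrib power_divide power2_eq_square del: power_Suc)

lemma defect_measurable: "(defect :: complex ^ 'n \<Rightarrow> real) \<in> borel_measurable borel"
 by (intro borel_measurable_continuous_onI continuous_intros)

lemma inv_vol_alt: "inv_vol = density vol (\<lambda>z :: complex ^ 'n. ennreal (1 / defect z ^ (CARD('n) + 1)))"
 by (simp add: inv_vol_def defect_def)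

theorem distr_inv_vol_mobius:
 fixes z :: "complex ^ 'n"
 assumes z: "z \<in> unit_ball"
 shows "distr inv_vol inv_vol (mobius z) = inv_vol"
proof (rule measure_eqI)
 define N where "N = CARD('n) + 1"
 have m: "mobius z \<in> measurable vol vol" by (rule mobius_measurable[OF z])
 have m': "mobius z \<in> measurable inv_vol inv_vol"
  using m by (simp add: measurable_cong_sets[OF sets_inv_vol sets_inv_vol])
 note [measurable] = measurable_volI[OF defect_measurable] measurable_volI[OF mobius_density_measurable[OF z]]
 fix A assume "A \<in> sets (distr inv_vol inv_vol (mobius z))"
 then have A: "A \<in> sets inv_vol" by simp
 then have Av[measurable]: "A \<in> sets vol" by (simp add: sets_inv_vol)
 have dm: "(\<lambda>w. ennreal (1 / defect w ^ N)) \<in> borel_measurable vol" by measurable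
 have e: "emeasure inv_vol B = (\<integral>\<^sup>+w. ennreal (1 / defect w ^ N) * indicator B w \<partial>vol)" if "B \<in> sets vol" for B :: "(complex ^ 'n) set"
  using dm that unfolding N_def inv_vol_alt by (rule emeasure_density)
 define h where "h w = ennreal (1 / defect w ^ N) * indicator A w" for w
 have hm[measurable]: "h \<in> borel_measurable vol" unfolding h_def by measurable
 have "emeasure inv_vol A = (\<integral>\<^sup>+w. h w \<partial>vol)" using e[OF Av] by (simp add: h_def)
 also have "... = (\<integral>\<^sup>+w. h w \<partial>distr (density vol (\<lambda>w. ennreal (mobius_density z w))) vol (mobius z))"
  unfolding distr_vol_mobius[OF z] ..
 also have "... = (\<integral>\<^sup>+w. h (mobius z w) \<partial>density vol (\<lambda>w. ennreal (mobius_density z w)))"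
  by (rule nn_integral_distr) (use m in auto)
 also have "... = (\<integral>\<^sup>+w. ennreal (mobius_density z w) * h (mobius z w) \<partial>vol)"
  using measurable_compose[OF m hm] by (intro nn_integral_density) auto
 also have "... = (\<integral>\<^sup>+w. ennreal (1 / defect w ^ N) * indicator (mobius z -` A \<inter> space vol) w \<partial>vol)"
 proof (rule nn_integral_cong)
  fix w :: "complex ^ 'n" assume "w \<in> space vol"
  then have w: "w \<in> unit_ball" by simp
  have dw: "defect w ^ N > 0" using defect_pos[OF w] by simp
  have dz: "defect (mobius z w) ^ N = defect w ^ N * mobius_density z w"
   unfolding N_def by (rule defect_eq_kernel[OF z w])
  have "defect (mobius z w) ^ N > 0" using defect_pos[OF mobius_in_ball[OF z w]] by simp
  then have g: "mobius_density z w > 0" using dw unfolding dz by (rule zero_less_mult_pos)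
  have "mobius_density z w * (1 / defect (mobius z w) ^ N) = 1 / defect w ^ N"
   using g dw by (simp add: dz)
  then have "ennreal (mobius_density z w) * ennreal (1 / defect (mobius z w) ^ N) = ennreal (1 / defect w ^ N)"
   using g by (simp flip: ennreal_mult')
  then show "ennreal (mobius_density z w) * h (mobius z w) = ennreal (1 / defect w ^ N) * indicator (mobius z -` A \<inter> space vol) w"
   unfolding h_def mult.assoc[symmetric] using w by (simp add: indicator_def)
 qed
 also have "... = emeasure inv_vol (mobius z -` A \<inter> space vol)"
  by (rule e[symmetric]) (rule measurable_sets[OF m Av])
 also have "... = emeasure (distr inv_vol inv_vol (mobius z)) A"
  using A m' by (simp add: emeasure_distr)
 finally show "emeasure (distr inv_vol inv_vol (mobius z)) A = emeasure inv_vol A" ..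
qed simp

section \<open>Holomorphic functions of several variables\<close>

definition cderiv :: "(complex ^ 'n \<Rightarrow> complex) \<Rightarrow> (complex ^ 'n \<Rightarrow> complex) \<Rightarrow> complex ^ 'n \<Rightarrow> bool" where
 "cderiv f D w \<longleftrightarrow> (f has_derivative D) (at w) \<and> (\<forall>c x. D (c *s x) = c * D x)"

lemma holomorphic_several_alt: "holomorphic_several f S \<longleftrightarrow> (\<forall>z\<in>S. \<exists>D. cderiv f D z)"
 by (simp add: holomorphic_several_def cderiv_def)

lemma holomorphic_severalI: "(\<And>z. z \<in> S ==> \<exists>D. cderiv f D z) ==> holomorphic_several f S"
 unfolding holomorphic_several_alt by blast

lemma holomorphic_severalE:
 assumes "holomorphic_several f S" "z \<in> S" obtains D where "cderiv f D z"
 using assms unfolding holomorphic_several_alt by blast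

lemma cderiv_const: "cderiv (\<lambda>_. c) (\<lambda>_. 0) w"
 by (simp add: cderiv_def)

lemma cderiv_add: "cderiv f D w ==> cderiv g E w ==> cderiv (\<lambda>x. f x + g x) (\<lambda>x. D x + E x) w"
 by (auto simp: cderiv_def distrib_left intro!: derivative_eq_intros)

lemma cderiv_mult: "cderiv f D w ==> cderiv g E w ==> cderiv (\<lambda>x. f x * g x) (\<lambda>h. f w * E h + D h * g w) w"
 unfolding cderiv_def by (intro conjI has_derivative_mult) (auto simp: algebra_simps)

lemma cderiv_cdot: "cderiv (\<lambda>x. cdot x z) (\<lambda>h. cdot h z) w"
proof -
 have "bounded_linear (\<lambda>h. cdot h z)"
  by (rule bounded_linear_intro[of _ "norm z"]) (simp_all add: cdot_simps scaleR_conv_of_real[where 'a = complex] norm_cdot_le)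
 then show ?thesis by (auto simp: cderiv_def cdot_simps intro: bounded_linear_imp_has_derivative)
qed

lemma cderiv_compose_field:
 assumes f: "cderiv f D w" and g: "(g has_field_derivative g') (at (f w))"
 shows "cderiv (\<lambda>x. g (f x)) (\<lambda>h. g' * D h) w"
 using f has_derivative_compose[of f D w UNIV g "(*) g'"] g
 by (auto simp: cderiv_def has_field_derivative_def)

lemma cderiv_power: "cderiv f D w ==> cderiv (\<lambda>x. f x ^ k) (\<lambda>h. (of_nat k * f w ^ (k - 1)) * D h) w"
 by (rule cderiv_compose_field) (auto intro!: derivative_eq_intros)

lemma cderiv_inverse: "cderiv f D w ==> f w \<noteq> 0 ==> cderiv (\<lambda>x. inverse (f x)) (\<lambda>h. - (inverse (f w) ^ 2) * D h) w"
 by (rule cderiv_compose_field) (auto intro!: derivative_eq_intros simp: power2_eq_square)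

lemma cderiv_transform:
 "cderiv f D w ==> open S ==> w \<in> S ==> (\<And>x. x \<in> S ==> f x = g x) ==> cderiv g D w"
 unfolding cderiv_def by (auto intro: has_derivative_transform_within_open)

lemma holomorphic_several_add:
 "holomorphic_several f S ==> holomorphic_several g S ==> holomorphic_several (\<lambda>x. f x + g x) S"
 by (rule holomorphic_severalI) (erule (1) holomorphic_severalE, erule (1) holomorphic_severalE, rule exI, erule (1) cderiv_add)

lemma holomorphic_several_mult:
 "holomorphic_several f S ==> holomorphic_several g S ==> holomorphic_several (\<lambda>x. f x * g x) S"
 by (rule holomorphic_severalI) (erule (1) holomorphic_severalE, erule (1) holomorphic_severalE, rule exI, erule (1) cderiv_mult)

lemma holomorphic_several_cmult:
 "holomorphic_several f S ==> holomorphic_several (\<lambda>x. c * f x) S"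
 by (rule holomorphic_severalI) (erule (1) holomorphic_severalE, rule exI, rule cderiv_mult[OF cderiv_const])

lemma holomorphic_several_power:
 "holomorphic_several f S ==> holomorphic_several (\<lambda>x. f x ^ k) S"
 by (rule holomorphic_severalI) (erule (1) holomorphic_severalE, rule exI, erule cderiv_power)

lemma holomorphic_several_one_minus_cdot: "holomorphic_several (\<lambda>x. 1 - cdot x z) S"
proof -
 have "cderiv (\<lambda>x. 1 + (-1) * cdot x z) (\<lambda>h. 0 + ((-1) * cdot h z + 0 * cdot w z)) w" for w
  by (intro cderiv_add cderiv_mult cderiv_const cderiv_cdot)
 then show ?thesis unfolding holomorphic_several_alt by (auto simp: )
qed

lemma holomorphic_several_cong:
 assumes "open S" "\<And>x. x \<in> S ==> f x = g x" "holomorphic_several f S"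
 shows "holomorphic_several g S"
 using assms unfolding holomorphic_several_alt by (meson cderiv_transform)

lemma holomorphic_several_continuous: "holomorphic_several f S ==> continuous_on S f"
 unfolding holomorphic_several_alt cderiv_def
 by (metis continuous_at_imp_continuous_on has_derivative_continuous)

lemma holomorphic_several_kernel:
 assumes z: "z \<in> unit_ball" shows "holomorphic_several (kernel z) unit_ball"
proof (rule holomorphic_several_cong)
 show "holomorphic_several (\<lambda>w. inverse (1 - cdot w z) ^ (CARD('a) + 1)) (unit_ball :: (complex ^ 'a) set)"
 proof (rule holomorphic_several_power)
  show "holomorphic_several (\<lambda>w. inverse (1 - cdot w z)) unit_ball"
  proof (rule holomorphic_severalI)
   fix w :: "complex ^ 'a" assume w: "w \<in> unit_ball"
   obtain D where "cderiv (\<lambda>w. 1 - cdot w z) D w"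
    using holomorphic_severalE[OF holomorphic_several_one_minus_cdot w] .
   from cderiv_inverse[OF this one_minus_cdot_nz[OF w z]]
   show "\<exists>D. cderiv (\<lambda>w. inverse (1 - cdot w z)) D w" by blast
  qed
 qed
 show "inverse (1 - cdot w z) ^ (CARD('a) + 1) = kernel z w" if "w \<in> unit_ball" for w
  using that by (simp only: kernel_in divide_inverse mult_1_left power_inverse)
qed simp

lemma bounded_bilinear_smult_vec: "bounded_bilinear (\<lambda>c (x :: complex ^ 'n). c *s x)"
proof
 show "\<exists>K. \<forall>c (x :: complex ^ 'n). norm (c *s x) \<le> norm c * norm x * K"
  by (rule exI[of _ 1]) (simp add: norm_smult_vec)
qed (simp_all add: vec_eq_iff algebra_simps)

lemma mobius_has_derivative:
 fixes z w :: "complex ^ 'n"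
 assumes z: "z \<in> unit_ball" and w: "w \<in> unit_ball"
 shows "\<exists>D. (mobius z has_derivative D) (at w) \<and> (\<forall>c x. D (c *s x) = c *s D x)"
proof -
 interpret bb: bounded_bilinear "\<lambda>c (x :: complex ^ 'n). c *s x" by (rule bounded_bilinear_smult_vec)
 define s where "s = complex_of_real (sqrt (defect z))"
 define k :: complex where "k = 1 / of_real (1 + sqrt (defect z))"
 define A where "A x = inverse (1 - cdot x z)" for x
 have nz: "1 - cdot w z \<noteq> 0" by (rule one_minus_cdot_nz[OF w z])
 obtain E where "cderiv (\<lambda>x. 1 - cdot x z) E w"
  using holomorphic_several_one_minus_cdot[of z "{w}"] by (auto simp: holomorphic_several_alt)
 then have "cderiv A (\<lambda>h. - (inverse (1 - cdot w z) ^ 2) * E h) w"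
  unfolding A_def using nz by (rule cderiv_inverse)
 then obtain DA where DA: "cderiv A DA w" by blast
 obtain DB where DB: "cderiv (\<lambda>x. 1 + (- k) * cdot x z) DB w"
  using cderiv_add[OF cderiv_const cderiv_mult[OF cderiv_const cderiv_cdot]] by blast
 have mob: "mobius z = (\<lambda>x. A x *s ((1 + (- k) * cdot x z) *s z - s *s x))"
  by (rule ext) (simp add: mobius_alt[OF z] A_def k_def s_def divide_inverse mult.commute)
 define D1 where "D1 h = DB h *s z - s *s h" for h
 have d1: "((\<lambda>x. (1 + (- k) * cdot x z) *s z - s *s x) has_derivative D1) (at w)"
  unfolding D1_def using DB unfolding cderiv_def
  by (intro has_derivative_diff bounded_linear.has_derivative[OF bb.bounded_linear_left]
    bounded_linear_imp_has_derivative[OF bb.bounded_linear_right]) blast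
 have "((\<lambda>x. A x *s ((1 + (- k) * cdot x z) *s z - s *s x)) has_derivative
  (\<lambda>h. A w *s D1 h + DA h *s ((1 + (- k) * cdot w z) *s z - s *s w))) (at w)"
  using DA d1 unfolding cderiv_def by (intro bb.FDERIV) auto
 moreover have "A w *s D1 (c *s x) + DA (c *s x) *s y = c *s (A w *s D1 x + DA x *s y)" for c x y
  using DA DB unfolding cderiv_def D1_def by (simp add: vec_eq_iff algebra_simps)
 ultimately show ?thesis unfolding mob by blast
qed

lemma holomorphic_several_mobius:
 fixes f :: "complex ^ 'n \<Rightarrow> complex"
 assumes f: "holomorphic_several f unit_ball" and z: "z \<in> unit_ball"
 shows "holomorphic_several (\<lambda>w. f (mobius z w)) unit_ball"
 unfolding holomorphic_several_alt
proof
 fix w :: "complex ^ 'n" assume w: "w \<in> unit_ball"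
 obtain D where D: "(mobius z has_derivative D) (at w)" "\<And>c x. D (c *s x) = c *s D x"
  using mobius_has_derivative[OF z w] by blast
 obtain E where E: "cderiv f E (mobius z w)"
  using holomorphic_severalE[OF f mobius_in_ball[OF z w]] .
 then have "((\<lambda>w. f (mobius z w)) has_derivative (\<lambda>h. E (D h))) (at w)"
  unfolding cderiv_def using has_derivative_compose[OF D(1)] by blast
 then show "\<exists>D. cderiv (\<lambda>w. f (mobius z w)) D w"
  using D(2) E unfolding cderiv_def by (intro exI[of _ "\<lambda>h. E (D h)"]) auto
qed

section \<open>Mean value property and reproducing formula\<close>

lemma circle_mean:
 fixes f :: "complex ^ 'n \<Rightarrow> complex"
 assumes f: "holomorphic_several f unit_ball" and w: "w \<in> unit_ball"
 shows "((\<lambda>t. f (cis (2 * pi * t) *s w)) has_integral f 0) {0..1}"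
proof -
 \<comment> \<open>The slice of \<open>f\<close> through \<open>w\<close> is holomorphic on the
   closed unit disc because \<open>|w| < 1\<close>, so Cauchy's formula may be used on the unit
   circle.\<close>
 define g where "g \<zeta> = f (\<zeta> *s w)" for \<zeta>
 have hol: "g holomorphic_on cball 0 1"
 proof (rule holomorphic_onI)
  fix \<zeta> :: complex assume "\<zeta> \<in> cball 0 1"
  then have "\<zeta> *s w \<in> unit_ball" using w mult_left_le_one_le[of "norm w" "norm \<zeta>"] by (simp add: norm_smult_vec)
  then obtain D where D: "cderiv f D (\<zeta> *s w)" using holomorphic_severalE[OF f] by blast
  have "((\<lambda>\<zeta>. \<zeta> *s w) has_derivative (\<lambda>h. h *s w)) (at \<zeta>)"
   by (rule bounded_linear_imp_has_derivative)
    (rule bounded_bilinear.bounded_linear_left[OF bounded_bilinear_smult_vec])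
  then have "(g has_derivative (\<lambda>h. D (h *s w))) (at \<zeta>)"
   using D unfolding g_def cderiv_def by (intro has_derivative_compose[of "\<lambda>\<zeta>. \<zeta> *s w" _ _ _ f]) auto
  moreover have "(\<lambda>h. D (h *s w)) = (*) (D w)" using D by (auto simp: cderiv_def mult.commute)
  ultimately have "(g has_field_derivative D w) (at \<zeta>)" by (simp add: has_field_derivative_def)
  then show "g field_differentiable at \<zeta> within cball 0 1"
   using field_differentiable_at_within field_differentiable_def by blast
 qed
 have "((\<lambda>u. g u / (u - 0)) has_contour_integral (2 * of_real pi * \<i> * g 0)) (circlepath 0 1)"
  by (rule Cauchy_integral_circlepath_simple[OF hol]) simp
 then have "((\<lambda>x. g (circlepath 0 1 x) / circlepath 0 1 x * (2 * pi * \<i> * exp (2 * of_real pi * \<i> * x))) has_integral (2 * of_real pi * \<i> * g 0)) {0..1}"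
  unfolding has_contour_integral_def
  by (rule has_integral_eq[rotated]) (simp add: vector_derivative_circlepath01)
 then have "((\<lambda>x. (2 * pi * \<i>) * g (cis (2 * pi * x))) has_integral (2 * pi * \<i>) * g 0) {0..1}"
  by (simp add: circlepath cis_conv_exp mult_ac)
 then have "((\<lambda>x. (1 / (2 * pi * \<i>)) * ((2 * pi * \<i>) * g (cis (2 * pi * x)))) has_integral (1 / (2 * pi * \<i>)) * ((2 * pi * \<i>) * g 0)) {0..1}"
  by (rule has_integral_mult_right)
 then show ?thesis by (simp add: g_def)
qed

text \<open>The integral is averaged over the rotations by \<open>cis (2 * pi * t)\<close>. Each of
  them leaves it unchanged, and after Fubini the average over \<open>t\<close> is \<open>f 0\<close>
  by \<open>circle_mean\<close>.\<close>

theorem mean_value_ball: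
 fixes f :: "complex ^ 'n \<Rightarrow> complex"
 assumes f: "holomorphic_several f unit_ball" and int: "integrable vol f"
 shows "(LINT w|vol. f w) = f 0"
proof -
 define L where "L = restrict_space lborel {0..1::real}"
 have L1: "emeasure L (space L) = 1"
  unfolding L_def by (simp add: emeasure_restrict_space space_restrict_space)
 interpret L: finite_measure L by (rule finite_measureI) (simp add: L1)
 interpret P: pair_sigma_finite vol L by standard
 define F where "F p = f (cis (2 * pi * snd p) *s fst p)" for p :: "(complex ^ 'n) \<times> real"
 have c: "norm (cis t) = 1" for t by simp
 have idL: "(\<lambda>t. t) \<in> measurable L borel" unfolding L_def by (intro measurable_restrict_space1) simp
 have Fm: "F \<in> borel_measurable (vol \<Otimes>\<^sub>M L)"
 proof -
  have cont: "continuous_on (unit_ball \<times> UNIV) F"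
   unfolding F_def
  proof (rule continuous_on_compose2[OF holomorphic_several_continuous[OF f]])
   show "continuous_on (unit_ball \<times> UNIV) (\<lambda>p :: (complex ^ 'n) \<times> real. cis (2 * pi * snd p) *s fst p)"
    by (intro continuous_intros)
  qed (auto simp: norm_smult_vec)
  have "(\<lambda>p. indicator (unit_ball \<times> UNIV) p *\<^sub>R F p) \<in> borel_measurable borel"
   by (intro borel_measurable_continuous_on_indicator cont) (auto intro!: borel_open open_Times)
  then have "(\<lambda>p. indicator (unit_ball \<times> UNIV) p *\<^sub>R F p) \<in> borel_measurable (borel \<Otimes>\<^sub>M borel)"
   by (simp add: borel_prod)
  moreover have "(\<lambda>p. p) \<in> measurable (vol \<Otimes>\<^sub>M L) (borel \<Otimes>\<^sub>M borel)"
   using measurable_Pair[OF measurable_compose[OF measurable_fst measurable_ident_vol] measurable_compose[OF measurable_snd idL]] by simp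
  ultimately have "(\<lambda>p. indicator (unit_ball \<times> UNIV) p *\<^sub>R F p) \<in> borel_measurable (vol \<Otimes>\<^sub>M L)"
   by (rule measurable_compose[rotated])
  then show ?thesis by (rule measurable_cong[THEN iffD1, rotated]) (auto simp: space_pair_measure indicator_def)
 qed
 have fm: "f \<in> borel_measurable vol" using int by simp
 have rot: "integrable vol (\<lambda>w. g (cis t *s w)) \<and> (LINT w|vol. g (cis t *s w)) = (LINT w|vol. g w)"
  if "integrable vol g" for g :: "complex ^ 'n \<Rightarrow> 'b::{banach,second_countable_topology}" and t
 proof -
  have "integrable (distr vol vol (\<lambda>w. cis t *s w)) g" using that by (simp add: distr_vol_rotation)
  then have 1: "integrable vol (\<lambda>w. g (cis t *s w))" using smult_measurable_vol[OF c] that by (subst (asm) integrable_distr_eq) auto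
  have "(LINT w|vol. g w) = (LINT w|(distr vol vol (\<lambda>w. cis t *s w)). g w)" by (simp add: distr_vol_rotation)
  also have "... = (LINT w|vol. g (cis t *s w))" using smult_measurable_vol[OF c] that by (intro integral_distr) auto
  finally show ?thesis using 1 by simp
 qed
 \<comment> \<open>Absolute integrability is checked with \<open>t\<close> as the outer variable,
   where rotation invariance makes the inner integral constant.\<close>
 have Fi: "integrable (vol \<Otimes>\<^sub>M L) (\<lambda>(w, t). f (cis (2 * pi * t) *s w))"
 proof -
  have "integrable (L \<Otimes>\<^sub>M vol) (\<lambda>(t, w). f (cis (2 * pi * t) *s w))"
  proof -
   interpret Q: pair_sigma_finite L vol by standard
   have m: "(\<lambda>(t, w). f (cis (2 * pi * t) *s w)) \<in> borel_measurable (L \<Otimes>\<^sub>M vol)"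
    using measurable_compose[OF measurable_pair_swap' Fm] by (simp add: F_def case_prod_beta)
   show ?thesis
   proof (rule Q.Fubini_integrable[OF m])
    have "(LINT w|vol. norm (f (cis (2 * pi * t) *s w))) = (LINT w|vol. norm (f w))" for t
     using rot[of "\<lambda>w. norm (f w)"] int by simp
    then show "integrable L (\<lambda>t. \<integral>w. norm (case (t, w) of (t, w) \<Rightarrow> f (cis (2 * pi * t) *s w)) \<partial>vol)" by simp
    show "AE t in L. integrable vol (\<lambda>w. case (t, w) of (t, w) \<Rightarrow> f (cis (2 * pi * t) *s w))"
     using rot[OF int] by simp
   qed
  qed
  then show ?thesis using P.integrable_product_swap_iff[of "\<lambda>(w, t). f (cis (2 * pi * t) *s w)"] by simp
 qed
 have circ: "(LINT t|L. f (cis (2 * pi * t) *s w)) = f 0" if w: "w \<in> unit_ball" for w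
 proof -
  have "continuous_on {0..1} (\<lambda>t. f (cis (2 * pi * t) *s w))"
   by (rule continuous_on_compose2[OF holomorphic_several_continuous[OF f]])
    (use w in \<open>auto simp: norm_smult_vec intro!: continuous_intros\<close>)
  then have "set_integrable lborel {0..1} (\<lambda>t. f (cis (2 * pi * t) *s w))"
   by (rule borel_integrable_atLeastAtMost')
  then have "(LINT t:{0..1}|lborel. f (cis (2 * pi * t) *s w)) = integral {0..1} (\<lambda>t. f (cis (2 * pi * t) *s w))"
   by (rule set_borel_integral_eq_integral)
  also have "... = f 0" using circle_mean[OF f w] by (rule integral_unique)
  finally show ?thesis unfolding L_def by (simp add: integral_restrict_space set_lebesgue_integral_def)
 qed
 have "(LINT w|vol. f w) = (LINT t|L. (LINT w|vol. f w))" using L1 by (simp add: measure_def)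
 also have "... = (LINT t|L. (LINT w|vol. f (cis (2 * pi * t) *s w)))" using rot[OF int] by simp
 also have "... = (LINT w|vol. (LINT t|L. f (cis (2 * pi * t) *s w)))" by (rule P.Fubini_integral[OF Fi])
 also have "... = (LINT w|(vol :: (complex ^ 'n) measure). f 0)" by (intro lint_cong) (auto simp: circ)
 also have "... = f 0" by simp
 finally show ?thesis .
qed

text \<open>The mean value property is applied to \<open>F\<close> composed with
  \<open>mobius z\<close>. The factor \<open>(1 - cdot w z) ^ N\<close> in \<open>F\<close> is
  chosen to cancel one of the two kernels in the density: \<open>mobius_density z w * F w\<close> is
  \<open>defect z ^ N * f w * cnj (kernel z w)\<close>. The value at 0 is \<open>F z\<close>, which
  contains the same \<open>defect z ^ N\<close>.\<close>

theorem reproducing: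
 fixes f :: "complex ^ 'n \<Rightarrow> complex"
 assumes f: "holomorphic_several f unit_ball" and int: "integrable vol f" and z: "z \<in> unit_ball"
 shows "(LINT w|vol. f w * cnj (kernel z w)) = f z"
proof -
 define N where "N = CARD('n) + 1"
 define F where "F w = f w * (1 - cdot w z) ^ N" for w
 have Fh: "holomorphic_several F unit_ball"
  unfolding F_def by (intro holomorphic_several_mult f holomorphic_several_power holomorphic_several_one_minus_cdot)
 then have Gh: "holomorphic_several (\<lambda>w. F (mobius z w)) unit_ball" using z by (rule holomorphic_several_mobius)
 define h where "h w = of_real (mobius_density z w) * F w" for w
 have h: "h w = of_real (defect z ^ N) * (f w * cnj (kernel z w))" if w: "w \<in> unit_ball" for w
 proof -
  have "of_real ((norm (kernel z w))\<^sup>2) * (1 - cdot w z) ^ N = cnj (kernel z w) * (kernel z w * (1 - cdot w z) ^ N)"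
   by (simp add: complex_norm_square mult_ac del: of_real_power)
  also have "kernel z w * (1 - cdot w z) ^ N = 1"
   using one_minus_cdot_nz[OF w z] unfolding kernel_in[OF w] N_def[symmetric] by simp
  finally have "of_real ((norm (kernel z w))\<^sup>2) * (1 - cdot w z) ^ N = cnj (kernel z w)" by simp
  then show ?thesis unfolding h_def mobius_density_def F_def N_def[symmetric] of_real_mult
   by (metis mult.assoc mult.commute)
 qed
 have Km: "(\<lambda>w. cnj (kernel z w)) \<in> borel_measurable vol"
  using measurable_volI[OF kernel_measurable_borel[OF z]] by measurable
 have "integrable vol (\<lambda>w. f w * cnj (kernel z w))"
 proof (rule integrable_dominated)
  show "integrable vol (\<lambda>w. (1 / (1 - norm z) ^ (CARD('n) + 1)) * norm (f w))" using int by simp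
  show "AE w in vol. norm (f w * cnj (kernel z w)) \<le> norm ((1 / (1 - norm z) ^ (CARD('n) + 1)) * norm (f w))"
  proof (rule AE_I2)
   fix w :: "complex ^ 'n" assume "w \<in> space vol"
   then have w: "w \<in> unit_ball" by simp
   have "norm (kernel z w) * norm (f w) \<le> (1 / (1 - norm z) ^ (CARD('n) + 1)) * norm (f w)"
    using norm_kernel_le[OF w z] by (rule mult_right_mono) simp
   then show "norm (f w * cnj (kernel z w)) \<le> norm ((1 / (1 - norm z) ^ (CARD('n) + 1)) * norm (f w))"
    using order_trans[OF _ abs_ge_self] by (simp only: norm_mult[of "f w"] complex_mod_cnj real_norm_def mult.commute[of "norm (f w)"])
  qed
  show "(\<lambda>w. f w * cnj (kernel z w)) \<in> borel_measurable vol"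
   using int Km by measurable
 qed
 then have hi: "integrable vol h"
  using Bochner_Integration.integrable_cong[of vol vol h "\<lambda>w. of_real (defect z ^ N) * (f w * cnj (kernel z w))"] h by simp
 have gm: "(\<lambda>w. mobius_density z w) \<in> borel_measurable vol" by (rule measurable_volI[OF mobius_density_measurable[OF z]])
 let ?P = "density vol (\<lambda>w. ennreal (mobius_density z w))"
 have mm: "mobius z \<in> measurable ?P vol" using mobius_measurable[OF z] by simp
 have hmm: "(\<lambda>w. h (mobius z w)) \<in> borel_measurable vol"
  using measurable_compose[OF mobius_measurable[OF z], of h borel] hi by simp
 \<comment> \<open>The densities at \<open>w\<close> and at its image multiply to 1, so the one
   introduced by the change of variables disappears.\<close>
 have eqF: "mobius_density z w *\<^sub>R h (mobius z w) = F (mobius z w)" if w: "w \<in> unit_ball" for w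
 proof -
  have "mobius_density z w *\<^sub>R h (mobius z w) = of_real (mobius_density z (mobius z w) * mobius_density z w) * F (mobius z w)"
   by (simp add: h_def scaleR_conv_of_real)
  then show ?thesis unfolding mobius_density_mobius[OF z w] by simp
 qed
 have "integrable (distr ?P vol (mobius z)) h" unfolding distr_vol_mobius[OF z] by (rule hi)
 then have "integrable ?P (\<lambda>w. h (mobius z w))" using mm hi by (subst (asm) integrable_distr_eq) auto
 then have "integrable vol (\<lambda>w. mobius_density z w *\<^sub>R h (mobius z w))"
  using gm hmm mobius_density_nonneg[OF z] by (subst (asm) integrable_density) auto
 then have Gi: "integrable vol (\<lambda>w. F (mobius z w))"
  using Bochner_Integration.integrable_cong[of vol vol "\<lambda>w. mobius_density z w *\<^sub>R h (mobius z w)" "\<lambda>w. F (mobius z w)"] eqF by simp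
 have "of_real (defect z ^ N) * (LINT w|vol. f w * cnj (kernel z w)) = (LINT w|vol. of_real (defect z ^ N) * (f w * cnj (kernel z w)))"
  by (rule integral_mult_right_zero[symmetric])
 also have "... = (LINT w|vol. h w)" by (intro lint_cong) (auto simp: h)
 also have "... = (LINT w|(distr ?P vol (mobius z)). h w)" unfolding distr_vol_mobius[OF z] ..
 also have "... = (LINT w|(?P). h (mobius z w))" using mm hi by (intro integral_distr) auto
 also have "... = (LINT w|vol. mobius_density z w *\<^sub>R h (mobius z w))"
  using gm hmm mobius_density_nonneg[OF z] by (intro integral_density) auto
 also have "... = (LINT w|vol. F (mobius z w))" by (intro lint_cong) (auto simp: eqF)
 also have "... = F (mobius z 0)" by (rule mean_value_ball[OF Gh Gi])
 also have "mobius z 0 = z" by (simp add: mobius_alt[OF z])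
 also have "F z = of_real (defect z ^ N) * f z"
  unfolding F_def by (simp add: cdot_self defect_def)
 finally show ?thesis using defect_pos[OF z] by simp
qed

section \<open>L^p functions, Hoelder's inequality and the Schur test\<close>

abbreviation vol2 :: "((complex ^ 'n) \<times> (complex ^ 'm)) measure" where
 "vol2 \<equiv> vol \<Otimes>\<^sub>M vol"

locale conjugate_exponents =
 fixes p q :: real
 assumes p_gt_1: "1 < p" and pq: "1 / p + 1 / q = 1"
begin

lemma q_gt_1: "1 < q"
proof -
 have "1 / p < 1" using p_gt_1 by simp
 then have a: "1 / q > 0" using pq by linarith
 then have "q > 0" by (simp add: zero_less_divide_iff)
 have "1 / q < 1" using pq p_gt_1 by (smt (verit) zero_less_divide_1_iff)
 then show ?thesis using \<open>q > 0\<close> by (simp add: divide_less_eq)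
qed

lemma p_q: "p > 0" "q > 0" "p \<noteq> 0" "q \<noteq> 0" using p_gt_1 q_gt_1 by auto

text \<open>Makes each result of the locale available with the two exponents exchanged.\<close>

lemma swap: "conjugate_exponents q p"
 using q_gt_1 pq by unfold_locales (simp_all add: add.commute)

lemma sum_eq_mult: "p + q = p * q"
 using pq p_q by (simp add: field_simps)

lemma q_minus_1_mult: "(q - 1) * p = q"
 using sum_eq_mult by (simp add: left_diff_distrib) (simp add: mult.commute)

end

text \<open>\<open>bergman_norm\<close> serves as the norm of all L^p functions, holomorphic or
  not.\<close>

definition lp :: "real \<Rightarrow> ('n::finite) cfun \<Rightarrow> bool" where
 "lp p f \<longleftrightarrow> f \<in> borel_measurable vol \<and> integrable vol (\<lambda>z. norm (f z) powr p)"

lemma lp_measurable: "lp p f ==> f \<in> borel_measurable vol"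
 by (simp add: lp_def)

lemma lp_integrable: "lp p f ==> integrable vol (\<lambda>z. norm (f z) powr p)"
 by (simp add: lp_def)

lemma bergman_norm_nonneg: "0 \<le> bergman_norm p f"
 by (simp add: bergman_norm_def)

lemma bergman_norm_powr: "p > 0 ==> bergman_norm p f powr p = (LINT z|vol. norm (f z) powr p)"
 unfolding bergman_norm_def by (simp add: powr_powr integral_nonneg_AE)

lemma bergman_norm_leI:
 assumes "p > 0" "(LINT z|vol. norm (f z) powr p) \<le> K powr p" "K \<ge> 0"
 shows "bergman_norm p f \<le> K"
proof -
 have "bergman_norm p f \<le> (K powr p) powr (1 / p)"
  unfolding bergman_norm_def using assms by (intro powr_mono2) (auto simp: integral_nonneg_AE)
 then show ?thesis using assms by (simp add: powr_powr)
qed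

lemma bergman_norm_cong: "(\<And>z. z \<in> unit_ball ==> norm (f z) = norm (g z)) ==> bergman_norm p f = bergman_norm p g"
 unfolding bergman_norm_def by (intro arg_cong2[where f = "(powr)"] lint_cong) auto

lemma lp_dominated:
 assumes g: "lp p g" and f: "f \<in> borel_measurable vol" and p: "p > 0"
  and le: "\<And>z. z \<in> unit_ball ==> norm (f z) \<le> norm (g z)"
 shows "lp p f" "bergman_norm p f \<le> bergman_norm p g"
proof -
 have le': "norm (f z) powr p \<le> norm (g z) powr p" if "z \<in> unit_ball" for z
  using le[OF that] p by (intro powr_mono2) auto
 have "integrable vol (\<lambda>z. norm (f z) powr p)"
  by (rule integrable_dominated[OF lp_integrable[OF g]]) (use f le' in auto)
 then show l: "lp p f" using f by (simp add: lp_def)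
 show "bergman_norm p f \<le> bergman_norm p g"
 proof -
  have "(LINT z|vol. norm (f z) powr p) \<le> (LINT z|vol. norm (g z) powr p)"
  proof (rule integral_mono[OF lp_integrable[OF l] lp_integrable[OF g]])
   fix z :: "complex ^ 'a" assume "z \<in> space vol"
   then have "z \<in> unit_ball" by simp
   then show "norm (f z) powr p \<le> norm (g z) powr p" by (rule le')
  qed
  then show ?thesis unfolding bergman_norm_def using p by (intro powr_mono2) (auto simp: integral_nonneg_AE)
 qed
qed

lemma lp_cmult:
 assumes "lp p f" "p > 0"
 shows "lp p (\<lambda>z. c * f z)" "bergman_norm p (\<lambda>z. c * f z) = norm c * bergman_norm p f"
proof -
 have [measurable]: "f \<in> borel_measurable vol" by (rule lp_measurable[OF assms(1)])
 have e: "norm (c * f z) powr p = norm c powr p * norm (f z) powr p" for z by (simp add: norm_mult powr_mult)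
 show "lp p (\<lambda>z. c * f z)" using assms unfolding lp_def e by simp
 show "bergman_norm p (\<lambda>z. c * f z) = norm c * bergman_norm p f"
  unfolding bergman_norm_def e using assms by (simp add: powr_mult powr_powr integral_nonneg_AE)
qed

lemma lp_const: "p > 0 ==> lp p (\<lambda>_. c)" "p > 0 ==> bergman_norm p (\<lambda>_. c) = norm c"
 by (simp_all add: lp_def bergman_norm_def powr_powr)

lemma lp_bounded:
 fixes f :: "('n::finite) cfun"
 assumes "f \<in> borel_measurable vol" "p > 0" "\<And>z. z \<in> unit_ball ==> norm (f z) \<le> K" "K \<ge> 0"
 shows "lp p f" "bergman_norm p f \<le> K"
proof -
 have le: "norm (f z) \<le> norm (complex_of_real K)" if "z \<in> unit_ball" for z using assms(3)[OF that] assms(4) by simp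
 show "lp p f" by (rule lp_dominated(1)[OF lp_const(1)[OF assms(2)] assms(1,2) le])
 have "bergman_norm p f \<le> bergman_norm p (\<lambda>_ :: complex ^ 'n. complex_of_real K)"
  by (rule lp_dominated(2)[OF lp_const(1)[OF assms(2)] assms(1,2) le])
 then show "bergman_norm p f \<le> K" unfolding lp_const(2)[OF assms(2)] using assms(4) by simp
qed

text \<open>Minkowski's inequality from convexity of the power: \<open>f + g\<close> is
  \<open>A + B\<close> times the convex combination of \<open>f / A\<close> and \<open>g / B\<close>
  with weight \<open>s = A / (A + B)\<close>.\<close>

lemma lp_add:
 assumes f: "lp p f" and g: "lp p g" and p: "p \<ge> 1"
 shows "lp p (\<lambda>z. f z + g z)" "bergman_norm p (\<lambda>z. f z + g z) \<le> bergman_norm p f + bergman_norm p g"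
proof -
 note [measurable] = lp_measurable[OF f] lp_measurable[OF g]
 have p0: "p > 0" using p by simp
 have conv: "(s * x + (1 - s) * y) powr p \<le> s * x powr p + (1 - s) * y powr p"
  if "0 \<le> s" "s \<le> 1" "0 \<le> x" "0 \<le> y" for s x y :: real
 proof -
  have z: "(t * x) powr p \<le> t * x powr p" if "0 \<le> t" "t \<le> 1" "0 \<le> x" for t x :: real
  proof -
   have "t powr p \<le> t powr 1" using that p by (intro powr_mono') auto
   then show ?thesis using that by (simp add: powr_mult mult_right_mono)
  qed
  show ?thesis
  proof (cases "x = 0 \<or> y = 0")
   case True
   then show ?thesis using z[of s x] z[of "1 - s" y] that by auto
  next
   case False
   then show ?thesis using convex_onD[OF powr_convex[OF p], of s y x] that by (simp add: add.commute)
  qed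
 qed
 \<comment> \<open>\<open>A\<close> and \<open>B\<close> are positive so that they can be divided
   by; in the end they exceed the norms by \<open>e / 2\<close>.\<close>
 have main: "integrable vol (\<lambda>z. norm (f z + g z) powr p) \<and> (LINT z|vol. norm (f z + g z) powr p) \<le> (A + B) powr p"
  if A: "A > 0" "bergman_norm p f \<le> A" and B: "B > 0" "bergman_norm p g \<le> B" for A B
 proof -
  define s where "s = A / (A + B)"
  have s: "0 \<le> s" "s \<le> 1" "1 - s = B / (A + B)" using A B by (auto simp: s_def field_simps)
  define h where "h z = (A + B) powr p * (s * (norm (f z) powr p / A powr p) + (1 - s) * (norm (g z) powr p / B powr p))" for z
  have le: "norm (f z + g z) powr p \<le> h z" for z
  proof -
   have "norm (f z + g z) \<le> (A + B) * (s * (norm (f z) / A) + (1 - s) * (norm (g z) / B))"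
   proof -
    have "(A + B) * s = A" "(A + B) * (1 - s) = B" using A B unfolding s(3) by (simp_all add: s_def)
    then have "(A + B) * (s * (norm (f z) / A) + (1 - s) * (norm (g z) / B)) = A * (norm (f z) / A) + B * (norm (g z) / B)"
     by (simp only: distrib_left mult.assoc[symmetric])
    then show ?thesis using A B norm_triangle_ineq[of "f z" "g z"] by simp
   qed
   then have "norm (f z + g z) powr p \<le> ((A + B) * (s * (norm (f z) / A) + (1 - s) * (norm (g z) / B))) powr p"
    using p0 by (intro powr_mono2) auto
   also have "... = (A + B) powr p * (s * (norm (f z) / A) + (1 - s) * (norm (g z) / B)) powr p"
    by (rule powr_mult)
   also have "... \<le> (A + B) powr p * (s * (norm (f z) / A) powr p + (1 - s) * (norm (g z) / B) powr p)"
    using A B s by (intro mult_left_mono conv) auto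
   finally show ?thesis using A B by (simp add: h_def powr_divide)
  qed
  have hi: "integrable vol h" unfolding h_def
   using lp_integrable[OF f] lp_integrable[OF g] by simp
  have i: "integrable vol (\<lambda>z. norm (f z + g z) powr p)"
   by (rule integrable_dominated[OF hi]) (use le in \<open>auto intro: order_trans[OF _ abs_ge_self]\<close>)
  have AB: "(LINT z|vol. norm (f z) powr p) \<le> A powr p" "(LINT z|vol. norm (g z) powr p) \<le> B powr p"
   unfolding bergman_norm_powr[OF p0, symmetric] using A B p0 by (auto intro!: powr_mono2 simp: bergman_norm_nonneg)
  have "(LINT z|vol. norm (f z + g z) powr p) \<le> (LINT z|vol. h z)" by (intro integral_mono i hi le)
  also have "... = (A + B) powr p * (s * ((LINT z|vol. norm (f z) powr p) / A powr p) + (1 - s) * ((LINT z|vol. norm (g z) powr p) / B powr p))"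
   unfolding h_def using lp_integrable[OF f] lp_integrable[OF g] by simp
  also have "... \<le> (A + B) powr p * (s * 1 + (1 - s) * 1)"
   using A B s AB by (intro mult_left_mono add_mono) (auto simp: divide_le_eq)
  finally show ?thesis using i by simp
 qed
 show l: "lp p (\<lambda>z. f z + g z)"
  using main[of "bergman_norm p f + 1" "bergman_norm p g + 1"] bergman_norm_nonneg[of p f] bergman_norm_nonneg[of p g]
  by (simp add: lp_def add_nonneg_pos)
 show "bergman_norm p (\<lambda>z. f z + g z) \<le> bergman_norm p f + bergman_norm p g"
 proof (rule field_le_epsilon)
  fix e :: real assume e: "e > 0"
  have pos: "bergman_norm p f + e / 2 > 0" "bergman_norm p g + e / 2 > 0"
   using e bergman_norm_nonneg[of p f] bergman_norm_nonneg[of p g] by (auto intro: add_nonneg_pos)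
  have "bergman_norm p (\<lambda>z. f z + g z) \<le> (bergman_norm p f + e / 2) + (bergman_norm p g + e / 2)"
   using main[OF pos(1) _ pos(2)] e pos p0 by (intro bergman_norm_leI) auto
  then show "bergman_norm p (\<lambda>z. f z + g z) \<le> bergman_norm p f + bergman_norm p g + e" by simp
 qed
qed

lemma lp_diff:
 assumes f: "lp p f" and g: "lp p g" and p: "p \<ge> 1"
 shows "lp p (\<lambda>z. f z - g z)" "bergman_norm p (\<lambda>z. f z - g z) \<le> bergman_norm p f + bergman_norm p g"
proof -
 have "lp p (\<lambda>z. (-1) * g z)" "bergman_norm p (\<lambda>z. (-1) * g z) = bergman_norm p g"
  using lp_cmult[OF g, of "-1"] p by simp_all
 then show "lp p (\<lambda>z. f z - g z)" "bergman_norm p (\<lambda>z. f z - g z) \<le> bergman_norm p f + bergman_norm p g"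
  using lp_add[OF f, of "\<lambda>z. (-1) * g z"] p by simp_all
qed

lemma lp_cnj: "lp p (\<lambda>z. cnj (f z)) \<longleftrightarrow> lp p f"
proof -
 have "(\<lambda>z. cnj (f z)) \<in> borel_measurable vol \<longleftrightarrow> f \<in> borel_measurable vol"
 proof
  assume "(\<lambda>z. cnj (f z)) \<in> borel_measurable vol"
  from borel_measurable_cnj[OF this] show "f \<in> borel_measurable vol" by simp
 qed (rule borel_measurable_cnj)
 then show ?thesis by (simp add: lp_def)
qed

context conjugate_exponents
begin

text \<open>Young's inequality after division by \<open>A\<close> and \<open>B\<close>. The form
  with nonnegative integrals and upper bounds is the one that the Schur test requires, where
  integrability is not known in advance.\<close>

lemma nn_Hoelder:
 fixes F G :: "'a \<Rightarrow> real"
 assumes [measurable]: "F \<in> borel_measurable M" "G \<in> borel_measurable M"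
  and F0: "\<And>x. 0 \<le> F x" and G0: "\<And>x. 0 \<le> G x"
  and F: "(\<integral>\<^sup>+x. ennreal (F x powr p) \<partial>M) \<le> ennreal a" and G: "(\<integral>\<^sup>+x. ennreal (G x powr q) \<partial>M) \<le> ennreal b"
  and ab: "0 \<le> a" "0 \<le> b"
 shows "(\<integral>\<^sup>+x. ennreal (F x * G x) \<partial>M) \<le> ennreal (a powr (1 / p) * b powr (1 / q))"
proof -
 have z: "(\<integral>\<^sup>+x. ennreal (F x * G x) \<partial>M) = 0" if "AE x in M. F x * G x = 0"
  using that by (simp add: nn_integral_0_iff_AE F0 G0)
 consider "a = 0" | "b = 0" | "a > 0" "b > 0" using ab by fastforce
 then show ?thesis
 proof cases
  case 1
  then have "AE x in M. ennreal (F x powr p) = 0" using F by (subst nn_integral_0_iff_AE[symmetric]) auto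
  then have "AE x in M. F x * G x = 0" by eventually_elim (use F0 in auto)
  then show ?thesis using z by simp
 next
  case 2
  then have "AE x in M. ennreal (G x powr q) = 0" using G by (subst nn_integral_0_iff_AE[symmetric]) auto
  then have "AE x in M. F x * G x = 0" by eventually_elim (use G0 in auto)
  then show ?thesis using z by simp
 next
  case 3
  define A B where "A = a powr (1 / p)" and "B = b powr (1 / q)"
  have AB: "A > 0" "B > 0" "A powr p = a" "B powr q = b" using 3 p_q by (auto simp: A_def B_def powr_powr)
  have pt: "ennreal (F x * G x) \<le> ennreal (A * B / (p * a)) * ennreal (F x powr p) + ennreal (A * B / (q * b)) * ennreal (G x powr q)" for x
  proof -
   have "(F x / A) * (G x / B) \<le> (F x / A) powr p / p + (G x / B) powr q / q"
    using F0[of x] G0[of x] AB by (intro Youngs_inequality p_gt_1 q_gt_1 pq) auto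
   then have "A * B * ((F x / A) * (G x / B)) \<le> A * B * ((F x / A) powr p / p + (G x / B) powr q / q)"
    using AB by (intro mult_left_mono) auto
   then have "F x * G x \<le> A * B / (p * a) * F x powr p + A * B / (q * b) * G x powr q"
    using AB by (simp add: powr_divide distrib_left mult_ac)
   then show ?thesis using AB 3 p_q by (simp add: ennreal_leI flip: ennreal_mult ennreal_plus)
  qed
  have "(\<integral>\<^sup>+x. ennreal (F x * G x) \<partial>M) \<le> (\<integral>\<^sup>+x. ennreal (A * B / (p * a)) * ennreal (F x powr p) + ennreal (A * B / (q * b)) * ennreal (G x powr q) \<partial>M)"
   by (intro nn_integral_mono pt)
  also have "... = ennreal (A * B / (p * a)) * (\<integral>\<^sup>+x. ennreal (F x powr p) \<partial>M) + ennreal (A * B / (q * b)) * (\<integral>\<^sup>+x. ennreal (G x powr q) \<partial>M)"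
   by (simp add: nn_integral_add nn_integral_cmult)
  also have "... \<le> ennreal (A * B / (p * a)) * ennreal a + ennreal (A * B / (q * b)) * ennreal b"
   by (intro add_mono mult_left_mono F G) auto
  also have "... = ennreal (A * B * (1 / p + 1 / q))"
   using AB 3 p_q by (simp add: distrib_left flip: ennreal_mult ennreal_plus)
  finally show ?thesis by (simp add: pq A_def B_def)
 qed
qed

lemma Hoelder:
 assumes f: "lp p f" and g: "lp q g"
 shows "integrable vol (\<lambda>z. f z * g z)" "(LINT z|vol. norm (f z) * norm (g z)) \<le> bergman_norm p f * bergman_norm q g"
proof -
 note [measurable] = lp_measurable[OF f] lp_measurable[OF g]
 have "(\<integral>\<^sup>+z. ennreal (norm (f z) * norm (g z)) \<partial>vol) \<le> ennreal ((bergman_norm p f powr p) powr (1 / p) * (bergman_norm q g powr q) powr (1 / q))"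
  by (rule nn_Hoelder) (auto simp: bergman_norm_powr[OF p_q(1)] bergman_norm_powr[OF p_q(2)] integral_nonneg_AE nn_integral_eq_integral lp_integrable f g)
 then have n: "(\<integral>\<^sup>+z. ennreal (norm (f z) * norm (g z)) \<partial>vol) \<le> ennreal (bergman_norm p f * bergman_norm q g)"
  using p_q by (simp add: powr_powr bergman_norm_nonneg)
 then have i: "integrable vol (\<lambda>z. norm (f z) * norm (g z))"
  by (intro integrableI_bounded) (auto simp: abs_mult intro: order_le_less_trans)
 then show "integrable vol (\<lambda>z. f z * g z)"
  by (rule integrable_dominated) (auto simp: norm_mult)
 show "(LINT z|vol. norm (f z) * norm (g z)) \<le> bergman_norm p f * bergman_norm q g"
  using n i by (subst (asm) nn_integral_eq_integral) (auto simp: bergman_norm_nonneg)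
qed

lemma lp_L1:
 fixes f :: "('n::finite) cfun"
 assumes f: "lp p f"
 shows "integrable vol f" "(LINT z|vol. norm (f z)) \<le> bergman_norm p f"
proof -
 have "bergman_norm q (\<lambda>_ :: complex ^ 'n. 1) = 1" using lp_const(2)[OF p_q(2), of 1] by simp
 then show "integrable vol f" "(LINT z|vol. norm (f z)) \<le> bergman_norm p f"
  using Hoelder[OF f lp_const(1)[OF p_q(2), of 1]] by simp_all
qed

text \<open>Hoelder's inequality for the splitting of \<open>k\<close> into its powers
  \<open>1 / p\<close> and \<open>1 / q\<close>, with \<open>h\<close> inserted in one factor and
  divided out of the other, bounds \<open>|g x|^p\<close> by
  \<open>C1 powr (p / q) * h x powr p * J x\<close>. Integration over \<open>x\<close>, Fubini and
  the second condition remove \<open>h\<close> again. Since \<open>g\<close> is merely dominated by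
  the integral operator, the convergence of the latter is part of the conclusion rather than a
  premise.\<close>

theorem Schur_test:
 fixes k :: "complex ^ 'n \<Rightarrow> complex ^ 'n \<Rightarrow> real"
 assumes km: "case_prod k \<in> borel_measurable vol2" and k0: "\<And>x u. 0 \<le> k x u"
  and hm[measurable]: "h \<in> borel_measurable vol" and h0: "\<And>x. x \<in> unit_ball ==> 0 < h x"
  and C: "C1 \<ge> 0" "C2 \<ge> 0"
  and 1: "\<And>x. x \<in> unit_ball ==> (\<integral>\<^sup>+u. ennreal (k x u * h u powr q) \<partial>vol) \<le> ennreal (C1 * h x powr q)"
  and 2: "\<And>u. u \<in> unit_ball ==> (\<integral>\<^sup>+x. ennreal (k x u * h x powr p) \<partial>vol) \<le> ennreal (C2 * h u powr p)"
  and f: "lp p f"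
  and g: "g \<in> borel_measurable vol" "\<And>x. x \<in> unit_ball ==> ennreal (norm (g x)) \<le> (\<integral>\<^sup>+u. ennreal (k x u * norm (f u)) \<partial>vol)"
 shows "lp p g" "bergman_norm p g \<le> C1 powr (1 / q) * C2 powr (1 / p) * bergman_norm p f"
proof -
 note [measurable] = lp_measurable[OF f] g(1) km
 define J where "J x = (\<integral>\<^sup>+u. ennreal (k x u * (norm (f u) powr p / h u powr p)) \<partial>vol)" for x
 have Jm[measurable]: "J \<in> borel_measurable vol" unfolding J_def by measurable
 have pt: "ennreal (norm (g x) powr p) \<le> ennreal (C1 powr (p / q) * h x powr p) * J x" if x: "x \<in> unit_ball" for x
 \<comment> \<open>In \<open>ennreal\<close> the product of 0 and infinity is 0, so an infinite
   \<open>J x\<close> makes the bound trivial only if \<open>C1 > 0\<close>. For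
   \<open>C1 = 0\<close> the first condition forces the integrand to vanish almost
   everywhere.\<close>
 proof (cases "J x = \<infinity> \<and> C1 > 0")
  case True
  define c where "c = C1 powr (p / q) * h x powr p"
  have "c > 0" unfolding c_def using h0[OF x] True by simp
  then have "ennreal c * J x = top" using True by (simp add: ennreal_mult_top)
  then show ?thesis by (simp only: c_def top_greatest)
 next
  case False
  have kx[measurable]: "(\<lambda>u. k x u) \<in> borel_measurable vol"
   using measurable_compose_Pair1[OF _ km] x by simp
  have b: "(\<integral>\<^sup>+u. ennreal (((k x u) powr (1 / q) * h u) powr q) \<partial>vol) \<le> ennreal (C1 * h x powr q)"
  proof -
   have "(\<integral>\<^sup>+u. ennreal (((k x u) powr (1 / q) * h u) powr q) \<partial>vol) = (\<integral>\<^sup>+u. ennreal (k x u * h u powr q) \<partial>vol)"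
    using k0 p_q by (intro nn_integral_cong) (auto simp: powr_mult powr_powr less_imp_le h0)
   then show ?thesis using 1[OF x] by simp
  qed
  have split: "k x u * norm (f u) = ((k x u) powr (1 / p) * (norm (f u) / h u)) * ((k x u) powr (1 / q) * h u)"
   if "u \<in> unit_ball" for u
  proof -
   have "(k x u) powr (1 / p) * (k x u) powr (1 / q) = k x u"
    using k0[of x u] by (simp add: pq flip: powr_add)
   then show ?thesis using h0[OF that] by (simp add: field_simps)
  qed
  \<comment> \<open>The absolute values make the factors nonnegative off the ball as well, as
    \<open>nn_Hoelder\<close> demands.\<close>
  have a: "(\<integral>\<^sup>+u. ennreal (((k x u) powr (1 / p) * (norm (f u) / \<bar>h u\<bar>)) powr p) \<partial>vol) = J x"
   unfolding J_def using k0 p_q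
   by (intro nn_integral_cong) (auto simp: powr_mult powr_powr powr_divide less_imp_le h0)
  have le: "ennreal (norm (g x)) \<le> (\<integral>\<^sup>+u. ennreal (((k x u) powr (1 / p) * (norm (f u) / \<bar>h u\<bar>)) * ((k x u) powr (1 / q) * \<bar>h u\<bar>)) \<partial>vol)"
  proof -
   have "(\<integral>\<^sup>+u. ennreal (k x u * norm (f u)) \<partial>vol) = (\<integral>\<^sup>+u. ennreal (((k x u) powr (1 / p) * (norm (f u) / \<bar>h u\<bar>)) * ((k x u) powr (1 / q) * \<bar>h u\<bar>)) \<partial>vol)"
    by (intro nn_integral_cong) (use split h0 in \<open>auto simp: less_imp_le\<close>)
   then show ?thesis using g(2)[OF x] by simp
  qed
  have b': "(\<integral>\<^sup>+u. ennreal (((k x u) powr (1 / q) * \<bar>h u\<bar>) powr q) \<partial>vol) \<le> ennreal (C1 * h x powr q)"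
  proof -
   have "(\<integral>\<^sup>+u. ennreal (((k x u) powr (1 / q) * \<bar>h u\<bar>) powr q) \<partial>vol) = (\<integral>\<^sup>+u. ennreal (((k x u) powr (1 / q) * h u) powr q) \<partial>vol)"
    by (intro nn_integral_cong) (use h0 in \<open>auto simp: less_imp_le\<close>)
   then show ?thesis using b by simp
  qed
  show ?thesis
  proof (cases "J x = \<infinity>")
   case True
   then have C0: "C1 = 0" using False C by simp
   then have "AE u in vol. ennreal (((k x u) powr (1 / q) * \<bar>h u\<bar>) powr q) = 0"
    using b' by (subst nn_integral_0_iff_AE[symmetric]) auto
   then have "AE u in vol. ennreal (((k x u) powr (1 / p) * (norm (f u) / \<bar>h u\<bar>)) * ((k x u) powr (1 / q) * \<bar>h u\<bar>)) = 0"
    by eventually_elim auto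
   then have "(\<integral>\<^sup>+u. ennreal (((k x u) powr (1 / p) * (norm (f u) / \<bar>h u\<bar>)) * ((k x u) powr (1 / q) * \<bar>h u\<bar>)) \<partial>vol) = 0"
    by (subst nn_integral_0_iff_AE) auto
   then show ?thesis using le by simp
  next
   case False
   then obtain \<alpha> where \<alpha>: "J x = ennreal \<alpha>" "\<alpha> \<ge> 0" by (cases "J x") auto
   have "ennreal (norm (g x)) \<le> ennreal (\<alpha> powr (1 / p) * (C1 * h x powr q) powr (1 / q))"
    by (rule order_trans[OF le]) (rule nn_Hoelder, use k0 b' a \<alpha> C in \<open>auto\<close>)
   then have "norm (g x) \<le> \<alpha> powr (1 / p) * (C1 * h x powr q) powr (1 / q)" by simp
   then have "norm (g x) powr p \<le> (\<alpha> powr (1 / p) * (C1 * h x powr q) powr (1 / q)) powr p"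
    using p_q by (intro powr_mono2) auto
   also have "... = C1 powr (p / q) * h x powr p * \<alpha>"
    using \<alpha> C h0[OF x] p_q by (simp add: powr_mult powr_powr)
   finally show ?thesis using \<alpha> by (simp add: ennreal_leI flip: ennreal_mult)
  qed
 qed
 have nn: "(\<integral>\<^sup>+x. ennreal (norm (g x) powr p) \<partial>vol) \<le> ennreal (C1 powr (p / q) * C2 * (LINT u|vol. norm (f u) powr p))"
 proof -
  interpret P: pair_sigma_finite "vol :: (complex ^ 'n) measure" vol by standard
  have "(\<integral>\<^sup>+x. ennreal (norm (g x) powr p) \<partial>vol) \<le> (\<integral>\<^sup>+x. ennreal (C1 powr (p / q) * h x powr p) * J x \<partial>vol)"
   by (intro nn_integral_mono) (use pt in auto)
  also have "... = (\<integral>\<^sup>+x. \<integral>\<^sup>+u. ennreal (C1 powr (p / q) * h x powr p) * ennreal (k x u * (norm (f u) powr p / h u powr p)) \<partial>vol \<partial>vol)"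
  proof (rule nn_integral_cong)
   fix x :: "complex ^ 'n" assume "x \<in> space vol"
   then have [measurable]: "(\<lambda>u. k x u) \<in> borel_measurable vol" using measurable_compose_Pair1[OF _ km] by simp
   show "ennreal (C1 powr (p / q) * h x powr p) * J x = (\<integral>\<^sup>+u. ennreal (C1 powr (p / q) * h x powr p) * ennreal (k x u * (norm (f u) powr p / h u powr p)) \<partial>vol)"
    unfolding J_def by (rule nn_integral_cmult[symmetric]) measurable
  qed
  also have "... = (\<integral>\<^sup>+u. \<integral>\<^sup>+x. ennreal (C1 powr (p / q) * h x powr p) * ennreal (k x u * (norm (f u) powr p / h u powr p)) \<partial>vol \<partial>vol)"
   by (rule P.Fubini'[symmetric]) measurable
  also have "... \<le> (\<integral>\<^sup>+u. ennreal (C1 powr (p / q) * C2 * norm (f u) powr p) \<partial>vol)"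
  proof (rule nn_integral_mono)
   fix u :: "complex ^ 'n" assume "u \<in> space vol"
   then have u: "u \<in> unit_ball" by simp
   have [measurable]: "(\<lambda>x. k x u) \<in> borel_measurable vol"
    using measurable_Pair1[OF km, of u] u by simp
   define c where "c = C1 powr (p / q) * (norm (f u) powr p / h u powr p)"
   have c: "c \<ge> 0" by (simp add: c_def)
   have "(\<integral>\<^sup>+x. ennreal (C1 powr (p / q) * h x powr p) * ennreal (k x u * (norm (f u) powr p / h u powr p)) \<partial>vol)
     = (\<integral>\<^sup>+x. ennreal c * ennreal (k x u * h x powr p) \<partial>vol)"
    using k0 by (intro nn_integral_cong) (simp add: c_def mult_ac flip: ennreal_mult)
   also have "... = ennreal c * (\<integral>\<^sup>+x. ennreal (k x u * h x powr p) \<partial>vol)"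
    by (rule nn_integral_cmult) measurable
   also have "... \<le> ennreal c * ennreal (C2 * h u powr p)" by (intro mult_left_mono 2[OF u]) simp
   also have "... = ennreal (C1 powr (p / q) * C2 * norm (f u) powr p)"
    using c C h0[OF u] by (simp add: c_def mult_ac flip: ennreal_mult)
   finally show "(\<integral>\<^sup>+x. ennreal (C1 powr (p / q) * h x powr p) * ennreal (k x u * (norm (f u) powr p / h u powr p)) \<partial>vol)
    \<le> ennreal (C1 powr (p / q) * C2 * norm (f u) powr p)" .
  qed
  also have "... = ennreal (C1 powr (p / q) * C2 * (LINT u|vol. norm (f u) powr p))"
   using C lp_integrable[OF f] by (subst nn_integral_eq_integral) auto
  finally show ?thesis .
 qed
 have i: "integrable vol (\<lambda>x. norm (g x) powr p)"
  using nn by (intro integrableI_nonneg) (auto intro: order_le_less_trans)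
 then show "lp p g" by (simp add: lp_def)
 show "bergman_norm p g \<le> C1 powr (1 / q) * C2 powr (1 / p) * bergman_norm p f"
 proof (rule bergman_norm_leI)
  have "(LINT z|vol. norm (g z) powr p) \<le> C1 powr (p / q) * C2 * (LINT u|vol. norm (f u) powr p)"
   using nn i C by (subst (asm) nn_integral_eq_integral) (auto simp: integral_nonneg_AE)
  also have "... = (C1 powr (1 / q) * C2 powr (1 / p) * bergman_norm p f) powr p"
   using C p_q bergman_norm_nonneg[of p f] by (simp add: powr_mult powr_powr flip: bergman_norm_powr)
  finally show "(LINT z|vol. norm (g z) powr p) \<le> (C1 powr (1 / q) * C2 powr (1 / p) * bergman_norm p f) powr p" .
 qed (simp_all add: p_q bergman_norm_nonneg)
qed

end

section \<open>The maximal Bergman projection and norms of kernels\<close>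

lemma measurable_vol2_continuous:
 fixes F :: "(complex ^ 'n) \<times> (complex ^ 'm) \<Rightarrow> 'b::real_normed_vector"
 assumes "continuous_on (unit_ball \<times> unit_ball) F"
 shows "F \<in> borel_measurable vol2"
proof -
 have "(\<lambda>p. indicator (unit_ball \<times> unit_ball) p *\<^sub>R F p) \<in> borel_measurable borel"
  by (intro borel_measurable_continuous_on_indicator assms) (auto intro!: borel_open open_Times)
 then have "(\<lambda>p. indicator (unit_ball \<times> unit_ball) p *\<^sub>R F p) \<in> borel_measurable (borel \<Otimes>\<^sub>M borel)"
  by (simp add: borel_prod)
 moreover have "(\<lambda>p :: (complex ^ 'n) \<times> (complex ^ 'm). p) \<in> measurable vol2 (borel \<Otimes>\<^sub>M borel)"
  using measurable_Pair[OF measurable_compose[OF measurable_fst measurable_ident_vol] measurable_compose[OF measurable_snd measurable_ident_vol]] by simp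
 ultimately have "(\<lambda>p. indicator (unit_ball \<times> unit_ball) p *\<^sub>R F p) \<in> borel_measurable vol2"
  by (rule measurable_compose[rotated])
 then show ?thesis by (rule measurable_cong[THEN iffD1, rotated]) (auto simp: space_pair_measure indicator_def)
qed

lemma norm_kernel_commute:
 fixes u x :: "complex ^ 'n"
 shows "u \<in> unit_ball ==> x \<in> unit_ball ==> norm (kernel u x) = norm (kernel x u)"
 by (metis complex_mod_cnj kernel_sym)

lemma kernel_measurable_pair:
 "(\<lambda>(x, u). kernel u x) \<in> borel_measurable (vol \<Otimes>\<^sub>M (vol :: (complex ^ 'n) measure))"
 unfolding case_prod_beta by (intro measurable_vol2_continuous continuous_intros) auto

lemma kernel_measurable_left:
 assumes "x \<in> unit_ball" shows "(\<lambda>u. kernel u x) \<in> borel_measurable vol"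
 using assms by (intro measurable_vol_continuous continuous_intros) auto

lemma integrable_mult_kernel:
 fixes f :: "('n::finite) cfun"
 assumes f: "integrable vol f" and x: "x \<in> unit_ball"
 shows "integrable vol (\<lambda>u. f u * kernel u x)"
proof (rule integrable_dominated)
 show "integrable vol (\<lambda>u. (1 / (1 - norm x) ^ (CARD('n) + 1)) * norm (f u))" using f by simp
 show "AE u in vol. norm (f u * kernel u x) \<le> norm ((1 / (1 - norm x) ^ (CARD('n) + 1)) * norm (f u))"
 proof (rule AE_I2)
  fix u :: "complex ^ 'n" assume "u \<in> space vol"
  then have u: "u \<in> unit_ball" by simp
  have "norm (kernel u x) * norm (f u) \<le> (1 / (1 - norm x) ^ (CARD('n) + 1)) * norm (f u)"
   using norm_kernel_le[OF u x] unfolding norm_kernel_commute[OF u x] by (rule mult_right_mono) simp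
  then show "norm (f u * kernel u x) \<le> norm ((1 / (1 - norm x) ^ (CARD('n) + 1)) * norm (f u))"
   using order_trans[OF _ abs_ge_self] by (simp only: norm_mult[of "f u"] real_norm_def mult.commute[of "norm (f u)"])
 qed
 show "(\<lambda>u. f u * kernel u x) \<in> borel_measurable vol"
  using f kernel_measurable_left[OF x] by simp
qed

abbreviation abs_proj :: "('n::finite) cfun \<Rightarrow> complex ^ 'n \<Rightarrow> real" where
 "abs_proj f x \<equiv> (LINT u|vol. norm (f u) * norm (kernel u x))"

context conjugate_exponents
begin

text \<open>Schur test with the weight \<open>defect x powr (- (1 / (p * q)))\<close>. Its
  \<open>q\<close>-th and \<open>p\<close>-th powers have the exponents \<open>- (1 / p)\<close> and
  \<open>- (1 / q)\<close>, and for \<open>2 * c = n + 1\<close> and \<open>a = - (1 / r)\<close>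
  the estimate \<open>Forelli_Rudin\<close> returns the exponent \<open>- (1 / r)\<close> unchanged.
  Every \<open>g\<close> dominated by \<open>abs_proj f\<close> is covered, because the operators at
  \<open>v\<close> are dominated in this way too.\<close>

theorem maximal_projection_bounded:
 obtains C where "C > 0" "\<And>f g :: ('n::finite) cfun. lp p f ==> g \<in> borel_measurable vol ==>
  (\<And>x. x \<in> unit_ball ==> norm (g x) \<le> abs_proj f x) ==>
  lp p g \<and> bergman_norm p g \<le> C * bergman_norm p f"
proof -
 define N where "N = real CARD('n) + 1"
 define h :: "complex ^ 'n \<Rightarrow> real" where "h x = defect x powr (- (1 / (p * q)))" for x
 have hp: "h x powr q = defect x powr (- (1 / p))" "h x powr p = defect x powr (- (1 / q))" for x
  using p_q by (simp_all add: h_def powr_powr)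
 have FR: "\<exists>C > 0. \<forall>x :: complex ^ 'n. x \<in> unit_ball \<longrightarrow>
  (\<integral>\<^sup>+u. ennreal (norm (kernel u x) * defect u powr (- (1 / r))) \<partial>vol) \<le> ennreal (C * defect x powr (- (1 / r)))"
  if r: "r > 1" for r
 proof -
  have "0 < 1 / r" "1 / r < 1" using r by auto
  then obtain C where C: "C > 0" "\<And>v :: complex ^ 'n. v \<in> unit_ball ==>
   (\<integral>\<^sup>+w. ennreal (defect w powr (- (1 / r)) * norm (1 - cdot w v) powr (- (2 * (N / 2)))) \<partial>vol) \<le> ennreal (C * defect v powr (- (1 / r)))"
   using Forelli_Rudin[of "- (1 / r)" "N / 2" "1 / r", where 'n='n] unfolding N_def by (auto simp: field_simps)
  have "(\<integral>\<^sup>+u. ennreal (norm (kernel u x) * defect u powr (- (1 / r))) \<partial>vol)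
   = (\<integral>\<^sup>+w. ennreal (defect w powr (- (1 / r)) * norm (1 - cdot w x) powr (- (2 * (N / 2)))) \<partial>vol)"
   if x: "x \<in> unit_ball" for x :: "complex ^ 'n"
  proof (rule nn_integral_cong)
   fix u :: "complex ^ 'n" assume "u \<in> space vol"
   then have u: "u \<in> unit_ball" by simp
   show "ennreal (norm (kernel u x) * defect u powr (- (1 / r))) = ennreal (defect u powr (- (1 / r)) * norm (1 - cdot u x) powr (- (2 * (N / 2))))"
   proof -
    have "- (2 * (N / 2)) = - (real CARD('n) + 1)" unfolding N_def by (simp add: field_simps)
    then show ?thesis unfolding norm_kernel_commute[OF u x] norm_kernel_powr[OF u x] by (simp only: mult.commute)
   qed
  qed
  then show ?thesis using C by (intro exI[of _ C]) auto
 qed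
 obtain C1 where C1: "C1 > 0" "\<And>x :: complex ^ 'n. x \<in> unit_ball ==>
  (\<integral>\<^sup>+u. ennreal (norm (kernel u x) * defect u powr (- (1 / p))) \<partial>vol) \<le> ennreal (C1 * defect x powr (- (1 / p)))"
  using FR[OF p_gt_1] by blast
 obtain C2 where C2: "C2 > 0" "\<And>x :: complex ^ 'n. x \<in> unit_ball ==>
  (\<integral>\<^sup>+u. ennreal (norm (kernel u x) * defect u powr (- (1 / q))) \<partial>vol) \<le> ennreal (C2 * defect x powr (- (1 / q)))"
  using FR[OF q_gt_1] by blast
 define C where "C = C1 powr (1 / q) * C2 powr (1 / p)"
 show ?thesis
 proof (rule that)
  show "C > 0" using C1 C2 by (simp add: C_def)
  fix f g :: "'n cfun"
  assume f: "lp p f" and g: "g \<in> borel_measurable vol"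
   and le: "\<And>x. x \<in> unit_ball ==> norm (g x) \<le> abs_proj f x"
  define k where "k x u = norm (kernel u x)" for x u :: "complex ^ 'n"
  have km: "case_prod k \<in> borel_measurable vol2"
   using kernel_measurable_pair unfolding k_def case_prod_beta by measurable
  have hm: "h \<in> borel_measurable vol" 
   unfolding h_def using measurable_volI[OF defect_measurable] by measurable
  have h0: "0 < h x" if "x \<in> unit_ball" for x using defect_pos[OF that] by (simp add: h_def)
  have s1: "(\<integral>\<^sup>+u. ennreal (k x u * h u powr q) \<partial>vol) \<le> ennreal (C1 * h x powr q)" if "x \<in> unit_ball" for x
    unfolding hp k_def by (rule C1(2)[OF that])
  have s2: "(\<integral>\<^sup>+x. ennreal (k x u * h x powr p) \<partial>vol) \<le> ennreal (C2 * h u powr p)" if u: "u \<in> unit_ball" for u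
   proof -
    have "(\<integral>\<^sup>+x. ennreal (k x u * h x powr p) \<partial>vol) = (\<integral>\<^sup>+x. ennreal (norm (kernel x u) * defect x powr (- (1 / q))) \<partial>vol)"
     unfolding hp k_def using u by (intro nn_integral_cong) (simp add: norm_kernel_commute)
    then show ?thesis using C2(2)[OF u] by (simp add: hp)
   qed
  have gle: "ennreal (norm (g x)) \<le> (\<integral>\<^sup>+u. ennreal (k x u * norm (f u)) \<partial>vol)" if x: "x \<in> unit_ball" for x
   proof -
    have "integrable vol (\<lambda>u. norm (f u) * norm (kernel u x))"
     using integrable_norm[OF integrable_mult_kernel[OF lp_L1(1)[OF f] x]] by (simp add: norm_mult)
    then have "(\<integral>\<^sup>+u. ennreal (k x u * norm (f u)) \<partial>vol) = ennreal (abs_proj f x)"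
     unfolding k_def mult.commute[of "norm (kernel _ _)"] by (intro nn_integral_eq_integral) auto
    then show ?thesis using le[OF x] by (simp add: ennreal_leI)
   qed
  have k0: "0 \<le> k x u" for x u by (simp add: k_def)
  have "lp p g" by (rule Schur_test(1)[OF km k0 hm h0 less_imp_le[OF C1(1)] less_imp_le[OF C2(1)] s1 s2 f g gle])
  moreover have "bergman_norm p g \<le> C1 powr (1 / q) * C2 powr (1 / p) * bergman_norm p f"
   by (rule Schur_test(2)[OF km k0 hm h0 less_imp_le[OF C1(1)] less_imp_le[OF C2(1)] s1 s2 f g gle])
  ultimately show "lp p g \<and> bergman_norm p g \<le> C * bergman_norm p f" by (simp add: C_def)
 qed
qed

text \<open>\<open>Forelli_Rudin\<close> gives the exponent \<open>N * (p - 1)\<close> for the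
  \<open>p\<close>-th power of the norm, and \<open>(p - 1) / p = 1 / q\<close>. The exponents for
  \<open>p\<close> and for \<open>q\<close> add up to \<open>n + 1\<close>, on which
  \<open>symb_bound\<close> relies.\<close>

theorem kernel_norm_le:
 obtains C where "C > 0" "\<And>u :: complex ^ 'n. u \<in> unit_ball ==>
  bergman_norm p (kernel u) \<le> C * defect u powr (- ((real CARD('n) + 1) / q))"
proof -
 define N where "N = real CARD('n) + 1"
 have N: "N > 0" by (simp add: N_def)
 have "1 + N * p - N - 1 = N * (p - 1)" by (simp add: algebra_simps)
 moreover have "N * (p - 1) > 0" using N p_gt_1 by simp
 ultimately have e: "N * (p - 1) > 0" "N * (p - 1) = 2 * (N * p / 2) - (real CARD('n) + 1 + 0)"
  by (simp_all add: N_def)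
 have c: "N * p / 2 > 0" using N p_q by simp
 obtain C where C: "C > 0" "\<And>v :: complex ^ 'n. v \<in> unit_ball ==>
  (\<integral>\<^sup>+w. ennreal (defect w powr 0 * norm (1 - cdot w v) powr (- (2 * (N * p / 2)))) \<partial>vol) \<le> ennreal (C * defect v powr (- (N * (p - 1))))"
  using Forelli_Rudin[of 0 "N * p / 2" "N * (p - 1)", where 'n='n, OF _ c e] by auto
 show ?thesis
 proof (rule that)
  show "C powr (1 / p) > 0" using C by simp
  fix u :: "complex ^ 'n" assume u: "u \<in> unit_ball"
  have "(\<integral>\<^sup>+w. ennreal (norm (kernel u w) powr p) \<partial>vol)
    = (\<integral>\<^sup>+w. ennreal (defect w powr 0 * norm (1 - cdot w u) powr (- (2 * (N * p / 2)))) \<partial>vol)"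
  proof (rule nn_integral_cong)
   fix w :: "complex ^ 'n" assume "w \<in> space vol"
   then have w: "w \<in> unit_ball" by simp
   show "ennreal (norm (kernel u w) powr p) = ennreal (defect w powr 0 * norm (1 - cdot w u) powr (- (2 * (N * p / 2))))"
   proof -
    have "- (real CARD('n) + 1) * p = - (2 * (N * p / 2))" unfolding N_def by (simp add: field_simps)
    then show ?thesis using defect_pos[OF w] unfolding norm_kernel_powr[OF w u] powr_powr by simp
   qed
  qed
  then have le: "(\<integral>\<^sup>+w. ennreal (norm (kernel u w) powr p) \<partial>vol) \<le> ennreal (C * defect u powr (- (N * (p - 1))))"
   using C(2)[OF u] by simp
  note [measurable] = measurable_volI[OF kernel_measurable_borel[OF u]]
  have "integrable vol (\<lambda>w. norm (kernel u w) powr p)"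
   using le by (intro integrableI_nonneg) (auto intro: order_le_less_trans)
  then have "(LINT w|vol. norm (kernel u w) powr p) \<le> C * defect u powr (- (N * (p - 1)))"
   using le C by (subst (asm) nn_integral_eq_integral) auto
  then have "bergman_norm p (kernel u) \<le> (C * defect u powr (- (N * (p - 1)))) powr (1 / p)"
   unfolding bergman_norm_def using p_q by (intro powr_mono2) (auto simp: integral_nonneg_AE)
  also have "... = C powr (1 / p) * defect u powr (- (N * ((p - 1) / p)))"
   using C by (simp add: powr_mult powr_powr)
  also have "(p - 1) / p = 1 / q" using pq p_q by (simp add: diff_divide_distrib)
  finally show "bergman_norm p (kernel u) \<le> C powr (1 / p) * defect u powr (- ((real CARD('n) + 1) / q))"
   by (simp add: N_def)
 qed
qed

end

lemma bergman_norm_2_kernel: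
 fixes u :: "complex ^ 'n"
 assumes u: "u \<in> unit_ball"
 shows "bergman_norm 2 (kernel u) = defect u powr (- ((real CARD('n) + 1) / 2))"
proof -
 note [measurable] = measurable_volI[OF kernel_measurable_borel[OF u]]
 have d: "defect u > 0" by (rule defect_pos[OF u])
 have "(LINT w|vol. norm (kernel u w) powr 2) = enn2real (\<integral>\<^sup>+w. ennreal (norm (kernel u w) powr 2) \<partial>vol)"
  by (rule integral_eq_nn_integral) auto
 also have "... = 1 / defect u ^ (CARD('n) + 1)"
  using kernel_norm2[OF u] d by simp
 also have "... = defect u powr (- (real CARD('n) + 1))"
 proof -
  have "- (real CARD('n) + 1) = - real (CARD('n) + 1)" by simp
  then show ?thesis by (simp only: powr_minus powr_realpow[OF d] divide_inverse mult_1_left)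
 qed
 finally show ?thesis unfolding bergman_norm_def by (simp add: powr_powr minus_divide_left)
qed

lemma normalized_kernel_eq:
 fixes u :: "complex ^ 'n"
 assumes u: "u \<in> unit_ball"
 shows "normalized_kernel u w = of_real (defect u powr ((real CARD('n) + 1) / 2)) * kernel u w"
 unfolding normalized_kernel_def bergman_norm_2_kernel[OF u] powr_minus of_real_inverse
  divide_inverse[of "kernel u w"] inverse_inverse_eq by (rule mult.commute)

section \<open>Holomorphy of superpositions of kernels\<close>

lemma has_derivative_quadratic:
 fixes f :: "'a::real_normed_vector \<Rightarrow> 'b::real_normed_vector"
 assumes D: "bounded_linear D" and r: "r > 0"
  and le: "\<And>h. norm h \<le> r ==> norm (f (w + h) - f w - D h) \<le> C * (norm h)\<^sup>2"
 shows "(f has_derivative D) (at w)"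
 unfolding has_derivative_at
proof (intro conjI D tendstoI)
 fix e :: real assume e: "e > 0"
 define d where "d = min r (e / (\<bar>C\<bar> + 1))"
 have d: "d > 0" using r e by (simp add: d_def)
 have "norm (f (w + h) - f w - D h) / norm h < e" if h: "h \<noteq> 0" "norm h < d" for h
 proof -
  have "norm (f (w + h) - f w - D h) \<le> C * (norm h)\<^sup>2" using h by (intro le) (simp add: d_def)
  also have "... \<le> (\<bar>C\<bar> + 1) * (norm h)\<^sup>2" by (intro mult_right_mono) auto
  finally have "norm (f (w + h) - f w - D h) / norm h \<le> (\<bar>C\<bar> + 1) * norm h"
   using h by (simp add: divide_le_eq power2_eq_square mult.assoc)
  also have "... < (\<bar>C\<bar> + 1) * (e / (\<bar>C\<bar> + 1))" using h by (intro mult_strict_left_mono) (auto simp: d_def)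
  finally show ?thesis by simp
 qed
 then show "\<forall>\<^sub>F h in at 0. dist (norm (f (w + h) - f w - D h) / norm h) 0 < e"
  unfolding eventually_at using d by (intro exI[of _ d]) auto
qed

definition kernel_deriv :: "complex ^ 'n \<Rightarrow> complex ^ 'n \<Rightarrow> complex ^ 'n \<Rightarrow> complex" where
 "kernel_deriv x w h = of_nat (CARD('n) + 1) * cdot h x / (1 - cdot w x) ^ (CARD('n) + 2)"

lemma inverse_power_has_derivative:
 fixes s :: complex assumes "1 - s \<noteq> 0"
 shows "((\<lambda>s. a * inverse (1 - s) ^ k) has_field_derivative (a * of_nat k * inverse (1 - s) ^ (k + 1))) (at s within S)"
proof -
 have "((\<lambda>s. inverse (1 - s)) has_field_derivative inverse (1 - s) ^ 2) (at s within S)"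
  using assms by (auto intro!: derivative_eq_intros simp: power2_eq_square)
 from DERIV_cmult[OF DERIV_power[OF this, of k], of a]
 show ?thesis by (cases k) (simp_all add: power2_eq_square mult_ac)
qed

text \<open>For all points near \<open>w\<close> and all \<open>x\<close> in the ball the inner
  products stay in one disc of radius \<open>\<rho> < 1\<close>, where the second derivative of
  \<open>(1 - s)\<close> to the power \<open>- N\<close> is bounded. The constant is therefore
  independent of \<open>x\<close>, which permits differentiation under integrals and under
  functionals.\<close>

lemma kernel_taylor:
 fixes w :: "complex ^ 'n"
 assumes w: "w \<in> unit_ball"
 obtains C where "C \<ge> 0" "\<And>x h. x \<in> unit_ball ==> norm h \<le> (1 - norm w) / 2 ==>
  norm (kernel x (w + h) - kernel x w - kernel_deriv x w h) \<le> C * (norm h)\<^sup>2"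
proof -
 define N where "N = CARD('n) + 1"
 define \<rho> where "\<rho> = (1 + norm w) / 2"
 have \<rho>: "0 \<le> \<rho>" "\<rho> < 1" using w by (auto simp: \<rho>_def)
 \<comment> \<open>The numbers \<open>a i\<close> make \<open>F i\<close> the \<open>i\<close>-th
   derivative of \<open>F 0\<close> for \<open>i \<le> 2\<close>.\<close>
 define a :: "nat \<Rightarrow> complex" where "a i = (if i = 0 then 1 else if i = 1 then of_nat N else of_nat N * of_nat (N + 1))" for i
 define F where "F i s = a i * inverse (1 - s) ^ (N + i)" for i :: nat and s :: complex
 have nz: "1 - s \<noteq> 0" if "s \<in> cball 0 \<rho>" for s :: complex using that \<rho> by auto
 define B where "B = real N * real (N + 1) * inverse (1 - \<rho>) ^ (N + 2)"
 have tay: "norm (F 0 z - (\<Sum>i\<le>1. F i s * (z - s) ^ i / fact i)) \<le> B * norm (z - s) ^ Suc 1 / fact 1"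
  if "s \<in> cball 0 \<rho>" "z \<in> cball 0 \<rho>" for s z
 proof (rule complex_Taylor[of "cball 0 \<rho>"])
  show "(F i has_field_derivative F (Suc i) x) (at x within cball 0 \<rho>)" if "x \<in> cball 0 \<rho>" "i \<le> 1" for i x
  proof -
   have "a i * of_nat (N + i) = a (Suc i)" using that by (cases i) (auto simp: a_def)
   then show ?thesis
    using inverse_power_has_derivative[OF nz[OF that(1)], of "a i" "N + i" "cball 0 \<rho>"] unfolding F_def by simp
  qed
  show "norm (F (Suc 1) x) \<le> B" if "x \<in> cball 0 \<rho>" for x
  proof -
   have "1 - \<rho> \<le> norm (1 - x)" using that norm_triangle_ineq2[of 1 x] by simp
   then have "inverse (norm (1 - x)) \<le> inverse (1 - \<rho>)" using \<rho> by (intro le_imp_inverse_le) auto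
   then have "inverse (norm (1 - x)) ^ (N + 2) \<le> inverse (1 - \<rho>) ^ (N + 2)" by (intro power_mono) auto
   then have "real N * real (N + 1) * inverse (norm (1 - x)) ^ (N + 2) \<le> B"
    unfolding B_def by (intro mult_left_mono) auto
   moreover have "norm (F (Suc 1) x) = real N * real (N + 1) * inverse (norm (1 - x)) ^ (N + 2)"
    unfolding F_def a_def by (simp add: norm_mult norm_power norm_inverse del: power_Suc of_nat_Suc of_nat_add)
   ultimately show ?thesis by simp
  qed
 qed (use that in auto)
 show ?thesis
 proof (rule that)
  show "B \<ge> 0" using \<rho> by (simp add: B_def)
  fix x h :: "complex ^ 'n" assume x: "x \<in> unit_ball" and h: "norm h \<le> (1 - norm w) / 2"
  have wh: "norm (w + h) \<le> \<rho>" using norm_triangle_ineq[of w h] h by (simp add: \<rho>_def field_simps)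
  then have whb: "w + h \<in> unit_ball" using \<rho> by simp
  have cb: "cdot y x \<in> cball 0 \<rho>" if "norm y \<le> \<rho>" for y
   using norm_cdot_le[of y x] mult_mono[of "norm y" \<rho> "norm x" 1] that x \<rho> by simp
  have nw: "norm w \<le> \<rho>" using w by (simp add: \<rho>_def)
  have "norm (F 0 (cdot (w + h) x) - (\<Sum>i\<le>1. F i (cdot w x) * (cdot (w + h) x - cdot w x) ^ i / fact i))
   \<le> B * norm (cdot (w + h) x - cdot w x) ^ Suc 1 / fact 1"
   by (rule tay[OF cb[OF nw] cb[OF wh]])
  moreover have "cdot (w + h) x - cdot w x = cdot h x" by (simp add: cdot_add_left)
  moreover have "F 0 (cdot (w + h) x) = kernel x (w + h)" "F 0 (cdot w x) = kernel x w"
   unfolding kernel_in[OF whb] kernel_in[OF w] F_def N_def a_def by (simp_all add: power_inverse divide_inverse)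
  moreover have "F 1 (cdot w x) * cdot h x = kernel_deriv x w h"
   unfolding F_def a_def kernel_deriv_def N_def by (simp add: power_inverse divide_inverse)
  ultimately have "norm (kernel x (w + h) - kernel x w - kernel_deriv x w h) \<le> B * (norm (cdot h x))\<^sup>2"
   by (simp add: numeral_2_eq_2 diff_diff_add)
  also have "... \<le> B * (norm h)\<^sup>2"
   using \<open>B \<ge> 0\<close> norm_cdot_le[of h x] mult_left_le[of "norm x" "norm h"] x
   by (intro mult_left_mono power_mono) auto
  finally show "norm (kernel x (w + h) - kernel x w - kernel_deriv x w h) \<le> B * (norm h)\<^sup>2" .
 qed
qed

lemma norm_kernel_deriv_le:
 fixes w x h :: "complex ^ 'n"
 assumes "w \<in> unit_ball" "x \<in> unit_ball"
 shows "norm (kernel_deriv x w h) \<le> real (CARD('n) + 1) / (1 - norm w) ^ (CARD('n) + 2) * norm h"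
proof -
 have 1: "1 - norm w \<le> norm (1 - cdot w x)"
  using norm_one_minus_cdot_ge1[OF assms(2,1)] by (simp add: norm_one_minus_cdot_commute)
 have "norm (cdot h x) \<le> norm h" using norm_cdot_le[of h x] mult_left_le[of "norm x" "norm h"] assms by auto
 then have "norm (kernel_deriv x w h) \<le> real (CARD('n) + 1) * norm h / (1 - norm w) ^ (CARD('n) + 2)"
  unfolding kernel_deriv_def norm_divide norm_mult norm_power norm_of_nat using 1 assms
  by (intro frac_le mult_left_mono power_mono mult_nonneg_nonneg zero_less_power) auto
 then show ?thesis by (simp add: mult_ac)
qed

text \<open>The uniform remainder of \<open>kernel_taylor\<close> is integrated against
  \<open>|a|\<close>. The measure and the map \<open>\<psi>\<close> are arbitrary so that the
  Bergman projection, the operators at \<open>v\<close> and their integral over \<open>v\<close>,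
  where the parameter runs through a product space, are all covered.\<close>

theorem holomorphic_several_superposition:
 fixes a :: "'m \<Rightarrow> complex" and \<psi> :: "'m \<Rightarrow> complex ^ 'n"
 assumes a: "integrable M a" and \<psi>: "\<psi> \<in> measurable M vol"
 shows "holomorphic_several (\<lambda>w. \<integral>m. a m * kernel (\<psi> m) w \<partial>M) unit_ball"
proof (rule holomorphic_severalI)
 fix w :: "complex ^ 'n" assume w: "w \<in> unit_ball"
 obtain C where C: "C \<ge> 0" "\<And>x h. x \<in> unit_ball ==> norm h \<le> (1 - norm w) / 2 ==>
  norm (kernel x (w + h) - kernel x w - kernel_deriv x w h) \<le> C * (norm h)\<^sup>2"
  using kernel_taylor[OF w] by blast
 have am[measurable]: "a \<in> borel_measurable M" using a by simp
 have \<psi>b: "\<psi> m \<in> unit_ball" if "m \<in> space M" for m using measurable_space[OF \<psi> that] by simp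
 have bdd: "integrable M (\<lambda>m. a m * g (\<psi> m))"
  if "continuous_on unit_ball g" "\<And>x. x \<in> unit_ball ==> norm (g x) \<le> K" for g :: "complex ^ 'n \<Rightarrow> complex" and K
 proof (rule integrable_dominated)
  show "integrable M (\<lambda>m. K * norm (a m))" using a by simp
  have "(\<lambda>m. g (\<psi> m)) \<in> borel_measurable M"
   by (rule measurable_compose[OF \<psi> measurable_vol_continuous[OF that(1)]])
  then show "(\<lambda>m. a m * g (\<psi> m)) \<in> borel_measurable M" by measurable
  show "AE m in M. norm (a m * g (\<psi> m)) \<le> norm (K * norm (a m))"
  proof (rule AE_I2)
   fix m assume "m \<in> space M"
   then have "norm (g (\<psi> m)) \<le> \<bar>K\<bar>" using that(2)[OF \<psi>b] by fastforce
   from mult_right_mono[OF this, of "norm (a m)"] show "norm (a m * g (\<psi> m)) \<le> norm (K * norm (a m))"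
    by (simp add: norm_mult abs_mult mult.commute)
  qed
 qed
 have ik: "integrable M (\<lambda>m. a m * kernel (\<psi> m) y)" if y: "y \<in> unit_ball" for y
 proof (rule bdd)
  show "continuous_on unit_ball (\<lambda>x. kernel x y)" using y by (intro continuous_intros) auto
  show "norm (kernel x y) \<le> 1 / (1 - norm y) ^ (CARD('n) + 1)" if "x \<in> unit_ball" for x
   using norm_kernel_le[OF that y] by (simp add: norm_kernel_commute[OF that y])
 qed
 have id: "integrable M (\<lambda>m. a m * kernel_deriv (\<psi> m) w h)" for h
 proof (rule bdd)
  show "continuous_on unit_ball (\<lambda>x. kernel_deriv x w h)"
   unfolding kernel_deriv_def using one_minus_cdot_nz[OF w] by (intro continuous_intros) auto
  show "norm (kernel_deriv x w h) \<le> real (CARD('n) + 1) / (1 - norm w) ^ (CARD('n) + 2) * norm h" if "x \<in> unit_ball" for x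
   by (rule norm_kernel_deriv_le[OF w that])
 qed
 define D where "D h = (LINT m|M. a m * kernel_deriv (\<psi> m) w h)" for h
 have Dadd: "D (h + k) = D h + D k" for h k
  unfolding D_def by (subst Bochner_Integration.integral_add[OF id id, symmetric])
   (simp add: kernel_deriv_def cdot_add_left distrib_left add_divide_distrib)
 have Dc: "D (c *s h) = c * D h" for c h
  unfolding D_def by (subst integral_mult_right_zero[symmetric])
   (intro lint_cong, simp_all add: kernel_deriv_def cdot_smult_left)
 have Dn: "norm (D h) \<le> norm h * ((LINT m|M. norm (a m)) * (real (CARD('n) + 1) / (1 - norm w) ^ (CARD('n) + 2)))" for h
 proof -
  have "norm (D h) \<le> (LINT m|M. norm (a m * kernel_deriv (\<psi> m) w h))" unfolding D_def by (rule integral_norm_bound)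
  also have "... \<le> (LINT m|M. norm (a m) * (real (CARD('n) + 1) / (1 - norm w) ^ (CARD('n) + 2) * norm h))"
  proof (rule integral_mono)
   show "norm (a m * kernel_deriv (\<psi> m) w h) \<le> norm (a m) * (real (CARD('n) + 1) / (1 - norm w) ^ (CARD('n) + 2) * norm h)"
    if "m \<in> space M" for m
    unfolding norm_mult using norm_kernel_deriv_le[OF w \<psi>b[OF that]] by (intro mult_left_mono) auto
  qed (use id a in auto)
  finally show ?thesis by (simp add: mult_ac)
 qed
 have lin: "bounded_linear D"
 proof (rule bounded_linear_intro[OF Dadd _ Dn])
  show "D (r *\<^sub>R h) = r *\<^sub>R D h" for r h
  proof -
   have "r *\<^sub>R h = complex_of_real r *s h" by (simp add: vec_eq_iff scaleR_conv_of_real[where 'a = complex])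
   then show ?thesis by (simp only: Dc scaleR_conv_of_real)
  qed
 qed
 have "((\<lambda>w. \<integral>m. a m * kernel (\<psi> m) w \<partial>M) has_derivative D) (at w)"
 proof (rule has_derivative_quadratic[OF lin])
  show "(1 - norm w) / 2 > 0" using w by simp
  fix h :: "complex ^ 'n" assume h: "norm h \<le> (1 - norm w) / 2"
  then have "norm h < 1 - norm w" using w by simp
  then have wh: "w + h \<in> unit_ball" using norm_triangle_ineq[of w h] by simp
  have "(LINT m|M. a m * kernel (\<psi> m) (w + h)) - (LINT m|M. a m * kernel (\<psi> m) w) - D h
   = (LINT m|M. a m * (kernel (\<psi> m) (w + h) - kernel (\<psi> m) w - kernel_deriv (\<psi> m) w h))"
   unfolding D_def using ik[OF wh] ik[OF w] id by (simp add: right_diff_distrib)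
  also have "norm ... \<le> (LINT m|M. norm (a m * (kernel (\<psi> m) (w + h) - kernel (\<psi> m) w - kernel_deriv (\<psi> m) w h)))"
   by (rule integral_norm_bound)
  also have "... \<le> (LINT m|M. norm (a m) * (C * (norm h)\<^sup>2))"
  proof (rule integral_mono)
   show "integrable M (\<lambda>m. norm (a m * (kernel (\<psi> m) (w + h) - kernel (\<psi> m) w - kernel_deriv (\<psi> m) w h)))"
    unfolding right_diff_distrib using ik[OF wh] ik[OF w] id by simp
   show "norm (a m * (kernel (\<psi> m) (w + h) - kernel (\<psi> m) w - kernel_deriv (\<psi> m) w h)) \<le> norm (a m) * (C * (norm h)\<^sup>2)"
    if "m \<in> space M" for m
    unfolding norm_mult using C(2)[OF \<psi>b[OF that] h] by (intro mult_left_mono) auto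
  qed (use a in auto)
  finally show "norm ((LINT m|M. a m * kernel (\<psi> m) (w + h)) - (LINT m|M. a m * kernel (\<psi> m) w) - D h)
   \<le> ((LINT m|M. norm (a m)) * C) * (norm h)\<^sup>2" by (simp add: mult_ac)
 qed
 then show "\<exists>D. cderiv (\<lambda>w. \<integral>m. a m * kernel (\<psi> m) w \<partial>M) D w"
  using Dc by (auto simp: cderiv_def)
qed

section \<open>Bergman spaces and the Bergman projection\<close>

lemma bergman_spaceD:
 assumes "f \<in> bergman_space p"
 shows "lp p f" "holomorphic_several f unit_ball" "\<And>z. z \<notin> unit_ball ==> f z = 0"
proof -
 show h: "holomorphic_several f unit_ball" and "\<And>z. z \<notin> unit_ball ==> f z = 0"
  using assms by (auto simp: bergman_space_def)
 show "lp p f" unfolding lp_def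
  using assms measurable_vol_continuous[OF holomorphic_several_continuous[OF h]] by (auto simp: bergman_space_def)
qed

lemma bergman_spaceI:
 "holomorphic_several f unit_ball ==> (\<And>z. z \<notin> unit_ball ==> f z = 0) ==> lp p f ==> f \<in> bergman_space p"
 by (auto simp: bergman_space_def lp_def)

lemma bergman_space_zero: "p > 0 ==> (\<lambda>_. 0) \<in> bergman_space p"
 by (rule bergman_spaceI) (auto simp: lp_const holomorphic_several_alt intro: cderiv_const)

lemma bergman_space_add:
 "p \<ge> 1 ==> f \<in> bergman_space p ==> g \<in> bergman_space p ==> (\<lambda>z. f z + g z) \<in> bergman_space p"
 by (rule bergman_spaceI) (simp_all add: holomorphic_several_add lp_add bergman_spaceD)

lemma bergman_space_cmult:
 "p > 0 ==> f \<in> bergman_space p ==> (\<lambda>z. c * f z) \<in> bergman_space p"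
 by (rule bergman_spaceI) (simp_all add: holomorphic_several_cmult lp_cmult bergman_spaceD)

lemma bergman_space_diff:
 assumes "p \<ge> 1" "f \<in> bergman_space p" "g \<in> bergman_space p"
 shows "(\<lambda>z. f z - g z) \<in> bergman_space p"
 using bergman_space_add[OF assms(1,2) bergman_space_cmult[of p g "-1"]] assms by simp

lemma bergman_space_sum:
 assumes "p \<ge> 1" "finite X" "\<And>x. x \<in> X ==> f x \<in> bergman_space p"
 shows "(\<lambda>z. \<Sum>x\<in>X. f x z) \<in> bergman_space p"
 using assms(2,3)
proof (induction X rule: finite_induct)
 case empty then show ?case using assms(1) by (simp add: bergman_space_zero)
next
 case (insert x X)
 then have "(\<lambda>z. f x z + (\<Sum>x\<in>X. f x z)) \<in> bergman_space p" using assms(1) by (intro bergman_space_add) auto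
 then show ?case using insert by simp
qed

lemma kernel_bergman:
 fixes z :: "complex ^ 'n"
 assumes "z \<in> unit_ball" "p > 0" shows "kernel z \<in> bergman_space p"
proof (rule bergman_spaceI)
 show "lp p (kernel z)"
  using norm_kernel_le[OF _ assms(1)] assms
  by (intro lp_bounded(1)[where K = "1 / (1 - norm z) ^ (CARD('n) + 1)"] measurable_volI kernel_measurable_borel) auto
qed (use assms in \<open>auto intro: holomorphic_several_kernel\<close>)

text \<open>As long as \<open>z\<close> stays in a smaller closed ball, the formula for the kernel
  is continuous in \<open>w\<close> up to the boundary, so compactness yields uniformity in
  \<open>w\<close>.\<close>

lemma kernel_uniform:
 fixes \<rho> e :: real
 assumes \<rho>: "0 \<le> \<rho>" "\<rho> < 1" and e: "e > 0"
 obtains \<delta> where "\<delta> > 0" "\<And>z z' w :: complex ^ 'n. z \<in> cball 0 \<rho> ==> z' \<in> cball 0 \<rho> ==> dist z z' < \<delta> ==>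
  norm (kernel z w - kernel z' w) \<le> e"
proof -
 define F where "F p = 1 / (1 - cdot (snd p) (fst p)) ^ (CARD('n) + 1)" for p :: "(complex ^ 'n) \<times> (complex ^ 'n)"
 have nz: "1 - cdot w z \<noteq> 0" if "z \<in> cball 0 \<rho>" "w \<in> cball 0 1" for z w :: "complex ^ 'n"
 proof -
  have "norm (cdot w z) \<le> 1 * \<rho>" using norm_cdot_le[of w z] mult_mono[of "norm w" 1 "norm z" \<rho>] that by simp
  then show ?thesis using \<rho> by auto
 qed
 have "continuous_on (cball 0 \<rho> \<times> cball 0 1) F"
  unfolding F_def using nz by (intro continuous_intros) auto
 then have "uniformly_continuous_on (cball 0 \<rho> \<times> cball 0 1) F"
  by (rule compact_uniformly_continuous) (simp add: compact_Times)
 then obtain \<delta> where \<delta>: "\<delta> > 0" "\<And>x y. x \<in> cball 0 \<rho> \<times> cball 0 1 ==> y \<in> cball 0 \<rho> \<times> cball 0 1 ==> dist y x < \<delta> ==> dist (F y) (F x) < e"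
  using e unfolding uniformly_continuous_on_def by blast
 show ?thesis
 proof (rule that[OF \<delta>(1)])
  fix z z' w :: "complex ^ 'n" assume z: "z \<in> cball 0 \<rho>" "z' \<in> cball 0 \<rho>" "dist z z' < \<delta>"
  show "norm (kernel z w - kernel z' w) \<le> e"
  proof (cases "w \<in> unit_ball")
   case True
   then have "dist (F (z, w)) (F (z', w)) < e" using z by (intro \<delta>(2)) (auto simp: dist_Pair_Pair)
   then show ?thesis using True by (simp add: F_def kernel_in dist_norm less_imp_le)
  qed (use e in simp)
 qed
qed

lemma finite_nearest:
 assumes "finite X" "X \<noteq> {}"
 shows "\<exists>c :: 'a::euclidean_space \<Rightarrow> 'a. simple_function borel c \<and> range c \<subseteq> X \<and> (\<forall>z\<in>(\<Union>x\<in>X. ball x d). dist (c z) z < d)"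
 using assms
proof (induction X rule: finite_ne_induct)
 case (singleton x)
 then show ?case by (intro exI[of _ "\<lambda>_. x"]) auto
next
 case (insert x X)
 then obtain c where c: "simple_function borel c" "range c \<subseteq> X" "\<And>z. z \<in> (\<Union>x\<in>X. ball x d) ==> dist (c z) z < d" by blast
 define c' where "c' z = (if z \<in> ball x d then x else c z)" for z
 have "simple_function borel c'"
  unfolding c'_def by (rule simple_function_If_set) (use c in auto)
 moreover have "range c' \<subseteq> insert x X" using c by (auto simp: c'_def)
 moreover have "dist (c' z) z < d" if "z \<in> (\<Union>x\<in>insert x X. ball x d)" for z
  using that c(3)[of z] by (auto simp: c'_def)
 ultimately show ?case by blast
qed

text \<open>A simple approximation of the identity of \<open>S\<close>. Composition with it produces
  the finite sums in \<open>l_proj\<close> and the simple functions in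
  \<open>Aop_has_integral\<close>.\<close>

lemma simple_nearest:
 fixes S :: "'a::euclidean_space set"
 assumes "compact S" "S \<noteq> {}" "d > 0"
 obtains c where "simple_function borel c" "range c \<subseteq> S" "\<And>z. z \<in> S ==> dist (c z) z < d"
proof -
 obtain X where X: "X \<subseteq> S" "finite X" "S \<subseteq> (\<Union>x\<in>X. ball x d)"
  using compactE_image[OF assms(1), of S "\<lambda>x. ball x d"] assms(3) by (metis UN_I centre_in_ball open_ball subsetI)
 moreover have "X \<noteq> {}" using X assms(2) by auto
 ultimately obtain c where "simple_function borel c" "range c \<subseteq> X" "\<forall>z\<in>(\<Union>x\<in>X. ball x d). dist (c z) z < d"
  using finite_nearest[of X d] by blast
 then show ?thesis using X by (intro that[of c]) auto
qed

definition proj :: "('n::finite) cfun \<Rightarrow> 'n cfun" where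
 "proj \<phi> w = (if w \<in> unit_ball then \<integral>u. \<phi> u * kernel u w \<partial>vol else 0)"

context conjugate_exponents
begin

lemma p_ge_1: "p \<ge> 1" using p_gt_1 by simp

lemma lp_integrable_mult_kernel:
 "lp p \<phi> ==> x \<in> unit_ball ==> integrable vol (\<lambda>u. \<phi> u * kernel u x)"
 by (rule integrable_mult_kernel[OF lp_L1(1)])

lemma holomorphic_several_proj:
 assumes "lp p \<phi>" shows "holomorphic_several (proj \<phi>) unit_ball"
proof (rule holomorphic_several_cong)
 show "holomorphic_several (\<lambda>w. \<integral>m. \<phi> m * kernel m w \<partial>vol) unit_ball"
  by (rule holomorphic_several_superposition[OF lp_L1(1)[OF assms]]) simp
qed (simp_all add: proj_def)

theorem proj_bounded:
 obtains C where "C > 0" "\<And>\<phi> :: ('n::finite) cfun. lp p \<phi> ==> proj \<phi> \<in> bergman_space p \<and> bergman_norm p (proj \<phi>) \<le> C * bergman_norm p \<phi>"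
proof -
 obtain C where C: "C > 0" "\<And>f g :: 'n cfun. lp p f ==> g \<in> borel_measurable vol ==>
  (\<And>x. x \<in> unit_ball ==> norm (g x) \<le> abs_proj f x) ==>
  lp p g \<and> bergman_norm p g \<le> C * bergman_norm p f"
  using maximal_projection_bounded by blast
 show ?thesis
 proof (rule that[OF C(1)])
  fix \<phi> :: "'n cfun" assume \<phi>: "lp p \<phi>"
  have h: "holomorphic_several (proj \<phi>) unit_ball" by (rule holomorphic_several_proj[OF \<phi>])
  have "lp p (proj \<phi>) \<and> bergman_norm p (proj \<phi>) \<le> C * bergman_norm p \<phi>"
  proof (rule C(2)[OF \<phi>])
   show "proj \<phi> \<in> borel_measurable vol" by (rule measurable_vol_continuous[OF holomorphic_several_continuous[OF h]])
   show "norm (proj \<phi> x) \<le> (LINT u|vol. norm (\<phi> u) * norm (kernel u x))" if "x \<in> unit_ball" for x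
    using that integral_norm_bound[of vol "\<lambda>u. \<phi> u * kernel u x"] by (simp add: proj_def norm_mult)
  qed
  then show "proj \<phi> \<in> bergman_space p \<and> bergman_norm p (proj \<phi>) \<le> C * bergman_norm p \<phi>"
   using h by (auto intro!: bergman_spaceI simp: proj_def)
 qed
qed

lemma pairing_kernel:
 assumes f: "f \<in> bergman_space p" and z: "z \<in> unit_ball"
 shows "pairing f (kernel z) = f z"
 unfolding pairing_def by (rule reproducing[OF bergman_spaceD(2)[OF f] lp_L1(1)[OF bergman_spaceD(1)[OF f]] z])

lemma proj_bergman: 
 assumes f: "f \<in> bergman_space p" shows "proj f = f"
proof
 fix z :: "complex ^ 'a"
 show "proj f z = f z"
 proof (cases "z \<in> unit_ball")
  case True
  have "(LINT u|vol. f u * kernel u z) = (LINT u|vol. f u * cnj (kernel z u))"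
   by (intro lint_cong) (use True in \<open>auto simp: kernel_sym\<close>)
  then show ?thesis using True pairing_kernel[OF f True] by (simp add: proj_def pairing_def)
 qed (use bergman_spaceD(3)[OF f] in \<open>simp add: proj_def\<close>)
qed

text \<open>The reproducing formula with the kernel bounded at the fixed point \<open>z\<close>.
  Operators and their integrals are compared through such evaluations.\<close>

lemma point_eval:
 fixes z :: "complex ^ 'n"
 assumes f: "f \<in> bergman_space p" and z: "z \<in> unit_ball"
 shows "norm (f z) \<le> 1 / (1 - norm z) ^ (CARD('n) + 1) * bergman_norm p f"
proof -
 have i: "integrable vol f" by (rule lp_L1(1)[OF bergman_spaceD(1)[OF f]])
 have "norm (f z) = norm (LINT u|vol. f u * kernel u z)" using proj_bergman[OF f] z by (metis proj_def)
 also have "... \<le> (LINT u|vol. norm (f u * kernel u z))" by (rule integral_norm_bound)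
 also have "... \<le> (LINT u|vol. 1 / (1 - norm z) ^ (CARD('n) + 1) * norm (f u))"
 proof (rule integral_mono)
  show "integrable vol (\<lambda>u. norm (f u * kernel u z))" using integrable_mult_kernel[OF i z] by simp
  show "integrable vol (\<lambda>u. 1 / (1 - norm z) ^ (CARD('n) + 1) * norm (f u))" using i by simp
  fix u :: "complex ^ 'n" assume "u \<in> space vol"
  then have u: "u \<in> unit_ball" by simp
  show "norm (f u * kernel u z) \<le> 1 / (1 - norm z) ^ (CARD('n) + 1) * norm (f u)"
   unfolding norm_mult norm_kernel_commute[OF u z] mult.commute[of "norm (f u)"]
   by (rule mult_right_mono[OF norm_kernel_le[OF u z]]) simp
 qed
 also have "... = 1 / (1 - norm z) ^ (CARD('n) + 1) * (LINT u|vol. norm (f u))" by (rule integral_mult_right_zero)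
 also have "... \<le> 1 / (1 - norm z) ^ (CARD('n) + 1) * bergman_norm p f"
  using lp_L1(2)[OF bergman_spaceD(1)[OF f]] z by (intro mult_left_mono) auto
 finally show ?thesis .
qed

lemma pairing_bound:
 assumes "lp p f" "lp q g"
 shows "norm (pairing f g) \<le> bergman_norm p f * bergman_norm q g" "integrable vol (\<lambda>z. f z * cnj (g z))"
proof -
 have g: "lp q (\<lambda>z. cnj (g z))" using assms(2) by (simp add: lp_cnj)
 have n: "bergman_norm q (\<lambda>z. cnj (g z)) = bergman_norm q g" by (rule bergman_norm_cong) simp
 show "integrable vol (\<lambda>z. f z * cnj (g z))" by (rule Hoelder(1)[OF assms(1) g])
 show "norm (pairing f g) \<le> bergman_norm p f * bergman_norm q g"
  using integral_norm_bound[of vol "\<lambda>z. f z * cnj (g z)"] Hoelder(2)[OF assms(1) g] n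
  by (simp add: pairing_def norm_mult)
qed

end

section \<open>Representation of bounded functionals\<close>

locale bergman_functional = conjugate_exponents p q for p q :: real +
 fixes \<ll> :: "('n::finite) cfun \<Rightarrow> complex" and L :: real
 assumes L0: "L \<ge> 0"
  and l_add: "\<And>f g. f \<in> bergman_space p ==> g \<in> bergman_space p ==> \<ll> (\<lambda>z. f z + g z) = \<ll> f + \<ll> g"
  and l_cmult: "\<And>c f. f \<in> bergman_space p ==> \<ll> (\<lambda>z. c * f z) = c * \<ll> f"
  and l_bound: "\<And>f. f \<in> bergman_space p ==> norm (\<ll> f) \<le> L * bergman_norm p f"
begin

lemma l_diff: "f \<in> bergman_space p ==> g \<in> bergman_space p ==> \<ll> (\<lambda>z. f z - g z) = \<ll> f - \<ll> g"
 using l_add[of f "\<lambda>z. (-1) * g z"] l_cmult[of g "-1"] bergman_space_cmult[of p g "-1"] p_q by simp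

lemma l_zero: "\<ll> (\<lambda>_. 0) = 0"
 using l_cmult[OF bergman_space_zero[OF p_q(1)], of 0] by simp

lemma l_sum:
 assumes "finite X" "\<And>x. x \<in> X ==> f x \<in> bergman_space p"
 shows "\<ll> (\<lambda>z. \<Sum>x\<in>X. f x z) = (\<Sum>x\<in>X. \<ll> (f x))"
 using assms
proof (induction X rule: finite_induct)
 case (insert x X)
 then have "\<ll> (\<lambda>z. f x z + (\<Sum>x\<in>X. f x z)) = \<ll> (f x) + \<ll> (\<lambda>z. \<Sum>x\<in>X. f x z)"
  using p_ge_1 by (intro l_add bergman_space_sum) auto
 then show ?case using insert by simp
qed (simp add: l_zero)

lemma l_sup_bound:
 assumes "f \<in> bergman_space p" "\<And>z. z \<in> unit_ball ==> norm (f z) \<le> K" "K \<ge> 0"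
 shows "norm (\<ll> f) \<le> L * K"
proof -
 have "bergman_norm p f \<le> K" using assms p_q by (intro lp_bounded(2) lp_measurable[OF bergman_spaceD(1)]) auto
 then show ?thesis using l_bound[OF assms(1)] L0 by (meson mult_left_mono order_trans)
qed

lemma l_kernel_uniform:
 assumes \<rho>: "0 \<le> \<rho>" "\<rho> < 1" and e: "e > 0"
 obtains \<delta> where "\<delta> > 0" "\<And>z z'. z \<in> cball 0 \<rho> ==> z' \<in> cball 0 \<rho> ==> dist z z' < \<delta> ==>
  norm (\<ll> (kernel z) - \<ll> (kernel z')) \<le> L * e"
  "\<And>z z' w :: complex ^ 'n. z \<in> cball 0 \<rho> ==> z' \<in> cball 0 \<rho> ==> dist z z' < \<delta> ==> norm (kernel z w - kernel z' w) \<le> e"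
proof -
 obtain \<delta> where \<delta>: "\<delta> > 0" "\<And>z z' w :: complex ^ 'n. z \<in> cball 0 \<rho> ==> z' \<in> cball 0 \<rho> ==> dist z z' < \<delta> ==>
  norm (kernel z w - kernel z' w) \<le> e"
  using kernel_uniform[OF assms] by blast
 have kb: "kernel z \<in> bergman_space p" if "z \<in> cball 0 \<rho>" for z :: "complex ^ 'n"
  using that \<rho> p_q by (intro kernel_bergman) auto
 show ?thesis
 proof (rule that[OF \<delta>(1)])
  fix z z' :: "complex ^ 'n" assume z: "z \<in> cball 0 \<rho>" "z' \<in> cball 0 \<rho>" "dist z z' < \<delta>"
  have "norm (\<ll> (\<lambda>w. kernel z w - kernel z' w)) \<le> L * e"
   using \<delta>(2)[OF z] e kb z p_ge_1 by (intro l_sup_bound bergman_space_diff) auto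
  then show "norm (\<ll> (kernel z) - \<ll> (kernel z')) \<le> L * e" using l_diff[OF kb kb] z by simp
 qed (rule \<delta>(2))
qed

lemma l_kernel_continuous: "continuous_on unit_ball (\<lambda>z. \<ll> (kernel z))"
proof (rule continuous_at_imp_continuous_on, rule ballI)
 fix z0 :: "complex ^ 'n" assume z0: "z0 \<in> unit_ball"
 define \<rho> where "\<rho> = (1 + norm z0) / 2"
 have \<rho>: "0 \<le> \<rho>" "\<rho> < 1" "norm z0 < \<rho>" using z0 by (auto simp: \<rho>_def)
 show "isCont (\<lambda>z. \<ll> (kernel z)) z0"
  unfolding continuous_at_eps_delta
 proof (intro allI impI)
  fix e :: real assume e: "e > 0"
  have e': "e / (2 * (L + 1)) > 0" using e L0 by simp
  obtain \<delta> where \<delta>: "\<delta> > 0" "\<And>z z'. z \<in> cball 0 \<rho> ==> z' \<in> cball 0 \<rho> ==> dist z z' < \<delta> ==>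
   norm (\<ll> (kernel z) - \<ll> (kernel z')) \<le> L * (e / (2 * (L + 1)))"
   using l_kernel_uniform[OF \<rho>(1,2) e'] by metis
  have "L * (e / (2 * (L + 1))) \<le> (L + 1) * (e / (2 * (L + 1)))" using e L0 by (intro mult_right_mono) auto
  also have "... = e / 2"
  proof -
   have "K * (e / (2 * K)) = e / 2" if "K > 0" for K :: real using that by simp
   from this[of "L + 1"] show ?thesis using L0 by simp
  qed
  also have "... < e" using e by simp
  finally have le: "L * (e / (2 * (L + 1))) < e" .
  have "dist (\<ll> (kernel z)) (\<ll> (kernel z0)) < e" if "dist z z0 < min \<delta> (\<rho> - norm z0)" for z
  proof -
   have "norm z \<le> norm z0 + dist z z0" by (metis dist_norm norm_triangle_sub)
   then have "z \<in> cball 0 \<rho>" "z0 \<in> cball 0 \<rho>" using that \<rho> by auto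
   then have "norm (\<ll> (kernel z) - \<ll> (kernel z0)) \<le> L * (e / (2 * (L + 1)))" using that by (intro \<delta>(2)) auto
   then show ?thesis using le by (simp add: dist_norm)
  qed
  then show "\<exists>d>0. \<forall>x'. dist x' z0 < d \<longrightarrow> dist (\<ll> (kernel x')) (\<ll> (kernel z0)) < e"
   using \<delta>(1) \<rho> by (intro exI[of _ "min \<delta> (\<rho> - norm z0)"]) auto
 qed
qed

text \<open>The functional is exchanged with the integral that defines \<open>proj\<close>.
  Replacing \<open>kernel z\<close> by \<open>kernel (c z)\<close> for a simple function
  \<open>c\<close> gives a finite sum \<open>Q\<close> of kernels, where linearity suffices. As
  \<open>\<phi>\<close> vanishes off a smaller ball, the kernels vary uniformly and both replacement
  errors are of order \<open>e\<close>.\<close>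

theorem l_proj:
 assumes \<phi>: "lp p \<phi>" and \<rho>: "0 \<le> \<rho>" "\<rho> < 1" and supp: "\<And>z. z \<notin> cball 0 \<rho> ==> \<phi> z = 0"
 shows "\<ll> (proj \<phi>) = (LINT z|vol. (\<phi> z * \<ll> (kernel z)))"
proof -
 have \<phi>i: "integrable vol \<phi>" by (rule lp_L1(1)[OF \<phi>])
 then have \<phi>m[measurable]: "\<phi> \<in> borel_measurable vol" by simp
 define I where "I = (LINT z|vol. norm (\<phi> z))"
 have I0: "I \<ge> 0" by (simp add: I_def)
 have lkm[measurable]: "(\<lambda>z. \<ll> (kernel z)) \<in> borel_measurable vol"
  by (rule measurable_vol_continuous[OF l_kernel_continuous])
 have pb: "proj \<phi> \<in> bergman_space p" using proj_bounded \<phi> by metis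
 have cb: "cball 0 \<rho> \<subseteq> (unit_ball :: (complex ^ 'n) set)" using \<rho> by auto
 have main: "norm (\<ll> (proj \<phi>) - (LINT z|vol. (\<phi> z * \<ll> (kernel z)))) \<le> 2 * L * I * e" if e: "e > 0" for e
 proof -
  obtain \<delta> where \<delta>: "\<delta> > 0" "\<And>z z'. z \<in> cball 0 \<rho> ==> z' \<in> cball 0 \<rho> ==> dist z z' < \<delta> ==>
    norm (\<ll> (kernel z) - \<ll> (kernel z')) \<le> L * e"
   "\<And>z z' w :: complex ^ 'n. z \<in> cball 0 \<rho> ==> z' \<in> cball 0 \<rho> ==> dist z z' < \<delta> ==> norm (kernel z w - kernel z' w) \<le> e"
   using l_kernel_uniform[OF \<rho> e] by metis
  obtain c where c: "simple_function borel c" "range c \<subseteq> cball (0 :: complex ^ 'n) \<rho>"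
   "\<And>z. z \<in> cball 0 \<rho> ==> dist (c z) z < \<delta>"
   using simple_nearest[of "cball (0 :: complex ^ 'n) \<rho>" \<delta>] \<rho> \<delta>(1) by auto
  define X where "X = range c"
  have X: "finite X" using c(1) unfolding X_def simple_function_def by simp
  have Xb: "x \<in> unit_ball" if "x \<in> X" for x using that c(2) cb unfolding X_def by blast
  have kb: "kernel x \<in> bergman_space p" if "x \<in> X" for x using Xb[OF that] p_q by (intro kernel_bergman)
  have sx: "c -` {x} \<inter> unit_ball \<in> sets vol" for x
  proof -
   have "c -` {x} \<in> sets borel" using simple_functionD(2)[OF c(1), of "{x}"] by simp
   then show ?thesis by (simp add: in_sets_vol_iff)
  qed
  define a where "a x = (LINT z|vol. (\<phi> z * indicator (c -` {x} \<inter> unit_ball) z))" for x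
  have ai: "integrable vol (\<lambda>z. \<phi> z * indicator (c -` {x} \<inter> unit_ball) z)" for x
  proof (rule integrable_dominated[OF \<phi>i])
   note [measurable] = sx[of x]
   show "(\<lambda>z. \<phi> z * indicator (c -` {x} \<inter> unit_ball) z) \<in> borel_measurable vol" by measurable
  qed (rule AE_I2, simp add: indicator_def)
  \<comment> \<open>\<open>g\<close> is arbitrary because it stands for the values
    \<open>kernel x w\<close> as well as for \<open>\<ll> (kernel x)\<close>.\<close>
  have simp_int: "(LINT z|vol. (\<phi> z * g (c z))) = (\<Sum>x\<in>X. a x * g x)" and simp_i: "integrable vol (\<lambda>z. \<phi> z * g (c z))" for g
  proof -
   have eq: "\<phi> z * g (c z) = (\<Sum>x\<in>X. (\<phi> z * indicator (c -` {x} \<inter> unit_ball) z) * g x)" if z: "z \<in> unit_ball" for z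
   proof -
    have "(\<Sum>x\<in>X. (\<phi> z * indicator (c -` {x} \<inter> unit_ball) z) * g x) = (\<Sum>x\<in>{c z}. (\<phi> z * indicator (c -` {x} \<inter> unit_ball) z) * g x)"
     using X by (intro sum.mono_neutral_right) (auto simp: X_def indicator_def)
    then show ?thesis using z by (simp add: indicator_def)
   qed
   have i: "integrable vol (\<lambda>z. \<Sum>x\<in>X. (\<phi> z * indicator (c -` {x} \<inter> unit_ball) z) * g x)" using ai by simp
   show "integrable vol (\<lambda>z. \<phi> z * g (c z))"
    using i by (rule Bochner_Integration.integrable_cong[THEN iffD1, rotated 2]) (simp_all add: eq)
   have "(LINT z|vol. (\<phi> z * g (c z))) = (LINT z|vol. (\<Sum>x\<in>X. (\<phi> z * indicator (c -` {x} \<inter> unit_ball) z) * g x))"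
    by (intro lint_cong) (auto simp: eq)
   also have "... = (\<Sum>x\<in>X. a x * g x)" using ai by (simp add: a_def)
   finally show "(LINT z|vol. (\<phi> z * g (c z))) = (\<Sum>x\<in>X. a x * g x)" .
  qed
  define Q where "Q w = (\<Sum>x\<in>X. a x * kernel x w)" for w
  have Qb: "Q \<in> bergman_space p" unfolding Q_def using X kb p_ge_1 p_q by (intro bergman_space_sum bergman_space_cmult) auto
  have lQ: "\<ll> Q = (LINT z|vol. (\<phi> z * \<ll> (kernel (c z))))"
  proof -
   have "\<ll> Q = (\<Sum>x\<in>X. \<ll> (\<lambda>w. a x * kernel x w))"
    unfolding Q_def using X kb p_q by (intro l_sum bergman_space_cmult) auto
   also have "... = (\<Sum>x\<in>X. a x * \<ll> (kernel x))" using kb by (intro sum.cong) (auto simp: l_cmult)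
   finally show ?thesis using simp_int[of "\<lambda>x. \<ll> (kernel x)"] by simp
  qed
  have cz: "c z \<in> cball 0 \<rho>" for z using c(2) by blast
  have d1: "norm (\<ll> (proj \<phi>) - \<ll> Q) \<le> L * (I * e)"
  proof -
   have "norm (\<ll> (\<lambda>w. proj \<phi> w - Q w)) \<le> L * (I * e)"
   proof (rule l_sup_bound)
    show "(\<lambda>w. proj \<phi> w - Q w) \<in> bergman_space p" using pb Qb p_ge_1 by (intro bergman_space_diff)
    show "I * e \<ge> 0" using I0 e by simp
    fix w :: "complex ^ 'n" assume w: "w \<in> unit_ball"
    have "proj \<phi> w - Q w = (LINT z|vol. (\<phi> z * kernel z w)) - (LINT z|vol. (\<phi> z * kernel (c z) w))"
     using w simp_int[of "\<lambda>x. kernel x w"] by (simp add: proj_def Q_def)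
    also have "... = (LINT z|vol. (\<phi> z * (kernel z w - kernel (c z) w)))"
     using integrable_mult_kernel[OF \<phi>i w] simp_i[of "\<lambda>x. kernel x w"] by (simp add: right_diff_distrib)
    also have "norm ... \<le> (LINT z|vol. norm (\<phi> z * (kernel z w - kernel (c z) w)))" by (rule integral_norm_bound)
    also have "... \<le> (LINT z|vol. norm (\<phi> z) * e)"
    proof (rule integral_mono)
     show "integrable vol (\<lambda>z. norm (\<phi> z * (kernel z w - kernel (c z) w)))"
      unfolding right_diff_distrib using integrable_mult_kernel[OF \<phi>i w] simp_i[of "\<lambda>x. kernel x w"] by simp
     show "norm (\<phi> z * (kernel z w - kernel (c z) w)) \<le> norm (\<phi> z) * e" for z
      using \<delta>(3)[OF _ cz, of z z w] c(3)[of z] supp[of z]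
      by (cases "z \<in> cball 0 \<rho>") (auto simp: norm_mult dist_commute intro!: mult_left_mono)
    qed (use \<phi>i in simp)
    also have "... = I * e" by (simp add: I_def)
    finally show "norm (proj \<phi> w - Q w) \<le> I * e" .
   qed
   then show ?thesis using l_diff[OF pb Qb] by simp
  qed
  have d2: "norm (\<ll> Q - (LINT z|vol. (\<phi> z * \<ll> (kernel z)))) \<le> I * (L * e)"
  proof -
   have pt: "norm (\<phi> z * (\<ll> (kernel (c z)) - \<ll> (kernel z))) \<le> norm (\<phi> z) * (L * e)" for z
    using \<delta>(2)[OF cz, of z z] c(3)[of z] supp[of z]
    by (cases "z \<in> cball 0 \<rho>") (auto simp: norm_mult intro!: mult_left_mono)
   have i1: "integrable vol (\<lambda>z. \<phi> z * \<ll> (kernel (c z)))" by (rule simp_i)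
   have i2: "integrable vol (\<lambda>z. \<phi> z * (\<ll> (kernel (c z)) - \<ll> (kernel z)))"
   proof (rule integrable_dominated)
    show "integrable vol (\<lambda>z. norm (\<phi> z) * (L * e))" using \<phi>i by simp
    show "AE z in vol. norm (\<phi> z * (\<ll> (kernel (c z)) - \<ll> (kernel z))) \<le> norm (norm (\<phi> z) * (L * e))"
     using pt by (intro AE_I2) (auto intro: order_trans[OF _ abs_ge_self])
    have "(\<lambda>z. \<phi> z * \<ll> (kernel (c z)) - \<phi> z * \<ll> (kernel z)) \<in> borel_measurable vol"
     using i1 by (intro borel_measurable_diff) auto
    then show "(\<lambda>z. \<phi> z * (\<ll> (kernel (c z)) - \<ll> (kernel z))) \<in> borel_measurable vol" by (simp only: right_diff_distrib)
   qed
   then have i3: "integrable vol (\<lambda>z. \<phi> z * \<ll> (kernel z))"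
    using Bochner_Integration.integrable_diff[OF i1 i2] by (simp add: right_diff_distrib)
   have "\<ll> Q - (LINT z|vol. (\<phi> z * \<ll> (kernel z))) = (LINT z|vol. (\<phi> z * (\<ll> (kernel (c z)) - \<ll> (kernel z))))"
    unfolding lQ using i1 i3 by (simp add: right_diff_distrib)
   also have "norm ... \<le> (LINT z|vol. norm (\<phi> z * (\<ll> (kernel (c z)) - \<ll> (kernel z))))" by (rule integral_norm_bound)
   also have "... \<le> (LINT z|vol. norm (\<phi> z) * (L * e))" using i2 \<phi>i pt by (intro integral_mono) auto
   finally show ?thesis by (simp add: I_def)
  qed
  show ?thesis using norm_triangle_mono[OF d1 d2] by (simp add: algebra_simps)
 qed
 have "norm (\<ll> (proj \<phi>) - (LINT z|vol. (\<phi> z * \<ll> (kernel z)))) \<le> 0 + e" if e: "e > 0" for e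
 proof -
  have pos: "2 * L * I + 1 > 0" using L0 I0 by (simp add: add_nonneg_pos)
  have "norm (\<ll> (proj \<phi>) - (LINT z|vol. (\<phi> z * \<ll> (kernel z)))) \<le> 2 * L * I * (e / (2 * L * I + 1))"
   using e pos by (intro main) auto
  also have "... \<le> (2 * L * I + 1) * (e / (2 * L * I + 1))" using e pos by (intro mult_right_mono) auto
  finally show ?thesis using pos by simp
 qed
 then have "norm (\<ll> (proj \<phi>) - (LINT z|vol. (\<phi> z * \<ll> (kernel z)))) \<le> 0" by (rule field_le_epsilon)
 then show ?thesis by simp
qed

end

lemma holomorphic_several_cdot: "holomorphic_several (\<lambda>w. cdot w z) S"
 by (rule holomorphic_severalI) (rule exI, rule cderiv_cdot)

lemma holomorphic_several_inverse:
 assumes "holomorphic_several f S" "\<And>w. w \<in> S ==> f w \<noteq> 0"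
 shows "holomorphic_several (\<lambda>w. inverse (f w)) S"
proof (rule holomorphic_severalI)
 fix w assume w: "w \<in> S"
 obtain D where "cderiv f D w" using holomorphic_severalE[OF assms(1) w] .
 from cderiv_inverse[OF this assms(2)[OF w]] show "\<exists>D. cderiv (\<lambda>w. inverse (f w)) D w" by blast
qed

text \<open>A compact exhaustion of the ball, which brings functions without compact support within
  reach of \<open>l_proj\<close>.\<close>

definition trunc :: "nat \<Rightarrow> (complex ^ 'n) set" where
 "trunc k = cball 0 (1 - 1 / (real k + 2))"

lemma trunc_radius: "0 \<le> 1 - 1 / (real k + 2)" "1 - 1 / (real k + 2) < 1"
 by simp_all

lemma trunc_subset: "trunc k \<subseteq> unit_ball"
proof
 fix z :: "complex ^ 'a" assume "z \<in> trunc k"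
 then have "norm z \<le> 1 - 1 / (real k + 2)" by (simp add: trunc_def)
 also have "... < 1" by simp
 finally show "z \<in> unit_ball" by simp
qed

lemma trunc_sets: "trunc k \<in> sets vol"
 using trunc_subset[of k] unfolding in_sets_vol_iff by (simp add: trunc_def)

lemma in_trunc_eventually:
 assumes z: "z \<in> unit_ball" shows "\<forall>\<^sub>F k in sequentially. z \<in> trunc k"
proof -
 have "1 - norm z > 0" using z by simp
 then obtain m where m: "inverse (real (Suc m)) < 1 - norm z" using reals_Archimedean by blast
 have "z \<in> trunc k" if "k \<ge> m" for k
 proof -
  have "1 / (real k + 2) \<le> inverse (real (Suc m))" using that by (simp add: divide_inverse le_imp_inverse_le)
  then show ?thesis using m by (simp add: trunc_def)
 qed
 then show ?thesis using eventually_sequentially by blast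
qed

lemma trunc_indicator_lim:
 assumes z: "z \<in> unit_ball" shows "(\<lambda>k. indicator (trunc k) z :: 'a::{real_normed_vector, zero_neq_one}) \<longlonglongrightarrow> 1"
 by (rule tendsto_eventually) (use in_trunc_eventually[OF z] in \<open>eventually_elim, simp\<close>)

lemma lp_trunc:
 assumes f: "lp p f" and p: "p > 0"
 shows "lp p (\<lambda>z. indicator (trunc k) z * f z)" "lp p (\<lambda>z. f z - indicator (trunc k) z * f z)"
  "(\<lambda>k. bergman_norm p (\<lambda>z. f z - indicator (trunc k) z * f z)) \<longlonglongrightarrow> 0"
proof -
 note [measurable] = lp_measurable[OF f] trunc_sets
 show "lp p (\<lambda>z. indicator (trunc k) z * f z)"
  by (rule lp_dominated(1)[OF f _ p]) (measurable, simp add: indicator_def)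
 have l: "lp p (\<lambda>z. f z - indicator (trunc k) z * f z)" for k
  by (rule lp_dominated(1)[OF f _ p]) (measurable, simp add: indicator_def)
 then show "lp p (\<lambda>z. f z - indicator (trunc k) z * f z)" .
 have "(\<lambda>k. \<integral>z. norm (f z - indicator (trunc k) z * f z) powr p \<partial>vol) \<longlonglongrightarrow> (LINT z|(vol :: (complex ^ 'a) measure). 0)"
 proof (rule integral_dominated_convergence[OF _ _ lp_integrable[OF f]])
  show "AE z in vol. (\<lambda>k. norm (f z - indicator (trunc k) z * f z) powr p) \<longlonglongrightarrow> 0"
  proof (rule AE_I2)
   fix z :: "complex ^ 'a" assume "z \<in> space vol"
   then have "\<forall>\<^sub>F k in sequentially. z \<in> trunc k" by (intro in_trunc_eventually) simp
   then have "\<forall>\<^sub>F k in sequentially. norm (f z - indicator (trunc k) z * f z) powr p = 0"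
    by eventually_elim simp
   then show "(\<lambda>k. norm (f z - indicator (trunc k) z * f z) powr p) \<longlonglongrightarrow> 0" by (rule tendsto_eventually)
  qed
  show "AE z in vol. norm (norm (f z - indicator (trunc k) z * f z) powr p) \<le> norm (f z) powr p" for k
   by (rule AE_I2) (simp add: indicator_def)
  show "(\<lambda>z. norm (f z - indicator (trunc k) z * f z) powr p) \<in> borel_measurable vol" for k
   by measurable
 qed simp
 then have "(\<lambda>k. (LINT z|vol. norm (f z - indicator (trunc k) z * f z) powr p) powr (1 / p)) \<longlonglongrightarrow> 0 powr (1 / p)"
  using p by (intro tendsto_powr2) (auto simp: integral_nonneg_AE)
 then show "(\<lambda>k. bergman_norm p (\<lambda>z. f z - indicator (trunc k) z * f z)) \<longlonglongrightarrow> 0"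
  by (simp add: bergman_norm_def)
qed

lemma (in conjugate_exponents) proj_in_bergman:
 fixes \<phi> :: "('n::finite) cfun"
 assumes "lp p \<phi>" shows "proj \<phi> \<in> bergman_space p"
proof -
 obtain C where "\<And>\<phi> :: 'n cfun. lp p \<phi> ==> proj \<phi> \<in> bergman_space p \<and> bergman_norm p (proj \<phi>) \<le> C * bergman_norm p \<phi>"
  using proj_bounded by blast
 then show ?thesis using assms by blast
qed

context bergman_functional
begin

text \<open>Forced by the reproducing formula: a representing function \<open>g\<close> must satisfy
  \<open>\<ll> (kernel z) = pairing (kernel z) g = cnj (g z)\<close>.\<close>

definition repr :: "'n cfun" where
 "repr z = (if z \<in> unit_ball then cnj (\<ll> (kernel z)) else 0)"

text \<open>The kernel depends on \<open>z\<close> antiholomorphically, and the conjugation in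
  \<open>repr\<close> undoes this. The differential is the conjugate of the functional at
  \<open>E h\<close>, since \<open>kernel z w\<close> is the conjugate of \<open>kernel w z\<close>;
  the remainder is small in the sup norm by \<open>kernel_taylor\<close>.\<close>

lemma repr_holomorphic: "holomorphic_several repr unit_ball"
proof (rule holomorphic_severalI)
 fix z :: "complex ^ 'n" assume z: "z \<in> unit_ball"
 define N where "N = CARD('n) + 1"
 obtain C where C: "C \<ge> 0" "\<And>x h. x \<in> unit_ball ==> norm h \<le> (1 - norm z) / 2 ==>
  norm (kernel x (z + h) - kernel x z - kernel_deriv x z h) \<le> C * (norm h)\<^sup>2"
  using kernel_taylor[OF z] by blast
 define K where "K = real (CARD('n) + 1) / (1 - norm z) ^ (CARD('n) + 2)"
 have K: "K \<ge> 0" using z by (simp add: K_def)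
 define E where "E h w = (if w \<in> unit_ball then cnj (kernel_deriv w z h) else 0)" for h w
 have Eb: "E h \<in> bergman_space p" for h
 proof (rule bergman_spaceI)
  show h: "holomorphic_several (E h) unit_ball"
  proof (rule holomorphic_several_cong)
   show "holomorphic_several (\<lambda>w. of_nat N * (cdot w h * inverse (1 - cdot w z) ^ (N + 1))) unit_ball"
    using one_minus_cdot_nz[OF _ z]
    by (intro holomorphic_several_cmult holomorphic_several_mult holomorphic_several_cdot holomorphic_several_power
      holomorphic_several_inverse holomorphic_several_one_minus_cdot) auto
   show "of_nat N * (cdot w h * inverse (1 - cdot w z) ^ (N + 1)) = E h w" if "w \<in> unit_ball" for w
    using that by (simp add: E_def kernel_deriv_def N_def cnj_cdot power_inverse divide_inverse)
  qed simp
  show "lp p (E h)"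
  proof (rule lp_bounded(1)[OF measurable_vol_continuous[OF holomorphic_several_continuous[OF h]] p_q(1)])
   show "norm (E h w) \<le> K * norm h" if "w \<in> unit_ball" for w
    using norm_kernel_deriv_le[OF z that, of h] that by (simp add: E_def K_def)
   show "0 \<le> K * norm h" using K by simp
  qed
 qed (simp add: E_def)
 have Ele: "norm (E h w) \<le> K * norm h" if "w \<in> unit_ball" for h w
  using norm_kernel_deriv_le[OF z that, of h] that by (simp add: E_def K_def)
 define D where "D h = cnj (\<ll> (E h))" for h
 have Dadd: "D (h + k) = D h + D k" for h k
 proof -
  have "E (h + k) = (\<lambda>w. E h w + E k w)"
   by (auto simp: E_def kernel_deriv_def cdot_add_left distrib_left add_divide_distrib fun_eq_iff)
  then show ?thesis using l_add[OF Eb Eb] by (simp add: D_def)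
 qed
 have Dc: "D (c *s h) = c * D h" for c h
 proof -
  have "E (c *s h) = (\<lambda>w. cnj c * E h w)"
   by (auto simp: E_def kernel_deriv_def cdot_smult_left fun_eq_iff)
  then show ?thesis using l_cmult[OF Eb] by (simp add: D_def)
 qed
 have Dn: "norm (D h) \<le> norm h * (L * K)" for h
  using l_sup_bound[OF Eb Ele] K by (simp add: D_def mult_ac)
 have lin: "bounded_linear D"
 proof (rule bounded_linear_intro[OF Dadd _ Dn])
  show "D (r *\<^sub>R h) = r *\<^sub>R D h" for r h
  proof -
   have "r *\<^sub>R h = complex_of_real r *s h" by (simp add: vec_eq_iff scaleR_conv_of_real[where 'a = complex])
   then show ?thesis by (simp only: Dc scaleR_conv_of_real)
  qed
 qed
 have "(repr has_derivative D) (at z)"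
 proof (rule has_derivative_quadratic[OF lin])
  show "(1 - norm z) / 2 > 0" using z by simp
  fix h :: "complex ^ 'n" assume h: "norm h \<le> (1 - norm z) / 2"
  then have "norm h < 1 - norm z" using z by simp
  then have zh: "z + h \<in> unit_ball" using norm_triangle_ineq[of z h] by simp
  note kb = kernel_bergman[OF zh p_q(1)] kernel_bergman[OF z p_q(1)]
  have kd: "(\<lambda>w. kernel (z + h) w - kernel z w) \<in> bergman_space p" using kb p_ge_1 by (intro bergman_space_diff)
  have "repr (z + h) - repr z - D h = cnj (\<ll> (kernel (z + h)) - \<ll> (kernel z) - \<ll> (E h))"
   using z zh by (simp add: repr_def D_def)
  also have "\<ll> (kernel (z + h)) - \<ll> (kernel z) - \<ll> (E h) = \<ll> (\<lambda>w. kernel (z + h) w - kernel z w - E h w)"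
   using l_diff[OF kb] l_diff[OF kd Eb] by simp
  finally have "norm (repr (z + h) - repr z - D h) = norm (\<ll> (\<lambda>w. kernel (z + h) w - kernel z w - E h w))" by simp
  also have "... \<le> L * (C * (norm h)\<^sup>2)"
  proof (rule l_sup_bound)
   show "(\<lambda>w. kernel (z + h) w - kernel z w - E h w) \<in> bergman_space p" by (rule bergman_space_diff[OF p_ge_1 kd Eb])
   show "C * (norm h)\<^sup>2 \<ge> 0" using C by simp
   fix w :: "complex ^ 'n" assume w: "w \<in> unit_ball"
   have "kernel (z + h) w - kernel z w - E h w = cnj (kernel w (z + h) - kernel w z - kernel_deriv w z h)"
    using w kernel_sym[OF zh w] kernel_sym[OF z w] by (simp add: E_def)
   then show "norm (kernel (z + h) w - kernel z w - E h w) \<le> C * (norm h)\<^sup>2"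
    using C(2)[OF w h] by (simp only: complex_mod_cnj)
  qed
  finally show "norm (repr (z + h) - repr z - D h) \<le> (L * C) * (norm h)\<^sup>2" by (simp add: mult_ac)
 qed
 then show "\<exists>D. cderiv repr D z" using Dc by (auto simp: cderiv_def)
qed

lemma repr_measurable: "repr \<in> borel_measurable vol"
 by (rule measurable_vol_continuous[OF holomorphic_several_continuous[OF repr_holomorphic]])

text \<open>The norm of \<open>repr\<close> is computed by testing against \<open>repr |repr|\<^sup>q\<^sup>-\<^sup>2\<close> on compact balls.\<close>

theorem repr_bergman:
 assumes C: "C \<ge> 0" "\<And>\<phi> :: 'n cfun. lp p \<phi> ==> bergman_norm p (proj \<phi>) \<le> C * bergman_norm p \<phi>"
 shows "repr \<in> bergman_space q" "bergman_norm q repr \<le> L * C"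
proof -
 note [measurable] = repr_measurable trunc_sets
 \<comment> \<open>For \<open>q < 2\<close> the exponent is negative, but at zeros of
   \<open>repr\<close> the product is 0 all the same.\<close>
 define \<phi> where "\<phi> k z = indicator (trunc k) z * (repr z * of_real (norm (repr z) powr (q - 2)))" for k z
 define X where "X k = (LINT z|vol. indicator (trunc k) z * norm (repr z) powr q)" for k
 have LC: "0 \<le> L * C" using L0 C by simp
 have bd: "\<exists>B. \<forall>z\<in>trunc k. norm (repr z) \<le> B" for k
 proof -
  have "continuous_on (trunc k) repr"
   by (rule continuous_on_subset[OF holomorphic_several_continuous[OF repr_holomorphic] trunc_subset])
  then have "compact (repr ` trunc k)" unfolding trunc_def by (rule compact_continuous_image) simp
  then have "bounded (repr ` trunc k)" by (rule compact_imp_bounded)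
  then show ?thesis unfolding bounded_iff by blast
 qed
 have q2: "a * a powr (q - 2) = a powr (q - 1)" "a * (a * a powr (q - 2)) = a powr q" if "a \<ge> 0" for a
 proof -
  show 1: "a * a powr (q - 2) = a powr (q - 1)" using that q_gt_1
   by (cases "a = 0") (simp_all add: powr_mult_base)
  show "a * (a * a powr (q - 2)) = a powr q" unfolding 1 using that q_gt_1
   by (cases "a = 0") (simp_all add: powr_mult_base)
 qed
 have n\<phi>: "norm (\<phi> k z) = indicator (trunc k) z * norm (repr z) powr (q - 1)" for k z
  using q2(1)[of "norm (repr z)"] by (simp add: \<phi>_def norm_mult indicator_def)
 have n\<phi>p: "norm (\<phi> k z) powr p = indicator (trunc k) z * norm (repr z) powr q" for k z
  unfolding n\<phi> using p_q by (simp add: indicator_def powr_powr q_minus_1_mult)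
 have \<phi>m: "\<phi> k \<in> borel_measurable vol" for k unfolding \<phi>_def by measurable
 have Xi: "integrable vol (\<lambda>z. indicator (trunc k) z * norm (repr z) powr q)" for k
 proof -
  obtain B where B: "\<And>z. z \<in> trunc k ==> norm (repr z) \<le> B" using bd by blast
  show ?thesis
  proof (rule vol.integrable_const_bound[where B = "\<bar>B\<bar> powr q"])
   show "AE z in vol. norm (indicator (trunc k) z * norm (repr z) powr q) \<le> \<bar>B\<bar> powr q"
    using B q_gt_1 by (intro AE_I2) (auto simp: indicator_def intro!: powr_mono2 order_trans[OF B])
  qed measurable
 qed
 have X0: "X k \<ge> 0" for k unfolding X_def by (intro integral_nonneg_AE AE_I2) simp
 have \<phi>l: "lp p (\<phi> k)" for k using \<phi>m Xi unfolding lp_def n\<phi>p by simp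
 have n\<phi>X: "bergman_norm p (\<phi> k) = X k powr (1 / p)" for k unfolding bergman_norm_def n\<phi>p X_def ..
 \<comment> \<open>Testing yields \<open>X k \<le> (L * C) * X k powr (1 / p)\<close>. Truncation
   has made \<open>X k\<close> finite, so the power can be cancelled, which leaves
   \<open>X k powr (1 / q)\<close>.\<close>
 have XLC: "X k \<le> (L * C) powr q" for k
 proof -
  have "\<ll> (proj (\<phi> k)) = (LINT z|vol. (\<phi> k z * \<ll> (kernel z)))"
   by (rule l_proj[OF \<phi>l[of k] trunc_radius[of k]]) (auto simp: \<phi>_def trunc_def)
  also have "... = (LINT z|vol. of_real (indicator (trunc k) z * norm (repr z) powr q))"
  proof (rule lint_cong[OF refl])
   fix z :: "complex ^ 'n" assume "z \<in> space vol"
   then have "\<ll> (kernel z) = cnj (repr z)" by (simp add: repr_def)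
   then have "\<phi> k z * \<ll> (kernel z) = indicator (trunc k) z * ((repr z * cnj (repr z)) * of_real (norm (repr z) powr (q - 2)))"
    by (simp add: \<phi>_def mult_ac)
   also have "repr z * cnj (repr z) = of_real (norm (repr z) * norm (repr z))"
    by (simp only: complex_norm_square[symmetric] of_real_mult power2_eq_square)
   finally show "\<phi> k z * \<ll> (kernel z) = of_real (indicator (trunc k) z * norm (repr z) powr q)"
    using q2(2)[of "norm (repr z)"] by (simp add: indicator_def mult.assoc flip: of_real_mult)
  qed
  also have "... = of_real (X k)" unfolding X_def by (rule integral_complex_of_real)
  finally have "X k = norm (\<ll> (proj (\<phi> k)))" using X0 by simp
  also have "... \<le> L * bergman_norm p (proj (\<phi> k))"
   by (rule l_bound[OF proj_in_bergman[OF \<phi>l]])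
  also have "... \<le> L * (C * X k powr (1 / p))" using C(2)[OF \<phi>l] L0 unfolding n\<phi>X[symmetric] by (intro mult_left_mono)
  finally have le: "X k \<le> (L * C) * X k powr (1 / p)" by (simp add: mult_ac)
  show ?thesis
  proof (cases "X k = 0")
   case False
   then have pos: "X k > 0" using X0[of k] by simp
   have "X k = X k powr (1 / q) * X k powr (1 / p)" using pos pq by (simp add: add.commute flip: powr_add)
   then have "X k powr (1 / q) * X k powr (1 / p) \<le> (L * C) * X k powr (1 / p)" using le by simp
   then have "X k powr (1 / q) \<le> L * C" using pos by simp
   then have "(X k powr (1 / q)) powr q \<le> (L * C) powr q" using p_q by (intro powr_mono2) auto
   then show ?thesis using pos p_q by (simp add: powr_powr)
  qed simp
 qed
 have "(\<integral>\<^sup>+z. ennreal (norm (repr z) powr q) \<partial>vol) \<le> (\<integral>\<^sup>+z. (SUP k. ennreal (indicator (trunc k) z * norm (repr z) powr q)) \<partial>vol)"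
 proof (rule nn_integral_mono)
  fix z :: "complex ^ 'n" assume "z \<in> space vol"
  then have "\<forall>\<^sub>F k in sequentially. z \<in> trunc k" by (intro in_trunc_eventually) simp
  then obtain k where "z \<in> trunc k" by (auto simp: eventually_sequentially)
  then show "ennreal (norm (repr z) powr q) \<le> (SUP k. ennreal (indicator (trunc k) z * norm (repr z) powr q))"
   by (intro SUP_upper2[of k]) auto
 qed
 also have "... = (SUP k. (\<integral>\<^sup>+z. ennreal (indicator (trunc k) z * norm (repr z) powr q) \<partial>vol))"
 proof (rule nn_integral_monotone_convergence_SUP)
  have "trunc i \<subseteq> (trunc (Suc i) :: (complex ^ 'n) set)" for i
   unfolding trunc_def by (intro subset_cball) (simp add: frac_le)
  then show "incseq (\<lambda>k z. ennreal (indicator (trunc k) z * norm (repr z) powr q))"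
   by (intro incseq_SucI le_funI ennreal_leI mult_right_mono) (auto simp: indicator_def dest: subsetD)
 qed measurable
 also have "... \<le> ennreal ((L * C) powr q)"
 proof (rule SUP_least)
  fix k
  have "(\<integral>\<^sup>+z. ennreal (indicator (trunc k) z * norm (repr z) powr q) \<partial>vol) = ennreal (X k)"
   unfolding X_def using Xi by (intro nn_integral_eq_integral) auto
  then show "(\<integral>\<^sup>+z. ennreal (indicator (trunc k) z * norm (repr z) powr q) \<partial>vol) \<le> ennreal ((L * C) powr q)"
   using XLC by (simp add: ennreal_leI)
 qed
 finally have nn: "(\<integral>\<^sup>+z. ennreal (norm (repr z) powr q) \<partial>vol) \<le> ennreal ((L * C) powr q)" .
 then have i: "integrable vol (\<lambda>z. norm (repr z) powr q)"
  by (intro integrableI_nonneg) (auto intro: order_le_less_trans)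
 then have "lp q repr" using repr_measurable by (simp add: lp_def)
 then show "repr \<in> bergman_space q" by (intro bergman_spaceI repr_holomorphic) (auto simp: repr_def)
 show "bergman_norm q repr \<le> L * C"
  using nn i LC p_q by (intro bergman_norm_leI) (auto simp: nn_integral_eq_integral)
qed

text \<open>\<open>l_proj\<close> gives the formula for the truncations of \<open>f\<close>. On one
  side they converge by dominated convergence, on the other because \<open>proj\<close> is bounded
  and \<open>proj f = f\<close>.\<close>

theorem repr_pairing:
 assumes f: "f \<in> bergman_space p"
 shows "\<ll> f = pairing f repr"
proof -
 obtain C where C: "C > 0" "\<And>\<phi> :: 'n cfun. lp p \<phi> ==> proj \<phi> \<in> bergman_space p \<and> bergman_norm p (proj \<phi>) \<le> C * bergman_norm p \<phi>"
  using proj_bounded by blast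
 have rb: "repr \<in> bergman_space q" by (rule repr_bergman(1)[of C]) (use C in auto)
 have fl: "lp p f" by (rule bergman_spaceD(1)[OF f])
 note t = lp_trunc[OF fl p_q(1)]
 have fi: "integrable vol (\<lambda>z. f z * cnj (repr z))" by (rule pairing_bound(2)[OF fl bergman_spaceD(1)[OF rb]])
 note [measurable] = lp_measurable[OF fl] repr_measurable trunc_sets
 have eq: "\<ll> (proj (\<lambda>z. indicator (trunc k) z * f z)) = (LINT z|vol. indicator (trunc k) z * (f z * cnj (repr z)))" for k
 proof -
  have "\<ll> (proj (\<lambda>z. indicator (trunc k) z * f z)) = (LINT z|vol. (indicator (trunc k) z * f z * \<ll> (kernel z)))"
   by (rule l_proj[OF t(1)[of k] trunc_radius[of k]]) (auto simp: trunc_def)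
  also have "... = (LINT z|vol. indicator (trunc k) z * (f z * cnj (repr z)))"
   by (intro lint_cong) (auto simp: repr_def)
  finally show ?thesis .
 qed
 have "(\<lambda>k. \<integral>z. indicator (trunc k) z * (f z * cnj (repr z)) \<partial>vol) \<longlonglongrightarrow> (LINT z|vol. f z * cnj (repr z))"
 proof (rule integral_dominated_convergence[where w = "\<lambda>z. norm (f z * cnj (repr z))"])
  show "AE z in vol. (\<lambda>k. indicator (trunc k) z * (f z * cnj (repr z))) \<longlonglongrightarrow> f z * cnj (repr z)"
  proof (rule AE_I2)
   fix z :: "complex ^ 'n" assume "z \<in> space vol"
   then show "(\<lambda>k. indicator (trunc k) z * (f z * cnj (repr z))) \<longlonglongrightarrow> f z * cnj (repr z)"
    using tendsto_mult[OF trunc_indicator_lim tendsto_const, of z "f z * cnj (repr z)"] by simp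
  qed
  show "AE z in vol. norm (indicator (trunc k) z * (f z * cnj (repr z))) \<le> norm (f z * cnj (repr z))" for k
   by (intro AE_I2) (simp add: indicator_def)
 qed (use fi in \<open>measurable, simp\<close>)
 then have 1: "(\<lambda>k. \<ll> (proj (\<lambda>z. indicator (trunc k) z * f z))) \<longlonglongrightarrow> pairing f repr"
  unfolding eq pairing_def .
 have 2: "(\<lambda>k. \<ll> (proj (\<lambda>z. indicator (trunc k) z * f z))) \<longlonglongrightarrow> \<ll> f"
 proof (rule LIM_zero_cancel)
  show "(\<lambda>k. \<ll> (proj (\<lambda>z. indicator (trunc k) z * f z)) - \<ll> f) \<longlonglongrightarrow> 0"
  proof (rule Lim_null_comparison)
   show "(\<lambda>k. L * (C * bergman_norm p (\<lambda>z. f z - indicator (trunc k) z * f z))) \<longlonglongrightarrow> 0"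
    by (intro tendsto_mult_right_zero t(3))
   have "norm (\<ll> (proj (\<lambda>z. indicator (trunc k) z * f z)) - \<ll> f) \<le> L * (C * bergman_norm p (\<lambda>z. f z - indicator (trunc k) z * f z))" for k
   proof -
    have "proj (\<lambda>z. f z - indicator (trunc k) z * f z) = (\<lambda>w. f w - proj (\<lambda>z. indicator (trunc k) z * f z) w)"
    proof
     fix w :: "complex ^ 'n"
     show "proj (\<lambda>z. f z - indicator (trunc k) z * f z) w = f w - proj (\<lambda>z. indicator (trunc k) z * f z) w"
     proof (cases "w \<in> unit_ball")
      case True
      have "f w = proj f w" by (simp add: proj_bergman[OF f])
      moreover have "proj (\<lambda>z. f z - indicator (trunc k) z * f z) w = proj f w - proj (\<lambda>z. indicator (trunc k) z * f z) w"
       using True lp_integrable_mult_kernel[OF fl True] lp_integrable_mult_kernel[OF t(1) True]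
       by (simp add: proj_def left_diff_distrib)
      ultimately show ?thesis by simp
     qed (use bergman_spaceD(3)[OF f] in \<open>simp add: proj_def\<close>)
    qed
    then have "\<ll> (proj (\<lambda>z. f z - indicator (trunc k) z * f z)) = \<ll> f - \<ll> (proj (\<lambda>z. indicator (trunc k) z * f z))"
     using l_diff[OF f] C(2)[OF t(1)] by simp
    then have "norm (\<ll> (proj (\<lambda>z. indicator (trunc k) z * f z)) - \<ll> f) = norm (\<ll> (proj (\<lambda>z. f z - indicator (trunc k) z * f z)))"
     by (simp add: norm_minus_commute)
    also have "... \<le> L * bergman_norm p (proj (\<lambda>z. f z - indicator (trunc k) z * f z))"
     using C(2)[OF t(2)] by (intro l_bound) simp
    also have "... \<le> L * (C * bergman_norm p (\<lambda>z. f z - indicator (trunc k) z * f z))"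
     using C(2)[OF t(2)] L0 by (intro mult_left_mono) auto
    finally show ?thesis .
   qed
   then show "\<forall>\<^sub>F k in sequentially. norm (\<ll> (proj (\<lambda>z. indicator (trunc k) z * f z)) - \<ll> f) \<le> L * (C * bergman_norm p (\<lambda>z. f z - indicator (trunc k) z * f z))"
    by simp
  qed
 qed
 show ?thesis by (rule LIMSEQ_unique[OF 2 1])
qed

end

section \<open>Bounded operators, adjoints and integral kernels of operators\<close>

lemma bounded_opD:
 assumes "bounded_op p T"
 shows "\<And>f. f \<in> bergman_space p ==> T f \<in> bergman_space p"
  "\<And>f. f \<notin> bergman_space p ==> T f = (\<lambda>_. 0)"
  "\<And>f g. f \<in> bergman_space p ==> g \<in> bergman_space p ==> T (\<lambda>z. f z + g z) = (\<lambda>z. T f z + T g z)"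
  "\<And>c f. f \<in> bergman_space p ==> T (\<lambda>z. c * f z) = (\<lambda>z. c * T f z)"
 using assms unfolding bounded_op_def by auto

lemma bounded_op_bound:
 fixes T :: "('n::finite) oper"
 assumes "bounded_op p T"
 obtains C where "C \<ge> 0" "\<And>f. f \<in> bergman_space p ==> bergman_norm p (T f) \<le> C * bergman_norm p f"
proof -
 obtain C where C: "\<And>f. f \<in> bergman_space p ==> bergman_norm p (T f) \<le> C * bergman_norm p f"
  using assms unfolding bounded_op_def by blast
 have "bergman_norm p (T f) \<le> max C 0 * bergman_norm p f" if "f \<in> bergman_space p" for f
  using C[OF that] mult_right_mono[of C "max C 0" "bergman_norm p f"] bergman_norm_nonneg[of p f] by simp
 then show ?thesis by (intro that[of "max C 0"]) auto
qed

lemma bergman_norm_zero: "p > 0 ==> bergman_norm p (\<lambda>_. 0) = 0"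
 by (simp add: lp_const)

lemma op_norm_le:
 fixes D :: "('n::finite) oper"
 assumes p: "p > 0" and "K \<ge> 0" and le: "\<And>f. f \<in> bergman_space p ==> bergman_norm p (D f) \<le> K * bergman_norm p f"
 shows "op_norm p D \<le> K"
 unfolding op_norm_def
proof (rule cSup_least)
 show "{bergman_norm p (D f) | f. f \<in> bergman_space p \<and> bergman_norm p f \<le> 1} \<noteq> {}"
  using bergman_space_zero[OF p] by (auto intro!: exI[of _ "\<lambda>_. 0"] simp: bergman_norm_zero[OF p])
 fix x assume "x \<in> {bergman_norm p (D f) | f. f \<in> bergman_space p \<and> bergman_norm p f \<le> 1}"
 then obtain f where f: "x = bergman_norm p (D f)" "f \<in> bergman_space p" "bergman_norm p f \<le> 1" by auto
 have "x \<le> K * bergman_norm p f" using le f by simp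
 also have "... \<le> K * 1" using f assms by (intro mult_left_mono) auto
 finally show "x \<le> K" by simp
qed

lemma op_norm_nonneg:
 fixes D :: "('n::finite) oper"
 assumes p: "p > 0" and le: "\<And>f. f \<in> bergman_space p ==> bergman_norm p (D f) \<le> K * bergman_norm p f"
 shows "0 \<le> op_norm p D"
proof -
 have "bergman_norm p (D (\<lambda>_. 0)) \<le> op_norm p D"
  unfolding op_norm_def
 proof (rule cSup_upper)
  show "bdd_above {bergman_norm p (D f) | f. f \<in> bergman_space p \<and> bergman_norm p f \<le> 1}"
  proof (rule bdd_aboveI)
   fix x assume "x \<in> {bergman_norm p (D f) | f. f \<in> bergman_space p \<and> bergman_norm p f \<le> 1}"
   then obtain f where f: "x = bergman_norm p (D f)" "f \<in> bergman_space p" "bergman_norm p f \<le> 1" by auto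
   have "x \<le> K * bergman_norm p f" using le f by simp
   also have "... \<le> \<bar>K\<bar> * 1" using f bergman_norm_nonneg[of p f] by (intro mult_mono) auto
   finally show "x \<le> \<bar>K\<bar>" by simp
  qed
  show "bergman_norm p (D (\<lambda>_. 0)) \<in> {bergman_norm p (D f) | f. f \<in> bergman_space p \<and> bergman_norm p f \<le> 1}"
   using bergman_space_zero[OF p] by (auto intro!: exI[of _ "\<lambda>_. 0"] simp: bergman_norm_zero[OF p])
 qed
 then show ?thesis using bergman_norm_nonneg order_trans by blast
qed

text \<open>A supremum of reals bounds its set only if the set is bounded above, which
  \<open>K\<close> guarantees. The estimate follows by normalizing \<open>f\<close>; if the norm of
  \<open>f\<close> is 0, it is \<open>K\<close> that forces the norm of \<open>D f\<close> to be
  0.\<close>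

lemma op_norm_upper:
 fixes D :: "('n::finite) oper"
 assumes p: "p > 0" and le: "\<And>f. f \<in> bergman_space p ==> bergman_norm p (D f) \<le> K * bergman_norm p f"
  and hom: "\<And>c f. f \<in> bergman_space p ==> D (\<lambda>z. c * f z) = (\<lambda>z. c * D f z)"
  and Db: "\<And>f. f \<in> bergman_space p ==> D f \<in> bergman_space p"
  and f: "f \<in> bergman_space p"
 shows "bergman_norm p (D f) \<le> op_norm p D * bergman_norm p f"
proof (cases "bergman_norm p f = 0")
 case True
 then show ?thesis using le[OF f] bergman_norm_nonneg[of p "D f"] by simp
next
 case False
 define b where "b = bergman_norm p f"
 have b: "b > 0" using False bergman_norm_nonneg[of p f] by (simp add: b_def)
 define g where "g z = of_real (1 / b) * f z" for z
 have g: "g \<in> bergman_space p" unfolding g_def using f p by (intro bergman_space_cmult)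
 have ng: "bergman_norm p g = 1"
  unfolding g_def lp_cmult(2)[OF bergman_spaceD(1)[OF f] p] using b by (simp add: b_def[symmetric] norm_divide)
 have "bergman_norm p (D g) \<le> op_norm p D"
  unfolding op_norm_def
 proof (rule cSup_upper)
  show "bergman_norm p (D g) \<in> {bergman_norm p (D f) | f. f \<in> bergman_space p \<and> bergman_norm p f \<le> 1}"
   using g ng by auto
  show "bdd_above {bergman_norm p (D f) | f. f \<in> bergman_space p \<and> bergman_norm p f \<le> 1}"
  proof (rule bdd_aboveI)
   fix x assume "x \<in> {bergman_norm p (D f) | f. f \<in> bergman_space p \<and> bergman_norm p f \<le> 1}"
   then obtain f where f: "x = bergman_norm p (D f)" "f \<in> bergman_space p" "bergman_norm p f \<le> 1" by auto
   have "x \<le> K * bergman_norm p f" using le f by simp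
   also have "... \<le> \<bar>K\<bar> * 1" using f bergman_norm_nonneg[of p f] by (intro mult_mono) auto
   finally show "x \<le> \<bar>K\<bar>" by simp
  qed
 qed
 moreover have "D g = (\<lambda>z. of_real (1 / b) * D f z)" unfolding g_def by (rule hom[OF f])
 then have "bergman_norm p (D g) = (1 / b) * bergman_norm p (D f)"
  using lp_cmult(2)[OF bergman_spaceD(1)[OF Db[OF f]] p, of "of_real (1 / b)"] b by (simp add: norm_divide)
 ultimately show ?thesis using b by (simp add: b_def[symmetric] divide_le_eq)
qed

context conjugate_exponents
begin

lemma bounded_op_diff_bound:
 fixes S T :: "('n::finite) oper"
 assumes S: "bounded_op p S" and T: "bounded_op p T" and f: "f \<in> bergman_space p"
 shows "bergman_norm p ((S - T) f) \<le> op_norm p (S - T) * bergman_norm p f" "(S - T) f \<in> bergman_space p"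
  "0 \<le> op_norm p (S - T)"
proof -
 obtain C1 where C1: "C1 \<ge> 0" "\<And>f. f \<in> bergman_space p ==> bergman_norm p (S f) \<le> C1 * bergman_norm p f"
  using bounded_op_bound[OF S] by blast
 obtain C2 where C2: "C2 \<ge> 0" "\<And>f. f \<in> bergman_space p ==> bergman_norm p (T f) \<le> C2 * bergman_norm p f"
  using bounded_op_bound[OF T] by blast
 have e: "(S - T) f = (\<lambda>z. S f z - T f z)" for f by (simp add: fun_eq_iff)
 have b: "(S - T) f \<in> bergman_space p" if "f \<in> bergman_space p" for f
  unfolding e using that bounded_opD(1)[OF S] bounded_opD(1)[OF T] p_ge_1 by (intro bergman_space_diff) auto
 have n: "bergman_norm p ((S - T) f) \<le> (C1 + C2) * bergman_norm p f" if f: "f \<in> bergman_space p" for f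
 proof -
  have "bergman_norm p ((S - T) f) \<le> bergman_norm p (S f) + bergman_norm p (T f)"
   unfolding e using bounded_opD(1)[OF S f] bounded_opD(1)[OF T f] p_ge_1 by (intro lp_diff(2) bergman_spaceD(1))
  then show ?thesis using C1(2)[OF f] C2(2)[OF f] by (simp add: distrib_right)
 qed
 have hom: "(S - T) (\<lambda>z. c * f z) = (\<lambda>z. c * (S - T) f z)" if "f \<in> bergman_space p" for c f
  unfolding e using bounded_opD(4)[OF S that] bounded_opD(4)[OF T that] by (simp add: right_diff_distrib)
 show "(S - T) f \<in> bergman_space p" by (rule b[OF f])
 show "bergman_norm p ((S - T) f) \<le> op_norm p (S - T) * bergman_norm p f"
  by (rule op_norm_upper[OF p_q(1) n hom b f])
 show "0 \<le> op_norm p (S - T)" by (rule op_norm_nonneg[OF p_q(1) n])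
qed

lemma pairing_cnj: "cnj (pairing f g) = pairing g f"
 unfolding pairing_def Bochner_Integration.integral_cnj[symmetric]
 by (simp add: mult.commute del: Bochner_Integration.integral_cnj)

lemma functional_pairing:
 fixes T :: "('n::finite) oper"
 assumes T: "bounded_op p T" and C: "C \<ge> 0" "\<And>f. f \<in> bergman_space p ==> bergman_norm p (T f) \<le> C * bergman_norm p f"
  and g: "g \<in> bergman_space q"
 shows "bergman_functional p q (\<lambda>f. pairing (T f) g) (C * bergman_norm q g)"
proof
 note gl = bergman_spaceD(1)[OF g]
 have Tl: "lp p (T f)" if "f \<in> bergman_space p" for f by (rule bergman_spaceD(1)[OF bounded_opD(1)[OF T that]])
 show "0 \<le> C * bergman_norm q g" using C bergman_norm_nonneg[of q g] by simp
 show "pairing (T (\<lambda>z. f z + h z)) g = pairing (T f) g + pairing (T h) g"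
  if "f \<in> bergman_space p" "h \<in> bergman_space p" for f h
  unfolding bounded_opD(3)[OF T that] using pairing_bound(2)[OF Tl[OF that(1)] gl] pairing_bound(2)[OF Tl[OF that(2)] gl]
  by (simp add: pairing_def distrib_right)
 show "pairing (T (\<lambda>z. c * f z)) g = c * pairing (T f) g" if "f \<in> bergman_space p" for c f
  unfolding bounded_opD(4)[OF T that] by (simp add: pairing_def mult.assoc)
 show "norm (pairing (T f) g) \<le> C * bergman_norm q g * bergman_norm p f" if f: "f \<in> bergman_space p" for f
 proof -
  have "norm (pairing (T f) g) \<le> bergman_norm p (T f) * bergman_norm q g" by (rule pairing_bound(1)[OF Tl[OF f] gl])
  also have "... \<le> (C * bergman_norm p f) * bergman_norm q g" using C(2)[OF f] bergman_norm_nonneg by (rule mult_right_mono)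
  finally show ?thesis by (simp add: mult_ac)
 qed
qed

text \<open>At \<open>g\<close> this is the representing function \<open>repr\<close> of the
  functional that sends \<open>f\<close> to \<open>pairing (T f) g\<close>.\<close>

definition adj :: "('n::finite) oper \<Rightarrow> 'n oper" where
 "adj T g z = (if g \<in> bergman_space q \<and> z \<in> unit_ball then cnj (pairing (T (kernel z)) g) else 0)"

theorem adj:
 fixes T :: "('n::finite) oper"
 assumes T: "bounded_op p T"
 shows "bounded_op q (adj T)" "\<And>f g. f \<in> bergman_space p ==> g \<in> bergman_space q ==> pairing (T f) g = pairing f (adj T g)"
proof -
 obtain C where C: "C \<ge> 0" "\<And>f. f \<in> bergman_space p ==> bergman_norm p (T f) \<le> C * bergman_norm p f"
  using bounded_op_bound[OF T] by blast
 obtain B where B: "B > 0" "\<And>\<phi> :: 'n cfun. lp p \<phi> ==> proj \<phi> \<in> bergman_space p \<and> bergman_norm p (proj \<phi>) \<le> B * bergman_norm p \<phi>"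
  using proj_bounded by blast
 have Kl: "lp p (T (kernel z))" if "z \<in> unit_ball" for z
  using that p_q by (intro bergman_spaceD(1) bounded_opD(1)[OF T] kernel_bergman)
 have main: "adj T g \<in> bergman_space q \<and> bergman_norm q (adj T g) \<le> (C * B) * bergman_norm q g \<and>
   (\<forall>f\<in>bergman_space p. pairing (T f) g = pairing f (adj T g))" if g: "g \<in> bergman_space q" for g
 proof -
  interpret F: bergman_functional p q "\<lambda>f. pairing (T f) g" "C * bergman_norm q g"
   by (rule functional_pairing[OF T C g])
  have "F.repr = adj T g" using g by (auto simp: F.repr_def adj_def fun_eq_iff)
  then show ?thesis using F.repr_bergman[of B] F.repr_pairing B by (simp add: mult_ac less_imp_le)
 qed
 then show "\<And>f g. f \<in> bergman_space p ==> g \<in> bergman_space q ==> pairing (T f) g = pairing f (adj T g)" by blast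
 have add: "adj T (\<lambda>z. f z + g z) = (\<lambda>z. adj T f z + adj T g z)" if fg: "f \<in> bergman_space q" "g \<in> bergman_space q" for f g
 proof
  fix z :: "complex ^ 'n"
  have "(\<lambda>z. f z + g z) \<in> bergman_space q" using fg q_gt_1 by (intro bergman_space_add) auto
  then show "adj T (\<lambda>z. f z + g z) z = adj T f z + adj T g z"
   using fg pairing_bound(2)[OF Kl bergman_spaceD(1)[OF fg(1)]] pairing_bound(2)[OF Kl bergman_spaceD(1)[OF fg(2)]]
   by (simp add: adj_def pairing_def distrib_left)
 qed
 have cmult: "adj T (\<lambda>z. c * f z) = (\<lambda>z. c * adj T f z)" if f: "f \<in> bergman_space q" for c f
 proof
  fix z :: "complex ^ 'n"
  have "(\<lambda>z. c * f z) \<in> bergman_space q" using f p_q by (intro bergman_space_cmult)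
  moreover have "pairing (T (kernel z)) (\<lambda>z. c * f z) = cnj c * pairing (T (kernel z)) f"
   by (simp add: pairing_def mult.left_commute)
  ultimately show "adj T (\<lambda>z. c * f z) z = c * adj T f z" using f by (simp add: adj_def)
 qed
 have "adj T g = (\<lambda>_. 0)" if "g \<notin> bergman_space q" for g using that by (auto simp: adj_def fun_eq_iff)
 then show "bounded_op q (adj T)" unfolding bounded_op_def using main add cmult by blast
qed

theorem adjoint_op_eq:
 fixes T :: "('n::finite) oper"
 assumes T: "bounded_op p T"
 shows "adjoint_op p q T = adj T"
 unfolding adjoint_op_def
proof (rule the_equality)
 show "bounded_op q (adj T) \<and> (\<forall>f\<in>bergman_space p. \<forall>g\<in>bergman_space q. pairing (T f) g = pairing f (adj T g))"
  using adj[OF T] by blast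
 fix S assume S: "bounded_op q S \<and> (\<forall>f\<in>bergman_space p. \<forall>g\<in>bergman_space q. pairing (T f) g = pairing f (S g))"
 show "S = adj T"
 proof (intro ext)
  fix g and z :: "complex ^ 'n"
  interpret sw: conjugate_exponents q p by (rule swap)
  show "S g z = adj T g z"
  proof (cases "g \<in> bergman_space q")
   case True
   then have Sg: "S g \<in> bergman_space q" using S bounded_opD(1) by blast
   show ?thesis
   proof (cases "z \<in> unit_ball")
    case z: True
    have "S g z = cnj (pairing (kernel z) (S g))" using sw.pairing_kernel[OF Sg z] by (simp add: pairing_cnj)
    also have "pairing (kernel z) (S g) = pairing (T (kernel z)) g"
     using S True kernel_bergman[OF z p_q(1)] by simp
    finally show ?thesis using True z by (simp add: adj_def)
   qed (use bergman_spaceD(3)[OF Sg] in \<open>simp add: adj_def\<close>)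
  next
   case False
   then have "S g = (\<lambda>_. 0)" using S bounded_opD(2)[of q S g] by blast
   then show ?thesis using False by (simp add: adj_def)
  qed
 qed
qed

lemma adj_kernel:
 fixes T :: "('n::finite) oper"
 assumes T: "bounded_op p T" and zw: "z \<in> unit_ball" "w \<in> unit_ball"
 shows "adj T (kernel z) w = cnj (T (kernel w) z)"
 using zw kernel_bergman[of z q] kernel_bergman[of w p] p_q bounded_opD(1)[OF T]
 by (simp add: adj_def pairing_kernel)

text \<open>Evaluation at \<open>x\<close> is the pairing with \<open>kernel x\<close>, and moving
  \<open>T\<close> to the other side turns \<open>T f x\<close> into an integral against
  \<open>f\<close>. As a function of \<open>u\<close> the kernel \<open>T (kernel u) x\<close> is
  the conjugate of the adjoint applied to \<open>kernel x\<close>, hence in L^q.\<close>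

theorem operator_kernel:
 fixes T :: "('n::finite) oper"
 assumes T: "bounded_op p T" and x: "x \<in> unit_ball"
 shows "lp q (\<lambda>u. T (kernel u) x)"
  "\<And>f. f \<in> bergman_space p ==> T f x = (LINT u|vol. f u * T (kernel u) x)"
proof -
 interpret sw: conjugate_exponents q p by (rule swap)
 have kx: "kernel x \<in> bergman_space q" using x p_q by (intro kernel_bergman)
 have a: "adj T (kernel x) \<in> bergman_space q" by (rule bounded_opD(1)[OF adj(1)[OF T] kx])
 have e: "cnj (adj T (kernel x) u) = T (kernel u) x" if "u \<in> unit_ball" for u
  using adj_kernel[OF T x that] by simp
 have l: "lp q (\<lambda>u. cnj (adj T (kernel x) u))" using bergman_spaceD(1)[OF a] by (simp add: lp_cnj)
 have m: "(\<lambda>u. T (kernel u) x) \<in> borel_measurable vol"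
  using lp_measurable[OF l] by (rule measurable_cong[THEN iffD1, rotated]) (simp add: e)
 show "lp q (\<lambda>u. T (kernel u) x)" by (rule lp_dominated(1)[OF l m p_q(2)]) (simp add: e)
 fix f :: "'n cfun" assume f: "f \<in> bergman_space p"
 have "T f x = pairing (T f) (kernel x)" using pairing_kernel[OF bounded_opD(1)[OF T f] x] by simp
 also have "... = pairing f (adj T (kernel x))" by (rule adj(2)[OF T f kx])
 also have "... = (LINT u|vol. f u * T (kernel u) x)"
  unfolding pairing_def by (intro lint_cong) (auto simp: e)
 finally show "T f x = (LINT u|vol. f u * T (kernel u) x)" .
qed

text \<open>Joint continuity supplies the joint measurability for Fubini. In \<open>u\<close> it
  comes from the sup norm continuity of \<open>kernel u\<close> together with
  \<open>point_eval\<close>, in \<open>x\<close> from holomorphy.\<close>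

lemma operator_kernel_continuous:
 fixes T :: "('n::finite) oper"
 assumes T: "bounded_op p T"
 shows "continuous_on (unit_ball \<times> unit_ball) (\<lambda>y. T (kernel (fst y)) (snd y))"
proof (rule continuous_at_imp_continuous_on, rule ballI)
 fix y0 :: "(complex ^ 'n) \<times> (complex ^ 'n)" assume "y0 \<in> unit_ball \<times> unit_ball"
 then obtain u0 x0 where y0: "y0 = (u0, x0)" "u0 \<in> unit_ball" "x0 \<in> unit_ball" by (cases y0) auto
 obtain C where C: "C \<ge> 0" "\<And>f. f \<in> bergman_space p ==> bergman_norm p (T f) \<le> C * bergman_norm p f"
  using bounded_op_bound[OF T] by blast
 define \<rho> where "\<rho> = (1 + max (norm u0) (norm x0)) / 2"
 have \<rho>: "0 \<le> \<rho>" "\<rho> < 1" "norm u0 < \<rho>" "norm x0 < \<rho>" using y0 by (auto simp: \<rho>_def max_def)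
 \<comment> \<open>The \<open>+ 1\<close> keeps the divisor positive when
   \<open>C = 0\<close>.\<close>
 define M where "M = 1 / (1 - \<rho>) ^ (CARD('n) + 1) * C + 1"
 have M: "M > 0" using C \<rho> by (simp add: M_def add_nonneg_pos)
 have TKb: "T (kernel u0) \<in> bergman_space p" using y0 p_q by (intro bounded_opD(1)[OF T] kernel_bergman) auto
 show "isCont (\<lambda>y. T (kernel (fst y)) (snd y)) y0"
  unfolding continuous_at_eps_delta
 proof (intro allI impI)
  fix e :: real assume e: "e > 0"
  obtain \<delta> where \<delta>: "\<delta> > 0" "\<And>z z' w :: complex ^ 'n. z \<in> cball 0 \<rho> ==> z' \<in> cball 0 \<rho> ==> dist z z' < \<delta> ==>
   norm (kernel z w - kernel z' w) \<le> e / (2 * M)"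
   using kernel_uniform[OF \<rho>(1,2), of "e / (2 * M)"] e M by auto
  have "isCont (T (kernel u0)) x0"
   using holomorphic_several_continuous[OF bergman_spaceD(2)[OF TKb]] y0(3) continuous_on_eq_continuous_at[OF open_ball] by blast
  then obtain \<eta> where \<eta>: "\<eta> > 0" "\<And>x. dist x x0 < \<eta> ==> dist (T (kernel u0) x) (T (kernel u0) x0) < e / 2"
   unfolding continuous_at_eps_delta using e by (meson half_gt_zero)
  define d where "d = min (min \<delta> \<eta>) (min (\<rho> - norm u0) (\<rho> - norm x0))"
  have "dist (T (kernel (fst y)) (snd y)) (T (kernel (fst y0)) (snd y0)) < e" if y: "dist y y0 < d" for y
  proof -
   obtain u x where ux: "y = (u, x)" by (cases y)
   have du: "dist u u0 < d" and dx: "dist x x0 < d"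
    using y dist_fst_le[of y y0] dist_snd_le[of y y0] by (auto simp: ux y0)
   have "norm u \<le> norm u0 + dist u u0" "norm x \<le> norm x0 + dist x x0" by (metis dist_norm norm_triangle_sub)+
   then have nu: "norm u \<le> \<rho>" "norm x \<le> \<rho>" using du dx by (auto simp: d_def)
   then have ub: "u \<in> unit_ball" "x \<in> unit_ball" using \<rho> by auto
   define k where "k w = kernel u w - kernel u0 w" for w
   have ku: "kernel u \<in> bergman_space p" "kernel u0 \<in> bergman_space p" using ub y0 p_q by (auto intro: kernel_bergman simp del: mem_ball_0)
   have kb: "k \<in> bergman_space p" unfolding k_def using ku p_ge_1 by (intro bergman_space_diff)
   have keq: "kernel u = (\<lambda>w. k w + kernel u0 w)" by (simp add: k_def)
   have Tk: "T (kernel u) x = T k x + T (kernel u0) x"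
    by (subst keq) (simp add: bounded_opD(3)[OF T kb ku(2)])
   have "bergman_norm p k \<le> e / (2 * M)"
    using \<delta>(2)[of u u0] nu \<rho> du e M p_q
    by (intro lp_bounded(2) lp_measurable[OF bergman_spaceD(1)[OF kb]]) (auto simp: k_def d_def)
   then have "bergman_norm p (T k) \<le> C * (e / (2 * M))"
    using C(2)[OF kb] C(1) by (meson mult_left_mono order_trans)
   then have "norm (T k x) \<le> 1 / (1 - norm x) ^ (CARD('n) + 1) * (C * (e / (2 * M)))"
    using point_eval[OF bounded_opD(1)[OF T kb] ub(2)] ub by (meson divide_nonneg_nonneg mult_left_mono order_trans zero_le_one zero_le_power diff_ge_0_iff_ge mem_ball_0 less_imp_le)
   also have "... \<le> 1 / (1 - \<rho>) ^ (CARD('n) + 1) * (C * (e / (2 * M)))"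
    using nu \<rho> C e M by (intro mult_right_mono divide_left_mono power_mono mult_pos_pos zero_less_power) auto
   also have "... = (1 / (1 - \<rho>) ^ (CARD('n) + 1) * C) * (e / (2 * M))" by (simp only: mult.assoc)
   also have "... \<le> M * (e / (2 * M))" using e M by (intro mult_right_mono) (auto simp: M_def)
   also have "... = e / 2" using M by simp
   finally have "norm (T k x) \<le> e / 2" .
   moreover have "norm (T (kernel u0) x - T (kernel u0) x0) < e / 2" using \<eta>(2)[of x] dx by (simp add: d_def dist_norm)
   ultimately have "norm (T k x + (T (kernel u0) x - T (kernel u0) x0)) < e"
    using norm_triangle_ineq[of "T k x" "T (kernel u0) x - T (kernel u0) x0"] by linarith
   then show ?thesis by (simp add: ux y0 dist_norm Tk add_diff_eq)
  qed
  moreover have "d > 0" using \<delta>(1) \<eta>(1) \<rho> by (simp add: d_def)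
  ultimately show "\<exists>d>0. \<forall>y. dist y y0 < d \<longrightarrow> dist (T (kernel (fst y)) (snd y)) (T (kernel (fst y0)) (snd y0)) < e" by blast
 qed
qed

end

section \<open>Normalized kernels and the Bergman metric\<close>

lemma normalized_kernel_0:
 "(w :: complex ^ 'n) \<in> unit_ball ==> normalized_kernel 0 w = 1"
 using normalized_kernel_eq[of "0 :: complex ^ 'n" w] by (simp add: kernel_def)

lemma normalized_kernel_out: "w \<notin> unit_ball ==> normalized_kernel z w = 0"
 by (simp add: normalized_kernel_def)

lemma transl_0:
 fixes u :: "complex ^ 'n"
 assumes u: "u \<in> unit_ball" shows "transl u (normalized_kernel 0) = normalized_kernel u"
proof
 fix w :: "complex ^ 'n"
 show "transl u (normalized_kernel 0) w = normalized_kernel u w"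
 proof (cases "w \<in> unit_ball")
  case True
  then show ?thesis using normalized_kernel_0[OF mobius_in_ball[OF u True]] by (simp add: transl_def)
 qed (simp add: transl_def normalized_kernel_out)
qed

lemma norm_normalized_kernel_le:
 fixes v w :: "complex ^ 'n"
 assumes v: "v \<in> cball 0 R" and R: "R < 1" and w: "w \<in> unit_ball"
 shows "norm (normalized_kernel v w) \<le> 1 / (1 - R) ^ (CARD('n) + 1)"
proof -
 have vb: "v \<in> unit_ball" using v R by simp
 have "defect v powr ((real CARD('n) + 1) / 2) \<le> 1"
  using defect_pos[OF vb] defect_le_1[of v] by (intro powr_le1) auto
 then have "norm (normalized_kernel v w) \<le> 1 * norm (kernel v w)"
  unfolding normalized_kernel_eq[OF vb] norm_mult by (intro mult_right_mono) auto
 also have "... \<le> 1 / (1 - norm v) ^ (CARD('n) + 1)" using norm_kernel_le[OF w vb] by simp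
 also have "... \<le> 1 / (1 - R) ^ (CARD('n) + 1)"
  using v R by (intro divide_left_mono power_mono mult_pos_pos zero_less_power) auto
 finally show ?thesis .
qed

lemma normalized_kernel_uniform:
 fixes R e :: real
 assumes R: "0 \<le> R" "R < 1" and e: "e > 0"
 obtains \<delta> where "\<delta> > 0" "\<And>v v' w :: complex ^ 'n. v \<in> cball 0 R ==> v' \<in> cball 0 R ==> dist v v' < \<delta> ==> w \<in> unit_ball ==>
  norm (normalized_kernel v w - normalized_kernel v' w) \<le> e"
proof -
 define a where "a v = defect v powr ((real CARD('n) + 1) / 2)" for v :: "complex ^ 'n"
 define K where "K = 1 / (1 - R) ^ (CARD('n) + 1)"
 have K: "K > 0" using R by (simp add: K_def)
 have "continuous_on (cball 0 R) a" unfolding a_def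
 proof (intro continuous_intros ballI)
  fix v :: "complex ^ 'n" assume "v \<in> cball 0 R"
  then have "v \<in> unit_ball" using R by simp
  then show "defect v \<noteq> 0" using defect_pos[of v] by simp
 qed
 then have "uniformly_continuous_on (cball 0 R) a" by (rule compact_uniformly_continuous) simp
 moreover have "e / (2 * K) > 0" using e K by simp
 ultimately obtain d1 where d1: "d1 > 0" "\<And>v v'. v \<in> cball 0 R ==> v' \<in> cball 0 R ==> dist v' v < d1 ==> dist (a v') (a v) < e / (2 * K)"
  unfolding uniformly_continuous_on_def by blast
 obtain d2 where d2: "d2 > 0" "\<And>z z' w :: complex ^ 'n. z \<in> cball 0 R ==> z' \<in> cball 0 R ==> dist z z' < d2 ==>
  norm (kernel z w - kernel z' w) \<le> e / 2"
  using kernel_uniform[OF R, of "e / 2"] e by auto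
 show ?thesis
 proof (rule that[of "min d1 d2"])
  show "min d1 d2 > 0" using d1 d2 by simp
  fix v v' w :: "complex ^ 'n"
  assume v: "v \<in> cball 0 R" "v' \<in> cball 0 R" "dist v v' < min d1 d2" and w: "w \<in> unit_ball"
  have vb: "v \<in> unit_ball" "v' \<in> unit_ball" using v R by auto
  have a1: "\<bar>a v'\<bar> \<le> 1" using defect_pos[OF vb(2)] defect_le_1[of v'] by (auto simp: a_def intro!: powr_le1)
  have k: "norm (kernel v w) \<le> K"
  proof -
   have "norm (kernel v w) \<le> 1 / (1 - norm v) ^ (CARD('n) + 1)" by (rule norm_kernel_le[OF w vb(1)])
   also have "... \<le> K" unfolding K_def using v R by (intro divide_left_mono power_mono mult_pos_pos zero_less_power) auto
   finally show ?thesis .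
  qed
  have "normalized_kernel v w - normalized_kernel v' w
   = of_real (a v - a v') * kernel v w + of_real (a v') * (kernel v w - kernel v' w)"
   unfolding normalized_kernel_eq[OF vb(1)] normalized_kernel_eq[OF vb(2)] a_def by (simp add: algebra_simps)
  also have "norm ... \<le> \<bar>a v - a v'\<bar> * norm (kernel v w) + \<bar>a v'\<bar> * norm (kernel v w - kernel v' w)"
   by (rule order_trans[OF norm_triangle_ineq]) (simp add: norm_mult flip: of_real_diff)
  also have "... \<le> e / (2 * K) * K + 1 * (e / 2)"
  proof (intro add_mono mult_mono)
   show "\<bar>a v - a v'\<bar> \<le> e / (2 * K)" using d1(2)[OF v(2,1)] v(3) by (simp add: dist_real_def less_imp_le)
   show "norm (kernel v w - kernel v' w) \<le> e / 2" using d2(2)[OF v(1,2)] v(3) by simp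
  qed (use e K k a1 in auto)
  also have "... = e" using K by simp
  finally show "norm (normalized_kernel v w - normalized_kernel v' w) \<le> e" .
 qed
qed

lemma bergman_dist_commute: "z \<in> unit_ball ==> w \<in> unit_ball ==> bergman_dist z w = bergman_dist w z"
 by (simp add: bergman_dist_def norm_mobius_commute)

text \<open>A nonnegative term is dropped from \<open>|mobius v w|^2 * |1 - cdot w v|^2 = defect v *
  |w - v|^2 + |cdot (w - v) v|^2\<close>, and 4 bounds \<open>|1 - cdot w v|^2\<close>. Through this
  estimate the Bergman distance controls the Euclidean one on compact subsets of the ball.\<close>

lemma norm_mobius_ge:
 assumes v: "v \<in> unit_ball" and w: "w \<in> unit_ball"
 shows "defect v * (dist v w)\<^sup>2 \<le> 4 * (norm (mobius v w))\<^sup>2"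
proof -
 define x where "x = cdot w v"
 define d where "d = w - v"
 have nz: "norm (1 - x) > 0" using one_minus_cdot_nz[OF w v] by (simp add: x_def)
 have n2: "(norm (1 - x))\<^sup>2 = 1 - 2 * Re x + (norm x)\<^sup>2"
  by (simp add: cmod_power2 power2_diff algebra_simps)
 have Rx: "Re x = inner w v" by (simp add: x_def Re_cdot)
 have xd: "x = of_real ((norm v)\<^sup>2) + cdot d v"
  by (simp add: x_def d_def cdot_diff_left cdot_self)
 have nx: "(norm x)\<^sup>2 = (norm v)\<^sup>2 * (norm v)\<^sup>2 + 2 * (norm v)\<^sup>2 * inner d v + (norm (cdot d v))\<^sup>2"
 proof -
  have "Re x = (norm v)\<^sup>2 + inner d v" "Im x = Im (cdot d v)"
   unfolding xd by (simp_all add: Re_cdot del: of_real_power)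
  then show ?thesis unfolding cmod_power2 by (simp add: Re_cdot power2_eq_square algebra_simps)
 qed
 have nw: "(norm w)\<^sup>2 = (norm v)\<^sup>2 + 2 * inner d v + (norm d)\<^sup>2"
  unfolding d_def by (simp add: power2_norm_eq_inner inner_simps inner_commute algebra_simps)
 have wv: "inner w v = (norm v)\<^sup>2 + inner d v" unfolding d_def by (simp add: power2_norm_eq_inner inner_simps)
 have "defect (mobius v w) * (norm (1 - x))\<^sup>2 = defect v * defect w"
  unfolding defect_mobius[OF v w] x_def using nz by (simp add: x_def)
 then have "(norm (mobius v w))\<^sup>2 * (norm (1 - x))\<^sup>2 = (norm (1 - x))\<^sup>2 - defect v * defect w"
  by (simp add: defect_def[of "mobius v w"] left_diff_distrib)
 also have "... = defect v * (norm d)\<^sup>2 + (norm (cdot d v))\<^sup>2"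
  unfolding n2 Rx wv nx defect_def nw by (simp add: algebra_simps)
 finally have "defect v * (norm d)\<^sup>2 \<le> (norm (mobius v w))\<^sup>2 * (norm (1 - x))\<^sup>2" by simp
 also have "... \<le> (norm (mobius v w))\<^sup>2 * 2\<^sup>2"
  using norm_one_minus_cdot_le[OF w v] by (intro mult_left_mono power_mono) (auto simp: x_def)
 finally show ?thesis by (simp add: d_def dist_norm norm_minus_commute mult.commute)
qed

lemma bergman_dist_ge:
 assumes "v \<in> unit_ball" "w \<in> unit_ball" shows "norm (mobius v w) \<le> 2 * bergman_dist v w"
proof -
 define m where "m = norm (mobius v w)"
 have m: "0 \<le> m" "m < 1" using mobius_in_ball[OF assms] by (auto simp: m_def)
 have "ln (1 - m) \<le> - m" using ln_le_minus_one[of "1 - m"] m by simp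
 moreover have "ln (1 + m) \<ge> 0" using m by simp
 ultimately have "m \<le> ln (1 + m) - ln (1 - m)" by simp
 also have "... = ln ((1 + m) / (1 - m))" using m by (simp add: ln_div)
 finally show ?thesis by (simp add: bergman_dist_def m_def)
qed

lemma bergman_ball_0_subset:
 assumes "r > 0" obtains R where "0 \<le> R" "R < 1" "bergman_ball (0 :: complex ^ 'n) r \<subseteq> cball 0 R"
proof -
 define E where "E = exp (2 * r)"
 have E: "E > 1" using assms by (simp add: E_def)
 \<comment> \<open>\<open>R\<close> is the hyperbolic tangent of \<open>r\<close>, the Euclidean
   radius of the Bergman ball.\<close>
 define R where "R = (E - 1) / (E + 1)"
 show ?thesis
 proof (rule that[of R])
  show "0 \<le> R" "R < 1" using E by (auto simp: R_def)
  show "bergman_ball (0 :: complex ^ 'n) r \<subseteq> cball 0 R"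
  proof
   fix w :: "complex ^ 'n" assume "w \<in> bergman_ball 0 r"
   then have w: "norm w < 1" "ln ((1 + norm w) / (1 - norm w)) < 2 * r"
    by (auto simp: bergman_ball_def bergman_dist_def)
   have "(1 + norm w) / (1 - norm w) > 0" using w by (simp add: add_pos_nonneg)
   then have "(1 + norm w) / (1 - norm w) < E" using w(2) unfolding E_def by (metis exp_less_mono exp_ln)
   then have "1 + norm w < E * (1 - norm w)" using w by (simp add: divide_less_eq)
   then have "norm w * (E + 1) \<le> E - 1" by (simp add: algebra_simps)
   then show "w \<in> cball 0 R" using E by (simp add: R_def pos_le_divide_eq)
  qed
 qed
qed

lemma continuous_on_bergman_dist:
 "continuous_on (unit_ball \<times> unit_ball) (\<lambda>y. bergman_dist (fst y) (snd y))"
proof -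
 have m: "norm (mobius (fst y) (snd y)) < 1" if "y \<in> unit_ball \<times> unit_ball" for y :: "(complex ^ 'n) \<times> (complex ^ 'n)"
  using mobius_in_ball[of "fst y" "snd y"] that by (cases y) auto
 show ?thesis unfolding bergman_dist_def
 proof (intro continuous_intros continuous_on_mobius ballI)
  fix y :: "(complex ^ 'n) \<times> (complex ^ 'n)" assume "y \<in> unit_ball \<times> unit_ball"
  from m[OF this] have "0 < 1 - norm (mobius (fst y) (snd y))" "0 < 1 + norm (mobius (fst y) (snd y))"
   by (auto simp: add_pos_nonneg)
  then show "1 - norm (mobius (fst y) (snd y)) \<noteq> 0" "(1 + norm (mobius (fst y) (snd y))) / (1 - norm (mobius (fst y) (snd y))) \<noteq> 0"
   by auto
 qed (auto simp: mem_Times_iff)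
qed

lemma bergman_ball_measurable_pair:
 "{y \<in> space vol2. snd y \<in> bergman_ball (fst y) r} \<in> sets (vol \<Otimes>\<^sub>M (vol :: (complex ^ 'n) measure))"
proof -
 note [measurable] = measurable_vol2_continuous[OF continuous_on_bergman_dist]
 have "{y \<in> space vol2. bergman_dist (fst y) (snd y) < r} \<in> sets (vol \<Otimes>\<^sub>M (vol :: (complex ^ 'n) measure))"
  by measurable
 also have "{y \<in> space vol2. bergman_dist (fst y) (snd y) < r}
  = {y \<in> space (vol \<Otimes>\<^sub>M (vol :: (complex ^ 'n) measure)). snd y \<in> bergman_ball (fst y) r}"
  by (auto simp: bergman_ball_def space_pair_measure)
 finally show ?thesis .
qed

lemma bergman_ball_sets: 
 assumes "z \<in> unit_ball" shows "bergman_ball z r \<in> sets vol"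
proof -
 have "bergman_ball z r = Pair z -` {y \<in> space vol2. snd y \<in> bergman_ball (fst y) r}"
  using assms by (auto simp: space_pair_measure bergman_ball_def)
 then show ?thesis using sets_Pair1[OF bergman_ball_measurable_pair, of z r] by simp
qed

section \<open>The operator at v as an integral operator\<close>

locale bergman_operator = conjugate_exponents p q for p q :: real +
 fixes T :: "('n::finite) oper"
 assumes T: "bounded_op p T"
begin

definition kap :: "complex ^ 'n \<Rightarrow> complex ^ 'n \<Rightarrow> complex" where
 "kap u x = T (kernel u) x"

definition symb :: "complex ^ 'n \<Rightarrow> complex ^ 'n \<Rightarrow> complex" where
 "symb v u = pairing (T (transl u (normalized_kernel 0))) (transl u (normalized_kernel v))"

text \<open>In this form \<open>v\<close> enters only through \<open>mobius u v\<close>, ready for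
  the substitution in \<open>\<Phi>_integral_v\<close>; \<open>\<Phi>_eq\<close> gives the form
  suited to estimates.\<close>

definition \<Phi> :: "complex ^ 'n \<Rightarrow> complex ^ 'n \<Rightarrow> complex ^ 'n \<Rightarrow> complex" where
 "\<Phi> v u w = of_real (defect (mobius u v) ^ (CARD('n) + 1)) * kap u (mobius u v) * kernel (mobius u v) w"

definition Aop :: "complex ^ 'n \<Rightarrow> 'n oper" where
 "Aop v f w = (if f \<in> bergman_space p \<and> w \<in> unit_ball then \<integral>u. f u * \<Phi> v u w \<partial>vol else 0)"

text \<open>The reciprocal of the L^2 norm of \<open>kernel u\<close>.\<close>

definition half :: "complex ^ 'n \<Rightarrow> real" where
 "half u = defect u powr ((real CARD('n) + 1) / 2)"

lemma half_pos: "u \<in> unit_ball ==> half u > 0"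
 using defect_pos[of u] by (simp add: half_def)

lemma half_sq: 
 assumes "u \<in> unit_ball" shows "half u * half u = defect u ^ (CARD('n) + 1)"
proof -
 have "(real CARD('n) + 1) / 2 + (real CARD('n) + 1) / 2 = real (CARD('n) + 1)" by simp
 then have "half u * half u = defect u powr (real (CARD('n) + 1))"
  unfolding half_def powr_add[symmetric] by (simp only:)
 then show ?thesis by (simp only: powr_realpow[OF defect_pos[OF assms]])
qed

lemma nk: "u \<in> unit_ball ==> normalized_kernel u = (\<lambda>w. of_real (half u) * kernel u w)"
 unfolding half_def by (rule ext, rule normalized_kernel_eq)

lemma nk_bergman: "(u :: complex ^ 'n) \<in> unit_ball ==> r > 0 ==> normalized_kernel u \<in> bergman_space r"
 by (simp add: nk bergman_space_cmult kernel_bergman del: mem_ball_0)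

text \<open>\<open>kernel_mobius\<close> shows that \<open>transl u\<close> maps a normalized kernel
  to a multiple of the kernel at \<open>mobius u v\<close>; by \<open>defect_mobius\<close> the
  scalar \<open>c\<close> has the modulus of the normalizing factor there. Its phase cancels in
  \<open>c * cnj c\<close>, which is how it occurs in \<open>\<Phi>\<close>.\<close>

lemma transl_eq:
 assumes u: "u \<in> unit_ball" and v: "v \<in> unit_ball"
 defines "c \<equiv> of_real (half u * half v) / (1 - cdot u v) ^ (CARD('n) + 1)"
 shows "transl u (normalized_kernel v) = (\<lambda>w. c * kernel (mobius u v) w)"
  "c * cnj c = of_real (defect (mobius u v) ^ (CARD('n) + 1))"
proof -
 show "transl u (normalized_kernel v) = (\<lambda>w. c * kernel (mobius u v) w)"
 proof
  fix w
  show "transl u (normalized_kernel v) w = c * kernel (mobius u v) w"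
  proof (cases "w \<in> unit_ball")
   case True
   have "transl u (normalized_kernel v) w = of_real (half u * half v) * (kernel v (mobius u w) * kernel u w)"
    by (simp add: transl_def nk[OF u] nk[OF v] mult_ac)
   then show ?thesis unfolding kernel_mobius[OF u v True] by (simp add: c_def)
  qed (simp add: transl_def normalized_kernel_out)
 qed
 have n: "norm (1 - cdot u v) > 0" using one_minus_cdot_nz[OF u v] by simp
 have "c * cnj c = of_real ((norm c)\<^sup>2)" by (simp add: complex_norm_square del: of_real_power)
 also have "norm c = half u * half v / norm (1 - cdot u v) ^ (CARD('n) + 1)"
  using half_pos[OF u] half_pos[OF v] unfolding c_def norm_divide norm_power norm_of_real by simp
 also have "(...)\<^sup>2 = (half u * half u) * (half v * half v) / (norm (1 - cdot u v) ^ (CARD('n) + 1))\<^sup>2"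
  by (simp add: power2_eq_square mult_ac)
 also have "... = (defect u * defect v / (norm (1 - cdot u v))\<^sup>2) ^ (CARD('n) + 1)"
  unfolding half_sq[OF u] half_sq[OF v] by (simp only: power_divide power_mult_distrib power_mult[symmetric] mult.commute)
 also have "... = defect (mobius u v) ^ (CARD('n) + 1)"
  unfolding defect_mobius[OF u v] norm_one_minus_cdot_commute[of v u] ..
 finally show "c * cnj c = of_real (defect (mobius u v) ^ (CARD('n) + 1))" .
qed

lemma T_nk: 
 assumes u: "u \<in> unit_ball" shows "T (normalized_kernel u) = (\<lambda>w. of_real (half u) * kap u w)"
 unfolding nk[OF u] kap_def by (rule bounded_opD(4)[OF T kernel_bergman[OF u p_q(1)]])

lemma T_kernel_bergman: "u \<in> unit_ball ==> T (kernel u) \<in> bergman_space p"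
 by (intro bounded_opD(1)[OF T] kernel_bergman p_q)

lemma symb_eq:
 assumes u: "u \<in> unit_ball" and v: "v \<in> unit_ball"
 shows "symb v u = of_real (half u) * cnj (of_real (half u * half v) / (1 - cdot u v) ^ (CARD('n) + 1)) * kap u (mobius u v)"
proof -
 have "symb v u = of_real (half u) * cnj (of_real (half u * half v) / (1 - cdot u v) ^ (CARD('n) + 1)) * pairing (T (kernel u)) (kernel (mobius u v))"
  unfolding symb_def transl_0[OF u] T_nk[OF u] transl_eq(1)[OF u v] pairing_def kap_def
  by (subst integral_mult_right_zero[symmetric]) (simp add: mult_ac)
 then show ?thesis using pairing_kernel[OF T_kernel_bergman[OF u] mobius_in_ball[OF u v]] by (simp add: kap_def)
qed

text \<open>Here \<open>v\<close> enters through the two factors \<open>symb v u\<close> and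
  \<open>normalized_kernel v\<close>, both bounded for \<open>v\<close> in a compact set, and
  \<open>kernel u w\<close> is split off as the dominating kernel.\<close>

lemma \<Phi>_eq:
 assumes u: "u \<in> unit_ball" and v: "v \<in> unit_ball" and w: "w \<in> unit_ball"
 shows "\<Phi> v u w = symb v u * normalized_kernel v (mobius u w) * kernel u w"
proof -
 define c where "c = of_real (half u * half v) / (1 - cdot u v) ^ (CARD('n) + 1)"
 have "transl u (normalized_kernel v) w = normalized_kernel v (mobius u w) * (of_real (half u) * kernel u w)"
  by (simp add: transl_def nk[OF u])
 then have 1: "of_real (half u) * (normalized_kernel v (mobius u w) * kernel u w) = c * kernel (mobius u v) w"
  unfolding transl_eq(1)[OF u v] c_def[symmetric] by (simp add: mult_ac)
 have "symb v u * normalized_kernel v (mobius u w) * kernel u w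
  = cnj c * kap u (mobius u v) * (of_real (half u) * (normalized_kernel v (mobius u w) * kernel u w))"
  unfolding symb_eq[OF u v] c_def[symmetric] by (simp only: mult_ac)
 also have "... = (c * cnj c) * kap u (mobius u v) * kernel (mobius u v) w" unfolding 1 by (simp only: mult_ac)
 finally show ?thesis unfolding c_def transl_eq(2)[OF u v] \<Phi>_def by simp
qed

text \<open>\<open>transl u\<close> multiplies a function composed with \<open>mobius u\<close> by
  \<open>normalized_kernel u\<close>, so \<open>symb\<close> is controlled by a sup norm times the
  product of the norms of \<open>normalized_kernel u\<close> in L^p and L^q. By
  \<open>kernel_norm_le\<close> this product is bounded: the powers of \<open>defect u\<close> add
  up to 0.\<close>

lemma symb_bound:
 obtains M where "M > 0"
  "\<And>u v v' e. u \<in> unit_ball ==> v \<in> unit_ball ==> v' \<in> unit_ball ==> e \<ge> 0 ==>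
   (\<And>w. w \<in> unit_ball ==> norm (normalized_kernel v w - normalized_kernel v' w) \<le> e) ==> norm (symb v u - symb v' u) \<le> M * e"
  "\<And>u v e. u \<in> unit_ball ==> v \<in> unit_ball ==> e \<ge> 0 ==>
   (\<And>w. w \<in> unit_ball ==> norm (normalized_kernel v w) \<le> e) ==> norm (symb v u) \<le> M * e"
proof -
 interpret sw: conjugate_exponents q p by (rule swap)
 obtain C where C: "C \<ge> 0" "\<And>f. f \<in> bergman_space p ==> bergman_norm p (T f) \<le> C * bergman_norm p f"
  using bounded_op_bound[OF T] by blast
 obtain Cp where Cp: "Cp > 0" "\<And>u :: complex ^ 'n. u \<in> unit_ball ==> bergman_norm p (kernel u) \<le> Cp * defect u powr (- ((real CARD('n) + 1) / q))"
  using kernel_norm_le by blast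
 obtain Cq where Cq: "Cq > 0" "\<And>u :: complex ^ 'n. u \<in> unit_ball ==> bergman_norm q (kernel u) \<le> Cq * defect u powr (- ((real CARD('n) + 1) / p))"
  using sw.kernel_norm_le by blast
 define M where "M = C * (Cp * Cq) + 1"
 have M: "M > 0" using C Cp Cq by (simp add: M_def add_nonneg_pos)
 have prod: "bergman_norm p (normalized_kernel u) * bergman_norm q (normalized_kernel u) \<le> Cp * Cq" if u: "u \<in> unit_ball" for u :: "complex ^ 'n"
 proof -
  define N where "N = real CARD('n) + 1"
  have d: "defect u > 0" by (rule defect_pos[OF u])
  have n: "bergman_norm r (normalized_kernel u) = half u * bergman_norm r (kernel u)" if "r > 0" for r
   unfolding nk[OF u] using lp_cmult(2)[OF bergman_spaceD(1)[OF kernel_bergman[OF u that]] that] half_pos[OF u] by simp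
  have "bergman_norm p (normalized_kernel u) * bergman_norm q (normalized_kernel u)
   \<le> (half u * (Cp * defect u powr (- (N / q)))) * (half u * (Cq * defect u powr (- (N / p))))"
   unfolding n[OF p_q(1)] n[OF p_q(2)] N_def using Cp Cq half_pos[OF u] u
   by (intro mult_mono mult_left_mono mult_nonneg_nonneg bergman_norm_nonneg) (auto simp: less_imp_le)
  also have "... = Cp * Cq * (half u * half u * (defect u powr (- (N / q)) * defect u powr (- (N / p))))" by (simp only: mult_ac)
  also have "half u * half u * (defect u powr (- (N / q)) * defect u powr (- (N / p))) = defect u powr 0"
  proof -
   have "N / 2 + N / 2 + (- (N / q) + - (N / p)) = N * (1 - (1 / p + 1 / q))" by (simp add: algebra_simps)
   then have "N / 2 + N / 2 + (- (N / q) + - (N / p)) = 0" unfolding pq by simp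
   then show ?thesis unfolding half_def N_def[symmetric] powr_add[symmetric] by simp
  qed
  finally show ?thesis using d by simp
 qed
 have gen: "norm (pairing (T (normalized_kernel u)) g) \<le> M * e"
  if u: "u \<in> unit_ball" and g: "g \<in> borel_measurable vol" and e: "e \<ge> 0"
   and le: "\<And>w. w \<in> unit_ball ==> norm (g w) \<le> e * norm (normalized_kernel u w)" for u :: "complex ^ 'n" and g e
 proof -
  have nkl: "lp q (\<lambda>w. of_real e * normalized_kernel u w)" "bergman_norm q (\<lambda>w. of_real e * normalized_kernel u w) = e * bergman_norm q (normalized_kernel u)"
   using lp_cmult[OF bergman_spaceD(1)[OF nk_bergman[OF u p_q(2)]] p_q(2), of "of_real e"] e by simp_all
  have gle: "norm (g w) \<le> norm (of_real e * normalized_kernel u w)" if "w \<in> unit_ball" for w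
   using le[OF that] e by (simp add: norm_mult)
  have gl: "lp q g" "bergman_norm q g \<le> e * bergman_norm q (normalized_kernel u)"
   using lp_dominated[OF nkl(1) g p_q(2) gle] nkl(2) by auto
  have nb: "normalized_kernel u \<in> bergman_space p" by (rule nk_bergman[OF u p_q(1)])
  have "norm (pairing (T (normalized_kernel u)) g) \<le> bergman_norm p (T (normalized_kernel u)) * bergman_norm q g"
   by (rule pairing_bound(1)[OF bergman_spaceD(1)[OF bounded_opD(1)[OF T nb]] gl(1)])
  also have "... \<le> (C * bergman_norm p (normalized_kernel u)) * (e * bergman_norm q (normalized_kernel u))"
   using C(2)[OF nb] gl(2) C(1) by (intro mult_mono mult_nonneg_nonneg bergman_norm_nonneg) auto
  also have "... = (C * e) * (bergman_norm p (normalized_kernel u) * bergman_norm q (normalized_kernel u))" by (simp only: mult_ac)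
  also have "... \<le> (C * e) * (Cp * Cq)" using prod[OF u] C e by (intro mult_left_mono) auto
  also have "... \<le> M * e" using e by (simp add: M_def algebra_simps)
  finally show ?thesis .
 qed
 have tm: "transl u (normalized_kernel v) \<in> borel_measurable vol" if "u \<in> unit_ball" "v \<in> unit_ball" for u v :: "complex ^ 'n"
  unfolding transl_eq(1)[OF that] using measurable_volI[OF kernel_measurable_borel[OF mobius_in_ball[OF that]]] by measurable
 have tl: "lp q (transl u (normalized_kernel v))" if "u \<in> unit_ball" "v \<in> unit_ball" for u v :: "complex ^ 'n"
  unfolding transl_eq(1)[OF that] using p_q by (intro lp_cmult bergman_spaceD(1)[OF kernel_bergman] mobius_in_ball[OF that])
 show ?thesis
 proof (rule that[OF M])
  fix u v v' :: "complex ^ 'n" and e :: real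
  assume u: "u \<in> unit_ball" and v: "v \<in> unit_ball" "v' \<in> unit_ball" and e: "e \<ge> 0"
   and le: "\<And>w. w \<in> unit_ball ==> norm (normalized_kernel v w - normalized_kernel v' w) \<le> e"
  have Tl: "lp p (T (normalized_kernel u))" by (rule bergman_spaceD(1)[OF bounded_opD(1)[OF T nk_bergman[OF u p_q(1)]]])
  have "symb v u - symb v' u = pairing (T (normalized_kernel u)) (\<lambda>w. transl u (normalized_kernel v) w - transl u (normalized_kernel v') w)"
   unfolding symb_def transl_0[OF u] pairing_def
   using pairing_bound(2)[OF Tl tl[OF u v(1)]] pairing_bound(2)[OF Tl tl[OF u v(2)]] by (simp add: right_diff_distrib)
  also have "norm ... \<le> M * e"
  proof (rule gen[OF u _ e])
   show "(\<lambda>w. transl u (normalized_kernel v) w - transl u (normalized_kernel v') w) \<in> borel_measurable vol"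
    using tm[OF u v(1)] tm[OF u v(2)] by measurable
   show "norm (transl u (normalized_kernel v) w - transl u (normalized_kernel v') w) \<le> e * norm (normalized_kernel u w)"
    if w: "w \<in> unit_ball" for w
    unfolding transl_def left_diff_distrib[symmetric] norm_mult
    by (rule mult_right_mono[OF le[OF mobius_in_ball[OF u w]]]) simp
  qed
  finally show "norm (symb v u - symb v' u) \<le> M * e" .
 next
  fix u v :: "complex ^ 'n" and e :: real
  assume u: "u \<in> unit_ball" and v: "v \<in> unit_ball" and e: "e \<ge> 0"
   and le: "\<And>w. w \<in> unit_ball ==> norm (normalized_kernel v w) \<le> e"
  show "norm (symb v u) \<le> M * e"
   unfolding symb_def transl_0[OF u]
  proof (rule gen[OF u tm[OF u v] e])
   show "norm (transl u (normalized_kernel v) w) \<le> e * norm (normalized_kernel u w)" if w: "w \<in> unit_ball" for w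
    unfolding transl_def norm_mult by (rule mult_right_mono[OF le[OF mobius_in_ball[OF u w]]]) simp
  qed
 qed
qed

theorem \<Phi>_bounds:
 assumes R: "0 \<le> R" "R < 1"
 obtains K where "K > 0"
  "\<And>u v w. v \<in> cball 0 R ==> u \<in> unit_ball ==> w \<in> unit_ball ==> norm (\<Phi> v u w) \<le> K * norm (kernel u w)"
  "\<And>e. e > 0 ==> \<exists>\<delta>>0. \<forall>v\<in>cball 0 R. \<forall>v'\<in>cball 0 R. dist v v' < \<delta> \<longrightarrow>
   (\<forall>u\<in>unit_ball. \<forall>w\<in>unit_ball. norm (\<Phi> v u w - \<Phi> v' u w) \<le> e * norm (kernel u w))"
proof -
 obtain M where M: "M > 0"
  "\<And>u v v' e. u \<in> unit_ball ==> v \<in> unit_ball ==> v' \<in> unit_ball ==> e \<ge> 0 ==>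
   (\<And>w. w \<in> unit_ball ==> norm (normalized_kernel v w - normalized_kernel v' w) \<le> e) ==> norm (symb v u - symb v' u) \<le> M * e"
  "\<And>u v e. u \<in> unit_ball ==> v \<in> unit_ball ==> e \<ge> 0 ==>
   (\<And>w. w \<in> unit_ball ==> norm (normalized_kernel v w) \<le> e) ==> norm (symb v u) \<le> M * e"
  using symb_bound by blast
 define B where "B = 1 / (1 - R) ^ (CARD('n) + 1)"
 have B: "B > 0" using R by (simp add: B_def)
 have cb: "v \<in> unit_ball" if "v \<in> cball 0 R" for v :: "complex ^ 'n" using that R by simp
 have nkB: "norm (normalized_kernel v w) \<le> B" if "v \<in> cball 0 R" "w \<in> unit_ball" for v w :: "complex ^ 'n"
  unfolding B_def by (rule norm_normalized_kernel_le[OF that(1) R(2) that(2)])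
 have sB: "norm (symb v u) \<le> M * B" if "v \<in> cball 0 R" "u \<in> unit_ball" for v u
  by (rule M(3)[OF that(2) cb[OF that(1)] less_imp_le[OF B] nkB[OF that(1)]])
 show ?thesis
 proof (rule that[of "M * B * B"])
  show "M * B * B > 0" using M B by simp
  show "norm (\<Phi> v u w) \<le> M * B * B * norm (kernel u w)" if "v \<in> cball 0 R" "u \<in> unit_ball" "w \<in> unit_ball" for u v w
   unfolding \<Phi>_eq[OF that(2) cb[OF that(1)] that(3)] norm_mult
   using sB[OF that(1,2)] nkB[OF that(1) mobius_in_ball[OF that(2,3)]] M B
   by (intro mult_right_mono mult_mono) auto
  fix e :: real assume e: "e > 0"
  define e' where "e' = e / (2 * (M * B))"
  have e': "e' > 0" using e M B by (simp add: e'_def)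
  obtain \<delta> where \<delta>: "\<delta> > 0" "\<And>v v' w :: complex ^ 'n. v \<in> cball 0 R ==> v' \<in> cball 0 R ==> dist v v' < \<delta> ==> w \<in> unit_ball ==>
   norm (normalized_kernel v w - normalized_kernel v' w) \<le> e'"
   using normalized_kernel_uniform[OF R e'] by blast
  have "norm (\<Phi> v u w - \<Phi> v' u w) \<le> e * norm (kernel u w)"
   if v: "v \<in> cball 0 R" "v' \<in> cball 0 R" "dist v v' < \<delta>" and u: "u \<in> unit_ball" and w: "w \<in> unit_ball" for v v' u w
  proof -
   have "\<Phi> v u w - \<Phi> v' u w = ((symb v u - symb v' u) * normalized_kernel v (mobius u w)
     + symb v' u * (normalized_kernel v (mobius u w) - normalized_kernel v' (mobius u w))) * kernel u w"
    unfolding \<Phi>_eq[OF u cb[OF v(1)] w] \<Phi>_eq[OF u cb[OF v(2)] w] by (simp add: algebra_simps)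
   also have "norm ... \<le> (norm (symb v u - symb v' u) * norm (normalized_kernel v (mobius u w))
     + norm (symb v' u) * norm (normalized_kernel v (mobius u w) - normalized_kernel v' (mobius u w))) * norm (kernel u w)"
    unfolding norm_mult by (intro mult_right_mono order_trans[OF norm_triangle_ineq]) (auto simp: norm_mult)
   also have "... \<le> ((M * e') * B + (M * B) * e') * norm (kernel u w)"
   proof (intro mult_right_mono add_mono mult_mono)
    show "norm (symb v u - symb v' u) \<le> M * e'" using \<delta>(2)[OF v] e' by (intro M(2) u cb v) auto
    show "norm (normalized_kernel v (mobius u w)) \<le> B" by (rule nkB[OF v(1) mobius_in_ball[OF u w]])
    show "norm (symb v' u) \<le> M * B" by (rule sB[OF v(2) u])
    show "norm (normalized_kernel v (mobius u w) - normalized_kernel v' (mobius u w)) \<le> e'"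
     by (rule \<delta>(2)[OF v mobius_in_ball[OF u w]])
   qed (use M e' B in auto)
   also have "(M * e') * B + (M * B) * e' = e" using M B by (simp add: e'_def field_simps)
   finally show ?thesis .
  qed
  then show "\<exists>\<delta>>0. \<forall>v\<in>cball 0 R. \<forall>v'\<in>cball 0 R. dist v v' < \<delta> \<longrightarrow>
   (\<forall>u\<in>unit_ball. \<forall>w\<in>unit_ball. norm (\<Phi> v u w - \<Phi> v' u w) \<le> e * norm (kernel u w))"
   using \<delta>(1) by blast
 qed
qed

lemma continuous_on_kap:
 assumes "continuous_on S f" "continuous_on S g" "\<And>x. x \<in> S ==> f x \<in> unit_ball" "\<And>x. x \<in> S ==> g x \<in> unit_ball"
 shows "continuous_on S (\<lambda>x. kap (f x) (g x))"
 using continuous_on_compose2[OF operator_kernel_continuous[OF T], of S "\<lambda>x. (f x, g x)"] assms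
 by (auto simp: kap_def image_subset_iff intro!: continuous_intros)

lemma continuous_on_\<Phi>:
 assumes "continuous_on S v" "continuous_on S u" "continuous_on S w"
  "\<And>x. x \<in> S ==> v x \<in> unit_ball" "\<And>x. x \<in> S ==> u x \<in> unit_ball" "\<And>x. x \<in> S ==> w x \<in> unit_ball"
 shows "continuous_on S (\<lambda>x. \<Phi> (v x) (u x) (w x))"
proof -
 have x: "continuous_on S (\<lambda>x. mobius (u x) (v x))"
  by (rule continuous_on_mobius_comp) (use assms in auto)
 have mb: "mobius (u x) (v x) \<in> unit_ball" if "x \<in> S" for x by (rule mobius_in_ball[OF assms(5,4)[OF that]])
 show ?thesis unfolding \<Phi>_def
  by (intro continuous_intros continuous_on_kap[OF assms(2) x assms(5) mb]
    continuous_on_kernel[OF x assms(3) mb assms(6)] x)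
qed

lemma maximal_bound:
 obtains C where "C > 0" "\<And>f g D. lp p f ==> g \<in> borel_measurable vol ==> D \<ge> 0 ==>
  (\<And>x :: complex ^ 'n. x \<in> unit_ball ==> norm (g x) \<le> D * abs_proj f x) ==>
  lp p g \<and> bergman_norm p g \<le> C * D * bergman_norm p f"
proof -
 obtain C where C: "C > 0" "\<And>f g :: 'n cfun. lp p f ==> g \<in> borel_measurable vol ==>
  (\<And>x. x \<in> unit_ball ==> norm (g x) \<le> abs_proj f x) ==>
  lp p g \<and> bergman_norm p g \<le> C * bergman_norm p f"
  using maximal_projection_bounded by blast
 show ?thesis
 proof (rule that[OF C(1)])
  fix f g :: "'n cfun" and D :: real
  assume f: "lp p f" and g: "g \<in> borel_measurable vol" and D: "D \<ge> 0"
   and le: "\<And>x. x \<in> unit_ball ==> norm (g x) \<le> D * abs_proj f x"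
  have l: "lp p (\<lambda>u. of_real D * f u)" and n: "bergman_norm p (\<lambda>u. of_real D * f u) = D * bergman_norm p f"
   using lp_cmult[OF f p_q(1), of "of_real D"] D by simp_all
  have "(LINT u|vol. norm (of_real D * f u) * norm (kernel u x)) = D * abs_proj f x" for x
  proof -
   have "norm (of_real D * f u) * norm (kernel u x) = D * (norm (f u) * norm (kernel u x))" for u
    using D by (simp add: norm_mult)
   then show ?thesis by (simp only: integral_mult_right_zero)
  qed
  then show "lp p g \<and> bergman_norm p g \<le> C * D * bergman_norm p f"
   using C(2)[OF l g] le unfolding n by (simp add: mult.assoc)
 qed
qed

text \<open>One constant of \<open>maximal_bound\<close>, chosen once for all estimates of this
  locale.\<close>

definition Cmax :: real where
 "Cmax = (SOME C. C > 0 \<and> (\<forall>f g D. lp p f \<longrightarrow> g \<in> borel_measurable vol \<longrightarrow> D \<ge> 0 \<longrightarrow>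
  (\<forall>x\<in>unit_ball. norm (g x) \<le> D * (LINT u|vol. norm (f u) * norm (kernel u (x :: complex ^ 'n)))) \<longrightarrow>
  lp p g \<and> bergman_norm p g \<le> C * D * bergman_norm p f))"

lemma Cmax:
 shows "Cmax > 0" and "\<And>f g D. lp p f ==> g \<in> borel_measurable vol ==> D \<ge> 0 ==>
  (\<And>x :: complex ^ 'n. x \<in> unit_ball ==> norm (g x) \<le> D * abs_proj f x) ==>
  lp p g \<and> bergman_norm p g \<le> Cmax * D * bergman_norm p f"
proof -
 have "\<exists>C > 0. \<forall>f g D. lp p f \<longrightarrow> g \<in> borel_measurable vol \<longrightarrow> D \<ge> 0 \<longrightarrow>
  (\<forall>x\<in>unit_ball. norm (g x) \<le> D * (LINT u|vol. norm (f u) * norm (kernel u (x :: complex ^ 'n)))) \<longrightarrow>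
  lp p g \<and> bergman_norm p g \<le> C * D * bergman_norm p f"
  by (rule maximal_bound) blast
 from someI_ex[OF this, folded Cmax_def] show "Cmax > 0"
  "\<And>f g D. lp p f ==> g \<in> borel_measurable vol ==> D \<ge> 0 ==>
  (\<And>x :: complex ^ 'n. x \<in> unit_ball ==> norm (g x) \<le> D * abs_proj f x) ==>
  lp p g \<and> bergman_norm p g \<le> Cmax * D * bergman_norm p f" by blast+
qed

lemma integrable_f_kernel:
 "lp p f ==> x \<in> unit_ball ==> integrable vol (\<lambda>u. norm (f u) * norm (kernel u (x :: complex ^ 'n)))"
 using integrable_norm[OF lp_integrable_mult_kernel, of f x] by (simp add: norm_mult)

lemma \<Phi>_measurable_u:
 assumes "v \<in> unit_ball" "w \<in> unit_ball" shows "(\<lambda>u. \<Phi> v u w) \<in> borel_measurable vol"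
 by (intro measurable_vol_continuous continuous_on_\<Phi> continuous_intros) (use assms in auto)

lemma dominated_by_kernel:
 assumes f: "lp p f" and w: "w \<in> unit_ball" and m: "\<psi> \<in> borel_measurable vol"
  and le: "\<And>u. u \<in> unit_ball ==> norm (\<psi> u) \<le> K * norm (kernel u (w :: complex ^ 'n))"
 shows "integrable vol (\<lambda>u. f u * \<psi> u)" "(LINT u|vol. norm (f u * \<psi> u)) \<le> K * abs_proj f w"
  "norm (LINT u|vol. (f u * \<psi> u)) \<le> K * abs_proj f w"
proof -
 have le': "norm (f u * \<psi> u) \<le> K * (norm (f u) * norm (kernel u w))" if "u \<in> space vol" for u
  using mult_left_mono[OF le, of u "norm (f u)"] that by (simp add: norm_mult mult_ac)
 have i: "integrable vol (\<lambda>u. K * (norm (f u) * norm (kernel u w)))" using integrable_f_kernel[OF f w] by simp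
 show fi: "integrable vol (\<lambda>u. f u * \<psi> u)"
 proof (rule integrable_dominated[OF i])
  show "(\<lambda>u. f u * \<psi> u) \<in> borel_measurable vol" using lp_measurable[OF f] m by measurable
  show "AE u in vol. norm (f u * \<psi> u) \<le> norm (K * (norm (f u) * norm (kernel u w)))"
   by (rule AE_I2, rule order_trans[OF le']) (simp_all only: real_norm_def abs_ge_self)
 qed
 have "(LINT u|vol. norm (f u * \<psi> u)) \<le> (LINT u|vol. K * (norm (f u) * norm (kernel u w)))"
  by (rule integral_mono[OF integrable_norm[OF fi] i le'])
 then show 2: "(LINT u|vol. norm (f u * \<psi> u)) \<le> K * abs_proj f w" by simp
 show "norm (LINT u|vol. (f u * \<psi> u)) \<le> K * abs_proj f w"
  by (rule order_trans[OF integral_norm_bound 2])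
qed

lemma \<Phi>_integrable:
 assumes v: "v \<in> unit_ball" and w: "w \<in> unit_ball" and f: "lp p f"
 shows "integrable vol (\<lambda>u. f u * \<Phi> v u w)"
proof -
 obtain K where K: "\<And>u w. u \<in> unit_ball ==> w \<in> unit_ball ==> norm (\<Phi> v u w) \<le> K * norm (kernel u w)"
  using \<Phi>_bounds[of "norm v"] v by (metis mem_ball_0 mem_cball_0 norm_ge_zero order_refl)
 show ?thesis by (rule dominated_by_kernel(1)[OF f w \<Phi>_measurable_u[OF v w] K[OF _ w]])
qed

lemma Aop_diff_le:
 assumes v: "v \<in> unit_ball" "v' \<in> unit_ball" and f: "f \<in> bergman_space p" and w: "w \<in> unit_ball"
  and le: "\<And>u. u \<in> unit_ball ==> norm (\<Phi> v u w - \<Phi> v' u w) \<le> e * norm (kernel u w)"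
 shows "norm (Aop v f w - Aop v' f w) \<le> e * abs_proj f w"
proof -
 note fl = bergman_spaceD(1)[OF f]
 have "Aop v f w - Aop v' f w = (LINT u|vol. f u * (\<Phi> v u w - \<Phi> v' u w))"
  using f w \<Phi>_integrable[OF v(1) w fl] \<Phi>_integrable[OF v(2) w fl] by (simp add: Aop_def right_diff_distrib)
 then show ?thesis
  using dominated_by_kernel(3)[OF fl w borel_measurable_diff[OF \<Phi>_measurable_u[OF v(1) w] \<Phi>_measurable_u[OF v(2) w]] le] by simp
qed

lemma Aop_le:
 assumes v: "v \<in> unit_ball" and f: "f \<in> bergman_space p" and w: "w \<in> unit_ball"
  and le: "\<And>u. u \<in> unit_ball ==> norm (\<Phi> v u w) \<le> K * norm (kernel u w)"
 shows "norm (Aop v f w) \<le> K * abs_proj f w"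
 using dominated_by_kernel(3)[OF bergman_spaceD(1)[OF f] w \<Phi>_measurable_u[OF v w] le] f w by (simp add: Aop_def)

lemma Aop_linear:
 assumes v: "v \<in> unit_ball"
 shows "f \<in> bergman_space p ==> g \<in> bergman_space p ==> Aop v (\<lambda>z. f z + g z) = (\<lambda>z. Aop v f z + Aop v g z)"
  "f \<in> bergman_space p ==> Aop v (\<lambda>z. c * f z) = (\<lambda>z. c * Aop v f z)"
  "f \<notin> bergman_space p ==> Aop v f = (\<lambda>_. 0)"
proof -
 show "Aop v (\<lambda>z. f z + g z) = (\<lambda>z. Aop v f z + Aop v g z)" if fg: "f \<in> bergman_space p" "g \<in> bergman_space p"
 proof
  fix w
  show "Aop v (\<lambda>z. f z + g z) w = Aop v f w + Aop v g w"
  proof (cases "w \<in> unit_ball")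
   case True
   have "(\<lambda>z. f z + g z) \<in> bergman_space p" by (rule bergman_space_add[OF p_ge_1 fg])
   then show ?thesis using True fg \<Phi>_integrable[OF v True bergman_spaceD(1)[OF fg(1)]] \<Phi>_integrable[OF v True bergman_spaceD(1)[OF fg(2)]]
    by (simp add: Aop_def distrib_right)
  qed (simp add: Aop_def)
 qed
 show "Aop v (\<lambda>z. c * f z) = (\<lambda>z. c * Aop v f z)" if f: "f \<in> bergman_space p"
  using bergman_space_cmult[OF p_q(1) f, of c] f by (auto simp: Aop_def fun_eq_iff mult.assoc)
 show "Aop v f = (\<lambda>_. 0)" if "f \<notin> bergman_space p" using that by (simp add: Aop_def fun_eq_iff)
qed

lemma Aop_holomorphic:
 assumes v: "v \<in> unit_ball" and f: "f \<in> bergman_space p"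
 shows "holomorphic_several (Aop v f) unit_ball"
proof (rule holomorphic_several_cong)
 \<comment> \<open>At \<open>w = 0\<close> the kernel is 1, so the known integrability of
   \<open>f u * \<Phi> v u 0\<close> is that of the coefficient function of the
   superposition.\<close>
 have k0: "kernel x 0 = 1" for x :: "complex ^ 'n" by (simp add: kernel_def)
 have "integrable vol (\<lambda>u. f u * \<Phi> v u 0)" by (rule \<Phi>_integrable[OF v _ bergman_spaceD(1)[OF f]]) simp
 then have a: "integrable vol (\<lambda>u. f u * (of_real (defect (mobius u v) ^ (CARD('n) + 1)) * kap u (mobius u v)))"
  by (simp only: \<Phi>_def k0 mult_1_right)
 have \<psi>: "(\<lambda>u. mobius u v) \<in> measurable vol vol"
  using v mobius_in_ball[OF _ v]
  by (intro measurable_into_vol measurable_vol_continuous continuous_on_mobius_comp continuous_intros) (simp_all del: mem_ball_0)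
 show "holomorphic_several (\<lambda>w. \<integral>u. f u * (of_real (defect (mobius u v) ^ (CARD('n) + 1)) * kap u (mobius u v)) * kernel (mobius u v) w \<partial>vol) unit_ball"
  by (rule holomorphic_several_superposition[OF a \<psi>])
 show "(LINT u|vol. f u * (of_real (defect (mobius u v) ^ (CARD('n) + 1)) * kap u (mobius u v)) * kernel (mobius u v) w) = Aop v f w"
  if "w \<in> unit_ball" for w
  using f that by (simp add: Aop_def \<Phi>_def mult.assoc)
qed simp

lemma Aop_bounded_op:
 assumes R: "0 \<le> R" "R < 1"
 obtains B where "B \<ge> 0" "\<And>v. v \<in> cball 0 R ==> bounded_op p (Aop v)"
  "\<And>v f. v \<in> cball 0 R ==> f \<in> bergman_space p ==> bergman_norm p (Aop v f) \<le> B * bergman_norm p f"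
proof -
 define C where "C = Cmax"
 note C = Cmax[folded C_def]
 obtain K where K: "K > 0" "\<And>u v w. v \<in> cball 0 R ==> u \<in> unit_ball ==> w \<in> unit_ball ==> norm (\<Phi> v u w) \<le> K * norm (kernel u w)"
  using \<Phi>_bounds[OF R] by metis
 have main: "Aop v f \<in> bergman_space p \<and> bergman_norm p (Aop v f) \<le> C * K * bergman_norm p f"
  if v: "v \<in> cball 0 R" and f: "f \<in> bergman_space p" for v f
 proof -
  have vb: "v \<in> unit_ball" using v R by simp
  have h: "holomorphic_several (Aop v f) unit_ball" by (rule Aop_holomorphic[OF vb f])
  have "lp p (Aop v f) \<and> bergman_norm p (Aop v f) \<le> C * K * bergman_norm p f"
   using K(1) Aop_le[OF vb f _ K(2)[OF v]]
   by (intro C(2) bergman_spaceD(1)[OF f] measurable_vol_continuous[OF holomorphic_several_continuous[OF h]]) auto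
  then show ?thesis using h by (auto intro!: bergman_spaceI simp: Aop_def)
 qed
 show ?thesis
 proof (rule that[of "C * K"])
  show "C * K \<ge> 0" using C(1) K(1) by simp
  show "bounded_op p (Aop v)" if v: "v \<in> cball 0 R" for v
  proof -
   have vb: "v \<in> unit_ball" using v R by simp
   show ?thesis unfolding bounded_op_def using main[OF v] Aop_linear[OF vb] by blast
  qed
 qed (use main in blast)
qed

text \<open>Fubini is justified by the majorant \<open>|f u| |kernel u w| |g w|\<close>, integrable
  by the maximal projection bound and Hoelder's inequality. The two normalized kernels contribute
  \<open>half u * half u = defect u ^ (n + 1)\<close>, which turns \<open>vol\<close> into
  \<open>inv_vol\<close>.\<close>

theorem Aop_weak:
 assumes v: "v \<in> unit_ball" and f: "f \<in> bergman_space p" and g: "g \<in> bergman_space q"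
 shows "pairing (Aop v f) g = (LINT u|inv_vol. symb v u * pairing f (transl u (normalized_kernel 0)) * pairing (transl u (normalized_kernel v)) g)"
proof -
 define NN where "NN = CARD('n) + 1"
 note fl = bergman_spaceD(1)[OF f] and gl = bergman_spaceD(1)[OF g]
 note fm[measurable] = lp_measurable[OF fl] and gm[measurable] = lp_measurable[OF gl]
 obtain K where K: "K > 0" "\<And>u w. u \<in> unit_ball ==> w \<in> unit_ball ==> norm (\<Phi> v u w) \<le> K * norm (kernel u w)"
  using \<Phi>_bounds[of "norm v"] v by (metis mem_ball_0 mem_cball_0 norm_ge_zero order_refl)
 define C where "C = Cmax"
 note C = Cmax[folded C_def]
 interpret P: pair_sigma_finite "vol :: (complex ^ 'n) measure" "vol :: (complex ^ 'n) measure" by standard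
 have \<Phi>m: "(\<lambda>(w, u). \<Phi> v u w) \<in> borel_measurable vol2"
  unfolding case_prod_beta using v by (intro measurable_vol2_continuous continuous_on_\<Phi> continuous_intros) auto
 have km: "(\<lambda>(w, u). kernel u w) \<in> borel_measurable (vol \<Otimes>\<^sub>M (vol :: (complex ^ 'n) measure))" by (rule kernel_measurable_pair)
 define G where "G w u = f u * \<Phi> v u w * cnj (g w)" for w u
 have Gm: "(\<lambda>(w, u). G w u) \<in> borel_measurable vol2"
  using \<Phi>m unfolding G_def case_prod_beta by measurable
 define m where "m w = abs_proj f w" for w :: "complex ^ 'n"
 have mm: "m \<in> borel_measurable vol"
 proof -
  have "(\<lambda>(w, u). norm (f u) * norm (kernel u w)) \<in> borel_measurable (vol \<Otimes>\<^sub>M (vol :: (complex ^ 'n) measure))"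
   using km unfolding case_prod_beta by measurable
  then show ?thesis unfolding m_def by (rule vol.borel_measurable_lebesgue_integral)
 qed
 have m0: "m w \<ge> 0" for w unfolding m_def by (intro integral_nonneg_AE AE_I2) simp
 have ml: "lp p (\<lambda>w. complex_of_real (m w))"
 proof -
  have mc: "(\<lambda>w. complex_of_real (m w)) \<in> borel_measurable vol" using mm by measurable
  have "norm (complex_of_real (m x)) \<le> 1 * abs_proj f x" for x
   using m0[of x] by (simp add: m_def[symmetric])
  then show ?thesis using C(2)[OF fl mc zero_le_one] by blast
 qed
 have mg: "integrable vol (\<lambda>w. m w * norm (g w))"
  using integrable_norm[OF Hoelder(1)[OF ml gl]] m0 by (simp add: norm_mult)
 have Gi: "integrable vol2 (\<lambda>(w, u). G w u)"
 proof (rule P.Fubini_integrable[OF Gm])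
  have Gw: "integrable vol (G w)" if "w \<in> unit_ball" for w
   unfolding G_def using \<Phi>_integrable[OF v that fl] by simp
  show "AE w in vol. integrable vol (\<lambda>u. case (w, u) of (w, u) \<Rightarrow> G w u)" by (rule AE_I2) (simp add: Gw)
  show "integrable vol (\<lambda>w. \<integral>u. norm (case (w, u) of (w, u) \<Rightarrow> G w u) \<partial>vol)"
  proof (rule integrable_dominated)
   show "integrable vol (\<lambda>w. K * (m w * norm (g w)))" using mg by simp
   have "(\<lambda>(w, u). norm (G w u)) \<in> borel_measurable vol2" using Gm unfolding case_prod_beta by measurable
   then show "(\<lambda>w. \<integral>u. norm (case (w, u) of (w, u) \<Rightarrow> G w u) \<partial>vol) \<in> borel_measurable vol"
    unfolding prod.case by (rule vol.borel_measurable_lebesgue_integral)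
   show "AE w in vol. norm (LINT u|vol. norm (case (w, u) of (w, u) \<Rightarrow> G w u)) \<le> norm (K * (m w * norm (g w)))"
   proof (rule AE_I2)
    fix w :: "complex ^ 'n" assume "w \<in> space vol"
    then have w: "w \<in> unit_ball" by simp
    have "(LINT u|vol. norm (G w u)) = (LINT u|vol. norm (f u * \<Phi> v u w)) * norm (g w)"
     unfolding G_def norm_mult[of _ "cnj (g w)"] complex_mod_cnj by (rule integral_mult_left_zero)
    then have "(LINT u|vol. norm (G w u)) \<le> K * (m w * norm (g w))"
     using mult_right_mono[OF dominated_by_kernel(2)[OF fl w \<Phi>_measurable_u[OF v w] K(2)[OF _ w]], of "norm (g w)"]
     by (simp add: m_def mult.assoc)
    moreover have "0 \<le> (LINT u|vol. norm (G w u))" by (intro integral_nonneg_AE AE_I2) simp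
    ultimately show "norm (LINT u|vol. norm (case (w, u) of (w, u) \<Rightarrow> G w u)) \<le> norm (K * (m w * norm (g w)))" by simp
   qed
  qed
 qed
 have "pairing (Aop v f) g = (LINT w|vol. (LINT u|vol. G w u))"
  unfolding pairing_def using f by (intro lint_cong) (auto simp: Aop_def G_def)
 also have "... = (LINT u|vol. (LINT w|vol. G w u))" by (rule P.Fubini_integral[OF Gi, symmetric])
 also have "... = (LINT u|vol. (1 / defect u ^ NN) *\<^sub>R (of_real (defect u ^ NN) * (LINT w|vol. G w u)))"
 proof (rule lint_cong[OF refl])
  fix u :: "complex ^ 'n" assume "u \<in> space vol"
  then have "defect u ^ NN \<noteq> 0" using defect_pos[of u] by simp
  then show "(LINT w|vol. G w u) = (1 / defect u ^ NN) *\<^sub>R (of_real (defect u ^ NN) * (LINT w|vol. G w u))"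
   by (simp add: scaleR_conv_of_real)
 qed
 also have "... = (LINT u|inv_vol. of_real (defect u ^ NN) * (LINT w|vol. G w u))"
  unfolding inv_vol_alt NN_def[symmetric]
 proof (rule integral_density[symmetric])
  have dm[measurable]: "(defect :: complex ^ 'n \<Rightarrow> real) \<in> borel_measurable vol" by (rule measurable_volI[OF defect_measurable])
  have "(\<lambda>(u, w). G w u) \<in> borel_measurable vol2"
   using measurable_compose[OF measurable_pair_swap' Gm] by (simp add: case_prod_beta)
  then have "(\<lambda>u. \<integral>w. G w u \<partial>vol) \<in> borel_measurable vol" by (rule vol.borel_measurable_lebesgue_integral)
  then show "(\<lambda>u. of_real (defect u ^ NN) * (LINT w|vol. G w u)) \<in> borel_measurable vol" by measurable
  show "(\<lambda>u :: complex ^ 'n. 1 / defect u ^ NN) \<in> borel_measurable vol" by measurable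
  show "AE u :: complex ^ 'n in vol. 0 \<le> 1 / defect u ^ NN" by (rule AE_I2) (simp add: defect_pos less_imp_le)
 qed
 also have "... = (LINT u|inv_vol. symb v u * pairing f (transl u (normalized_kernel 0)) * pairing (transl u (normalized_kernel v)) g)"
 proof (rule lint_cong[OF refl])
  fix u :: "complex ^ 'n" assume "u \<in> space inv_vol"
  then have u: "u \<in> unit_ball" by simp
  have 1: "pairing f (transl u (normalized_kernel 0)) = of_real (half u) * f u"
  proof -
   have "pairing f (transl u (normalized_kernel 0)) = of_real (half u) * pairing f (kernel u)"
    unfolding transl_0[OF u] nk[OF u] pairing_def by (subst integral_mult_right_zero[symmetric]) (simp add: mult_ac)
   then show ?thesis using pairing_kernel[OF f u] by simp
  qed
  have 2: "of_real (half u) * symb v u * (LINT w|vol. f u * (transl u (normalized_kernel v) w * cnj (g w)))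
    = of_real (half u * half u) * (LINT w|vol. G w u)"
   unfolding integral_mult_right_zero[symmetric]
  proof (rule lint_cong[OF refl])
   fix w :: "complex ^ 'n" assume "w \<in> space vol"
   then have w: "w \<in> unit_ball" by simp
   show "of_real (half u) * symb v u * (f u * (transl u (normalized_kernel v) w * cnj (g w))) = of_real (half u * half u) * G w u"
    unfolding G_def \<Phi>_eq[OF u v w] by (simp add: transl_def nk[OF u] mult_ac)
  qed
  have "symb v u * (of_real (half u) * f u) * pairing (transl u (normalized_kernel v)) g
   = of_real (half u) * symb v u * (f u * pairing (transl u (normalized_kernel v)) g)" by (simp only: mult_ac)
  also have "... = of_real (defect u ^ NN) * (LINT w|vol. G w u)"
   using 2 unfolding pairing_def half_sq[OF u] NN_def integral_mult_right_zero[of vol "f u"] .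
  finally show "of_real (defect u ^ NN) * (LINT w|vol. G w u) = symb v u * pairing f (transl u (normalized_kernel 0)) * pairing (transl u (normalized_kernel v)) g"
   unfolding 1 by simp
 qed
 finally show ?thesis .
qed

text \<open>\<open>Aop v\<close> satisfies the description by \<open>Aop_weak\<close>, and any other
  candidate has the same values, since these are pairings with \<open>kernel w\<close>.\<close>

theorem weak_op_integral_eq:
 assumes v: "v \<in> unit_ball"
 shows "weak_op_integral p q (symb v) (normalized_kernel v) (normalized_kernel 0) = Aop v"
 unfolding weak_op_integral_def
proof (rule the_equality)
 have "bounded_op p (Aop v)" using Aop_bounded_op[of "norm v"] v by (metis mem_ball_0 mem_cball_0 norm_ge_zero order_refl)
 then show "bounded_op p (Aop v) \<and> (\<forall>f\<in>bergman_space p. \<forall>g\<in>bergman_space q. pairing (Aop v f) g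
  = (LINT u|inv_vol. symb v u * pairing f (transl u (normalized_kernel 0)) * pairing (transl u (normalized_kernel v)) g))"
  using Aop_weak[OF v] by blast
 fix A
 assume A: "bounded_op p A \<and> (\<forall>f\<in>bergman_space p. \<forall>g\<in>bergman_space q. pairing (A f) g
  = (LINT u|inv_vol. symb v u * pairing f (transl u (normalized_kernel 0)) * pairing (transl u (normalized_kernel v)) g))"
 show "A = Aop v"
 proof (intro ext)
  fix f and w :: "complex ^ 'n"
  show "A f w = Aop v f w"
  proof (cases "f \<in> bergman_space p")
   case f: True
   have Af: "A f \<in> bergman_space p" using A bounded_opD(1) f by blast
   have Bf: "Aop v f \<in> bergman_space p" by (rule bounded_opD(1)[OF \<open>bounded_op p (Aop v)\<close> f])
   show ?thesis
   proof (cases "w \<in> unit_ball")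
    case w: True
    have kb: "kernel w \<in> bergman_space q" by (rule kernel_bergman[OF w p_q(2)])
    have "A f w = pairing (A f) (kernel w)" using pairing_kernel[OF Af w] by simp
    also have "... = pairing (Aop v f) (kernel w)" using A f kb Aop_weak[OF v f kb] by simp
    also have "... = Aop v f w" by (rule pairing_kernel[OF Bf w])
    finally show ?thesis .
   qed (use bergman_spaceD(3)[OF Af] bergman_spaceD(3)[OF Bf] in simp)
  next
   case False
   have "A f = (\<lambda>_. 0)" using A bounded_opD(2)[of p A f] False by blast
   then show ?thesis using Aop_linear(3)[OF v False] by simp
  qed
 qed
qed

end

section \<open>Integrals of operator-valued functions\<close>

lemma norm_integral_le_measure:
 fixes g :: "'m \<Rightarrow> complex"
 assumes "finite_measure M" "c \<ge> 0" "\<And>v. v \<in> space M ==> norm (g v) \<le> c"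
 shows "norm (LINT v|M. g v) \<le> measure M (space M) * c"
\<comment> \<open>A function that is not integrable has integral 0, so the bound holds without any
  measurability.\<close>
proof (cases "integrable M g")
 case True
 interpret finite_measure M by fact
 have "norm (LINT v|M. g v) \<le> (LINT v|M. norm (g v))" by (rule integral_norm_bound)
 also have "... \<le> (LINT v|M. c)" using True assms(3) by (intro integral_mono) auto
 finally show ?thesis by simp
qed (use assms(2) in \<open>simp add: not_integrable_integral_eq\<close>)

lemma bounded_op_zero: "p > 0 ==> bounded_op p (\<lambda>_ _. 0)"
 by (auto simp: bounded_op_def bergman_space_zero bergman_norm_zero bergman_norm_nonneg intro!: exI[of _ 0])

lemma bounded_op_lincomb:
 assumes p: "p \<ge> 1" and A: "bounded_op p A" and B: "bounded_op p B"
 shows "bounded_op p (\<lambda>f w. c * A f w + B f w)"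
proof -
 have p0: "p > 0" using p by simp
 obtain CA where CA: "CA \<ge> 0" "\<And>f. f \<in> bergman_space p ==> bergman_norm p (A f) \<le> CA * bergman_norm p f"
  using bounded_op_bound[OF A] by blast
 obtain CB where CB: "CB \<ge> 0" "\<And>f. f \<in> bergman_space p ==> bergman_norm p (B f) \<le> CB * bergman_norm p f"
  using bounded_op_bound[OF B] by blast
 note mem = bergman_space_cmult[OF p0 bounded_opD(1)[OF A]] bounded_opD(1)[OF B]
 have "bergman_norm p (\<lambda>w. c * A f w + B f w) \<le> (norm c * CA + CB) * bergman_norm p f" if f: "f \<in> bergman_space p" for f
 proof -
  have "bergman_norm p (\<lambda>w. c * A f w + B f w) \<le> bergman_norm p (\<lambda>w. c * A f w) + bergman_norm p (B f)"
   by (rule lp_add(2)[OF bergman_spaceD(1)[OF mem(1)[OF f]] bergman_spaceD(1)[OF mem(2)[OF f]] p])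
  also have "bergman_norm p (\<lambda>w. c * A f w) = norm c * bergman_norm p (A f)"
   by (rule lp_cmult(2)[OF bergman_spaceD(1)[OF bounded_opD(1)[OF A f]] p0])
  also have "norm c * bergman_norm p (A f) + bergman_norm p (B f) \<le> norm c * (CA * bergman_norm p f) + CB * bergman_norm p f"
   using CA(2)[OF f] CB(2)[OF f] by (intro add_mono mult_left_mono) auto
  finally show ?thesis by (simp add: algebra_simps)
 qed
 moreover have "(\<lambda>w. c * A f w + B f w) \<in> bergman_space p" if "f \<in> bergman_space p" for f
  by (rule bergman_space_add[OF p mem(1)[OF that] mem(2)[OF that]])
 ultimately have 1: "\<exists>C. \<forall>f\<in>bergman_space p. bergman_norm p (\<lambda>w. c * A f w + B f w) \<le> C * bergman_norm p f"
  and 2: "\<forall>f\<in>bergman_space p. (\<lambda>w. c * A f w + B f w) \<in> bergman_space p" by blast+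
 show ?thesis unfolding bounded_op_def
  by (intro conjI 1 2) (simp_all add: bounded_opD[OF A] bounded_opD[OF B] algebra_simps)
qed

lemma bounded_op_sum:
 assumes "p \<ge> 1" "finite X" "\<And>B. B \<in> X ==> bounded_op p (h B)"
 shows "bounded_op p (\<lambda>f w. \<Sum>B\<in>X. c B * h B f w)"
 using assms(2,3)
proof (induction X rule: finite_induct)
 case empty then show ?case using assms(1) bounded_op_zero[of p] by simp
next
 case (insert B X)
 then show ?case using bounded_op_lincomb[OF assms(1), of "h B" _ "c B"] by simp
qed

lemma op_simple_integral:
 assumes M: "finite_measure M" and S: "op_simple p M S"
 shows "integrable M (\<lambda>v. S v f w)" "op_simple_integral M S f w = (LINT v|M. S v f w)"
proof -
 interpret finite_measure M by (rule M)
 define E where "E B = {v \<in> space M. S v = B}" for B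
 have fin: "finite (S ` space M)" using S by (simp add: op_simple_def simple_function_def)
 have Es: "E B \<in> sets M" if "B \<in> S ` space M" for B
 proof -
  have "S -` {B} \<inter> space M \<in> sets M" using S that unfolding op_simple_def simple_function_def by blast
  also have "S -` {B} \<inter> space M = E B" by (auto simp: E_def)
  finally show ?thesis .
 qed
 have eq: "S v f w = (\<Sum>B\<in>S ` space M. indicator (E B) v *\<^sub>R B f w)" if v: "v \<in> space M" for v
 proof -
  have "(\<Sum>B\<in>S ` space M. indicator (E B) v *\<^sub>R B f w) = (\<Sum>B\<in>S ` space M. if B = S v then B f w else 0)"
   using v by (intro sum.cong) (auto simp: E_def)
  then show ?thesis using v fin by simp
 qed
 have i: "integrable M (\<lambda>v. indicator (E B) v *\<^sub>R B f w)" if "B \<in> S ` space M" for B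
  using Es[OF that] by (intro integrable_scaleR_left) (auto simp: emeasure_eq_measure)
 show "integrable M (\<lambda>v. S v f w)"
  using Bochner_Integration.integrable_cong[OF refl eq, of M "\<lambda>v. v"] i by auto
 have "(LINT v|M. S v f w) = (LINT v|M. (\<Sum>B\<in>S ` space M. indicator (E B) v *\<^sub>R B f w))"
  by (rule lint_cong[OF refl eq])
 also have "... = (\<Sum>B\<in>S ` space M. (LINT v|M. indicator (E B) v *\<^sub>R B f w))" by (rule Bochner_Integration.integral_sum[OF i])
 also have "... = (\<Sum>B\<in>S ` space M. of_real (measure M (E B)) * B f w)"
 proof (rule sum.cong[OF refl])
  fix B assume B: "B \<in> S ` space M"
  have "E B \<inter> space M = E B" by (auto simp: E_def)
  then show "(LINT v|M. indicator (E B) v *\<^sub>R B f w) = of_real (measure M (E B)) * B f w"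
   using Es[OF B] by (subst integral_scaleR_left) (auto simp: emeasure_eq_measure scaleR_conv_of_real)
 qed
 finally show "op_simple_integral M S f w = (LINT v|M. S v f w)" by (simp add: op_simple_integral_def E_def)
qed

lemma bounded_op_simple_integral:
 assumes "p \<ge> 1" "op_simple p M S" shows "bounded_op p (op_simple_integral M S)"
 unfolding op_simple_integral_def
 using assms by (intro bounded_op_sum) (auto simp: op_simple_def simple_function_def)

lemma op_has_integral_cong:
 assumes eq: "\<And>v. v \<in> space M ==> A v = A' v"
 shows "op_has_integral p M A I \<longleftrightarrow> op_has_integral p M A' I"
proof -
 have "(\<lambda>v. op_norm p (A v - S v)) \<in> borel_measurable M \<longleftrightarrow> (\<lambda>v. op_norm p (A' v - S v)) \<in> borel_measurable M"
  "(\<integral>\<^sup>+v. ennreal (op_norm p (A v - S v)) \<partial>M) = (\<integral>\<^sup>+v. ennreal (op_norm p (A' v - S v)) \<partial>M)" for S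
  using eq by (auto intro!: measurable_cong nn_integral_cong)
 then show ?thesis unfolding op_has_integral_def using eq by simp
qed

context conjugate_exponents
begin

lemma op_norm_triangle:
 fixes R S U :: "('n::finite) oper"
 assumes R: "bounded_op p R" and S: "bounded_op p S" and U: "bounded_op p U"
 shows "op_norm p (R - U) \<le> op_norm p (R - S) + op_norm p (S - U)"
proof (rule op_norm_le[OF p_q(1)])
 fix f :: "'n cfun" assume f: "f \<in> bergman_space p"
 note RS = bounded_op_diff_bound[OF R S f] and SU = bounded_op_diff_bound[OF S U f]
 have "(R - U) f = (\<lambda>z. (R - S) f z + (S - U) f z)" by (simp add: fun_eq_iff)
 then have "bergman_norm p ((R - U) f) \<le> bergman_norm p ((R - S) f) + bergman_norm p ((S - U) f)"
  using lp_add(2)[OF bergman_spaceD(1)[OF RS(2)] bergman_spaceD(1)[OF SU(2)] p_ge_1] by simp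
 then show "bergman_norm p ((R - U) f) \<le> (op_norm p (R - S) + op_norm p (S - U)) * bergman_norm p f"
  using RS(1) SU(1) by (simp add: distrib_right)
 have "f \<in> bergman_space p" by (rule f)
next
 show "op_norm p (R - S) + op_norm p (S - U) \<ge> 0"
  using bounded_op_diff_bound(3)[OF R S bergman_space_zero[OF p_q(1)]]
   bounded_op_diff_bound(3)[OF S U bergman_space_zero[OF p_q(1)]] by simp
qed

lemma op_norm_minus_commute:
 fixes S U :: "('n::finite) oper"
 shows "op_norm p (S - U) = op_norm p (U - S)"
proof -
 have "bergman_norm p ((S - U) f) = bergman_norm p ((U - S) f)" for f
  by (rule bergman_norm_cong) (simp add: norm_minus_commute)
 then show ?thesis by (simp add: op_norm_def)
qed

lemma op_diff_point_eval:
 fixes S U :: "('n::finite) oper"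
 assumes S: "bounded_op p S" and U: "bounded_op p U" and f: "f \<in> bergman_space p" and w: "w \<in> unit_ball"
 shows "norm (S f w - U f w) \<le> 1 / (1 - norm w) ^ (CARD('n) + 1) * bergman_norm p f * op_norm p (S - U)"
proof -
 have "norm (S f w - U f w) \<le> 1 / (1 - norm w) ^ (CARD('n) + 1) * bergman_norm p ((S - U) f)"
  using point_eval[OF bounded_op_diff_bound(2)[OF S U f] w] by simp
 also have "... \<le> 1 / (1 - norm w) ^ (CARD('n) + 1) * (op_norm p (S - U) * bergman_norm p f)"
  using bounded_op_diff_bound(1)[OF S U f] w by (intro mult_left_mono) auto
 finally show ?thesis by (simp only: mult_ac)
qed

text \<open>Evaluation at \<open>f\<close> and \<open>w\<close> is bounded with respect to the
  operator norm (\<open>op_diff_point_eval\<close>) and commutes with the integral of simple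
  functions, so it passes to the limit. Uniqueness of the operator-valued integral follows.\<close>

lemma op_has_integral_eval:
 fixes A :: "'m \<Rightarrow> ('n::finite) oper"
 assumes M: "finite_measure M" and I: "op_has_integral p M A I"
  and f: "f \<in> bergman_space p" and w: "w \<in> unit_ball" and Ai: "integrable M (\<lambda>v. A v f w)"
 shows "I f w = (LINT v|M. A v f w)"
proof -
 define c where "c = 1 / (1 - norm w) ^ (CARD('n) + 1) * bergman_norm p f"
 have c: "c \<ge> 0" using w by (simp add: c_def bergman_norm_nonneg)
 have Ab: "\<And>v. v \<in> space M ==> bounded_op p (A v)" and Ib: "bounded_op p I" using I by (auto simp: op_has_integral_def)
 obtain S where S: "\<And>i. op_simple p M (S i)"
  and l1: "(\<lambda>i. \<integral>\<^sup>+v. ennreal (op_norm p (A v - S i v)) \<partial>M) \<longlonglongrightarrow> 0"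
  and l2: "(\<lambda>i. op_norm p (op_simple_integral M (S i) - I)) \<longlonglongrightarrow> 0"
  and m: "\<And>i. (\<lambda>v. op_norm p (A v - S i v)) \<in> borel_measurable M"
  using I by (auto simp: op_has_integral_def)
 have le: "ennreal (norm ((LINT v|M. A v f w) - I f w)) \<le> ennreal c * (\<integral>\<^sup>+v. ennreal (op_norm p (A v - S i v)) \<partial>M)
   + ennreal (c * op_norm p (op_simple_integral M (S i) - I))" for i
 proof -
  have Sb: "bounded_op p (S i v)" if "v \<in> space M" for v using S[of i] that by (auto simp: op_simple_def)
  note Si = op_simple_integral[OF M S[of i], of f w]
  have "(LINT v|M. A v f w) - I f w = (LINT v|M. A v f w - S i v f w) + (op_simple_integral M (S i) f w - I f w)"
   unfolding Si(2) using Ai Si(1) by simp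
  then have "ennreal (norm ((LINT v|M. A v f w) - I f w))
   \<le> ennreal (norm (LINT v|M. A v f w - S i v f w) + norm (op_simple_integral M (S i) f w - I f w))"
   by (intro ennreal_leI) (simp only: norm_triangle_ineq)
  also have "... = ennreal (norm (LINT v|M. A v f w - S i v f w)) + ennreal (norm (op_simple_integral M (S i) f w - I f w))"
   by simp
  also have "... \<le> ennreal c * (\<integral>\<^sup>+v. ennreal (op_norm p (A v - S i v)) \<partial>M)
   + ennreal (c * op_norm p (op_simple_integral M (S i) - I))"
  proof (rule add_mono)
   have "ennreal (norm (LINT v|M. A v f w - S i v f w)) \<le> (\<integral>\<^sup>+v. ennreal (norm (A v f w - S i v f w)) \<partial>M)"
    using Ai Si(1) by (intro integral_norm_bound_ennreal) auto
   also have "... \<le> (\<integral>\<^sup>+v. ennreal c * ennreal (op_norm p (A v - S i v)) \<partial>M)"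
   proof (rule nn_integral_mono)
    fix v assume "v \<in> space M"
    then show "ennreal (norm (A v f w - S i v f w)) \<le> ennreal c * ennreal (op_norm p (A v - S i v))"
     using op_diff_point_eval[OF Ab Sb f w, of v v] bounded_op_diff_bound(3)[OF Ab Sb f, of v v]
     unfolding c_def[symmetric] ennreal_mult'[OF c, symmetric] by (intro ennreal_leI) simp
   qed
   also have "... = ennreal c * (\<integral>\<^sup>+v. ennreal (op_norm p (A v - S i v)) \<partial>M)"
    using m[of i] by (intro nn_integral_cmult) simp
   finally show "ennreal (norm (LINT v|M. A v f w - S i v f w)) \<le> ennreal c * (\<integral>\<^sup>+v. ennreal (op_norm p (A v - S i v)) \<partial>M)" .
   show "ennreal (norm (op_simple_integral M (S i) f w - I f w)) \<le> ennreal (c * op_norm p (op_simple_integral M (S i) - I))"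
    using op_diff_point_eval[OF bounded_op_simple_integral[OF p_ge_1 S] Ib f w]
    unfolding c_def by (rule ennreal_leI)
  qed
  finally show ?thesis .
 qed
 have "(\<lambda>i. ennreal c * (\<integral>\<^sup>+v. ennreal (op_norm p (A v - S i v)) \<partial>M)
   + ennreal (c * op_norm p (op_simple_integral M (S i) - I))) \<longlonglongrightarrow> ennreal c * 0 + ennreal (c * 0)"
  by (intro tendsto_add ennreal_tendsto_cmult l1 tendsto_ennrealI tendsto_mult_left l2) simp
 then have "ennreal (norm ((LINT v|M. A v f w) - I f w)) \<le> ennreal c * 0 + ennreal (c * 0)"
  by (rule tendsto_lowerbound) (use le in auto)
 then show ?thesis by simp
qed

lemma op_has_integral_unique:
 fixes A :: "'m \<Rightarrow> ('n::finite) oper"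
 assumes M: "finite_measure M" and I: "op_has_integral p M A I" and J: "op_has_integral p M A J"
  and Ai: "\<And>f w. f \<in> bergman_space p ==> w \<in> unit_ball ==> integrable M (\<lambda>v. A v f w)"
 shows "J = I"
proof (intro ext)
 fix f :: "'n cfun" and w :: "complex ^ 'n"
 have b: "bounded_op p I" "bounded_op p J" using I J by (auto simp: op_has_integral_def)
 consider "f \<notin> bergman_space p" | "f \<in> bergman_space p" "w \<notin> unit_ball" | "f \<in> bergman_space p" "w \<in> unit_ball" by blast
 then show "J f w = I f w"
 proof cases
  case 1 then show ?thesis using bounded_opD(2)[OF b(1)] bounded_opD(2)[OF b(2)] by simp
 next
  case 2 then show ?thesis
   using bergman_spaceD(3)[OF bounded_opD(1)[OF b(1)]] bergman_spaceD(3)[OF bounded_opD(1)[OF b(2)]] by simp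
 next
  case 3 then show ?thesis using op_has_integral_eval[OF M I 3 Ai] op_has_integral_eval[OF M J 3 Ai] by simp
 qed
qed

end

section \<open>Uniform continuity and boundedness in v\<close>

context bergman_operator
begin

text \<open>The pointwise bound is recorded next to the norm bound because it survives integration
  over \<open>v\<close>: in \<open>Aop_has_integral\<close> it bounds the difference of two
  integrals by a multiple of the maximal projection.\<close>

lemma Aop_uniform:
 assumes R: "0 \<le> R" "R < 1"
 obtains C where "C > 0" "\<And>e. e > 0 ==> \<exists>\<delta>>0. \<forall>v\<in>cball 0 R. \<forall>v'\<in>cball 0 R. dist v v' < \<delta> \<longrightarrow>
  op_norm p (Aop v - Aop v') \<le> C * e \<and>
  (\<forall>f\<in>bergman_space p. \<forall>w\<in>unit_ball. norm (Aop v f w - Aop v' f w) \<le> e * abs_proj f w)"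
proof -
 define C where "C = Cmax"
 note C = Cmax[folded C_def]
 obtain K where K: "\<And>e. e > 0 ==> \<exists>\<delta>>0. \<forall>v\<in>cball 0 R. \<forall>v'\<in>cball 0 R. dist v v' < \<delta> \<longrightarrow>
   (\<forall>u\<in>unit_ball. \<forall>w\<in>unit_ball. norm (\<Phi> v u w - \<Phi> v' u w) \<le> e * norm (kernel u w))"
  using \<Phi>_bounds[OF R] by metis
 obtain B where B: "\<And>v. v \<in> cball 0 R ==> bounded_op p (Aop v)" using Aop_bounded_op[OF R] by blast
 show ?thesis
 proof (rule that[OF C(1)])
  fix e :: real assume e: "e > 0"
  obtain \<delta> where \<delta>: "\<delta> > 0" "\<And>v v' u w. v \<in> cball 0 R ==> v' \<in> cball 0 R ==> dist v v' < \<delta> ==> u \<in> unit_ball ==> w \<in> unit_ball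
   ==> norm (\<Phi> v u w - \<Phi> v' u w) \<le> e * norm (kernel u w)"
   using K[OF e] by blast
  have "op_norm p (Aop v - Aop v') \<le> C * e \<and>
   (\<forall>f\<in>bergman_space p. \<forall>w\<in>unit_ball. norm (Aop v f w - Aop v' f w) \<le> e * abs_proj f w)"
   if v: "v \<in> cball 0 R" "v' \<in> cball 0 R" "dist v v' < \<delta>" for v v'
  proof -
   have vb: "v \<in> unit_ball" "v' \<in> unit_ball" using v R by auto
   have le: "norm (Aop v f w - Aop v' f w) \<le> e * abs_proj f w"
    if f: "f \<in> bergman_space p" and w: "w \<in> unit_ball" for f w
    by (rule Aop_diff_le[OF vb f w \<delta>(2)[OF v _ w]])
   have "op_norm p (Aop v - Aop v') \<le> C * e"
   proof (rule op_norm_le[OF p_q(1)])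
    fix f :: "'n cfun" assume f: "f \<in> bergman_space p"
    have m: "(Aop v - Aop v') f \<in> borel_measurable vol"
     by (rule lp_measurable[OF bergman_spaceD(1)[OF bounded_op_diff_bound(2)[OF B[OF v(1)] B[OF v(2)] f]]])
    show "bergman_norm p ((Aop v - Aop v') f) \<le> C * e * bergman_norm p f"
     using C(2)[OF bergman_spaceD(1)[OF f] m less_imp_le[OF e]] le[OF f] by simp
   qed (use C(1) e in simp)
   then show ?thesis using le by blast
  qed
  then show "\<exists>\<delta>>0. \<forall>v\<in>cball 0 R. \<forall>v'\<in>cball 0 R. dist v v' < \<delta> \<longrightarrow>
   op_norm p (Aop v - Aop v') \<le> C * e \<and>
   (\<forall>f\<in>bergman_space p. \<forall>w\<in>unit_ball. norm (Aop v f w - Aop v' f w) \<le> e * abs_proj f w)"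
   using \<delta>(1) by blast
 qed
qed

lemma Aop_uniform_bergman:
 assumes \<rho>: "\<rho> > 0" and e: "e > 0"
 shows "\<exists>\<delta>>0. \<forall>v\<in>bergman_ball 0 \<rho>. \<forall>v'\<in>bergman_ball 0 \<rho>. bergman_dist v v' < \<delta> \<longrightarrow> op_norm p (Aop v - Aop v') < e"
proof -
 obtain R where R: "0 \<le> R" "R < 1" "bergman_ball (0 :: complex ^ 'n) \<rho> \<subseteq> cball 0 R" by (rule bergman_ball_0_subset[OF \<rho>])
 obtain C where C: "C > 0" "\<And>e. e > 0 ==> \<exists>\<delta>>0. \<forall>v\<in>cball 0 R. \<forall>v'\<in>cball 0 R. dist v v' < \<delta> \<longrightarrow>
  op_norm p (Aop v - Aop v') \<le> C * e \<and>
  (\<forall>f\<in>bergman_space p. \<forall>w\<in>unit_ball. norm (Aop v f w - Aop v' f w) \<le> e * abs_proj f w)"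
  using Aop_uniform[OF R(1,2)] by blast
 have "e / (2 * C) > 0" using e C(1) by simp
 then obtain \<delta> where \<delta>: "\<delta> > 0" "\<And>v v'. v \<in> cball 0 R ==> v' \<in> cball 0 R ==> dist v v' < \<delta> ==> op_norm p (Aop v - Aop v') \<le> C * (e / (2 * C))"
  using C(2) by blast
 have d: "1 - R\<^sup>2 > 0" using R by (simp add: power_less_one_iff abs_square_less_1)
 \<comment> \<open>The 8 accounts for the factor 4 in \<open>norm_mobius_ge\<close> and the factor 2
   in \<open>bergman_dist_ge\<close>, and leaves
   \<open>dist v v' \<le> \<delta> / 2\<close>.\<close>
 define \<eta> where "\<eta> = \<delta> * sqrt (1 - R\<^sup>2) / 8"
 have \<eta>: "\<eta> > 0" using \<delta>(1) d by (simp add: \<eta>_def)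
 have "op_norm p (Aop v - Aop v') < e"
  if v: "v \<in> bergman_ball 0 \<rho>" "v' \<in> bergman_ball 0 \<rho>" and l: "bergman_dist v v' < \<eta>" for v v'
 proof -
  have vb: "v \<in> unit_ball" "v' \<in> unit_ball" using v by (auto simp: bergman_ball_def)
  have vR: "v \<in> cball 0 R" "v' \<in> cball 0 R" using v R by auto
  have "1 - R\<^sup>2 \<le> defect v" using vR(1) R(1) by (simp add: defect_def)
  then have "(1 - R\<^sup>2) * (dist v v')\<^sup>2 \<le> 4 * (norm (mobius v v'))\<^sup>2"
   using norm_mobius_ge[OF vb] mult_right_mono[of "1 - R\<^sup>2" "defect v" "(dist v v')\<^sup>2"] by simp
  also have "... \<le> 4 * (2 * \<eta>)\<^sup>2"
   using bergman_dist_ge[OF vb] l by (intro mult_left_mono power_mono) auto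
  also have "... = (1 - R\<^sup>2) * (\<delta> / 2)\<^sup>2" using d by (simp add: \<eta>_def power_mult_distrib power_divide)
  finally have "(dist v v')\<^sup>2 \<le> (\<delta> / 2)\<^sup>2" using d by simp
  then have "dist v v' \<le> \<delta> / 2" using \<delta>(1) by (simp add: power2_le_iff_abs_le)
  then have "dist v v' < \<delta>" using \<delta>(1) by simp
  then have "op_norm p (Aop v - Aop v') \<le> C * (e / (2 * C))" by (rule \<delta>(2)[OF vR])
  then show ?thesis using e C(1) by simp
 qed
 then show ?thesis using \<eta> by blast
qed

lemma Aop_norm_bounded:
 assumes \<rho>: "\<rho> > 0"
 shows "\<exists>C. \<forall>v\<in>bergman_ball 0 \<rho>. bounded_op p (Aop v) \<and> op_norm p (Aop v) \<le> C"
proof -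
 obtain R where R: "0 \<le> R" "R < 1" "bergman_ball (0 :: complex ^ 'n) \<rho> \<subseteq> cball 0 R" by (rule bergman_ball_0_subset[OF \<rho>])
 obtain B where B: "B \<ge> 0" "\<And>v. v \<in> cball 0 R ==> bounded_op p (Aop v)"
  "\<And>v f. v \<in> cball 0 R ==> f \<in> bergman_space p ==> bergman_norm p (Aop v f) \<le> B * bergman_norm p f"
  using Aop_bounded_op[OF R(1,2)] by blast
 have "op_norm p (Aop v) \<le> B" if "v \<in> cball 0 R" for v by (rule op_norm_le[OF p_q(1) B(1) B(3)[OF that]])
 then show ?thesis using B(2) R(3) by blast
qed

end

section \<open>The Bochner integral over a Bergman ball\<close>

lemma measurable_restrict_inv_vol:
 "f \<in> measurable vol N ==> f \<in> measurable (restrict_space inv_vol D) N"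
 by (rule measurable_restrict_space1) (simp add: measurable_cong_sets[OF sets_inv_vol refl])

lemma finite_measure_restrict_inv_vol:
 fixes D :: "(complex ^ 'n) set"
 assumes D: "D \<in> sets vol" and sub: "D \<subseteq> cball 0 R" and R: "0 \<le> R" "R < 1"
 shows "finite_measure (restrict_space inv_vol D)"
proof (rule finite_measureI)
 have [measurable]: "(defect :: complex ^ 'n \<Rightarrow> real) \<in> borel_measurable vol" by (rule measurable_volI[OF defect_measurable])
 have d: "1 - R\<^sup>2 > 0" using R by (simp add: power_less_one_iff abs_square_less_1)
 have Du: "D \<subseteq> unit_ball" using D by (simp add: in_sets_vol_iff)
 have "emeasure (restrict_space inv_vol D) (space (restrict_space inv_vol D)) = emeasure inv_vol D"
  using D Du by (subst emeasure_restrict_space) (auto simp: space_restrict_space sets_inv_vol Int_absorb2)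
 also have "... = (\<integral>\<^sup>+z. ennreal (1 / defect z ^ (CARD('n) + 1)) * indicator D z \<partial>vol)"
  unfolding inv_vol_alt by (rule emeasure_density[OF _ D]) measurable
 also have "... \<le> (\<integral>\<^sup>+z. ennreal (1 / (1 - R\<^sup>2) ^ (CARD('n) + 1)) \<partial>(vol :: (complex ^ 'n) measure))"
 proof (rule nn_integral_mono)
  fix z :: "complex ^ 'n"
  show "ennreal (1 / defect z ^ (CARD('n) + 1)) * indicator D z \<le> ennreal (1 / (1 - R\<^sup>2) ^ (CARD('n) + 1))"
  proof (cases "z \<in> D")
   case True
   then have "1 - R\<^sup>2 \<le> defect z" using sub R by (auto simp: defect_def)
   then have "(1 - R\<^sup>2) ^ (CARD('n) + 1) \<le> defect z ^ (CARD('n) + 1)" using d by (intro power_mono) auto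
   moreover have "(1 - R\<^sup>2) ^ (CARD('n) + 1) > 0" by (rule zero_less_power[OF d])
   ultimately have "1 / defect z ^ (CARD('n) + 1) \<le> 1 / (1 - R\<^sup>2) ^ (CARD('n) + 1)"
    by (intro divide_left_mono mult_pos_pos) linarith+
   then show ?thesis unfolding indicator_eq_1_iff[THEN iffD2, OF True] mult_1_right by (rule ennreal_leI)
  qed simp
 qed
 also have "... < \<infinity>" by (simp add: ennreal_mult_less_top vol.emeasure_eq_measure)
 finally show "emeasure (restrict_space inv_vol D) (space (restrict_space inv_vol D)) \<noteq> \<infinity>" by simp
qed

context bergman_operator
begin

abbreviation L :: "real \<Rightarrow> (complex ^ 'n) measure" where
 "L \<rho> \<equiv> restrict_space inv_vol (bergman_ball 0 \<rho>)"

text \<open>The candidate for the operator-valued integral, assembled from scalar integrals at each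
  \<open>f\<close> and \<open>w\<close>.\<close>

definition Iop :: "real \<Rightarrow> 'n oper" where
 "Iop \<rho> f w = (if f \<in> bergman_space p \<and> w \<in> unit_ball then \<integral>v. Aop v f w \<partial>L \<rho> else 0)"

lemma space_L: "space (L \<rho>) = bergman_ball 0 \<rho>"
 by (auto simp: space_restrict_space bergman_ball_def)

lemma space_L_unit_ball: "v \<in> space (L \<rho>) ==> v \<in> unit_ball"
 unfolding space_L by (simp add: bergman_ball_def)

lemma finite_measure_L:
 assumes "\<rho> > 0" shows "finite_measure (L \<rho>)"
proof -
 obtain R where R: "0 \<le> R" "R < 1" "bergman_ball (0 :: complex ^ 'n) \<rho> \<subseteq> cball 0 R" by (rule bergman_ball_0_subset[OF assms])
 show ?thesis by (rule finite_measure_restrict_inv_vol[OF bergman_ball_sets R(3,1,2)]) simp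
qed

lemma measurable_L_borel: "(\<lambda>v. v) \<in> measurable (L \<rho>) borel"
 by (intro measurable_restrict_inv_vol measurable_volI) simp

lemma measurable_L_pair:
 assumes "F \<in> borel_measurable vol2" shows "F \<in> borel_measurable (L \<rho> \<Otimes>\<^sub>M vol)"
proof -
 have [measurable]: "(\<lambda>v. v) \<in> measurable (L \<rho>) vol" by (rule measurable_restrict_inv_vol) simp
 have "(\<lambda>m. (fst m, snd m)) \<in> measurable (L \<rho> \<Otimes>\<^sub>M vol) vol2"
  by (intro measurable_Pair measurable_compose[OF measurable_fst, of "\<lambda>v. v"] measurable_snd) measurable
 from measurable_compose[OF this assms] show ?thesis by simp
qed

lemma \<Phi>_measurable_pair:
 assumes f: "lp p f" and w: "w \<in> unit_ball"
 shows "(\<lambda>m. f (snd m) * \<Phi> (fst m) (snd m) w) \<in> borel_measurable vol2"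
proof -
 note [measurable] = lp_measurable[OF f]
 have [measurable]: "(\<lambda>m. \<Phi> (fst m) (snd m) w) \<in> borel_measurable vol2"
  using w by (intro measurable_vol2_continuous continuous_on_\<Phi> continuous_intros) auto
 show ?thesis by measurable
qed

lemma \<Phi>_integrable_pair:
 assumes \<rho>: "\<rho> > 0" and f: "lp p f" and w: "w \<in> unit_ball"
 shows "integrable (L \<rho> \<Otimes>\<^sub>M vol) (\<lambda>m. f (snd m) * \<Phi> (fst m) (snd m) w)"
proof -
 obtain R where R: "0 \<le> R" "R < 1" "bergman_ball (0 :: complex ^ 'n) \<rho> \<subseteq> cball 0 R" by (rule bergman_ball_0_subset[OF \<rho>])
 obtain K where K: "K > 0" "\<And>u v w. v \<in> cball 0 R ==> u \<in> unit_ball ==> w \<in> unit_ball ==> norm (\<Phi> v u w) \<le> K * norm (kernel u w)"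
  using \<Phi>_bounds[OF R(1,2)] by metis
 interpret LL: finite_measure "L \<rho>" by (rule finite_measure_L[OF \<rho>])
 interpret P: pair_sigma_finite "L \<rho>" "vol :: (complex ^ 'n) measure" by standard
 have m: "(\<lambda>m. f (snd m) * \<Phi> (fst m) (snd m) w) \<in> borel_measurable (L \<rho> \<Otimes>\<^sub>M vol)"
  by (rule measurable_L_pair[OF \<Phi>_measurable_pair[OF f w]])
 show ?thesis
 proof (rule P.Fubini_integrable[OF m])
  have vb: "v \<in> unit_ball" if "v \<in> space (L \<rho>)" for v by (rule space_L_unit_ball[OF that])
  show "AE v in L \<rho>. integrable vol (\<lambda>u. f (snd (v, u)) * \<Phi> (fst (v, u)) (snd (v, u)) w)"
   by (rule AE_I2) (simp add: \<Phi>_integrable[OF vb w f])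
  show "integrable (L \<rho>) (\<lambda>v. \<integral>u. norm (f (snd (v, u)) * \<Phi> (fst (v, u)) (snd (v, u)) w) \<partial>vol)"
  proof (rule LL.integrable_const_bound)
   have "(\<lambda>(v, u). norm (f u * \<Phi> v u w)) \<in> borel_measurable (L \<rho> \<Otimes>\<^sub>M vol)" using m unfolding case_prod_beta by measurable
   from vol.borel_measurable_lebesgue_integral[OF this]
   show "(\<lambda>v. \<integral>u. norm (f (snd (v, u)) * \<Phi> (fst (v, u)) (snd (v, u)) w) \<partial>vol) \<in> borel_measurable (L \<rho>)" by simp
   show "AE v in L \<rho>. norm (LINT u|vol. norm (f (snd (v, u)) * \<Phi> (fst (v, u)) (snd (v, u)) w))
    \<le> K * abs_proj f w"
   proof (rule AE_I2)
    fix v assume v: "v \<in> space (L \<rho>)"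
    then have vR: "v \<in> cball 0 R" using R(3) by (auto simp: space_L)
    have "(LINT u|vol. norm (f u * \<Phi> v u w)) \<le> K * abs_proj f w"
     by (rule dominated_by_kernel(2)[OF f w \<Phi>_measurable_u[OF vb[OF v] w] K(2)[OF vR _ w]])
    moreover have "0 \<le> (LINT u|vol. norm (f u * \<Phi> v u w))" by (intro integral_nonneg_AE AE_I2) simp
    ultimately show "norm (LINT u|vol. norm (f (snd (v, u)) * \<Phi> (fst (v, u)) (snd (v, u)) w))
     \<le> K * abs_proj f w" by simp
   qed
  qed
 qed
qed

lemma Aop_integrable:
 assumes \<rho>: "\<rho> > 0" and f: "f \<in> bergman_space p" and w: "w \<in> unit_ball"
 shows "integrable (L \<rho>) (\<lambda>v. Aop v f w)"
  "(LINT v|(L \<rho>). Aop v f w) = (LINT m|(L \<rho> \<Otimes>\<^sub>M vol). (f (snd m) * \<Phi> (fst m) (snd m) w))"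
proof -
 interpret LL: finite_measure "L \<rho>" by (rule finite_measure_L[OF \<rho>])
 interpret P: pair_sigma_finite "L \<rho>" "vol :: (complex ^ 'n) measure" by standard
 have A: "Aop v f w = (LINT u|vol. (f u * \<Phi> v u w))" for v using f w by (simp add: Aop_def)
 note i = \<Phi>_integrable_pair[OF \<rho> bergman_spaceD(1)[OF f] w]
 show "integrable (L \<rho>) (\<lambda>v. Aop v f w)" using P.integrable_fst'[OF i] by (simp add: A)
 show "(LINT v|(L \<rho>). Aop v f w) = (LINT m|(L \<rho> \<Otimes>\<^sub>M vol). (f (snd m) * \<Phi> (fst m) (snd m) w))"
  using P.integral_fst'[OF i] by (simp add: A)
qed

text \<open>Holomorphy comes from a single superposition of kernels over the product of
  \<open>L \<rho>\<close> and \<open>vol\<close>; the norm bound comes from the pointwise bound of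
  \<open>Aop v f w\<close>, uniform in \<open>v\<close>, and the finite measure of the Bergman
  ball.\<close>

lemma Iop_bounded_op:
 assumes \<rho>: "\<rho> > 0" shows "bounded_op p (Iop \<rho>)"
proof -
 obtain R where R: "0 \<le> R" "R < 1" "bergman_ball (0 :: complex ^ 'n) \<rho> \<subseteq> cball 0 R" by (rule bergman_ball_0_subset[OF \<rho>])
 obtain K where K: "K > 0" "\<And>u v w. v \<in> cball 0 R ==> u \<in> unit_ball ==> w \<in> unit_ball ==> norm (\<Phi> v u w) \<le> K * norm (kernel u w)"
  using \<Phi>_bounds[OF R(1,2)] by metis
 define C where "C = Cmax"
 note C = Cmax[folded C_def]
 note fin = finite_measure_L[OF \<rho>]
 define D where "D = measure (L \<rho>) (space (L \<rho>)) * K"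
 have D: "D \<ge> 0" using K(1) by (simp add: D_def)
 have vb: "v \<in> unit_ball" if "v \<in> space (L \<rho>)" for v by (rule space_L_unit_ball[OF that])
 have hol: "holomorphic_several (Iop \<rho> f) unit_ball" if f: "f \<in> bergman_space p" for f
 proof (rule holomorphic_several_cong)
  define a where "a m = f (snd m) * (of_real (defect (mobius (snd m) (fst m)) ^ (CARD('n) + 1)) * kap (snd m) (mobius (snd m) (fst m)))" for m
  have k0: "kernel x 0 = 1" for x :: "complex ^ 'n" by (simp add: kernel_def)
  have a: "integrable (L \<rho> \<Otimes>\<^sub>M vol) a"
   using \<Phi>_integrable_pair[OF \<rho> bergman_spaceD(1)[OF f], of 0] by (simp add: \<Phi>_def k0 a_def[abs_def])
  have "(\<lambda>m :: (complex ^ 'n) \<times> (complex ^ 'n). mobius (snd m) (fst m)) \<in> borel_measurable vol2"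
   by (intro measurable_vol2_continuous continuous_on_mobius_comp continuous_intros) auto
  then have \<psi>: "(\<lambda>m. mobius (snd m) (fst m)) \<in> measurable (L \<rho> \<Otimes>\<^sub>M vol) vol"
  proof (intro measurable_into_vol measurable_L_pair)
   fix m assume "m \<in> space (L \<rho> \<Otimes>\<^sub>M (vol :: (complex ^ 'n) measure))"
   then have m: "fst m \<in> space (L \<rho>)" "snd m \<in> space vol" by (auto simp: space_pair_measure)
   show "mobius (snd m) (fst m) \<in> unit_ball" by (rule mobius_in_ball[OF m(2)[unfolded space_vol] vb[OF m(1)]])
  qed
  show "holomorphic_several (\<lambda>w. \<integral>m. a m * kernel (mobius (snd m) (fst m)) w \<partial>(L \<rho> \<Otimes>\<^sub>M vol)) unit_ball"
   by (rule holomorphic_several_superposition[OF a \<psi>])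
  show "(LINT m|(L \<rho> \<Otimes>\<^sub>M vol). a m * kernel (mobius (snd m) (fst m)) w) = Iop \<rho> f w" if w: "w \<in> unit_ball" for w
   using Aop_integrable(2)[OF \<rho> f w] f w by (simp add: Iop_def a_def \<Phi>_def mult.assoc)
 qed simp
 have main: "Iop \<rho> f \<in> bergman_space p \<and> bergman_norm p (Iop \<rho> f) \<le> C * D * bergman_norm p f"
  if f: "f \<in> bergman_space p" for f
 proof -
  have le: "norm (Iop \<rho> f w) \<le> D * abs_proj f w" if w: "w \<in> unit_ball" for w
  proof -
   have m0: "0 \<le> abs_proj f w" by (intro integral_nonneg_AE AE_I2) simp
   have "norm (Aop v f w) \<le> K * abs_proj f w" if v: "v \<in> space (L \<rho>)" for v
    using v R(3) by (intro Aop_le[OF vb[OF v] f w] K(2)[OF _ _ w]) (auto simp: space_L)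
   then show ?thesis
    using norm_integral_le_measure[OF fin, of "K * abs_proj f w" "\<lambda>v. Aop v f w"] m0 K(1) f w
    by (simp add: Iop_def D_def mult.assoc)
  qed
  have "lp p (Iop \<rho> f) \<and> bergman_norm p (Iop \<rho> f) \<le> C * D * bergman_norm p f"
   by (rule C(2)[OF bergman_spaceD(1)[OF f] measurable_vol_continuous[OF holomorphic_several_continuous[OF hol[OF f]]] D le])
  then show ?thesis using hol[OF f] by (auto intro!: bergman_spaceI simp: Iop_def)
 qed
 have add: "Iop \<rho> (\<lambda>z. f z + g z) = (\<lambda>z. Iop \<rho> f z + Iop \<rho> g z)" if fg: "f \<in> bergman_space p" "g \<in> bergman_space p" for f g
 proof
  fix w
  have "(LINT v|(L \<rho>). Aop v (\<lambda>z. f z + g z) w) = (LINT v|(L \<rho>). Aop v f w + Aop v g w)"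
   by (rule lint_cong[OF refl]) (simp add: Aop_linear(1)[OF vb fg])
  then show "Iop \<rho> (\<lambda>z. f z + g z) w = Iop \<rho> f w + Iop \<rho> g w"
   using fg bergman_space_add[OF p_ge_1 fg] Aop_integrable(1)[OF \<rho> fg(1)] Aop_integrable(1)[OF \<rho> fg(2)] by (simp add: Iop_def)
 qed
 have cmult: "Iop \<rho> (\<lambda>z. c * f z) = (\<lambda>z. c * Iop \<rho> f z)" if f: "f \<in> bergman_space p" for c f
 proof
  fix w
  have "(LINT v|(L \<rho>). Aop v (\<lambda>z. c * f z) w) = (LINT v|(L \<rho>). c * Aop v f w)"
   by (rule lint_cong[OF refl]) (simp add: Aop_linear(2)[OF vb f])
  then show "Iop \<rho> (\<lambda>z. c * f z) w = c * Iop \<rho> f w"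
   using f bergman_space_cmult[OF p_q(1) f, of c] by (simp add: Iop_def)
 qed
 have out: "Iop \<rho> f = (\<lambda>_. 0)" if "f \<notin> bergman_space p" for f using that by (simp add: Iop_def fun_eq_iff)
 show ?thesis unfolding bounded_op_def using main add cmult out by blast
qed

text \<open>Continuity gives the measurability of the distance to one fixed operator; a simple
  approximation of \<open>Aop\<close> has only finitely many values.\<close>

lemma op_norm_Aop_diff_continuous:
 assumes R: "0 \<le> R" "R < 1" and x: "x \<in> cball 0 R"
 shows "continuous_on (cball 0 R) (\<lambda>v. op_norm p (Aop v - Aop x))"
 unfolding continuous_on_iff
proof (intro ballI allI impI)
 fix v :: "complex ^ 'n" and e :: real assume v: "v \<in> cball 0 R" and e: "e > 0"
 obtain C where C: "C > 0" "\<And>e. e > 0 ==> \<exists>\<delta>>0. \<forall>v\<in>cball 0 R. \<forall>v'\<in>cball 0 R. dist v v' < \<delta> \<longrightarrow>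
  op_norm p (Aop v - Aop v') \<le> C * e \<and>
  (\<forall>f\<in>bergman_space p. \<forall>w\<in>unit_ball. norm (Aop v f w - Aop v' f w) \<le> e * abs_proj f w)"
  using Aop_uniform[OF R] by blast
 obtain B where B: "\<And>v. v \<in> cball 0 R ==> bounded_op p (Aop v)" using Aop_bounded_op[OF R] by blast
 have "e / (2 * C) > 0" using e C(1) by simp
 then obtain \<delta> where \<delta>: "\<delta> > 0" "\<And>v v'. v \<in> cball 0 R ==> v' \<in> cball 0 R ==> dist v v' < \<delta> ==> op_norm p (Aop v - Aop v') \<le> C * (e / (2 * C))"
  using C(2) by blast
 have "dist (op_norm p (Aop v' - Aop x)) (op_norm p (Aop v - Aop x)) < e" if v': "v' \<in> cball 0 R" "dist v' v < \<delta>" for v'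
 proof -
  have "op_norm p (Aop v' - Aop v) \<le> e / 2" using \<delta>(2)[OF v'(1) v v'(2)] C(1) by simp
  then show ?thesis
   using op_norm_triangle[OF B[OF v'(1)] B[OF v] B[OF x]] op_norm_triangle[OF B[OF v] B[OF v'(1)] B[OF x]]
    op_norm_minus_commute[of "Aop v" "Aop v'"] e by (simp add: dist_real_def)
 qed
 then show "\<exists>\<delta>>0. \<forall>v'\<in>cball 0 R. dist v' v < \<delta> \<longrightarrow> dist (op_norm p (Aop v' - Aop x)) (op_norm p (Aop v - Aop x)) < e"
  using \<delta>(1) by blast
qed

text \<open>The simple functions are \<open>Aop (c i v)\<close>, where \<open>c i\<close> is a
  simple approximation of the identity of a compact ball, fine enough for the error
  \<open>e i\<close> in \<open>Aop_uniform\<close>. Since the measure of the Bergman ball is finite,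
  uniform smallness of the errors implies convergence of both quantities in the definition.\<close>

theorem Aop_has_integral:
 assumes \<rho>: "\<rho> > 0"
 shows "op_has_integral p (L \<rho>) Aop (Iop \<rho>)"
proof -
 obtain R where R: "0 \<le> R" "R < 1" "bergman_ball (0 :: complex ^ 'n) \<rho> \<subseteq> cball 0 R" by (rule bergman_ball_0_subset[OF \<rho>])
 interpret LL: finite_measure "L \<rho>" by (rule finite_measure_L[OF \<rho>])
 note fin = finite_measure_L[OF \<rho>]
 have vR: "v \<in> cball 0 R" if "v \<in> space (L \<rho>)" for v using that R(3) by (auto simp: space_L)
 obtain C where C: "C > 0" "\<And>e. e > 0 ==> \<exists>\<delta>>0. \<forall>v\<in>cball 0 R. \<forall>v'\<in>cball 0 R. dist v v' < \<delta> \<longrightarrow>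
  op_norm p (Aop v - Aop v') \<le> C * e \<and>
  (\<forall>f\<in>bergman_space p. \<forall>w\<in>unit_ball. norm (Aop v f w - Aop v' f w) \<le> e * abs_proj f w)"
  using Aop_uniform[OF R(1,2)] by blast
 define C' where "C' = Cmax"
 note C' = Cmax[folded C'_def]
 obtain B where B: "\<And>v. v \<in> cball 0 R ==> bounded_op p (Aop v)" using Aop_bounded_op[OF R(1,2)] by blast
 define \<mu> where "\<mu> = measure (L \<rho>) (space (L \<rho>))"
 define e where "e i = inverse (real (Suc i))" for i
 have e: "e i > 0" for i by (simp add: e_def)
 have e0: "e \<longlonglongrightarrow> 0" unfolding e_def by (rule LIMSEQ_inverse_real_of_nat)
 define P where "P i c \<longleftrightarrow> simple_function borel c \<and> range c \<subseteq> cball 0 R \<and> (\<forall>v\<in>cball 0 R. op_norm p (Aop v - Aop (c v)) \<le> C * e i \<and>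
   (\<forall>f\<in>bergman_space p. \<forall>w\<in>unit_ball. norm (Aop v f w - Aop (c v) f w) \<le> e i * abs_proj f w))" for i c
 have "\<exists>c. P i c" for i
 proof -
  obtain \<delta> where \<delta>: "\<delta> > 0" "\<forall>v\<in>cball 0 R. \<forall>v'\<in>cball 0 R. dist v v' < \<delta> \<longrightarrow> op_norm p (Aop v - Aop v') \<le> C * e i \<and>
   (\<forall>f\<in>bergman_space p. \<forall>w\<in>unit_ball. norm (Aop v f w - Aop v' f w) \<le> e i * abs_proj f w)"
   using C(2)[OF e[of i]] by blast
  obtain c where c: "simple_function borel c" "range c \<subseteq> cball (0 :: complex ^ 'n) R" "\<And>z. z \<in> cball 0 R ==> dist (c z) z < \<delta>"
   using simple_nearest[of "cball (0 :: complex ^ 'n) R" \<delta>] R(1) \<delta>(1) by auto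
  show ?thesis unfolding P_def
  proof (intro exI[of _ c] conjI c(1,2) ballI)
   fix v :: "complex ^ 'n" assume v: "v \<in> cball 0 R"
   have "c v \<in> cball 0 R" using c(2) by blast
   then have cv: "c v \<in> cball 0 R" "dist v (c v) < \<delta>" using c(3)[OF v] by (simp_all add: dist_commute)
   show "op_norm p (Aop v - Aop (c v)) \<le> C * e i" using \<delta>(2) v cv by blast
   show "norm (Aop v f w - Aop (c v) f w) \<le> e i * abs_proj f w"
    if "f \<in> bergman_space p" "w \<in> unit_ball" for f w using \<delta>(2) v cv that by blast
  qed
 qed
 then obtain c where cP: "\<And>i. P i (c i)" by metis
 have c: "\<And>i. simple_function borel (c i)" "\<And>i. range (c i) \<subseteq> cball 0 R"
  "\<And>i v. v \<in> cball 0 R ==> op_norm p (Aop v - Aop (c i v)) \<le> C * e i"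
  "\<And>i v f w. v \<in> cball 0 R ==> f \<in> bergman_space p ==> w \<in> unit_ball ==>
   norm (Aop v f w - Aop (c i v) f w) \<le> e i * abs_proj f w"
  using cP unfolding P_def by blast+
 have cR: "c i v \<in> cball 0 R" for i v using c(2)[of i] by blast
 have cfin: "finite (range (c i))" for i using c(1)[of i] by (simp add: simple_function_def)
 have cs: "c i -` {x} \<inter> space (L \<rho>) \<in> sets (L \<rho>)" for i x
 proof -
  have "c i -` {x} \<in> sets borel" using simple_functionD(2)[OF c(1)[of i], of "{x}"] by simp
  from measurable_sets[OF measurable_L_borel this] show ?thesis by simp
 qed
 have simp: "op_simple p (L \<rho>) (\<lambda>v. Aop (c i v))" for i
 proof -
  have "simple_function (L \<rho>) (c i)" unfolding simple_function_def
   using finite_subset[OF _ cfin[of i]] cs[of i] by blast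
  then have "simple_function (L \<rho>) (\<lambda>v. Aop (c i v))" by (rule simple_function_compose1)
  then show ?thesis using B[OF cR] LL.emeasure_finite by (auto simp: op_simple_def)
 qed
 have meas: "(\<lambda>v. op_norm p (Aop v - Aop (c i v))) \<in> borel_measurable (L \<rho>)" for i
 proof (rule measurable_compose_countable'[where g = "c i" and I = "range (c i)"])
  fix x assume "x \<in> range (c i)"
  then have x: "x \<in> cball 0 R" using c(2) by blast
  have "(\<lambda>v. indicator (cball 0 R) v *\<^sub>R op_norm p (Aop v - Aop x)) \<in> borel_measurable borel"
   by (intro borel_measurable_continuous_on_indicator op_norm_Aop_diff_continuous[OF R(1,2) x]) simp
  from measurable_compose[OF measurable_L_borel this]
  have "(\<lambda>v. indicator (cball 0 R) v *\<^sub>R op_norm p (Aop v - Aop x)) \<in> borel_measurable (L \<rho>)" .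
  moreover have "indicator (cball 0 R) v *\<^sub>R op_norm p (Aop v - Aop x) = op_norm p (Aop v - Aop x)" if "v \<in> space (L \<rho>)" for v
   using vR[OF that] by simp
  ultimately show "(\<lambda>v. op_norm p (Aop v - Aop x)) \<in> borel_measurable (L \<rho>)"
   by (subst (asm) measurable_cong) auto
 next
  show "c i \<in> measurable (L \<rho>) (count_space (range (c i)))"
   using cfin[of i] cs[of i] by (subst measurable_count_space_eq2) auto
  show "countable (range (c i))" using cfin[of i] by (rule countable_finite)
 qed
 have l1: "(\<lambda>i. \<integral>\<^sup>+v. ennreal (op_norm p (Aop v - Aop (c i v))) \<partial>L \<rho>) \<longlonglongrightarrow> 0"
 proof (rule tendsto_sandwich[OF _ _ tendsto_const])
  have "(\<integral>\<^sup>+v. ennreal (op_norm p (Aop v - Aop (c i v))) \<partial>L \<rho>) \<le> ennreal (C * e i * \<mu>)" for i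
  proof -
   have "(\<integral>\<^sup>+v. ennreal (op_norm p (Aop v - Aop (c i v))) \<partial>L \<rho>) \<le> (\<integral>\<^sup>+v. ennreal (C * e i) \<partial>L \<rho>)"
    by (intro nn_integral_mono ennreal_leI c(3) vR)
   also have "... = ennreal (C * e i * \<mu>)"
    using C(1) e[of i] by (simp add: LL.emeasure_eq_measure \<mu>_def ennreal_mult'')
   finally show ?thesis .
  qed
  then show "\<forall>\<^sub>F i in sequentially. (\<integral>\<^sup>+v. ennreal (op_norm p (Aop v - Aop (c i v))) \<partial>L \<rho>) \<le> ennreal (C * e i * \<mu>)" by simp
  have "(\<lambda>i. ennreal (C * e i * \<mu>)) \<longlonglongrightarrow> ennreal (C * 0 * \<mu>)"
   by (intro tendsto_ennrealI tendsto_mult_left tendsto_mult_right e0)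
  then show "(\<lambda>i. ennreal (C * e i * \<mu>)) \<longlonglongrightarrow> 0" by simp
 qed simp
 have l2: "(\<lambda>i. op_norm p (op_simple_integral (L \<rho>) (\<lambda>v. Aop (c i v)) - Iop \<rho>)) \<longlonglongrightarrow> 0"
 proof (rule tendsto_sandwich[OF _ _ tendsto_const])
  note bd = bounded_op_diff_bound[OF bounded_op_simple_integral[OF p_ge_1 simp] Iop_bounded_op[OF \<rho>]]
  show "\<forall>\<^sub>F i in sequentially. 0 \<le> op_norm p (op_simple_integral (L \<rho>) (\<lambda>v. Aop (c i v)) - Iop \<rho>)"
   using bd(3)[OF bergman_space_zero[OF p_q(1)]] by simp
  have "op_norm p (op_simple_integral (L \<rho>) (\<lambda>v. Aop (c i v)) - Iop \<rho>) \<le> C' * (\<mu> * e i)" for i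
  proof (rule op_norm_le[OF p_q(1)])
   show "C' * (\<mu> * e i) \<ge> 0" using C'(1) e[of i] by (simp add: \<mu>_def)
   fix f :: "'n cfun" assume f: "f \<in> bergman_space p"
   show "bergman_norm p ((op_simple_integral (L \<rho>) (\<lambda>v. Aop (c i v)) - Iop \<rho>) f) \<le> C' * (\<mu> * e i) * bergman_norm p f"
   proof (rule C'(2)[OF bergman_spaceD(1)[OF f] lp_measurable[OF bergman_spaceD(1)[OF bd(2)[OF f]]], THEN conjunct2])
    show "0 \<le> \<mu> * e i" using e[of i] by (simp add: \<mu>_def)
    fix w :: "complex ^ 'n" assume w: "w \<in> unit_ball"
    note si = op_simple_integral[OF fin simp[of i], of f w]
    have m0: "0 \<le> abs_proj f w" by (intro integral_nonneg_AE AE_I2) simp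
    have "(op_simple_integral (L \<rho>) (\<lambda>v. Aop (c i v)) - Iop \<rho>) f w = (LINT v|(L \<rho>). Aop (c i v) f w - Aop v f w)"
     using si Aop_integrable(1)[OF \<rho> f w] f w by (simp add: Iop_def)
    also have "norm ... \<le> \<mu> * (e i * abs_proj f w)"
     unfolding \<mu>_def
    proof (rule norm_integral_le_measure[OF fin])
     fix v assume "v \<in> space (L \<rho>)"
     from c(4)[OF vR[OF this] f w, of i]
     show "norm (Aop (c i v) f w - Aop v f w) \<le> e i * abs_proj f w"
      by (simp add: norm_minus_commute)
    qed (use e[of i] m0 in simp)
    finally show "norm ((op_simple_integral (L \<rho>) (\<lambda>v. Aop (c i v)) - Iop \<rho>) f w)
     \<le> \<mu> * e i * abs_proj f w" by (simp add: mult.assoc)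
   qed
  qed
  then show "\<forall>\<^sub>F i in sequentially. op_norm p (op_simple_integral (L \<rho>) (\<lambda>v. Aop (c i v)) - Iop \<rho>) \<le> C' * (\<mu> * e i)" by simp
  have "(\<lambda>i. C' * (\<mu> * e i)) \<longlonglongrightarrow> C' * (\<mu> * 0)" by (intro tendsto_mult_left e0)
  then show "(\<lambda>i. C' * (\<mu> * e i)) \<longlonglongrightarrow> 0" by simp
 qed
 show ?thesis unfolding op_has_integral_def
 proof (intro conjI ballI exI[of _ "\<lambda>i v. Aop (c i v)"] allI)
  show "bounded_op p (Aop v)" if "v \<in> space (L \<rho>)" for v by (rule B[OF vR[OF that]])
 qed (use Iop_bounded_op[OF \<rho>] simp meas l1 l2 in auto)
qed

lemma op_integral_eq:
 assumes \<rho>: "\<rho> > 0" and eq: "\<And>v. v \<in> unit_ball ==> A v = Aop v"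
 shows "op_integrable p (L \<rho>) A" "op_integral p (L \<rho>) A = Iop \<rho>"
proof -
 have c: "op_has_integral p (L \<rho>) A J \<longleftrightarrow> op_has_integral p (L \<rho>) Aop J" for J
  by (rule op_has_integral_cong) (rule eq[OF space_L_unit_ball])
 show "op_integrable p (L \<rho>) A" using Aop_has_integral[OF \<rho>] c by (auto simp: op_integrable_def)
 show "op_integral p (L \<rho>) A = Iop \<rho>" unfolding op_integral_def c
 proof (rule the_equality)
  show "op_has_integral p (L \<rho>) Aop (Iop \<rho>)" by (rule Aop_has_integral[OF \<rho>])
  show "J = Iop \<rho>" if "op_has_integral p (L \<rho>) Aop J" for J
   by (rule op_has_integral_unique[OF finite_measure_L[OF \<rho>] Aop_has_integral[OF \<rho>] that]) (rule Aop_integrable(1)[OF \<rho>])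
 qed
qed

end

section \<open>Weak localization and norm convergence\<close>

lemma ennreal_le_divide:
 assumes "c > 0" "\<epsilon> \<ge> 0" "ennreal c * X \<le> ennreal \<epsilon>" shows "X \<le> ennreal (\<epsilon> * (1 / c))"
proof -
 have "ennreal (1 / c) * ennreal c = 1" using assms(1) by (subst ennreal_mult'[symmetric]) auto
 then have "X = ennreal (1 / c) * (ennreal c * X)" by (simp add: mult.assoc[symmetric])
 also have "... \<le> ennreal (1 / c) * ennreal \<epsilon>" by (rule mult_left_mono[OF assms(3)]) simp
 also have "... = ennreal (\<epsilon> * (1 / c))" using assms(1,2) by (subst ennreal_mult'[symmetric]) (auto simp: mult.commute)
 finally show ?thesis .
qed

text \<open>As \<open>mobius 0\<close> is negation, the distance of \<open>mobius u x\<close> from 0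
  is that of \<open>x\<close> from \<open>u\<close>.\<close>

lemma mobius_in_bergman_ball_0:
 assumes "u \<in> unit_ball" "x \<in> unit_ball"
 shows "mobius u x \<in> bergman_ball 0 \<rho> \<longleftrightarrow> x \<in> bergman_ball u \<rho>"
proof -
 have "bergman_dist 0 (mobius u x) = bergman_dist u x" by (simp add: bergman_dist_def)
 then show ?thesis using assms mobius_in_ball[OF assms] unfolding bergman_ball_def by (simp del: mem_ball_0)
qed

lemma bergman_ball_commute:
 assumes "u \<in> unit_ball" "x \<in> unit_ball"
 shows "x \<in> bergman_ball u \<rho> \<longleftrightarrow> u \<in> bergman_ball x \<rho>"
 using assms bergman_dist_commute[OF assms] unfolding bergman_ball_def by auto

context bergman_operator
begin

lemma kap_measurable: "z \<in> unit_ball ==> kap z \<in> borel_measurable vol"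
 unfolding kap_def[abs_def] by (rule lp_measurable[OF bergman_spaceD(1)[OF T_kernel_bergman]])

lemma pairing_normalized_kernel:
 assumes z: "z \<in> unit_ball" and w: "w \<in> unit_ball"
 shows "pairing (T (normalized_kernel z)) (normalized_kernel w) = of_real (half z * half w) * kap z w"
proof -
 have "pairing (T (normalized_kernel z)) (normalized_kernel w) = of_real (half z * half w) * pairing (T (kernel z)) (kernel w)"
  unfolding T_nk[OF z] nk[OF w] pairing_def kap_def
  by (subst integral_mult_right_zero[symmetric]) (simp add: mult_ac)
 then show ?thesis using pairing_kernel[OF T_kernel_bergman[OF z] w] by (simp add: kap_def)
qed

text \<open>All kernel norms are powers of \<open>defect\<close>, and the density of
  \<open>inv_vol\<close> cancels the remaining exponent \<open>N\<close>. What is left is one of the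
  two conditions of the Schur test, for \<open>|kap z w|\<close> and the weight
  \<open>defect w powr (- (s / a))\<close>.\<close>

lemma localization_integral_eq:
 assumes z: "z \<in> unit_ball" and E: "E \<in> sets vol" and a: "a > 0"
 shows "localization_integral a s T E z = ennreal (defect z powr (s / a)) *
  (\<integral>\<^sup>+w. ennreal (norm (kap z w) * indicator E w * defect w powr (- (s / a))) \<partial>vol)"
proof -
 define N where "N = real CARD('n) + 1"
 have N: "N > 0" by (simp add: N_def)
 define c where "c = 2 * s / (a * (CARD('n) + 1))"
 have "c = 2 * s / (a * N)" unfolding c_def N_def by (simp add: add.commute)
 \<comment> \<open>The total exponents of \<open>defect z\<close> and of \<open>defect w\<close>,
   each collected from a factor \<open>half\<close> and a power of a kernel norm.\<close>
 then have ce: "N / 2 + - (N / 2) * (1 - c) = s / a" "N / 2 - - (N / 2) * (1 - c) = N - s / a"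
  using a N by (simp_all add: field_simps)
 have [measurable]: "(defect :: complex ^ 'n \<Rightarrow> real) \<in> borel_measurable vol" by (rule measurable_volI[OF defect_measurable])
 note [measurable] = kap_measurable[OF z] E
 define F where "F w = ennreal (norm (kap z w) * indicator E w * defect w powr (N - s / a))" for w
 have Fm[measurable]: "F \<in> borel_measurable vol" unfolding F_def by measurable
 have "localization_integral a s T E z = (\<integral>\<^sup>+w. ennreal (defect z powr (s / a)) * F w \<partial>inv_vol)"
  unfolding localization_integral_def
 proof (rule nn_integral_cong)
  fix w :: "complex ^ 'n" assume "w \<in> space inv_vol"
  then have w: "w \<in> unit_ball" by simp
  note d = defect_pos[OF z] defect_pos[OF w]
  have n: "norm (pairing (T (normalized_kernel z)) (normalized_kernel w)) = half z * half w * norm (kap z w)"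
   using half_pos[OF z] half_pos[OF w] unfolding pairing_normalized_kernel[OF z w] norm_mult norm_of_real by simp
  have "half z * half w * norm (kap z w) * (bergman_norm 2 (kernel z) powr (1 - c) / bergman_norm 2 (kernel w) powr (1 - c))
   = (half z * defect z powr (- (N / 2) * (1 - c))) * (half w / defect w powr (- (N / 2) * (1 - c))) * norm (kap z w)"
   unfolding bergman_norm_2_kernel[OF z] bergman_norm_2_kernel[OF w] N_def powr_powr by simp
  also have "half z * defect z powr (- (N / 2) * (1 - c)) = defect z powr (s / a)"
   unfolding half_def N_def[symmetric] powr_add[symmetric] ce(1) ..
  also have "half w / defect w powr (- (N / 2) * (1 - c)) = defect w powr (N - s / a)"
   unfolding half_def N_def[symmetric] powr_diff[symmetric] ce(2) ..
  finally have "ennreal (norm (pairing (T (normalized_kernel z)) (normalized_kernel w)) *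
    (bergman_norm 2 (kernel z) powr (1 - c) / bergman_norm 2 (kernel w) powr (1 - c)))
   = ennreal (defect z powr (s / a)) * ennreal (norm (kap z w) * defect w powr (N - s / a))"
   unfolding n by (subst ennreal_mult'[symmetric]) (simp_all add: mult_ac)
  then show "ennreal (norm (pairing (T (normalized_kernel z)) (normalized_kernel w)) *
    (bergman_norm 2 (kernel z) powr (1 - 2 * s / (a * (CARD('n) + 1))) / bergman_norm 2 (kernel w) powr (1 - 2 * s / (a * (CARD('n) + 1)))))
    * indicator E w = ennreal (defect z powr (s / a)) * F w"
   unfolding c_def[symmetric] F_def by (simp split: split_indicator)
 qed
 also have "... = (\<integral>\<^sup>+w. ennreal (1 / defect w ^ (CARD('n) + 1)) * (ennreal (defect z powr (s / a)) * F w) \<partial>vol)"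
  unfolding inv_vol_alt by (rule nn_integral_density) measurable
 also have "... = (\<integral>\<^sup>+w. ennreal (defect z powr (s / a)) * ennreal (norm (kap z w) * indicator E w * defect w powr (- (s / a))) \<partial>vol)"
 proof (rule nn_integral_cong)
  fix w :: "complex ^ 'n" assume "w \<in> space vol"
  then have w: "w \<in> unit_ball" by simp
  have d: "defect w > 0" by (rule defect_pos[OF w])
  have "1 / defect w ^ (CARD('n) + 1) = defect w powr (- N)"
  proof -
   have NN: "N = real (CARD('n) + 1)" by (simp add: N_def)
   show ?thesis unfolding powr_minus_divide NN powr_realpow[OF d] ..
  qed
  then have "ennreal (1 / defect w ^ (CARD('n) + 1)) * F w = ennreal (defect w powr (- N) * (norm (kap z w) * indicator E w * defect w powr (N - s / a)))"
   unfolding F_def by (subst ennreal_mult'[symmetric]) simp_all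
  also have "defect w powr (- N) * (norm (kap z w) * indicator E w * defect w powr (N - s / a))
   = norm (kap z w) * indicator E w * (defect w powr (- N) * defect w powr (N - s / a))" by (simp only: mult_ac)
  also have "defect w powr (- N) * defect w powr (N - s / a) = defect w powr (- (s / a))"
   unfolding powr_add[symmetric] by simp
  finally show "ennreal (1 / defect w ^ (CARD('n) + 1)) * (ennreal (defect z powr (s / a)) * F w)
   = ennreal (defect z powr (s / a)) * ennreal (norm (kap z w) * indicator E w * defect w powr (- (s / a)))"
   by (simp only: mult.left_commute)
 qed
 also have "... = ennreal (defect z powr (s / a)) *
  (\<integral>\<^sup>+w. ennreal (norm (kap z w) * indicator E w * defect w powr (- (s / a))) \<partial>vol)"
  by (rule nn_integral_cmult) measurable
 finally show ?thesis .
qed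

lemma localization_bound:
 assumes z: "z \<in> unit_ball" and E: "E \<in> sets vol" and a: "a > 0" and \<epsilon>: "\<epsilon> \<ge> 0"
  and le: "localization_integral a s T E z \<le> ennreal \<epsilon>"
 shows "(\<integral>\<^sup>+w. ennreal (norm (kap z w) * indicator E w * defect w powr (- (s / a))) \<partial>vol) \<le> ennreal (\<epsilon> * defect z powr (- (s / a)))"
 using ennreal_le_divide[OF _ \<epsilon> le[unfolded localization_integral_eq[OF z E a]]] defect_pos[OF z]
 by (simp add: powr_minus_divide)

text \<open>With \<open>h = defect powr (- (s / (p * q)))\<close>, the power \<open>h powr p\<close>
  has the exponent \<open>- (s / q)\<close> of the condition on \<open>T\<close>, and
  \<open>h powr q\<close> the exponent \<open>- (s / p)\<close> of the condition on the adjoint,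
  whose integral kernel is the conjugate transpose by \<open>adj_kernel\<close>. The symmetry of
  \<open>E\<close> lets one region be described from either variable. The choice
  \<open>E z = unit_ball\<close> yields integrability, the complement of a Bergman ball the final
  estimate.\<close>

lemma localized_Schur:
 assumes Em: "{y \<in> space vol2. snd y \<in> E (fst y)} \<in> sets vol2" (is "?A \<in> _")
  and Esub: "\<And>z. E z \<subseteq> unit_ball"
  and sym: "\<And>x u. x \<in> unit_ball ==> u \<in> unit_ball ==> x \<in> E u \<longleftrightarrow> u \<in> E x"
  and \<epsilon>: "\<epsilon> \<ge> 0"
  and b1: "\<And>z. z \<in> unit_ball ==> localization_integral q s T (E z) z \<le> ennreal \<epsilon>"
  and b2: "\<And>z. z \<in> unit_ball ==> localization_integral p s (adjoint_op p q T) (E z) z \<le> ennreal \<epsilon>"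
  and f: "lp p f" and g: "g \<in> borel_measurable vol"
  and gle: "\<And>x. x \<in> unit_ball ==> ennreal (norm (g x)) \<le> (\<integral>\<^sup>+u. ennreal (norm (kap u x) * indicator (E u) x * norm (f u)) \<partial>vol)"
 shows "lp p g" "bergman_norm p g \<le> \<epsilon> * bergman_norm p f"
proof -
 interpret sw: conjugate_exponents q p by (rule swap)
 \<comment> \<open>The adjoint lives in the same locale with exchanged exponents, so
   \<open>localization_bound\<close> applies to it.\<close>
 interpret ad: bergman_operator q p "adj T" by standard (rule adj(1)[OF T])
 define k where "k x u = norm (kap u x) * indicator ?A (x, u)" for x u
 define h :: "complex ^ 'n \<Rightarrow> real" where "h x = defect x powr (- (s / (p * q)))" for x
 have hp: "h x powr p = defect x powr (- (s / q))" "h x powr q = defect x powr (- (s / p))" for x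
  using p_q by (simp_all add: h_def powr_powr)
 have Es: "E z \<in> sets vol" if "z \<in> unit_ball" for z
 proof -
  have "E z = Pair z -` ?A" using that Esub[of z] by (auto simp: space_pair_measure)
  then show ?thesis using sets_Pair1[OF Em, of z] by simp
 qed
 have i1: "indicator ?A (x, u) = (indicator (E u) x :: real)" and i2: "indicator ?A (x, u) = (indicator (E x) u :: real)"
  if "x \<in> unit_ball" "u \<in> unit_ball" for x u
  using that sym[OF that] by (auto simp: space_pair_measure indicator_def)
 have kapm: "(\<lambda>y. kap (snd y) (fst y)) \<in> borel_measurable vol2"
  by (intro measurable_vol2_continuous continuous_on_kap continuous_intros) auto
 have km: "case_prod k \<in> borel_measurable vol2"
 proof -
  have "(\<lambda>y. norm (kap (snd y) (fst y)) * indicator ?A y) \<in> borel_measurable vol2"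
   using kapm borel_measurable_indicator[OF Em] by measurable
  moreover have "case_prod k = (\<lambda>y. norm (kap (snd y) (fst y)) * indicator ?A y)"
   by (simp only: fun_eq_iff k_def case_prod_beta prod.collapse simp_thms)
  ultimately show ?thesis by (simp only:)
 qed
 have k0: "0 \<le> k x u" for x u by (simp add: k_def)
 have hm: "h \<in> borel_measurable vol"
  using measurable_volI[OF defect_measurable[where 'n = 'n]] unfolding h_def by measurable
 have h0: "0 < h x" if "x \<in> unit_ball" for x using defect_pos[OF that] by (simp add: h_def)
 have s1: "(\<integral>\<^sup>+u. ennreal (k x u * h u powr q) \<partial>vol) \<le> ennreal (\<epsilon> * h x powr q)" if x: "x \<in> unit_ball" for x
 proof -
  have "(\<integral>\<^sup>+u. ennreal (k x u * h u powr q) \<partial>vol)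
   = (\<integral>\<^sup>+u. ennreal (norm (ad.kap x u) * indicator (E x) u * defect u powr (- (s / p))) \<partial>vol)"
  proof (rule nn_integral_cong)
   fix u :: "complex ^ 'n" assume "u \<in> space vol"
   then have u: "u \<in> unit_ball" by simp
   show "ennreal (k x u * h u powr q) = ennreal (norm (ad.kap x u) * indicator (E x) u * defect u powr (- (s / p)))"
    unfolding k_def i2[OF x u] hp ad.kap_def adj_kernel[OF T x u] complex_mod_cnj kap_def ..
  qed
  also have "... \<le> ennreal (\<epsilon> * h x powr q)"
   unfolding hp using b2[OF x] by (intro ad.localization_bound[OF x Es[OF x] p_q(1) \<epsilon>]) (simp add: adjoint_op_eq[OF T])
  finally show ?thesis .
 qed
 have s2: "(\<integral>\<^sup>+x. ennreal (k x u * h x powr p) \<partial>vol) \<le> ennreal (\<epsilon> * h u powr p)" if u: "u \<in> unit_ball" for u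
 proof -
  have "(\<integral>\<^sup>+x. ennreal (k x u * h x powr p) \<partial>vol)
   = (\<integral>\<^sup>+x. ennreal (norm (kap u x) * indicator (E u) x * defect x powr (- (s / q))) \<partial>vol)"
   by (rule nn_integral_cong) (simp add: k_def i1[OF _ u] hp del: mem_ball_0)
  also have "... \<le> ennreal (\<epsilon> * h u powr p)"
   unfolding hp by (rule localization_bound[OF u Es[OF u] p_q(2) \<epsilon> b1[OF u]])
  finally show ?thesis .
 qed
 have gle': "ennreal (norm (g x)) \<le> (\<integral>\<^sup>+u. ennreal (k x u * norm (f u)) \<partial>vol)" if x: "x \<in> unit_ball" for x
 proof -
  have "(\<integral>\<^sup>+u. ennreal (norm (kap u x) * indicator (E u) x * norm (f u)) \<partial>vol) = (\<integral>\<^sup>+u. ennreal (k x u * norm (f u)) \<partial>vol)"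
   by (rule nn_integral_cong) (simp add: k_def i1[OF x] del: mem_ball_0)
  then show ?thesis using gle[OF x] by simp
 qed
 note S = Schur_test[OF km k0 hm h0 \<epsilon> \<epsilon> s1 s2 f g gle']
 show "lp p g" by (rule S(1))
 have "1 / q + 1 / p = 1" using pq by simp
 then have "\<epsilon> powr (1 / q) * \<epsilon> powr (1 / p) = \<epsilon>" using \<epsilon> unfolding powr_add[symmetric] by simp
 then show "bergman_norm p g \<le> \<epsilon> * bergman_norm p f" using S(2) by simp
qed

lemma integrable_f_kap: "lp p f ==> x \<in> unit_ball ==> integrable vol (\<lambda>u. f u * kap u x)"
 unfolding kap_def by (rule Hoelder(1)[OF _ operator_kernel(1)[OF T]])

text \<open>After the substitution, the involution turns \<open>mobius u (mobius u x)\<close> into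
  \<open>x\<close>, and the factor \<open>defect ^ (n + 1)\<close> in \<open>\<Phi>\<close> cancels
  the density of \<open>inv_vol\<close>.\<close>

lemma \<Phi>_integral_v:
 assumes u: "u \<in> unit_ball" and w: "w \<in> unit_ball"
 shows "(LINT v|(L \<rho>). (\<Phi> v u w)) = (LINT x|vol. indicator (bergman_ball u \<rho>) x *\<^sub>R (kap u x * kernel x w))"
proof -
 have b0: "bergman_ball 0 \<rho> \<in> sets (vol :: (complex ^ 'n) measure)" by (rule bergman_ball_sets) simp
 define F where "F v = indicator (bergman_ball 0 \<rho>) v *\<^sub>R \<Phi> v u w" for v
 have "(\<lambda>v. \<Phi> v u w) \<in> borel_measurable vol"
  by (intro measurable_vol_continuous continuous_on_\<Phi> continuous_intros) (use u w in auto)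
 then have Fv: "F \<in> borel_measurable vol" unfolding F_def using borel_measurable_indicator[OF b0] by measurable
 then have Fm: "F \<in> borel_measurable inv_vol" by (simp add: measurable_cong_sets[OF sets_inv_vol refl])
 have mm: "mobius u \<in> measurable vol vol" by (rule mobius_measurable[OF u])
 then have mi: "mobius u \<in> measurable inv_vol inv_vol" by (simp add: measurable_cong_sets[OF sets_inv_vol sets_inv_vol])
 have "(LINT v|(L \<rho>). (\<Phi> v u w)) = (LINT v|inv_vol. F v)"
  unfolding F_def using b0 by (intro integral_restrict_space) (auto simp: sets_inv_vol in_sets_vol_iff Int_absorb2)
 also have "... = (LINT v|(distr inv_vol inv_vol (mobius u)). F v)" by (simp only: distr_inv_vol_mobius[OF u])
 also have "... = (LINT x|inv_vol. F (mobius u x))" by (rule integral_distr[OF mi Fm])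
 also have "... = (LINT x|vol. (1 / defect x ^ (CARD('n) + 1)) *\<^sub>R F (mobius u x))"
  unfolding inv_vol_alt
 proof (rule integral_density)
  have [measurable]: "(defect :: complex ^ 'n \<Rightarrow> real) \<in> borel_measurable vol" by (rule measurable_volI[OF defect_measurable])
  show "(\<lambda>x. F (mobius u x)) \<in> borel_measurable vol" by (rule measurable_compose[OF mm Fv])
  show "(\<lambda>x :: complex ^ 'n. 1 / defect x ^ (CARD('n) + 1)) \<in> borel_measurable vol" by measurable
  show "AE x :: complex ^ 'n in vol. 0 \<le> 1 / defect x ^ (CARD('n) + 1)"
   by (rule AE_I2) (simp add: defect_pos less_imp_le)
 qed
 also have "... = (LINT x|vol. indicator (bergman_ball u \<rho>) x *\<^sub>R (kap u x * kernel x w))"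
 proof (rule lint_cong[OF refl])
  fix x :: "complex ^ 'n" assume "x \<in> space vol"
  then have x: "x \<in> unit_ball" by simp
  have d: "defect x ^ (CARD('n) + 1) \<noteq> 0" using defect_pos[OF x] by simp
  have "(1 / defect x ^ (CARD('n) + 1)) *\<^sub>R \<Phi> (mobius u x) u w = kap u x * kernel x w"
   unfolding \<Phi>_def mobius_mobius[OF u x] scaleR_conv_of_real mult.assoc[symmetric] of_real_mult[symmetric]
   using d by simp
  then show "(1 / defect x ^ (CARD('n) + 1)) *\<^sub>R F (mobius u x) = indicator (bergman_ball u \<rho>) x *\<^sub>R (kap u x * kernel x w)"
   unfolding F_def using mobius_in_bergman_ball_0[OF u x, of \<rho>] by (simp add: indicator_def)
 qed
 finally show ?thesis .
qed

text \<open>Here the two suprema over the whole ball enter. By \<open>localized_Schur\<close> the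
  integral of \<open>|f u * kap u x|\<close> over \<open>u\<close> is in L^p as a function of
  \<open>x\<close>, hence integrable, and for fixed \<open>w\<close> the factor
  \<open>kernel x w\<close> is bounded.\<close>

lemma H_integrable:
 assumes \<epsilon>: "\<epsilon> \<ge> 0"
  and b1: "\<And>z. z \<in> unit_ball ==> localization_integral q s T unit_ball z \<le> ennreal \<epsilon>"
  and b2: "\<And>z. z \<in> unit_ball ==> localization_integral p s (adjoint_op p q T) unit_ball z \<le> ennreal \<epsilon>"
  and f: "lp p f" and w: "w \<in> unit_ball"
 shows "integrable vol2 (\<lambda>y. f (snd y) * kap (snd y) (fst y) * kernel (fst y) w)"
proof -
 interpret P: pair_sigma_finite "vol :: (complex ^ 'n) measure" "vol :: (complex ^ 'n) measure" by standard
 note fm[measurable] = lp_measurable[OF f]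
 have kapm[measurable]: "(\<lambda>y. kap (snd y) (fst y)) \<in> borel_measurable vol2"
  by (intro measurable_vol2_continuous continuous_on_kap continuous_intros) auto
 have km[measurable]: "(\<lambda>y. kernel (fst y) w) \<in> borel_measurable (vol \<Otimes>\<^sub>M (vol :: (complex ^ 'n) measure))"
  by (intro measurable_vol2_continuous continuous_on_kernel continuous_intros) (use w in auto)
 have Hm: "(\<lambda>y. f (snd y) * kap (snd y) (fst y) * kernel (fst y) w) \<in> borel_measurable vol2" by measurable
 define g where "g x = (LINT u|vol. norm (f u * kap u x))" for x
 have gm: "g \<in> borel_measurable vol"
 proof -
  have "(\<lambda>(x, u). norm (f u * kap u x)) \<in> borel_measurable vol2" unfolding case_prod_beta by measurable
  from vol.borel_measurable_lebesgue_integral[OF this] show ?thesis by (simp add: g_def[abs_def])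
 qed
 have g0: "g x \<ge> 0" for x unfolding g_def by (intro integral_nonneg_AE AE_I2) simp
 have "lp p (\<lambda>x. complex_of_real (g x))"
 proof (rule localized_Schur(1)[where E = "\<lambda>_. unit_ball" and \<epsilon> = \<epsilon> and s = s and f = f])
  have eq: "{y \<in> space vol2. snd y \<in> unit_ball} = space (vol \<Otimes>\<^sub>M (vol :: (complex ^ 'n) measure))"
   by (auto simp: space_pair_measure)
  show "{y \<in> space vol2. snd y \<in> unit_ball} \<in> sets (vol \<Otimes>\<^sub>M (vol :: (complex ^ 'n) measure))"
   by (simp only: eq sets.top)
  show "(\<lambda>x. complex_of_real (g x)) \<in> borel_measurable vol" using gm by measurable
  fix x :: "complex ^ 'n" assume x: "x \<in> unit_ball"
  have "ennreal (norm (complex_of_real (g x))) = (\<integral>\<^sup>+u. ennreal (norm (f u * kap u x)) \<partial>vol)"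
   using g0[of x] integrable_norm[OF integrable_f_kap[OF f x]] unfolding g_def
   by (subst nn_integral_eq_integral) auto
  also have "... = (\<integral>\<^sup>+u. ennreal (norm (kap u x) * indicator unit_ball x * norm (f u)) \<partial>vol)"
   using x by (simp add: norm_mult mult_ac)
  finally show "ennreal (norm (complex_of_real (g x))) \<le> (\<integral>\<^sup>+u. ennreal (norm (kap u x) * indicator unit_ball x * norm (f u)) \<partial>vol)" by simp
 qed (use \<epsilon> b1 b2 f in auto)
 from integrable_norm[OF lp_L1(1)[OF this]] have gi: "integrable vol g" using g0 by simp
 define c where "c = 1 / (1 - norm w) ^ (CARD('n) + 1)"
 have c: "c \<ge> 0" using w by (simp add: c_def)
 have kc: "norm (kernel x w) \<le> c" if "x \<in> unit_ball" for x
  unfolding c_def using norm_kernel_le[OF that w] by (simp add: norm_kernel_commute[OF that w] del: mem_ball_0)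
 show ?thesis
 proof (rule P.Fubini_integrable[OF Hm])
  show "AE x in vol. integrable vol (\<lambda>u. f (snd (x, u)) * kap (snd (x, u)) (fst (x, u)) * kernel (fst (x, u)) w)"
   by (rule AE_I2) (simp add: integrable_f_kap[OF f])
  show "integrable vol (\<lambda>x. \<integral>u. norm (f (snd (x, u)) * kap (snd (x, u)) (fst (x, u)) * kernel (fst (x, u)) w) \<partial>vol)"
  proof (rule integrable_dominated)
   show "integrable vol (\<lambda>x. c * g x)" using gi by simp
   have "(\<lambda>(x, u). norm (f u * kap u x * kernel x w)) \<in> borel_measurable vol2" using Hm unfolding case_prod_beta by measurable
   from vol.borel_measurable_lebesgue_integral[OF this]
   show "(\<lambda>x. \<integral>u. norm (f (snd (x, u)) * kap (snd (x, u)) (fst (x, u)) * kernel (fst (x, u)) w) \<partial>vol) \<in> borel_measurable vol" by simp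
   show "AE x in vol. norm (LINT u|vol. norm (f (snd (x, u)) * kap (snd (x, u)) (fst (x, u)) * kernel (fst (x, u)) w)) \<le> norm (c * g x)"
   proof (rule AE_I2)
    fix x :: "complex ^ 'n" assume "x \<in> space vol"
    then have "norm (kernel x w) \<le> c" using kc by simp
    then have "g x * norm (kernel x w) \<le> c * g x" using g0[of x] by (subst mult.commute) (rule mult_right_mono)
    moreover have "(LINT u|vol. norm (f u * kap u x * kernel x w)) = g x * norm (kernel x w)"
     unfolding g_def norm_mult[of _ "kernel x w"] by (rule integral_mult_left_zero)
    ultimately show "norm (LINT u|vol. norm (f (snd (x, u)) * kap (snd (x, u)) (fst (x, u)) * kernel (fst (x, u)) w)) \<le> norm (c * g x)"
     using g0[of x] c by simp
   qed
  qed
 qed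
qed

definition far :: "real \<Rightarrow> 'n cfun \<Rightarrow> 'n cfun" where
 "far \<rho> f x = (LINT u|vol. indicator (unit_ball - bergman_ball u \<rho>) x *\<^sub>R (f u * kap u x))"

lemma far_bound:
 assumes \<epsilon>: "\<epsilon> \<ge> 0"
  and b1: "\<And>z. z \<in> unit_ball ==> localization_integral q s T (unit_ball - bergman_ball z \<rho>) z \<le> ennreal \<epsilon>"
  and b2: "\<And>z. z \<in> unit_ball ==> localization_integral p s (adjoint_op p q T) (unit_ball - bergman_ball z \<rho>) z \<le> ennreal \<epsilon>"
  and f: "lp p f"
 shows "lp p (far \<rho> f)" "bergman_norm p (far \<rho> f) \<le> \<epsilon> * bergman_norm p f"
proof -
 define A :: "((complex ^ 'n) \<times> (complex ^ 'n)) set" where "A = {y \<in> space vol2. snd y \<in> unit_ball - bergman_ball (fst y) \<rho>}"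
 have Ae: "A = space vol2 - {y \<in> space vol2. snd y \<in> bergman_ball (fst y) \<rho>}"
  by (auto simp: A_def space_pair_measure)
 have A: "A \<in> sets vol2" unfolding Ae by (rule sets.compl_sets[OF bergman_ball_measurable_pair])
 have sym: "x \<in> unit_ball - bergman_ball u \<rho> \<longleftrightarrow> u \<in> unit_ball - bergman_ball x \<rho>"
  if "x \<in> unit_ball" "u \<in> unit_ball" for x u :: "complex ^ 'n"
  using that bergman_ball_commute[OF that(2,1)] by blast
 have i: "indicator (unit_ball - bergman_ball u \<rho>) x = (indicator A (x, u) :: real)" if "x \<in> unit_ball" "u \<in> unit_ball" for x u
  using that sym[OF that] unfolding A_def by (auto simp: space_pair_measure indicator_def)
 note fm[measurable] = lp_measurable[OF f]
 have kapm[measurable]: "(\<lambda>y. kap (snd y) (fst y)) \<in> borel_measurable vol2"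
  by (intro measurable_vol2_continuous continuous_on_kap continuous_intros) auto
 have Fm: "(\<lambda>y. indicator A y *\<^sub>R (f (snd y) * kap (snd y) (fst y))) \<in> borel_measurable vol2"
  using borel_measurable_indicator[OF A] by measurable
 have fe: "far \<rho> f x = (LINT u|vol. indicator A (x, u) *\<^sub>R (f u * kap u x))" if "x \<in> unit_ball" for x
  unfolding far_def by (rule lint_cong[OF refl]) (simp add: i[OF that] del: mem_ball_0)
 have m: "far \<rho> f \<in> borel_measurable vol"
 proof -
  have "(\<lambda>(x, u). indicator A (x, u) *\<^sub>R (f u * kap u x)) \<in> borel_measurable vol2" using Fm unfolding case_prod_beta' by simp
  from vol.borel_measurable_lebesgue_integral[OF this]
  show ?thesis by (subst measurable_cong[of _ _ "\<lambda>x. \<integral>u. indicator A (x, u) *\<^sub>R (f u * kap u x) \<partial>vol"]) (simp_all add: fe del: mem_ball_0)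
 qed
 have le: "ennreal (norm (far \<rho> f x)) \<le> (\<integral>\<^sup>+u. ennreal (norm (kap u x) * indicator (unit_ball - bergman_ball u \<rho>) x * norm (f u)) \<partial>vol)"
  if x: "x \<in> unit_ball" for x
 proof -
  have mx: "(\<lambda>u. indicator A (x, u) *\<^sub>R (f u * kap u x)) \<in> borel_measurable vol"
   using measurable_compose[OF measurable_Pair1' Fm, of x] x by simp
  have "integrable vol (\<lambda>u. indicator A (x, u) *\<^sub>R (f u * kap u x))"
   by (rule integrable_dominated[OF integrable_f_kap[OF f x] mx]) (auto split: split_indicator)
  then have "ennreal (norm (far \<rho> f x)) \<le> (\<integral>\<^sup>+u. ennreal (norm (indicator A (x, u) *\<^sub>R (f u * kap u x))) \<partial>vol)"
   unfolding fe[OF x] by (rule integral_norm_bound_ennreal)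
  also have "... = (\<integral>\<^sup>+u. ennreal (norm (kap u x) * indicator (unit_ball - bergman_ball u \<rho>) x * norm (f u)) \<partial>vol)"
   by (rule nn_integral_cong) (simp add: i[OF x] norm_mult mult_ac del: mem_ball_0)
  finally show ?thesis .
 qed
 show "lp p (far \<rho> f)" "bergman_norm p (far \<rho> f) \<le> \<epsilon> * bergman_norm p f"
  by (rule localized_Schur[where E = "\<lambda>z. unit_ball - bergman_ball z \<rho>" and s = s, OF A[unfolded A_def] Diff_subset sym \<epsilon> b1 b2 f m le]; assumption)+
qed

text \<open>Both terms are integrals of the same function \<open>H'\<close> of the pair
  \<open>(x, u)\<close>: for \<open>Iop\<close> only pairs within Bergman distance
  \<open>\<rho>\<close> occur, for \<open>T f\<close> all of them. Absolute integrability allows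
  subtraction and Fubini.\<close>

lemma T_minus_Iop:
 assumes \<rho>: "\<rho> > 0" and f: "f \<in> bergman_space p" and w: "w \<in> unit_ball"
  and H: "integrable vol2 (\<lambda>y. f (snd y) * kap (snd y) (fst y) * kernel (fst y) w)"
 shows "T f w - Iop \<rho> f w = proj (far \<rho> f) w"
proof -
 interpret LL: finite_measure "L \<rho>" by (rule finite_measure_L[OF \<rho>])
 interpret P: pair_sigma_finite "vol :: (complex ^ 'n) measure" "vol :: (complex ^ 'n) measure" by standard
 interpret PL: pair_sigma_finite "L \<rho>" "vol :: (complex ^ 'n) measure" by standard
 note fl = bergman_spaceD(1)[OF f]
 define H' where "H' y = f (snd y) * kap (snd y) (fst y) * kernel (fst y) w" for y
 have Hi: "integrable vol2 H'" using H by (simp add: H'_def[abs_def])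
 define A :: "((complex ^ 'n) \<times> (complex ^ 'n)) set" where "A = {y \<in> space vol2. snd y \<in> bergman_ball (fst y) \<rho>}"
 have A: "A \<in> sets (vol \<Otimes>\<^sub>M (vol :: (complex ^ 'n) measure))" unfolding A_def by (rule bergman_ball_measurable_pair)
 have i: "indicator (bergman_ball u \<rho>) x = (indicator A (x, u) :: real)" if "x \<in> unit_ball" "u \<in> unit_ball" for x u
  using that bergman_ball_commute[OF that(2,1), of \<rho>] unfolding A_def by (auto simp: space_pair_measure indicator_def)
 have Gi: "integrable vol2 (\<lambda>y. indicator A y *\<^sub>R H' y)" by (rule integrable_mult_indicator[OF A Hi])
 \<comment> \<open>The projection is inserted to create the factor \<open>kernel x w\<close> that
   the other integral contains.\<close>
 have "T f w = proj (T f) w" by (simp add: proj_bergman[OF bounded_opD(1)[OF T f]])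
 also have "... = (LINT x|vol. (LINT u|vol. H' (x, u)))"
  unfolding proj_def if_P[OF w]
 proof (rule lint_cong[OF refl])
  fix x :: "complex ^ 'n" assume "x \<in> space vol"
  then have x: "x \<in> unit_ball" by simp
  have "T f x = (LINT u|vol. f u * kap u x)" unfolding kap_def by (rule operator_kernel(2)[OF T x f])
  then show "T f x * kernel x w = (LINT u|vol. H' (x, u))" by (simp add: H'_def)
 qed
 also have "... = (LINT y|vol2. H' y)" by (rule P.integral_fst'[OF Hi])
 finally have 1: "T f w = (LINT y|vol2. H' y)" .
 have "Iop \<rho> f w = (LINT m|(L \<rho> \<Otimes>\<^sub>M vol). (f (snd m) * \<Phi> (fst m) (snd m) w))"
  using Aop_integrable(2)[OF \<rho> f w] f w by (simp add: Iop_def)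
 also have "... = (LINT u|vol. (LINT v|(L \<rho>). (f u * \<Phi> v u w)))"
  using PL.integral_snd[of "\<lambda>v u. f u * \<Phi> v u w"] \<Phi>_integrable_pair[OF \<rho> fl w] unfolding case_prod_beta' by simp
 also have "... = (LINT u|vol. (LINT x|vol. indicator A (x, u) *\<^sub>R H' (x, u)))"
 proof (rule lint_cong[OF refl])
  fix u :: "complex ^ 'n" assume "u \<in> space vol"
  then have u: "u \<in> unit_ball" by simp
  have "(LINT v|(L \<rho>). (f u * \<Phi> v u w)) = (LINT x|vol. f u * (indicator (bergman_ball u \<rho>) x *\<^sub>R (kap u x * kernel x w)))"
   unfolding integral_mult_right_zero \<Phi>_integral_v[OF u w] ..
  also have "... = (LINT x|vol. indicator A (x, u) *\<^sub>R H' (x, u))"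
   by (rule lint_cong[OF refl]) (simp add: i[OF _ u] H'_def mult_ac del: mem_ball_0)
  finally show "(LINT v|(L \<rho>). (f u * \<Phi> v u w)) = (LINT x|vol. indicator A (x, u) *\<^sub>R H' (x, u))" .
 qed
 also have "... = (LINT y|vol2. indicator A y *\<^sub>R H' y)"
  using P.integral_snd[of "\<lambda>x u. indicator A (x, u) *\<^sub>R H' (x, u)"] Gi unfolding case_prod_beta' by simp
 finally have 2: "Iop \<rho> f w = (LINT y|vol2. indicator A y *\<^sub>R H' y)" .
 have "T f w - Iop \<rho> f w = (LINT y|vol2. H' y - indicator A y *\<^sub>R H' y)"
  unfolding 1 2 by (rule Bochner_Integration.integral_diff[OF Hi Gi, symmetric])
 also have "... = (LINT x|vol. (LINT u|vol. H' (x, u) - indicator A (x, u) *\<^sub>R H' (x, u)))"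
  by (rule P.integral_fst'[symmetric]) (rule Bochner_Integration.integrable_diff[OF Hi Gi])
 also have "... = proj (far \<rho> f) w"
  unfolding proj_def if_P[OF w] far_def integral_mult_left_zero[symmetric]
 proof (intro lint_cong[OF refl])
  fix x u :: "complex ^ 'n" assume "x \<in> space vol" "u \<in> space vol"
  then have xu: "x \<in> unit_ball" "u \<in> unit_ball" by simp_all
  have "indicator (unit_ball - bergman_ball u \<rho>) x = (1 - indicator A (x, u) :: real)"
   using i[OF xu] xu(1) by (simp add: indicator_diff split: split_indicator split_indicator_asm)
  then show "H' (x, u) - indicator A (x, u) *\<^sub>R H' (x, u) = indicator (unit_ball - bergman_ball u \<rho>) x *\<^sub>R (f u * kap u x) * kernel x w"
   by (simp add: H'_def scaleR_left_diff_distrib left_diff_distrib)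
 qed
 finally show ?thesis .
qed

theorem Iop_tendsto:
 assumes "weakly_localized p q s T"
 shows "((\<lambda>\<rho>. op_norm p (Iop \<rho> - T)) \<longlongrightarrow> 0) at_top"
proof (rule tendstoI)
 fix e :: real assume e: "e > 0"
 obtain C where C: "C > 0" "\<And>\<phi> :: 'n cfun. lp p \<phi> ==> proj \<phi> \<in> bergman_space p \<and> bergman_norm p (proj \<phi>) \<le> C * bergman_norm p \<phi>"
  using proj_bounded by blast
 define \<epsilon> where "\<epsilon> = e / (2 * C)"
 have \<epsilon>: "\<epsilon> > 0" using e C by (simp add: \<epsilon>_def)
 define S1 where "S1 = (SUP z\<in>unit_ball. localization_integral q s T unit_ball z)"
 define S2 where "S2 = (SUP z\<in>unit_ball. localization_integral p s (adjoint_op p q T) unit_ball z)"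
 have S: "S1 < \<infinity>" "S2 < \<infinity>" using assms by (auto simp: weakly_localized_def S1_def S2_def)
 define B where "B = max (enn2real S1) (enn2real S2)"
 have "ennreal (enn2real S1) \<le> ennreal B" "ennreal (enn2real S2) \<le> ennreal B"
  unfolding B_def by (intro ennreal_leI max.cobounded1 max.cobounded2)+
 then have B: "S1 \<le> ennreal B" "S2 \<le> ennreal B" using S by simp_all
 have B0: "B \<ge> 0" by (simp add: B_def le_max_iff_disj)
 have b: "localization_integral q s T unit_ball z \<le> ennreal B" "localization_integral p s (adjoint_op p q T) unit_ball z \<le> ennreal B"
  if "z \<in> unit_ball" for z :: "complex ^ 'n"
  using SUP_upper[OF that, of "localization_integral q s T unit_ball"]
   SUP_upper[OF that, of "localization_integral p s (adjoint_op p q T) unit_ball"] B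
  unfolding S1_def S2_def by (auto elim: order_trans)
 have "\<forall>\<^sub>F \<rho> in at_top. (SUP z\<in>unit_ball. localization_integral q s T (unit_ball - bergman_ball z \<rho>) z) < ennreal \<epsilon>"
  "\<forall>\<^sub>F \<rho> in at_top. (SUP z\<in>unit_ball. localization_integral p s (adjoint_op p q T) (unit_ball - bergman_ball z \<rho>) z) < ennreal \<epsilon>"
  using assms \<epsilon> by (auto simp: weakly_localized_def intro!: order_tendstoD(2))
 with eventually_gt_at_top[of 0] show "\<forall>\<^sub>F \<rho> in at_top. dist (op_norm p (Iop \<rho> - T)) 0 < e"
 proof eventually_elim
  case (elim \<rho>)
  have b1: "localization_integral q s T (unit_ball - bergman_ball z \<rho>) z \<le> ennreal \<epsilon>"
   and b2: "localization_integral p s (adjoint_op p q T) (unit_ball - bergman_ball z \<rho>) z \<le> ennreal \<epsilon>"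
   if "z \<in> unit_ball" for z
   using SUP_upper[OF that, of "\<lambda>z. localization_integral q s T (unit_ball - bergman_ball z \<rho>) z"]
    SUP_upper[OF that, of "\<lambda>z. localization_integral p s (adjoint_op p q T) (unit_ball - bergman_ball z \<rho>) z"] elim(2,3)
   by (auto intro: less_imp_le elim: order_trans)
  have "op_norm p (Iop \<rho> - T) \<le> C * \<epsilon>"
  proof (rule op_norm_le[OF p_q(1)])
   fix f :: "'n cfun" assume f: "f \<in> bergman_space p"
   note fl = bergman_spaceD(1)[OF f]
   note fb = far_bound[OF less_imp_le[OF \<epsilon>] b1 b2 fl]
   have "bergman_norm p ((Iop \<rho> - T) f) = bergman_norm p (proj (far \<rho> f))"
   proof (rule bergman_norm_cong)
    fix w :: "complex ^ 'n" assume w: "w \<in> unit_ball"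
    show "norm ((Iop \<rho> - T) f w) = norm (proj (far \<rho> f) w)"
    proof -
     have "(Iop \<rho> - T) f w = - proj (far \<rho> f) w"
      using T_minus_Iop[OF elim(1) f w H_integrable[OF B0 b fl w]] by (simp add: algebra_simps)
     then show ?thesis by simp
    qed
   qed
   also have "... \<le> C * bergman_norm p (far \<rho> f)" using C(2)[OF fb(1)] by simp
   also have "... \<le> C * (\<epsilon> * bergman_norm p f)" using fb(2) C(1) by (intro mult_left_mono) auto
   finally show "bergman_norm p ((Iop \<rho> - T) f) \<le> C * \<epsilon> * bergman_norm p f" by simp
  qed (use C \<epsilon> in simp)
  then have "op_norm p (Iop \<rho> - T) < e" using e C(1) by (simp add: \<epsilon>_def)
  moreover have "0 \<le> op_norm p (Iop \<rho> - T)"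
   by (rule bounded_op_diff_bound(3)[OF Iop_bounded_op[OF elim(1)] T bergman_space_zero[OF p_q(1)]])
  ultimately show ?case by simp
 qed
qed

end

theorem theorem3p3:
 fixes T :: "'n::finite oper" and p q s r :: real
 assumes "1 < p" and "1 / p + 1 / q = 1" and "0 < s" and "s < min p q" and "0 < r"
  and "bounded_op p T"
 shows "let A = (\<lambda>v. weak_op_integral p q
   (\<lambda>u. pairing (T (transl u (normalized_kernel 0))) (transl u (normalized_kernel v)))
   (normalized_kernel v) (normalized_kernel 0)) in
  (\<forall>\<epsilon>>0. \<exists>\<delta>>0. \<forall>v\<in>bergman_ball 0 r. \<forall>v'\<in>bergman_ball 0 r.
      bergman_dist v v' < \<delta> \<longrightarrow> op_norm p (A v - A v') < \<epsilon>)
  \<and> (\<exists>C. \<forall>v\<in>bergman_ball 0 r. bounded_op p (A v) \<and> op_norm p (A v) \<le> C)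
  \<and> op_integrable p (restrict_space inv_vol (bergman_ball 0 r)) A
  \<and> (weakly_localized p q s T \<longrightarrow>
    ((\<lambda>\<rho>. op_norm p (op_integral p (restrict_space inv_vol (bergman_ball 0 \<rho>)) A - T))
     \<longlongrightarrow> 0) at_top)"
proof -
 interpret bergman_operator p q T by unfold_locales (use assms in auto)
 define A where "A = (\<lambda>v. weak_op_integral p q
   (\<lambda>u. pairing (T (transl u (normalized_kernel 0))) (transl u (normalized_kernel v)))
   (normalized_kernel v) (normalized_kernel 0))"
 have A: "A v = Aop v" if "v \<in> unit_ball" for v
  using weak_op_integral_eq[OF that] by (simp add: A_def symb_def[abs_def])
 have Ab: "A v = Aop v" if "v \<in> bergman_ball 0 r" for v using that by (intro A) (simp add: bergman_ball_def)
 have "\<forall>\<epsilon>>0. \<exists>\<delta>>0. \<forall>v\<in>bergman_ball 0 r. \<forall>v'\<in>bergman_ball 0 r. bergman_dist v v' < \<delta> \<longrightarrow> op_norm p (A v - A v') < \<epsilon>"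
  using Aop_uniform_bergman[OF assms(5)] Ab by (metis (no_types, lifting))
 moreover have "\<exists>C. \<forall>v\<in>bergman_ball 0 r. bounded_op p (A v) \<and> op_norm p (A v) \<le> C"
  using Aop_norm_bounded[OF assms(5)] by (simp add: Ab)
 moreover have "op_integrable p (L r) A" by (rule op_integral_eq(1)[OF assms(5) A])
 moreover have "((\<lambda>\<rho>. op_norm p (op_integral p (L \<rho>) A - T)) \<longlongrightarrow> 0) at_top" if "weakly_localized p q s T"
 proof (rule Lim_transform_eventually[OF Iop_tendsto[OF that]])
  \<comment> \<open>The identification of the integral requires \<open>\<rho> > 0\<close>, which
    holds eventually.\<close>
  show "\<forall>\<^sub>F \<rho> in at_top. op_norm p (Iop \<rho> - T) = op_norm p (op_integral p (L \<rho>) A - T)"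
   using eventually_gt_at_top[of 0]
  proof eventually_elim
   case (elim \<rho>)
   show ?case by (simp only: op_integral_eq(2)[OF elim A])
  qed
 qed
 ultimately show ?thesis unfolding A_def[symmetric] Let_def by blast
qed

end
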